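(* Let $\Bbbk$ be a perfect field of characteristic $p>0$ and let $L$ be a (two-sided) ladder with $v$ lower-outside corners. For $\mathbf{t}=(t_1,\ldots,t_v)\in\mathbb{Z}_{>0}^v$ let $I_{\mathbf t}(L)\subseteq \Bbbk[L]$ be the corresponding mixed ladder determinantal ideal. Then the symbolic associated graded ring $\mathrm{gr}^s(I_{\mathbf t}(L))=\bigoplus_{n\ge 0} I_{\mathbf t}(L)^{(n)}/I_{\mathbf t}(L)^{(n+1)}$ is $F$-pure.
   Context: Ladders. Let $X=(x_{i,j})$ be a $k\times\ell$ matrix of distinct indeterminates. A subset $L\subseteq X$ is a (two-sided) ladder if whenever $x_{i,j},x_{i',j'}\in L$ with $i\le i'$ and $j\ge j'$, then $x_{u,w}\in L$ for all $i\le u\le i'$, $j'\le w\le j$. (An entry with indices out of range is regarded as not in $L$.) The upper-outside corners of $L$ are the elements $x_{b_1,a_1},\ldots,x_{b_u,a_u}\in L$, with $1=b_1<\cdots<b_u$ and $a_1<\cdots<a_u=\ell$, defined by $x_{b_h-1,a_h}\notin L$ and $x_{b_h,a_h+1}\notin L$. The lower-outside corners $x_{d_1,c_1},\ldots,x_{d_v,c_v}\in L$, with $d_1\le\cdots\le d_v=k$ and $1=c_1\le\cdots\le c_v$, are part of the data of the ladder: they include all $x_{i,j}\in L$ with $x_{i+1,j}\notin L$ and $x_{i,j-1}\notin L$, and each of them satisfies $x_{d_h+1,c_h}\notin L$ or $x_{d_h,c_h-1}\notin L$. All corners are assumed distinct. For $j=1,\ldots,v$ set $L_j=\{x_{b,a}\in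 L\mid 1\le b\le d_j,\ c_j\le a\le \ell\}$. Ideals. $\Bbbk[L]$ is the polynomial ring over $\Bbbk$ in the entries of $L$. For a positive integer $t$ and a subladder $L'\subseteq L$, $I_t(L')$ is the ideal of $\Bbbk[L]$ generated by the $t$-minors of $X$ all of whose entries lie in $L'$. The mixed ladder determinantal ideal is $I_{\mathbf t}(L)=I_{t_1}(L_1)+\cdots+I_{t_v}(L_v)$; it is prime. Standing assumptions: (1) every entry of $L$ is involved in some of the generating minors of $I_{\mathbf t}(L)$; (2) no two consecutive corners coincide, and no two upper-outside corners belong to the same row or the same column; (3) $I_{t_i}(L_i)\not\subseteq I_{t_j}(L_j)$ for all $i\ne j$; (4) no proper submatrix of $X$ contains $L$. $I^{(n)}$ denotes the $n$-th symbolic power of $I$, with $I^{(0)}$ the whole ring. A ring $S$ of characteristic $p>0$ is $F$-pure if the Frobenius map $S\to F_*S$ is pure, i.e. remains injective after tensoring with any $S$-module. *)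

theory Defs
  imports
    "HOL-Algebra.Algebra"
    "HOL-Library.Poly_Mapping"
    "Jordan_Normal_Form.Determinant"
begin

section \<open>Ladders\<close>

text \<open>The indeterminate in row \<open>i\<close> and column \<open>j\<close> is represented by the pair \<open>(i, j)\<close>;
  rows are numbered \<open>1..k\<close> and columns \<open>1..l\<close>. As \<open>L\<close> contains no pair with a zero component, the
  truncated \<open>i - 1\<close> and \<open>j - 1\<close> below refer to entries outside \<open>L\<close> when \<open>i = 1\<close> or \<open>j = 1\<close>.\<close>

definition is_ladder :: "nat \<Rightarrow> nat \<Rightarrow> (nat \<times> nat) set \<Rightarrow> bool" where
  "is_ladder k l L \<longleftrightarrow>
     L \<subseteq> {1..k} \<times> {1..l} \<and>
     (\<forall>i j i' j'. (i, j) \<in> L \<and> (i', j') \<in> L \<and> i \<le> i' \<and> j' \<le> j \<longrightarrow> {i..i'} \<times> {j'..j} \<subseteq> L)"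

text \<open>\<open>(b h, a h)\<close> for \<open>h = 1, \<dots>, u\<close> lists the upper-outside corners. Strict monotonicity says in
  particular that no two of them lie in the same row or in the same column.\<close>

definition upper_outside_corners ::
    "nat \<Rightarrow> (nat \<times> nat) set \<Rightarrow> nat \<Rightarrow> (nat \<Rightarrow> nat) \<Rightarrow> (nat \<Rightarrow> nat) \<Rightarrow> bool" where
  "upper_outside_corners l L u b a \<longleftrightarrow>
     1 \<le> u \<and>
     bij_betw (\<lambda>h. (b h, a h)) {1..u} {(i, j). (i, j) \<in> L \<and> (i - 1, j) \<notin> L \<and> (i, j + 1) \<notin> L} \<and>
     strict_mono_on {1..u} b \<and> strict_mono_on {1..u} a \<and> b 1 = 1 \<and> a u = l"

text \<open>The lower-outside corners \<open>(d h, c h)\<close>, \<open>h = 1, \<dots>, v\<close>, are data: beyond the corners determined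
  by the shape of \<open>L\<close>, further points of its lower-left boundary may be marked.\<close>

definition lower_outside_corners ::
    "nat \<Rightarrow> (nat \<times> nat) set \<Rightarrow> nat \<Rightarrow> (nat \<Rightarrow> nat) \<Rightarrow> (nat \<Rightarrow> nat) \<Rightarrow> bool" where
  "lower_outside_corners k L v d c \<longleftrightarrow>
     1 \<le> v \<and>
     (\<forall>h\<in>{1..v}. (d h, c h) \<in> L \<and> ((d h + 1, c h) \<notin> L \<or> (d h, c h - 1) \<notin> L)) \<and>
     (\<forall>i j. (i, j) \<in> L \<and> (i + 1, j) \<notin> L \<and> (i, j - 1) \<notin> L \<longrightarrow> (\<exists>h\<in>{1..v}. (i, j) = (d h, c h))) \<and>
     mono_on {1..v} d \<and> mono_on {1..v} c \<and> d v = k \<and> c 1 = 1"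

definition corners_distinct ::
    "nat \<Rightarrow> (nat \<Rightarrow> nat) \<Rightarrow> (nat \<Rightarrow> nat) \<Rightarrow> nat \<Rightarrow> (nat \<Rightarrow> nat) \<Rightarrow> (nat \<Rightarrow> nat) \<Rightarrow> bool" where
  "corners_distinct u b a v d c \<longleftrightarrow>
     inj_on (\<lambda>h. (b h, a h)) {1..u} \<and> inj_on (\<lambda>h. (d h, c h)) {1..v} \<and>
     (\<forall>g\<in>{1..u}. \<forall>h\<in>{1..v}. (b g, a g) \<noteq> (d h, c h))"

definition subladder ::
    "nat \<Rightarrow> (nat \<times> nat) set \<Rightarrow> (nat \<Rightarrow> nat) \<Rightarrow> (nat \<Rightarrow> nat) \<Rightarrow> nat \<Rightarrow> (nat \<times> nat) set" where
  "subladder l L d c j = {(b, a). (b, a) \<in> L \<and> 1 \<le> b \<and> b \<le> d j \<and> c j \<le> a \<and> a \<le> l}"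

section \<open>Mixed ladder determinantal ideals\<close>

text \<open>Polynomials in the indeterminates \<open>(i, j)\<close> are finitely supported functions from monomials
  (finitely supported exponent functions) to coefficients.\<close>

type_synonym 'a matpoly = "((nat \<times> nat) \<Rightarrow>\<^sub>0 nat) \<Rightarrow>\<^sub>0 'a"

definition indet :: "nat \<times> nat \<Rightarrow> 'a::comm_ring_1 matpoly" where
  "indet x = Poly_Mapping.single (Poly_Mapping.single x 1) 1"

definition ladder_ring :: "(nat \<times> nat) set \<Rightarrow> 'a::field matpoly ring" where
  "ladder_ring L =
     \<lparr>carrier = {f. \<forall>m\<in>Poly_Mapping.keys f. Poly_Mapping.keys m \<subseteq> L},
      monoid.mult = (*), one = 1, ring.zero = 0, add = (+)\<rparr>"

text \<open>\<open>r 0 < \<dots> < r (t - 1)\<close> and \<open>c 0 < \<dots> < c (t - 1)\<close> are the rows and columns of a square submatrix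
  with all its entries in \<open>L'\<close>.\<close>

definition submatrix_in :: "nat \<Rightarrow> (nat \<times> nat) set \<Rightarrow> (nat \<Rightarrow> nat) \<Rightarrow> (nat \<Rightarrow> nat) \<Rightarrow> bool" where
  "submatrix_in t L' r c \<longleftrightarrow>
     strict_mono_on {..<t} r \<and> strict_mono_on {..<t} c \<and> r ` {..<t} \<times> c ` {..<t} \<subseteq> L'"

definition minor :: "nat \<Rightarrow> (nat \<Rightarrow> nat) \<Rightarrow> (nat \<Rightarrow> nat) \<Rightarrow> 'a::field matpoly" where
  "minor t r c = det (mat t t (\<lambda>(i, j). indet (r i, c j)))"

definition minors_ideal ::
    "(nat \<times> nat) set \<Rightarrow> nat \<Rightarrow> (nat \<times> nat) set \<Rightarrow> 'a::field matpoly set" where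
  "minors_ideal L t L' = Idl\<^bsub>ladder_ring L\<^esub> {minor t r c | r c. submatrix_in t L' r c}"

text \<open>The sum of a family of ideals is the ideal generated by their union.\<close>

definition mixed_ladder_ideal ::
    "nat \<Rightarrow> (nat \<times> nat) set \<Rightarrow> nat \<Rightarrow> (nat \<Rightarrow> nat) \<Rightarrow> (nat \<Rightarrow> nat) \<Rightarrow> (nat \<Rightarrow> nat)
      \<Rightarrow> 'a::field matpoly set" where
  "mixed_ladder_ideal l L v d c t =
     Idl\<^bsub>ladder_ring L\<^esub> (\<Union>j\<in>{1..v}. minors_ideal L (t j) (subladder l L d c j))"

section \<open>Symbolic powers and the symbolic associated graded ring\<close>

definition minimal_primes :: "'r ring \<Rightarrow> 'r set \<Rightarrow> 'r set set" where
  "minimal_primes R I =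
     {P. primeideal P R \<and> I \<subseteq> P \<and> (\<forall>Q. primeideal Q R \<and> I \<subseteq> Q \<and> Q \<subseteq> P \<longrightarrow> Q = P)}"

text \<open>The intersection, over the minimal primes \<open>P\<close> of \<open>I\<close>, of the contractions to \<open>R\<close> of the
  localizations of \<open>I^n\<close> at \<open>P\<close>; for a prime ideal \<open>I\<close> the only such \<open>P\<close> is \<open>I\<close> itself.
  The monoid of ideals has the unit \<open>carrier R\<close>, so the zeroth symbolic power is \<open>carrier R\<close>.\<close>

definition symbolic_power :: "'r ring \<Rightarrow> 'r set \<Rightarrow> nat \<Rightarrow> 'r set" where
  "symbolic_power R I n =
     {f \<in> carrier R. \<forall>P\<in>minimal_primes R I.
        \<exists>s\<in>carrier R - P. s \<otimes>\<^bsub>R\<^esub> f \<in> I [^]\<^bsub>ideals_set R\<^esub> n}"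

text \<open>The graded ring of a decreasing filtration \<open>J 0 = R, J 1, \<dots>\<close> by ideals with
  \<open>J i \<cdot> J j \<subseteq> J (i + j)\<close>. An element is the family of its homogeneous components, the component of
  degree \<open>n\<close> being a coset in \<open>J n / J (n + 1)\<close>, viewed inside \<open>R / J (n + 1)\<close>. The product of cosets
  of \<open>J (i + 1)\<close> and \<open>J (j + 1)\<close> is the coset of \<open>J (i + j + 1)\<close> of the product of representatives,
  which is what \<^const>\<open>rcoset_mult\<close> computes.\<close>

definition graded_ring :: "'r ring \<Rightarrow> (nat \<Rightarrow> 'r set) \<Rightarrow> (nat \<Rightarrow> 'r set) ring" where
  "graded_ring R J =
     \<lparr>carrier = {g. (\<forall>n. \<exists>x\<in>J n. g n = J (Suc n) +>\<^bsub>R\<^esub> x) \<and> finite {n. g n \<noteq> J (Suc n)}},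
      monoid.mult = (\<lambda>g h n. \<Oplus>\<^bsub>R Quot J (Suc n)\<^esub>i\<in>{..n}. rcoset_mult R (J (Suc n)) (g i) (h (n - i))),
      one = (\<lambda>n. if n = 0 then J (Suc 0) +>\<^bsub>R\<^esub> \<one>\<^bsub>R\<^esub> else J (Suc n)),
      ring.zero = (\<lambda>n. J (Suc n)),
      add = (\<lambda>g h n. g n <+>\<^bsub>R\<^esub> h n)\<rparr>"

definition symbolic_gr :: "'r ring \<Rightarrow> 'r set \<Rightarrow> (nat \<Rightarrow> 'r set) ring" where
  "symbolic_gr R I = graded_ring R (symbolic_power R I)"

section \<open>Tensor products and purity\<close>

definition tensor_relators ::
    "'s ring \<Rightarrow> ('s, 'm) module \<Rightarrow> ('s, 'n) module \<Rightarrow> ('m \<times> 'n \<Rightarrow>\<^sub>0 int) set" where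
  "tensor_relators S M N =
     {frag_of (x \<oplus>\<^bsub>M\<^esub> x', y) - frag_of (x, y) - frag_of (x', y) | x x' y.
        x \<in> carrier M \<and> x' \<in> carrier M \<and> y \<in> carrier N} \<union>
     {frag_of (x, y \<oplus>\<^bsub>N\<^esub> y') - frag_of (x, y) - frag_of (x, y') | x y y'.
        x \<in> carrier M \<and> y \<in> carrier N \<and> y' \<in> carrier N} \<union>
     {frag_of (s \<odot>\<^bsub>M\<^esub> x, y) - frag_of (x, s \<odot>\<^bsub>N\<^esub> y) | s x y.
        s \<in> carrier S \<and> x \<in> carrier M \<and> y \<in> carrier N}"

definition tensor_kernel ::
    "'s ring \<Rightarrow> ('s, 'm) module \<Rightarrow> ('s, 'n) module \<Rightarrow> ('m \<times> 'n \<Rightarrow>\<^sub>0 int) set" where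
  "tensor_kernel S M N =
     generate (free_Abelian_group (carrier M \<times> carrier N)) (tensor_relators S M N)"

definition tensor_product ::
    "'s ring \<Rightarrow> ('s, 'm) module \<Rightarrow> ('s, 'n) module \<Rightarrow> ('m \<times> 'n \<Rightarrow>\<^sub>0 int) set monoid" where
  "tensor_product S M N =
     free_Abelian_group (carrier M \<times> carrier N) Mod tensor_kernel S M N"

text \<open>The map \<open>id \<otimes> \<phi>\<close> from \<open>M \<otimes> N\<close> to \<open>M \<otimes> N'\<close> on cosets: all representatives \<open>z\<close> of a
  coset \<open>C\<close> give the same coset on the right, which is therefore their union.\<close>

definition tensor_map ::
    "'s ring \<Rightarrow> ('s, 'm) module \<Rightarrow> ('s, 'n') module \<Rightarrow> ('n \<Rightarrow> 'n')
      \<Rightarrow> ('m \<times> 'n \<Rightarrow>\<^sub>0 int) set \<Rightarrow> ('m \<times> 'n' \<Rightarrow>\<^sub>0 int) set" where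
  "tensor_map S M N' \<phi> C =
     (\<Union>z\<in>C. tensor_kernel S M N' #>\<^bsub>free_Abelian_group (carrier M \<times> carrier N')\<^esub>
        frag_extend (\<lambda>(x, y). frag_of (x, \<phi> y)) z)"

text \<open>Purity quantifies over all modules. Here the modules range over those whose elements have
  type \<open>'m\<close>; a theorem that concludes purity for a type variable \<open>'m\<close> covers modules of every type.\<close>

definition pure_map ::
    "'m itself \<Rightarrow> 's ring \<Rightarrow> ('s, 'n) module \<Rightarrow> ('s, 'n') module \<Rightarrow> ('n \<Rightarrow> 'n') \<Rightarrow> bool" where
  "pure_map (_ :: 'm itself) S N N' \<phi> \<longleftrightarrow>
     (\<forall>M :: ('s, 'm) module. module S M \<longrightarrow>
        inj_on (tensor_map S M N' \<phi>) (carrier (tensor_product S M N)))"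

section \<open>F-purity\<close>

definition regular_module :: "'s ring \<Rightarrow> ('s, 's) module" where
  "regular_module S =
     \<lparr>carrier = carrier S, monoid.mult = monoid.mult S, one = \<one>\<^bsub>S\<^esub>, ring.zero = \<zero>\<^bsub>S\<^esub>, add = add S,
      module.smult = (\<lambda>s x. s \<otimes>\<^bsub>S\<^esub> x)\<rparr>"

text \<open>\<open>S\<close> as a module over itself by restriction of scalars along the Frobenius map.\<close>

definition frobenius_module :: "nat \<Rightarrow> 's ring \<Rightarrow> ('s, 's) module" where
  "frobenius_module p S =
     \<lparr>carrier = carrier S, monoid.mult = monoid.mult S, one = \<one>\<^bsub>S\<^esub>, ring.zero = \<zero>\<^bsub>S\<^esub>, add = add S,
      module.smult = (\<lambda>s x. (s [^]\<^bsub>S\<^esub> p) \<otimes>\<^bsub>S\<^esub> x)\<rparr>"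

definition has_characteristic :: "'s ring \<Rightarrow> nat \<Rightarrow> bool" where
  "has_characteristic S p \<longleftrightarrow> (\<forall>n::nat. [n] \<cdot>\<^bsub>S\<^esub> \<one>\<^bsub>S\<^esub> = \<zero>\<^bsub>S\<^esub> \<longleftrightarrow> p dvd n)"

definition F_pure :: "'m itself \<Rightarrow> nat \<Rightarrow> 's ring \<Rightarrow> bool" where
  "F_pure T p S \<longleftrightarrow>
     cring S \<and> Factorial_Ring.prime p \<and> has_characteristic S p \<and>
     pure_map T S (regular_module S) (frobenius_module p S) (\<lambda>x. x [^]\<^bsub>S\<^esub> p)"

end

theory Submission
  imports Defs "HOL-Library.Product_Lexorder"
begin

text \<open>Write \<open>r j = t j - 1\<close> and let \<open>delta j\<close> be the minor of size \<open>r j\<close> in the lower left corner of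
  the \<open>j\<close>-th subladder. Irredundancy and Laplace expansion show that the points
  \<open>(d j - r j, c j + r j)\<close> form a strict staircase inside \<open>L\<close>.

  No minimal prime \<open>P\<close> of the ideal \<open>I\<close> contains a \<open>delta j\<close>: over an infinite field containing the
  residue ring of \<open>P\<close>, the generic point of \<open>P\<close> satisfies the rank conditions that define \<open>I\<close>, and
  such a matrix can be deformed within the rank conditions until no \<open>delta j\<close> vanishes.

  Let \<open>H\<close> consist of the entries \<open>(i, m)\<close> with \<open>i \<le> d j - r j\<close> and \<open>c j + r j \<le> m\<close> for some \<open>j\<close>. Where
  the \<open>delta j\<close> are invertible, \<open>I\<close> is generated by one bordered minor for each element of \<open>H\<close>, and
  a product \<open>f\<close> of minors whose antidiagonals partition \<open>L\<close> lies in \<open>I ^ card H\<close>. Moreover \<open>f\<close> has a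
  unique monomial of minimal weight, the product of all entries of \<open>L\<close>, so the trace of
  \<open>f ^ (p - 1)\<close> is \<open>1\<close>.

  Hence \<open>g \<mapsto> trace (f ^ (p - 1) * g)\<close> splits the Frobenius map, and by the pigeonhole principle it
  maps the symbolic power of exponent \<open>n * p + 1\<close> into that of exponent \<open>n + 1\<close>. So it induces a
  splitting of the Frobenius map of the symbolic associated graded ring, which is therefore pure.\<close>

section \<open>Ranks of blocks of a matrix\<close>

text \<open>The number \<open>card H\<close> plays two roles at once: it counts the local generators
  of the ideal, and up to a local unit it is a power of the ideal that contains \<open>f\<close>. A
  monomial in \<open>card H\<close> generators loses at most \<open>p - 1\<close> per generator when
  its exponents are rounded down to multiples of \<open>p\<close>, and \<open>f ^ (p - 1)\<close>
  supplies exactly this loss of \<open>card H * (p - 1)\<close>. This is why \<open>f\<close> has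
  one factor for each antidiagonal \<open>i + m = s\<close>, lying locally in the power given by the
  number of points of \<open>H\<close> there.

  Working locally is legitimate only once every minimal prime misses the minors
  \<open>delta j\<close>. The obstacle is that the ladder bounds the ranks of overlapping blocks of
  a matrix with missing entries, where a change allowed by one block may violate another. The
  missing entries are therefore filled in first, which turns the conditions into rank bounds on full
  upper right rectangles; a point of that locus with maximal block ranks cannot have a singular
  corner block. Both steps choose a parameter outside a finite bad set, hence the infinite
  field.\<close>

definition rank_le :: "('i \<Rightarrow> 'j \<Rightarrow> 'f::field) \<Rightarrow> 'i set \<Rightarrow> 'j set \<Rightarrow> nat \<Rightarrow> bool" where
  "rank_le A I J r \<longleftrightarrow> (\<exists>B C. \<forall>i\<in>I. \<forall>j\<in>J. A i j = (\<Sum>q<r. B i q * C q j))"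

text \<open>A factorization through a smaller space can be padded with zeros, so any finite inner
  index set of size at most \<open>r\<close> serves.\<close>

lemma rank_le_index:
  assumes "finite E" "card E \<le> r" "\<And>i j. i \<in> I \<Longrightarrow> j \<in> J \<Longrightarrow> A i j = (\<Sum>e\<in>E. B i e * C e j)"
  shows "rank_le A I J r"
proof -
  obtain g where g: "bij_betw g {..<card E} E"
    using assms(1) ex_bij_betw_nat_finite lessThan_atLeast0 by metis
  define B' where "B' i q = (if q < card E then B i (g q) else 0)" for i q
  define C' where "C' q j = C (g q) j" for q j
  have "A i j = (\<Sum>q<r. B' i q * C' q j)" if "i \<in> I" "j \<in> J" for i j
  proof -
    have "A i j = (\<Sum>q<card E. B i (g q) * C (g q) j)"
      using assms(3)[OF that] sum.reindex_bij_betw[OF g, of "\<lambda>e. B i e * C e j"] by simp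
    also have "\<dots> = (\<Sum>q<card E. B' i q * C' q j)"
      by (simp add: B'_def C'_def)
    also have "\<dots> = (\<Sum>q<r. B' i q * C' q j)"
      by (rule sum.mono_neutral_left) (use assms(2) in \<open>auto simp: B'_def\<close>)
    finally show ?thesis .
  qed
  then show ?thesis unfolding rank_le_def by blast
qed

lemma rank_le_mono:
  assumes "rank_le A I J r" "I' \<subseteq> I" "J' \<subseteq> J" "r \<le> r'"
    and "\<And>i j. i \<in> I' \<Longrightarrow> j \<in> J' \<Longrightarrow> A' i j = A i j"
  shows "rank_le A' I' J' r'"
proof -
  obtain B C where "\<forall>i\<in>I. \<forall>j\<in>J. A i j = (\<Sum>q<r. B i q * C q j)"
    using assms(1) unfolding rank_le_def by blast
  then show ?thesis
    by (intro rank_le_index[of "{..<r}" _ _ _ _ B C]) (use assms in auto)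
qed

lemma rank_le_transpose:
  assumes "rank_le A I J r"
  shows "rank_le (\<lambda>j i. A i j) J I r"
proof -
  obtain B C where "\<forall>i\<in>I. \<forall>j\<in>J. A i j = (\<Sum>q<r. B i q * C q j)"
    using assms unfolding rank_le_def by blast
  then show ?thesis
    by (intro rank_le_index[of "{..<r}" _ _ _ _ "\<lambda>j q. C q j" "\<lambda>q i. B i q"]) (auto simp: mult.commute)
qed

lemma rank_le_rows:
  assumes "rank_le A I J r" "finite I"
    and "\<And>i. i \<in> I' \<Longrightarrow> \<exists>w. \<forall>j\<in>J. A' i j = (\<Sum>i'\<in>I. w i' * A i' j)"
  shows "rank_le A' I' J r"
proof -
  obtain B C where BC: "\<forall>i\<in>I. \<forall>j\<in>J. A i j = (\<Sum>q<r. B i q * C q j)"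
    using assms(1) unfolding rank_le_def by blast
  obtain w where w: "\<And>i. i \<in> I' \<Longrightarrow> \<forall>j\<in>J. A' i j = (\<Sum>i'\<in>I. w i i' * A i' j)"
    using assms(3) by metis
  show ?thesis
  proof (rule rank_le_index[of "{..<r}" _ _ _ _ "\<lambda>i q. \<Sum>i'\<in>I. w i i' * B i' q" C])
    fix i j assume ij: "i \<in> I'" "j \<in> J"
    have "A' i j = (\<Sum>i'\<in>I. w i i' * (\<Sum>q<r. B i' q * C q j))"
      using w[OF ij(1)] ij(2) BC by auto
    also have "\<dots> = (\<Sum>q<r. (\<Sum>i'\<in>I. w i i' * B i' q) * C q j)"
      by (simp add: sum_distrib_left sum_distrib_right mult.assoc) (rule sum.swap)
    finally show "A' i j = (\<Sum>q<r. (\<Sum>i'\<in>I. w i i' * B i' q) * C q j)" .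
  qed auto
qed

text \<open>The new rows are again combinations of the old rows, so no inner dimension is
  added.\<close>

lemma rank_le_add_row_span:
  assumes "rank_le A I J r" "finite I" "\<And>j. j \<in> J \<Longrightarrow> v j = (\<Sum>i\<in>I. w i * A i j)"
  shows "rank_le (\<lambda>i j. A i j + u i * v j) I J r"
proof (rule rank_le_rows[OF assms(1,2)])
  fix i assume i: "i \<in> I"
  have "A i j + u i * v j = (\<Sum>i'\<in>I. ((if i' = i then 1 else 0) + u i * w i') * A i' j)" if "j \<in> J" for j
  proof -
    have "(\<Sum>i'\<in>I. (if i' = i then 1 else 0) * A i' j) = A i j"
      using i assms(2) by (simp add: if_distrib[of "\<lambda>x. x * _"] cong: if_cong)
    then show ?thesis
      using assms(3)[OF that] by (simp add: distrib_right sum.distrib sum_distrib_left mult.assoc)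
  qed
  then show "\<exists>w. \<forall>j\<in>J. A i j + u i * v j = (\<Sum>i'\<in>I. w i' * A i' j)"
    by (intro exI[of _ "\<lambda>i'. (if i' = i then 1 else 0) + u i * w i'"]) simp
qed

lemma rank_le_add_col_span:
  assumes "rank_le A I J r" "finite J" "\<And>i. i \<in> I \<Longrightarrow> u i = (\<Sum>j\<in>J. A i j * w j)"
  shows "rank_le (\<lambda>i j. A i j + u i * v j) I J r"
proof -
  have "rank_le (\<lambda>j i. A i j + v j * u i) J I r"
    by (rule rank_le_add_row_span[OF rank_le_transpose[OF assms(1)] assms(2), where w = w])
      (use assms(3) in \<open>simp add: mult.commute\<close>)
  then have "rank_le (\<lambda>i j. A i j + v j * u i) I J r" by (rule rank_le_transpose)
  then show ?thesis by (simp only: mult.commute[of "v _"])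
qed

lemma rank_le_add_rank_one:
  assumes "rank_le A I J r"
  shows "rank_le (\<lambda>i j. A i j + u i * v j) I J (Suc r)"
proof -
  obtain B C where "\<forall>i\<in>I. \<forall>j\<in>J. A i j = (\<Sum>q<r. B i q * C q j)"
    using assms(1) unfolding rank_le_def by blast
  then show ?thesis
    by (intro rank_le_index[of "{..<Suc r}" _ _ _ _
          "\<lambda>i q. if q = r then u i else B i q" "\<lambda>q j. if q = r then v j else C q j"]) auto
qed

text \<open>The Fredholm alternative, by induction on the columns: a functional that detects
  \<open>x\<close> is corrected against each new column.\<close>

lemma linear_system_alternative:
  fixes N :: "'i \<Rightarrow> 'j \<Rightarrow> 'f::field"
  assumes "finite I" "finite J"
  shows "(\<exists>w. \<forall>i\<in>I. x i = (\<Sum>j\<in>J. N i j * w j)) \<or>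
    (\<exists>y. (\<forall>j\<in>J. (\<Sum>i\<in>I. y i * N i j) = 0) \<and> (\<Sum>i\<in>I. y i * x i) = 1)"
  using assms(2)
proof (induction J arbitrary: x rule: finite_induct)
  case empty
  show ?case
  proof (cases "\<forall>i\<in>I. x i = 0")
    case False
    then obtain i where i: "i \<in> I" "x i \<noteq> 0" by blast
    have "(\<Sum>i'\<in>I. (if i' = i then 1 / x i else 0) * x i') = 1"
      using i assms(1) by (simp add: if_distrib[of "\<lambda>y. y * _"] cong: if_cong)
    then show ?thesis
      by (intro disjI2 exI[of _ "\<lambda>i'. if i' = i then 1 / x i else 0"]) simp
  qed auto
next
  case (insert m J)
  let ?span = "\<lambda>x J. \<exists>w. \<forall>i\<in>I. x i = (\<Sum>j\<in>J. N i j * w j)"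
  let ?dual = "\<lambda>x J y. (\<forall>j\<in>J. (\<Sum>i\<in>I. y i * N i j) = 0) \<and> (\<Sum>i\<in>I. y i * x i) = 1"
  have ext: "?span x (insert m J)" if "\<forall>i\<in>I. x i = (\<Sum>j\<in>J. N i j * w j) + c * N i m" for x w c
    by (rule exI[of _ "w(m := c)"])
      (use that insert.hyps in \<open>auto simp: mult.commute intro!: sum.cong\<close>)
  show ?case
  proof (cases "?span x J")
    case True
    then obtain w where "\<forall>i\<in>I. x i = (\<Sum>j\<in>J. N i j * w j)" by blast
    then show ?thesis using ext[of x w 0] by auto
  next
    case False
    then obtain y where y: "?dual x J y" using insert.IH[of x] by blast
    let ?d = "\<Sum>i\<in>I. y i * N i m"
    show ?thesis
    proof (cases "?d = 0")
      case True
      then show ?thesis using y by blast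
    next
      case d: False
      \<comment> \<open>This choice makes \<open>y\<close> vanish on \<open>x'\<close>. The
        induction hypothesis for \<open>x'\<close> gives either the remaining coefficients or a
        second functional.\<close>
      define c where "c = 1 / ?d"
      define x' where "x' i = x i - c * N i m" for i
      from insert.IH[of x'] show ?thesis
      proof
        assume "?span x' J"
        then obtain w where "\<forall>i\<in>I. x' i = (\<Sum>j\<in>J. N i j * w j)" by blast
        then have "\<forall>i\<in>I. x i = (\<Sum>j\<in>J. N i j * w j) + c * N i m"
          by (auto simp: x'_def algebra_simps)
        then show ?thesis using ext by blast
      next
        assume "\<exists>y. ?dual x' J y"
        then obtain y' where y': "?dual x' J y'" by blast
        let ?e = "c * (\<Sum>i\<in>I. y' i * N i m)"
        \<comment> \<open>Subtracting this multiple of \<open>y\<close> kills column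
          \<open>m\<close> and leaves the value at \<open>x\<close> equal to
          \<open>1\<close>.\<close>
        define z where "z i = y' i - ?e * y i" for i
        have lin: "(\<Sum>i\<in>I. z i * t i) = (\<Sum>i\<in>I. y' i * t i) - ?e * (\<Sum>i\<in>I. y i * t i)" for t
          by (simp add: z_def left_diff_distrib sum_subtractf sum_distrib_left mult.assoc)
        have 1: "(\<Sum>i\<in>I. y' i * x i) = 1 + ?e"
        proof -
          have "1 = (\<Sum>i\<in>I. y' i * x' i)" using y' by simp
          also have "\<dots> = (\<Sum>i\<in>I. y' i * x i) - ?e"
            by (simp add: x'_def right_diff_distrib sum_subtractf sum_distrib_left mult_ac)
          finally show ?thesis by (simp add: algebra_simps)
        qed
        have "?dual x (insert m J) z"
          unfolding lin using y y' d 1 by (auto simp: c_def)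
        then show ?thesis by blast
      qed
    qed
  qed
qed

text \<open>The Wedderburn rank reduction formula, with \<open>N + c x v\<close> in the role of the given matrix.\<close>

lemma rank_le_reduce:
  fixes N :: "'i \<Rightarrow> 'j \<Rightarrow> 'f::field"
  assumes fin: "finite I" "finite J"
    and x: "\<not> (\<exists>w. \<forall>i\<in>I. x i = (\<Sum>j\<in>J. N i j * w j))"
    and v: "\<not> (\<exists>w. \<forall>j\<in>J. v j = (\<Sum>i\<in>I. w i * N i j))"
    and c: "c \<noteq> 0" and rk: "rank_le (\<lambda>i j. N i j + c * x i * v j) I J q"
  shows "0 < q" "rank_le N I J (q - 1)"
proof -
  \<comment> \<open>As \<open>x\<close> and \<open>v\<close> lie outside the spans, there are
    functionals that annihilate \<open>N\<close> and are normalized on \<open>x\<close> and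
    \<open>v\<close>. Applied to the factorization they isolate the rank one term.\<close>
  obtain y where y: "\<And>j. j \<in> J \<Longrightarrow> (\<Sum>i\<in>I. y i * N i j) = 0" "(\<Sum>i\<in>I. y i * x i) = 1"
    using linear_system_alternative[OF fin, of x N] x by blast
  obtain z where z: "\<And>i. i \<in> I \<Longrightarrow> (\<Sum>j\<in>J. z j * N i j) = 0" "(\<Sum>j\<in>J. z j * v j) = 1"
    using linear_system_alternative[OF fin(2,1), of v "\<lambda>j i. N i j"] v by (auto simp: mult.commute)
  obtain B C where BC: "\<And>i j. i \<in> I \<Longrightarrow> j \<in> J \<Longrightarrow> N i j + c * x i * v j = (\<Sum>e<q. B i e * C e j)"
    using rk unfolding rank_le_def by blast
  define b where "b e = (\<Sum>i\<in>I. y i * B i e)" for e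
  define g where "g e = (\<Sum>j\<in>J. z j * C e j)" for e
  have bC: "(\<Sum>e<q. b e * C e j) = c * v j" if j: "j \<in> J" for j
  proof -
    have "(\<Sum>e<q. b e * C e j) = (\<Sum>e<q. \<Sum>i\<in>I. y i * (B i e * C e j))"
      by (simp add: b_def sum_distrib_right mult.assoc)
    also have "\<dots> = (\<Sum>i\<in>I. y i * (\<Sum>e<q. B i e * C e j))"
      by (subst sum.swap) (simp add: sum_distrib_left)
    also have "\<dots> = (\<Sum>i\<in>I. y i * (N i j + c * x i * v j))"
      by (rule sum.cong) (use BC j in auto)
    also have "\<dots> = (\<Sum>i\<in>I. y i * N i j) + c * v j * (\<Sum>i\<in>I. y i * x i)"
      by (simp add: distrib_left sum.distrib sum_distrib_left mult_ac)
    finally show ?thesis using y j by simp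
  qed
  have Bg: "(\<Sum>e<q. B i e * g e) = c * x i" if i: "i \<in> I" for i
  proof -
    have "(\<Sum>e<q. B i e * g e) = (\<Sum>e<q. \<Sum>j\<in>J. z j * (B i e * C e j))"
      by (simp add: g_def sum_distrib_left mult_ac)
    also have "\<dots> = (\<Sum>j\<in>J. z j * (\<Sum>e<q. B i e * C e j))"
      by (subst sum.swap) (simp add: sum_distrib_left)
    also have "\<dots> = (\<Sum>j\<in>J. z j * (N i j + c * x i * v j))"
      by (rule sum.cong) (use BC i in auto)
    also have "\<dots> = (\<Sum>j\<in>J. z j * N i j) + c * x i * (\<Sum>j\<in>J. z j * v j)"
      by (simp add: distrib_left sum.distrib sum_distrib_left mult_ac)
    finally show ?thesis using z i by simp
  qed
  have bg: "(\<Sum>e<q. b e * g e) = c"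
  proof -
    have "(\<Sum>e<q. b e * g e) = (\<Sum>e<q. \<Sum>j\<in>J. z j * (b e * C e j))"
      by (simp add: g_def sum_distrib_left mult_ac)
    also have "\<dots> = (\<Sum>j\<in>J. z j * (\<Sum>e<q. b e * C e j))"
      by (subst sum.swap) (simp add: sum_distrib_left)
    also have "\<dots> = (\<Sum>j\<in>J. z j * (c * v j))"
      by (rule sum.cong) (use bC in auto)
    also have "\<dots> = c * (\<Sum>j\<in>J. z j * v j)"
      by (simp add: sum_distrib_left mult_ac)
    finally show ?thesis using z by simp
  qed
  \<comment> \<open>The sum in \<open>bg\<close> is nonzero, so some \<open>b a\<close> is nonzero;
    this is the inner index to be eliminated.\<close>
  obtain a where a: "a < q" "b a \<noteq> 0"
    using bg c sum.neutral[of "{..<q}" "\<lambda>e. b e * g e"] by (metis lessThan_iff mult_zero_left)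
  show "0 < q" using a by simp
  \<comment> \<open>Removing the multiple of \<open>v\<close> turns the right factor
    \<open>C\<close> into one for \<open>N\<close> itself, and its rows satisfy the linear relation
    \<open>bD\<close>. Solving that relation for row \<open>a\<close> drops one inner
    dimension.\<close>
  define D where "D e j = C e j - g e * v j" for e j
  have bD: "(\<Sum>e<q. b e * D e j) = 0" if "j \<in> J" for j
  proof -
    have "(\<Sum>e<q. b e * D e j) = (\<Sum>e<q. b e * C e j) - (\<Sum>e<q. b e * g e) * v j"
      by (simp add: D_def right_diff_distrib sum_subtractf sum_distrib_right mult.assoc)
    then show ?thesis using bC[OF that] bg by simp
  qed
  have ND: "N i j = (\<Sum>e<q. B i e * D e j)" if "i \<in> I" "j \<in> J" for i j
  proof -
    have "(\<Sum>e<q. B i e * D e j) = (\<Sum>e<q. B i e * C e j) - (\<Sum>e<q. B i e * g e) * v j"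
      by (simp add: D_def right_diff_distrib sum_subtractf sum_distrib_right mult.assoc)
    then show ?thesis using Bg[OF that(1)] BC[OF that] by (metis add_diff_cancel_right')
  qed
  show "rank_le N I J (q - 1)"
  proof (rule rank_le_index[of "{..<q} - {a}" _ _ _ _ "\<lambda>i e. B i e - B i a * b e / b a" D])
    fix i j assume ij: "i \<in> I" "j \<in> J"
    have split: "(\<Sum>e<q. t e) = t a + (\<Sum>e\<in>{..<q} - {a}. t e)" for t :: "nat \<Rightarrow> 'f"
      using a by (intro sum.remove) auto
    have "b a * D a j = - (\<Sum>e\<in>{..<q} - {a}. b e * D e j)"
      using bD[OF ij(2)] split[of "\<lambda>e. b e * D e j"] by (simp add: eq_neg_iff_add_eq_0)
    then have Da: "D a j = - (\<Sum>e\<in>{..<q} - {a}. b e * D e j) / b a"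
      using a by (simp add: field_simps)
    have "(\<Sum>e\<in>{..<q} - {a}. (B i e - B i a * b e / b a) * D e j)
      = (\<Sum>e\<in>{..<q} - {a}. B i e * D e j) - B i a / b a * (\<Sum>e\<in>{..<q} - {a}. b e * D e j)"
      by (simp add: left_diff_distrib sum_subtractf sum_distrib_left mult.assoc)
    also have "\<dots> = (\<Sum>e\<in>{..<q} - {a}. B i e * D e j) + B i a * D a j"
      by (simp add: Da)
    finally show "N i j = (\<Sum>e\<in>{..<q} - {a}. (B i e - B i a * b e / b a) * D e j)"
      using ND[OF ij] split[of "\<lambda>e. B i e * D e j"] by simp
  qed (use a in auto)
qed

section \<open>Nonsingular blocks and nonvanishing minors\<close>

definition nonsing :: "('i \<Rightarrow> 'j \<Rightarrow> 'f::field) \<Rightarrow> 'i set \<Rightarrow> 'j set \<Rightarrow> bool" where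
  "nonsing A I J \<longleftrightarrow>
     (\<forall>w. (\<forall>i\<in>I. (\<Sum>j\<in>J. A i j * w j) = 0) \<longrightarrow> (\<forall>j\<in>J. w j = 0))"

lemma nonsingD: "nonsing A I J \<Longrightarrow> \<forall>i\<in>I. (\<Sum>j\<in>J. A i j * w j) = 0 \<Longrightarrow> \<forall>j\<in>J. w j = 0"
  unfolding nonsing_def by simp

text \<open>Gaussian elimination: the last equation is solved for the variable at a pivot
  \<open>m\<close>, which leaves one equation and one variable fewer.\<close>

lemma underdetermined_system:
  fixes C :: "nat \<Rightarrow> 'j \<Rightarrow> 'f::field"
  assumes "finite J" "q < card J"
  shows "\<exists>w. (\<exists>j\<in>J. w j \<noteq> 0) \<and> (\<forall>e<q. (\<Sum>j\<in>J. C e j * w j) = 0)"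
  using assms
proof (induction q arbitrary: J C)
  case 0
  then show ?case by (intro exI[of _ "\<lambda>_. 1"]) (auto simp: card_gt_0_iff)
next
  case (Suc q)
  show ?case
  proof (cases "\<forall>j\<in>J. C q j = 0")
    case True
    then show ?thesis using Suc.IH[of J C] Suc.prems by (auto simp: less_Suc_eq)
  next
    case False
    then obtain m where m: "m \<in> J" "C q m \<noteq> 0" by blast
    have "finite (J - {m})" "q < card (J - {m})" using Suc.prems m by auto
    then obtain w where w: "\<exists>j\<in>J - {m}. w j \<noteq> 0"
        "\<And>e. e < q \<Longrightarrow> (\<Sum>j\<in>J - {m}. (C e j - C e m * C q j / C q m) * w j) = 0"
      using Suc.IH[of "J - {m}" "\<lambda>e j. C e j - C e m * C q j / C q m"] by metis
    define s where "s = (\<Sum>j\<in>J - {m}. C q j * w j)"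
    define w' where "w' = w(m := - s / C q m)"
    have eq: "(\<Sum>j\<in>J. C e j * w' j) = (\<Sum>j\<in>J - {m}. C e j * w j) - C e m * s / C q m" for e
    proof -
      have "(\<Sum>j\<in>J. C e j * w' j) = C e m * w' m + (\<Sum>j\<in>J - {m}. C e j * w' j)"
        using m Suc.prems by (intro sum.remove) auto
      also have "(\<Sum>j\<in>J - {m}. C e j * w' j) = (\<Sum>j\<in>J - {m}. C e j * w j)"
        by (rule sum.cong) (auto simp: w'_def)
      finally show ?thesis by (simp add: w'_def)
    qed
    have "(\<Sum>j\<in>J. C e j * w' j) = 0" if "e < Suc q" for e
    proof (cases "e = q")
      case True
      then show ?thesis unfolding eq using m by (simp add: s_def)
    next
      case False
      then have "0 = (\<Sum>j\<in>J - {m}. (C e j - C e m * C q j / C q m) * w j)"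
        using w(2)[of e] that by simp
      also have "\<dots> = (\<Sum>j\<in>J - {m}. C e j * w j - C e m / C q m * (C q j * w j))"
        by (intro sum.cong refl) (simp add: left_diff_distrib)
      also have "\<dots> = (\<Sum>j\<in>J - {m}. C e j * w j) - C e m / C q m * s"
        by (simp only: s_def sum_subtractf sum_distrib_left)
      finally show ?thesis unfolding eq by simp
    qed
    moreover have "\<exists>j\<in>J. w' j \<noteq> 0" using w(1) by (auto simp: w'_def)
    ultimately show ?thesis by blast
  qed
qed

lemma rank_le_not_nonsing:
  assumes "rank_le A I J q" "finite J" "q < card J"
  shows "\<not> nonsing A I J"
proof -
  obtain B C where BC: "\<And>i j. i \<in> I \<Longrightarrow> j \<in> J \<Longrightarrow> A i j = (\<Sum>e<q. B i e * C e j)"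
    using assms(1) unfolding rank_le_def by blast
  obtain w where w: "\<exists>j\<in>J. w j \<noteq> 0" "\<And>e. e < q \<Longrightarrow> (\<Sum>j\<in>J. C e j * w j) = 0"
    using underdetermined_system[OF assms(2,3)] by blast
  have "(\<Sum>j\<in>J. A i j * w j) = 0" if "i \<in> I" for i
  proof -
    have "(\<Sum>j\<in>J. A i j * w j) = (\<Sum>j\<in>J. \<Sum>e<q. B i e * (C e j * w j))"
      using BC[OF that] by (simp add: sum_distrib_right mult.assoc)
    also have "\<dots> = (\<Sum>e<q. B i e * (\<Sum>j\<in>J. C e j * w j))"
      by (subst sum.swap) (simp add: sum_distrib_left)
    finally show ?thesis using w(2) by simp
  qed
  then show ?thesis using w(1) unfolding nonsing_def by blast
qed

text \<open>A nonsingular block is enlarged by one row and one column. If no enlargement is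
  nonsingular, the columns of the old block span all columns, and the rank is too small.\<close>

lemma nonsing_exists:
  assumes "\<not> rank_le A I J q"
  shows "\<exists>I0 J0. I0 \<subseteq> I \<and> J0 \<subseteq> J \<and> finite I0 \<and> finite J0 \<and> card I0 = Suc q \<and> card J0 = Suc q \<and>
    nonsing A I0 J0"
  using assms
proof (induction q)
  case 0
  then obtain i j where "i \<in> I" "j \<in> J" "A i j \<noteq> 0" unfolding rank_le_def by auto
  then show ?case by (intro exI[of _ "{i}"] exI[of _ "{j}"]) (auto simp: nonsing_def)
next
  case (Suc q)
  have "\<not> rank_le A I J q" using Suc.prems rank_le_mono[of A I J q I J "Suc q" A] by auto
  then obtain I0 J0 where IJ: "I0 \<subseteq> I" "J0 \<subseteq> J" "finite I0" "finite J0" "card I0 = Suc q"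
      "card J0 = Suc q" "nonsing A I0 J0"
    using Suc.IH by blast
  show ?case
  proof (rule ccontr)
    assume no: "\<not> ?thesis"
    have dep: "\<exists>w. \<forall>i'\<in>insert i I0. A i' j = (\<Sum>j'\<in>J0. A i' j' * w j')"
      if i: "i \<in> I - I0" and j: "j \<in> J - J0" for i j
    proof -
      have "\<not> nonsing A (insert i I0) (insert j J0)"
        using no i j IJ by (auto intro!: exI[of _ "insert i I0"] exI[of _ "insert j J0"])
      then obtain w where w: "\<forall>i'\<in>insert i I0. (\<Sum>j'\<in>insert j J0. A i' j' * w j') = 0"
          "\<exists>j'\<in>insert j J0. w j' \<noteq> 0"
        unfolding nonsing_def by blast
      have sum: "(\<Sum>j'\<in>insert j J0. A i' j' * w j') = A i' j * w j + (\<Sum>j'\<in>J0. A i' j' * w j')" for i'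
        using j IJ by simp
      have wj: "w j \<noteq> 0"
      proof
        assume "w j = 0"
        then have "\<forall>i'\<in>I0. (\<Sum>j'\<in>J0. A i' j' * w j') = 0" using w(1) by (auto simp: sum)
        then have "\<forall>j'\<in>J0. w j' = 0" by (rule nonsingD[OF IJ(7)])
        then show False using w(2) \<open>w j = 0\<close> by blast
      qed
      show ?thesis
      proof (intro exI[of _ "\<lambda>j'. - w j' / w j"] ballI)
        fix i' assume "i' \<in> insert i I0"
        then have "A i' j * w j = - (\<Sum>j'\<in>J0. A i' j' * w j')"
          using bspec[OF w(1)] unfolding sum by (simp add: eq_neg_iff_add_eq_0)
        then have "A i' j = - (\<Sum>j'\<in>J0. A i' j' * w j') / w j" using wj by (simp add: field_simps)
        also have "\<dots> = (\<Sum>j'\<in>J0. A i' j' * (- w j' / w j))"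
          by (simp add: sum_negf sum_divide_distrib)
        finally show "A i' j = (\<Sum>j'\<in>J0. A i' j' * (- w j' / w j))" .
      qed
    qed
    \<comment> \<open>The old block determines the coefficients of a column, so the relations
      obtained for different extra rows \<open>i\<close> are one and the same.\<close>
    have uniq: "\<forall>j'\<in>J0. w j' = w' j'"
      if "\<forall>i'\<in>I0. (\<Sum>j'\<in>J0. A i' j' * w j') = (\<Sum>j'\<in>J0. A i' j' * w' j')" for w w'
    proof -
      have "\<forall>i'\<in>I0. (\<Sum>j'\<in>J0. A i' j' * (w j' - w' j')) = 0"
        using that by (simp add: right_diff_distrib sum_subtractf)
      from nonsingD[OF IJ(7) this] have "\<forall>j'\<in>J0. w j' - w' j' = 0" .
      then show ?thesis by simp
    qed
    have "\<exists>w. \<forall>i\<in>I. A i j = (\<Sum>j'\<in>J0. A i j' * w j')" if j: "j \<in> J" for j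
    proof (cases "j \<in> J0")
      case True
      show ?thesis
        by (rule exI[of _ "\<lambda>j'. if j' = j then 1 else 0"])
          (use True IJ in \<open>simp add: if_distrib[of "\<lambda>x. _ * x"] cong: if_cong\<close>)
    next
      case False
      obtain w0 where w0: "\<forall>i\<in>I0. A i j = (\<Sum>j'\<in>J0. A i j' * w0 j')"
      proof (cases "I - I0 = {}")
        case True
        have "rank_le A I J (Suc q)"
          by (rule rank_le_index[of I0 _ _ _ _ "\<lambda>i e. if i = e then 1 else 0" A])
            (use True IJ in \<open>auto simp: if_distrib[of "\<lambda>x. x * _"] cong: if_cong\<close>)
        then show ?thesis using Suc.prems by blast
      next
        case ne: False
        then obtain i where "i \<in> I - I0" by blast
        then obtain w where "\<forall>i'\<in>insert i I0. A i' j = (\<Sum>j'\<in>J0. A i' j' * w j')"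
          using dep[of i j] False j by blast
        then show ?thesis by (intro that[of w]) simp
      qed
      have "A i j = (\<Sum>j'\<in>J0. A i j' * w0 j')" if i: "i \<in> I" for i
      proof (cases "i \<in> I0")
        case True
        then show ?thesis using bspec[OF w0] by simp
      next
        case ni: False
        then obtain w where w: "\<forall>i'\<in>insert i I0. A i' j = (\<Sum>j'\<in>J0. A i' j' * w j')"
          using dep[of i j] i j False by blast
        have "(\<Sum>j'\<in>J0. A i' j' * w j') = (\<Sum>j'\<in>J0. A i' j' * w0 j')" if "i' \<in> I0" for i'
          using trans[OF bspec[OF w, of i', symmetric] bspec[OF w0, of i']] that by simp
        then have "\<forall>j'\<in>J0. w j' = w0 j'" using uniq[of w w0] by simp
        then have "(\<Sum>j'\<in>J0. A i j' * w j') = (\<Sum>j'\<in>J0. A i j' * w0 j')" by (intro sum.cong) auto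
        then show ?thesis using bspec[OF w, of i] by simp
      qed
      then show ?thesis by (intro exI[of _ w0]) simp
    qed
    then have "\<forall>j. \<exists>w. j \<in> J \<longrightarrow> (\<forall>i\<in>I. A i j = (\<Sum>j'\<in>J0. A i j' * w j'))" by simp
    from choice[OF this] obtain w where "\<And>i j. j \<in> J \<Longrightarrow> i \<in> I \<Longrightarrow> A i j = (\<Sum>j'\<in>J0. A i j' * w j j')"
      by auto
    then have "rank_le A I J (Suc q)"
      by (intro rank_le_index[of J0 _ _ _ _ A "\<lambda>e j. w j e"]) (use IJ in auto)
    then show False using Suc.prems by blast
  qed
qed

lemma det_eq_0_iff_not_nonsing:
  fixes A :: "'i \<Rightarrow> 'j \<Rightarrow> 'f::field"
  assumes "inj_on r {..<n}" "inj_on c {..<n}"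
  shows "det (mat n n (\<lambda>(a, b). A (r a) (c b))) = 0 \<longleftrightarrow> \<not> nonsing A (r ` {..<n}) (c ` {..<n})"
proof -
  let ?M = "mat n n (\<lambda>(a, b). A (r a) (c b))"
  have sum: "(\<Sum>j\<in>c ` {..<n}. A i j * w j) = (\<Sum>b<n. A i (c b) * w (c b))" for i w
    using assms(2) by (simp add: sum.reindex)
  have mv: "(?M *\<^sub>v x) $ a = (\<Sum>b<n. A (r a) (c b) * x $ b)" if "x \<in> carrier_vec n" "a < n" for x a
    using that by (auto simp: scalar_prod_def lessThan_atLeast0 intro!: sum.cong)
  have "det ?M = 0 \<longleftrightarrow> (\<exists>x. x \<in> carrier_vec n \<and> x \<noteq> 0\<^sub>v n \<and> ?M *\<^sub>v x = 0\<^sub>v n)"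
    by (rule det_0_iff_vec_prod_zero_field) auto
  also have "\<dots> \<longleftrightarrow> \<not> nonsing A (r ` {..<n}) (c ` {..<n})"
  proof
    assume "\<exists>x. x \<in> carrier_vec n \<and> x \<noteq> 0\<^sub>v n \<and> ?M *\<^sub>v x = 0\<^sub>v n"
    then obtain x where x: "x \<in> carrier_vec n" "x \<noteq> 0\<^sub>v n" "?M *\<^sub>v x = 0\<^sub>v n" by blast
    define w where "w j = x $ (the_inv_into {..<n} c j)" for j
    have wc: "w (c b) = x $ b" if "b < n" for b
      using that assms(2) by (simp add: w_def the_inv_into_f_f)
    have "\<exists>b<n. x $ b \<noteq> 0"
    proof (rule ccontr)
      assume "\<not> ?thesis"
      then have "x = 0\<^sub>v n" using x(1) by (intro eq_vecI) auto
      then show False using x(2) by simp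
    qed
    moreover have "(\<Sum>j\<in>c ` {..<n}. A (r a) j * w j) = 0" if "a < n" for a
    proof -
      have "(\<Sum>b<n. A (r a) (c b) * w (c b)) = (\<Sum>b<n. A (r a) (c b) * x $ b)"
        by (rule sum.cong) (auto simp: wc)
      also have "\<dots> = 0\<^sub>v n $ a" using mv[OF x(1) that] x(3) by simp
      finally show ?thesis using that by (simp add: sum)
    qed
    ultimately show "\<not> nonsing A (r ` {..<n}) (c ` {..<n})"
      unfolding nonsing_def using wc by fastforce
  next
    assume "\<not> nonsing A (r ` {..<n}) (c ` {..<n})"
    then obtain w where w: "\<And>a. a < n \<Longrightarrow> (\<Sum>b<n. A (r a) (c b) * w (c b)) = 0" "\<exists>b<n. w (c b) \<noteq> 0"
      unfolding nonsing_def sum by blast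
    define x where "x = vec n (\<lambda>b. w (c b))"
    have x: "x \<in> carrier_vec n" by (simp add: x_def)
    obtain b where b: "b < n" "w (c b) \<noteq> 0" using w(2) by blast
    then have "x $ b \<noteq> 0\<^sub>v n $ b" by (simp add: x_def)
    then have "x \<noteq> 0\<^sub>v n" by metis
    moreover have "?M *\<^sub>v x = 0\<^sub>v n"
    proof (rule eq_vecI)
      fix a assume "a < dim_vec (0\<^sub>v n :: 'f vec)"
      then have a: "a < n" by simp
      have "(?M *\<^sub>v x) $ a = (\<Sum>b<n. A (r a) (c b) * x $ b)" by (rule mv[OF x a])
      also have "\<dots> = (\<Sum>b<n. A (r a) (c b) * w (c b))"
        by (rule sum.cong) (auto simp: x_def)
      finally show "(?M *\<^sub>v x) $ a = 0\<^sub>v n $ a" using w(1)[OF a] a by simp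
    qed auto
    ultimately show "\<exists>x. x \<in> carrier_vec n \<and> x \<noteq> 0\<^sub>v n \<and> ?M *\<^sub>v x = 0\<^sub>v n" using x by blast
  qed
  finally show ?thesis .
qed

lemma strict_mono_enumeration:
  fixes S :: "nat set"
  assumes "finite S"
  obtains r where "strict_mono_on {..<card S} r" "r ` {..<card S} = S"
proof
  let ?r = "\<lambda>i. sorted_list_of_set S ! i"
  show "strict_mono_on {..<card S} ?r"
    using sorted_wrt_nth_less[OF strict_sorted_list_of_set[of S]] assms
    by (intro strict_mono_onI) auto
  have "?r ` {..<card S} = set (sorted_list_of_set S)"
    using assms by (auto simp: set_conv_nth image_def)
  then show "?r ` {..<card S} = S" using assms by simp
qed

lemma minor_neq_0_exists:
  fixes A :: "nat \<Rightarrow> nat \<Rightarrow> 'f::field"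
  assumes "\<not> rank_le A I J q"
  obtains r c where "strict_mono_on {..<Suc q} r" "strict_mono_on {..<Suc q} c"
    "r ` {..<Suc q} \<subseteq> I" "c ` {..<Suc q} \<subseteq> J"
    "det (mat (Suc q) (Suc q) (\<lambda>(a, b). A (r a) (c b))) \<noteq> 0"
proof -
  obtain I0 J0 where IJ: "I0 \<subseteq> I" "J0 \<subseteq> J" "finite I0" "finite J0" "card I0 = Suc q"
      "card J0 = Suc q" "nonsing A I0 J0"
    using nonsing_exists[OF assms] by blast
  obtain r where r: "strict_mono_on {..<Suc q} r" "r ` {..<Suc q} = I0"
    using strict_mono_enumeration[OF IJ(3)] unfolding IJ(5) .
  obtain c where c: "strict_mono_on {..<Suc q} c" "c ` {..<Suc q} = J0"
    using strict_mono_enumeration[OF IJ(4)] unfolding IJ(6) .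
  have "inj_on r {..<Suc q}" "inj_on c {..<Suc q}"
    using r c strict_mono_on_imp_inj_on by blast+
  from det_eq_0_iff_not_nonsing[OF this, of A]
  have "det (mat (Suc q) (Suc q) (\<lambda>(a, b). A (r a) (c b))) \<noteq> 0" using r c IJ(7) by auto
  with r c IJ that show ?thesis by blast
qed

lemma minor_eq_0:
  assumes "rank_le A I J q" "inj_on r {..<n}" "inj_on c {..<n}" "r ` {..<n} \<subseteq> I" "c ` {..<n} \<subseteq> J" "q < n"
  shows "det (mat n n (\<lambda>(a, b). A (r a) (c b))) = 0"
proof -
  have "rank_le A (r ` {..<n}) (c ` {..<n}) q"
    by (rule rank_le_mono[OF assms(1)]) (use assms in auto)
  then have "\<not> nonsing A (r ` {..<n}) (c ` {..<n})"
    by (rule rank_le_not_nonsing) (use assms(6) card_image[OF assms(3)] in auto)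
  then show ?thesis using det_eq_0_iff_not_nonsing[OF assms(2,3), of A] by simp
qed

section \<open>Row and column spans of blocks\<close>

definition unit_fun :: "'i \<Rightarrow> 'i \<Rightarrow> 'f::zero_neq_one" where
  "unit_fun i a = (if a = i then 1 else 0)"

lemma sum_unit_fun_right:
  fixes f :: "'i \<Rightarrow> 'f::comm_ring_1"
  shows "finite I \<Longrightarrow> i \<in> I \<Longrightarrow> (\<Sum>a\<in>I. f a * unit_fun i a) = f i"
  by (simp add: unit_fun_def if_distrib[of "\<lambda>x. _ * x"] cong: if_cong)

definition in_col_span :: "('i \<Rightarrow> 'j \<Rightarrow> 'f::field) \<Rightarrow> 'i set \<Rightarrow> 'j set \<Rightarrow> ('i \<Rightarrow> 'f) \<Rightarrow> bool" where
  "in_col_span A I J x \<longleftrightarrow> (\<exists>w. \<forall>i\<in>I. x i = (\<Sum>j\<in>J. A i j * w j))"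

abbreviation in_row_span :: "('i \<Rightarrow> 'j \<Rightarrow> 'f::field) \<Rightarrow> 'i set \<Rightarrow> 'j set \<Rightarrow> ('j \<Rightarrow> 'f) \<Rightarrow> bool" where
  "in_row_span A I J v \<equiv> in_col_span (\<lambda>j i. A i j) J I v"

lemma in_col_spanI: "(\<And>i. i \<in> I \<Longrightarrow> x i = (\<Sum>j\<in>J. A i j * w j)) \<Longrightarrow> in_col_span A I J x"
  unfolding in_col_span_def by (rule exI[of _ w]) simp

lemma in_col_spanE:
  assumes "in_col_span A I J x"
  obtains w where "\<forall>i\<in>I. x i = (\<Sum>j\<in>J. A i j * w j)"
  using assms unfolding in_col_span_def by (elim exE)

lemma in_col_span_alternative:
  assumes "finite I" "finite J" "\<not> in_col_span A I J x"
  obtains y where "\<forall>j\<in>J. (\<Sum>i\<in>I. y i * A i j) = 0" "(\<Sum>i\<in>I. y i * x i) = 1"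
proof -
  have "in_col_span A I J x \<or> (\<exists>y. (\<forall>j\<in>J. (\<Sum>i\<in>I. y i * A i j) = 0) \<and> (\<Sum>i\<in>I. y i * x i) = 1)"
    unfolding in_col_span_def by (rule linear_system_alternative[OF assms(1,2)])
  with assms(3) obtain y where y: "(\<forall>j\<in>J. (\<Sum>i\<in>I. y i * A i j) = 0) \<and> (\<Sum>i\<in>I. y i * x i) = 1"
    by (elim disjE) (erule notE, assumption, elim exE)
  show ?thesis by (rule that[OF conjunct1[OF y] conjunct2[OF y]])
qed

lemma in_col_span_column:
  assumes "finite J" "j \<in> J" "\<And>i. i \<in> I \<Longrightarrow> x i = A i j * c"
  shows "in_col_span A I J x"
proof (rule in_col_spanI[where w = "\<lambda>a. unit_fun j a * c"])
  fix i assume "i \<in> I"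
  have "(\<Sum>a\<in>J. A i a * (unit_fun j a * c)) = (\<Sum>a\<in>J. A i a * unit_fun j a) * c"
    by (simp only: sum_distrib_right mult.assoc)
  also have "\<dots> = A i j * c" by (simp only: sum_unit_fun_right[OF assms(1,2)])
  finally show "x i = (\<Sum>a\<in>J. A i a * (unit_fun j a * c))" using assms(3)[OF \<open>i \<in> I\<close>] by simp
qed

lemma in_col_span_mono:
  assumes "in_col_span A I J x" "I' \<subseteq> I" "J \<subseteq> J'" "finite J'"
  shows "in_col_span A I' J' x"
proof -
  obtain w where "\<forall>i\<in>I. x i = (\<Sum>j\<in>J. A i j * w j)"
    by (rule in_col_spanE[OF assms(1)])
  note w = bspec[OF this]
  show ?thesis
  proof (rule in_col_spanI[where w = "\<lambda>j. if j \<in> J then w j else 0"])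
    fix i assume "i \<in> I'"
    then have "x i = (\<Sum>j\<in>J. A i j * w j)" using w assms(2) by blast
    also have "\<dots> = (\<Sum>j\<in>J'. A i j * (if j \<in> J then w j else 0))"
      using assms(3,4) by (intro sum.mono_neutral_cong_left) auto
    finally show "x i = (\<Sum>j\<in>J'. A i j * (if j \<in> J then w j else 0))" .
  qed
qed

lemma rank_le_add_in_col_span:
  assumes "rank_le A I J r" "finite J" "in_col_span A I J u"
  shows "rank_le (\<lambda>i j. A i j + u i * v j) I J r"
proof -
  obtain w where "\<forall>i\<in>I. u i = (\<Sum>j\<in>J. A i j * w j)"
    by (rule in_col_spanE[OF assms(3)])
  from bspec[OF this] show ?thesis by (rule rank_le_add_col_span[OF assms(1,2)])
qed

lemma rank_le_add_in_row_span:
  assumes "rank_le A I J r" "finite I" "in_row_span A I J v"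
  shows "rank_le (\<lambda>i j. A i j + u i * v j) I J r"
proof -
  have "rank_le (\<lambda>j i. A i j + v j * u i) J I r"
    by (rule rank_le_add_in_col_span[OF rank_le_transpose[OF assms(1)] assms(2,3)])
  from rank_le_transpose[OF this] show ?thesis by (simp only: mult.commute[of "v _"])
qed

lemma rank_le_reduce_span:
  assumes "finite I" "finite J" "\<not> in_col_span N I J x" "\<not> in_row_span N I J v"
    and "c \<noteq> 0" "rank_le (\<lambda>i j. N i j + c * x i * v j) I J q"
  shows "0 < q" "rank_le N I J (q - 1)"
proof -
  have comm: "(\<Sum>i\<in>I. w i * N i j) = (\<Sum>i\<in>I. N i j * w i)" for w j
    by (simp only: mult.commute)
  have v: "\<not> (\<exists>w. \<forall>j\<in>J. v j = (\<Sum>i\<in>I. w i * N i j))"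
    unfolding comm using assms(4) unfolding in_col_span_def .
  note * = rank_le_reduce[OF assms(1,2) assms(3)[unfolded in_col_span_def] v assms(5,6)]
  show "0 < q" "rank_le N I J (q - 1)" by (rule *)+
qed

lemma rank_le_rows_span:
  assumes "rank_le A I J r" "finite I" "\<And>i. i \<in> I' \<Longrightarrow> in_row_span A I J (A i)"
  shows "rank_le A I' J r"
proof (rule rank_le_rows[OF assms(1,2)])
  fix i assume "i \<in> I'"
  then obtain w where "\<forall>j\<in>J. A i j = (\<Sum>i'\<in>I. A i' j * w i')"
    by (rule in_col_spanE[OF assms(3)])
  then show "\<exists>w. \<forall>j\<in>J. A i j = (\<Sum>i'\<in>I. w i' * A i' j)"
    by (intro exI[of _ w]) (simp add: mult.commute)
qed

lemma rank_le_cols_span: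
  assumes "rank_le A I J r" "finite J" "\<And>j. j \<in> J' \<Longrightarrow> in_col_span A I J (\<lambda>i. A i j)"
  shows "rank_le A I J' r"
  by (rule rank_le_transpose, rule rank_le_rows_span[OF rank_le_transpose[OF assms(1)] assms(2)])
    (use assms(3) in simp)

text \<open>Row \<open>i\<close> already follows the relation \<open>w\<close> on \<open>J\<close>,
  so only the corner entry can fail. If column \<open>m\<close> is independent of \<open>J\<close>,
  a functional that vanishes on \<open>J\<close> and is \<open>1\<close> on column \<open>m\<close>
  adjusts \<open>w\<close> to any corner entry.\<close>

lemma rank_le_corner_row:
  fixes A :: "'i \<Rightarrow> 'j \<Rightarrow> 'f::field"
  assumes fin: "finite I" "finite J"
    and rk: "rank_le A I (insert m J) r" and m: "m \<notin> J"
    and w: "\<And>j. j \<in> J \<Longrightarrow> A i j = (\<Sum>i'\<in>I. A i' j * w i')"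
    and corner: "A i m = (\<Sum>i'\<in>I. A i' m * w i') \<or> \<not> in_col_span A I J (\<lambda>i'. A i' m)"
  shows "rank_le A (insert i I) (insert m J) r"
proof -
  have "in_row_span A I (insert m J) (A i)"
    using corner
  proof
    assume "A i m = (\<Sum>i'\<in>I. A i' m * w i')"
    then show ?thesis by (intro in_col_spanI[where w = w]) (use w in auto)
  next
    assume nc: "\<not> in_col_span A I J (\<lambda>i'. A i' m)"
    obtain y where y: "\<forall>j\<in>J. (\<Sum>i'\<in>I. y i' * A i' j) = 0" "(\<Sum>i'\<in>I. y i' * A i' m) = 1"
      by (rule in_col_span_alternative[OF fin nc])
    define e where "e = A i m - (\<Sum>i'\<in>I. A i' m * w i')"
    have eq: "(\<Sum>i'\<in>I. A i' j * (w i' + e * y i')) = (\<Sum>i'\<in>I. A i' j * w i') + e * (\<Sum>i'\<in>I. y i' * A i' j)" for j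
      by (simp add: distrib_left sum.distrib sum_distrib_left mult_ac)
    show ?thesis
    proof (rule in_col_spanI[where w = "\<lambda>i'. w i' + e * y i'"])
      fix j assume "j \<in> insert m J"
      then show "A i j = (\<Sum>i'\<in>I. A i' j * (w i' + e * y i'))"
        unfolding eq using w y by (auto simp: e_def)
    qed
  qed
  then show ?thesis
    by (intro rank_le_rows_span[OF rk fin(1)])
      (auto intro: in_col_span_column[where c = 1] fin)
qed

text \<open>Columns that generate every unit vector span the whole space, and then the rows are
  independent.\<close>

lemma nonsing_rows_if_units:
  fixes A :: "'i \<Rightarrow> 'j \<Rightarrow> 'f::field"
  assumes "finite B" "\<And>i. i \<in> B \<Longrightarrow> in_col_span A B J (unit_fun i)"
  shows "nonsing (\<lambda>j i. A i j) J B"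
  unfolding nonsing_def
proof (intro allI impI ballI)
  fix w i assume w: "\<forall>j\<in>J. (\<Sum>i\<in>B. A i j * w i) = 0" and i: "i \<in> B"
  obtain u where "\<forall>a\<in>B. unit_fun i a = (\<Sum>j\<in>J. A a j * u j)"
    by (rule in_col_spanE[OF assms(2)[OF i]])
  note u = bspec[OF this]
  have "w i = (\<Sum>a\<in>B. w a * unit_fun i a)" by (rule sum_unit_fun_right[OF assms(1) i, symmetric])
  also have "\<dots> = (\<Sum>a\<in>B. \<Sum>j\<in>J. u j * (A a j * w a))"
    by (rule sum.cong) (auto simp: u sum_distrib_left mult_ac)
  also have "\<dots> = (\<Sum>j\<in>J. u j * (\<Sum>a\<in>B. A a j * w a))"
    by (subst sum.swap) (simp add: sum_distrib_left)
  also have "\<dots> = 0" using w by simp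
  finally show "w i = 0" .
qed

text \<open>If every unit vector is a column combination, the rows in \<open>B\<close> are
  independent, and a rank of at most \<open>card B\<close> forces row \<open>i\<close> to depend on
  them. The hypothesis \<open>alt\<close> has the shape of the dichotomy delivered by
  \<open>extremal_span\<close>.\<close>

lemma in_row_span_if_units:
  fixes A :: "'i \<Rightarrow> 'j \<Rightarrow> 'f::field"
  assumes fin: "finite B" "finite J" and i: "i \<notin> B"
    and rk: "rank_le A (insert i B) J (card B)"
    and alt: "\<And>i'. i' \<in> B \<Longrightarrow> in_col_span A B J (unit_fun i') \<or> in_row_span A B J (A i)"
  shows "in_row_span A B J (A i)"
proof (rule ccontr)
  assume no: "\<not> ?thesis"
  have ns: "nonsing (\<lambda>j i. A i j) J B"
    using nonsing_rows_if_units[OF fin(1), of A J] alt no by blast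
  have "nonsing (\<lambda>j i. A i j) J (insert i B)"
    unfolding nonsing_def
  proof (intro allI impI)
    fix w assume "\<forall>j\<in>J. (\<Sum>a\<in>insert i B. A a j * w a) = 0"
    then have w: "A i j * w i + (\<Sum>a\<in>B. A a j * w a) = 0" if "j \<in> J" for j
      using that fin i by simp
    have wi: "w i = 0"
    proof (rule ccontr)
      assume nz: "w i \<noteq> 0"
      have "in_row_span A B J (A i)"
      proof (rule in_col_spanI[where w = "\<lambda>a. - w a / w i"])
        fix j assume "j \<in> J"
        then have "A i j * w i = - (\<Sum>a\<in>B. A a j * w a)" using w by (simp add: eq_neg_iff_add_eq_0)
        then have "A i j = - (\<Sum>a\<in>B. A a j * w a) / w i" using nz by (simp add: field_simps)
        also have "\<dots> = (\<Sum>a\<in>B. A a j * (- w a / w i))"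
          by (simp add: sum_negf sum_divide_distrib)
        finally show "A i j = (\<Sum>a\<in>B. A a j * (- w a / w i))" .
      qed
      then show False using no by blast
    qed
    moreover have "\<forall>a\<in>B. w a = 0" by (rule nonsingD[OF ns]) (use w wi in simp)
    ultimately show "\<forall>a\<in>insert i B. w a = 0" by simp
  qed
  moreover have "\<not> nonsing (\<lambda>j i. A i j) J (insert i B)"
    by (rule rank_le_not_nonsing[OF rank_le_transpose[OF rk]]) (use fin i in auto)
  ultimately show False by blast
qed

section \<open>Polynomial functions on lines\<close>

text \<open>The set \<open>T\<close> bounds the entries on which the function may depend; entries
  outside \<open>T\<close> can then be changed freely, as happens when a matrix is filled
  in.\<close>

inductive polyfun :: "(nat \<times> nat) set \<Rightarrow> ((nat \<Rightarrow> nat \<Rightarrow> 'f::comm_ring_1) \<Rightarrow> 'f) \<Rightarrow> bool" for T where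
  polyfun_const: "polyfun T (\<lambda>_. a)"
| polyfun_coord: "(i, m) \<in> T \<Longrightarrow> polyfun T (\<lambda>A. A i m)"
| polyfun_add: "polyfun T G \<Longrightarrow> polyfun T H \<Longrightarrow> polyfun T (\<lambda>A. G A + H A)"
| polyfun_mult: "polyfun T G \<Longrightarrow> polyfun T H \<Longrightarrow> polyfun T (\<lambda>A. G A * H A)"

lemma polyfun_agree:
  "polyfun T G \<Longrightarrow> (\<And>i m. (i, m) \<in> T \<Longrightarrow> A i m = B i m) \<Longrightarrow> G A = G B"
  by (induction rule: polyfun.induct) auto

lemma polyfun_sum:
  "finite E \<Longrightarrow> (\<And>e. e \<in> E \<Longrightarrow> polyfun T (\<lambda>A. g e A)) \<Longrightarrow> polyfun T (\<lambda>A. \<Sum>e\<in>E. g e A)"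
  by (induction E rule: finite_induct) (auto intro: polyfun.intros)

lemma polyfun_prod:
  "finite E \<Longrightarrow> (\<And>e. e \<in> E \<Longrightarrow> polyfun T (\<lambda>A. g e A)) \<Longrightarrow> polyfun T (\<lambda>A. \<Prod>e\<in>E. g e A)"
  by (induction E rule: finite_induct) (auto intro: polyfun.intros)

lemma polyfun_power: "polyfun T G \<Longrightarrow> polyfun T (\<lambda>A. G A ^ n)"
  by (induction n) (auto intro: polyfun.intros)

lemma polyfun_line:
  assumes "polyfun T G"
  shows "\<exists>q. \<forall>s. poly q s = G (\<lambda>i m. A i m + s * N i m)"
  using assms
proof (induction rule: polyfun.induct)
  case (polyfun_const a)
  show ?case by (rule exI[of _ "[:a:]"]) simp
next
  case (polyfun_coord i m)
  show ?case by (rule exI[of _ "[:A i m, N i m:]"]) simp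
next
  case (polyfun_add G H)
  then obtain q q' where "\<forall>s. poly q s = G (\<lambda>i m. A i m + s * N i m)"
    "\<forall>s. poly q' s = H (\<lambda>i m. A i m + s * N i m)" by blast
  then show ?case by (intro exI[of _ "q + q'"]) simp
next
  case (polyfun_mult G H)
  then obtain q q' where "\<forall>s. poly q s = G (\<lambda>i m. A i m + s * N i m)"
    "\<forall>s. poly q' s = H (\<lambda>i m. A i m + s * N i m)" by blast
  then show ?case by (intro exI[of _ "q * q'"]) simp
qed

text \<open>On a line the function is a polynomial in \<open>s\<close>, and it is nonzero at
  \<open>s = 0\<close>.\<close>

lemma finite_line_zeros:
  fixes A :: "nat \<Rightarrow> nat \<Rightarrow> 'f::field"
  assumes "polyfun T G" "G A \<noteq> 0"
  shows "finite {s. G (\<lambda>i m. A i m + s * N i m) = 0}"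
proof -
  obtain q where q: "\<And>s. poly q s = G (\<lambda>i m. A i m + s * N i m)"
    using polyfun_line[OF assms(1), of A N] by blast
  have "q \<noteq> 0" using q[of 0] assms(2) by auto
  then show ?thesis using poly_roots_finite[of q] by (simp add: q)
qed

text \<open>A minor of size \<open>Suc q\<close> that is nonzero at \<open>s = 0\<close> is a
  nonzero polynomial in \<open>s\<close>, and it vanishes wherever the rank drops to
  \<open>q\<close>.\<close>

lemma finite_line_rank_drop:
  fixes A :: "nat \<Rightarrow> nat \<Rightarrow> 'f::field"
  assumes "\<not> rank_le A I J q"
  shows "finite {s. rank_le (\<lambda>i m. A i m + s * N i m) I J q}"
proof -
  obtain r c where rc: "strict_mono_on {..<Suc q} r" "strict_mono_on {..<Suc q} c"
    "r ` {..<Suc q} \<subseteq> I" "c ` {..<Suc q} \<subseteq> J"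
    "det (mat (Suc q) (Suc q) (\<lambda>(a, b). A (r a) (c b))) \<noteq> 0"
    using minor_neq_0_exists[OF assms] by blast
  define D where "D = det (mat (Suc q) (Suc q) (\<lambda>(a, b). [:A (r a) (c b), N (r a) (c b):]))"
  have D: "poly D s = det (mat (Suc q) (Suc q) (\<lambda>(a, b). A (r a) (c b) + s * N (r a) (c b)))" for s
  proof -
    interpret h: comm_ring_hom "\<lambda>p. poly p s" by unfold_locales auto
    show ?thesis unfolding D_def h.hom_det[symmetric]
      by (rule arg_cong[of _ _ det]) (rule eq_matI, auto)
  qed
  have "D \<noteq> 0"
  proof
    assume "D = 0"
    then have "det (mat (Suc q) (Suc q) (\<lambda>(a, b). A (r a) (c b) + 0 * N (r a) (c b))) = 0"
      unfolding D[symmetric] by simp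
    then show False using rc(5) by simp
  qed
  then have fin: "finite {s. poly D s = 0}" by (rule poly_roots_finite)
  have "poly D s = 0" if "rank_le (\<lambda>i m. A i m + s * N i m) I J q" for s
    unfolding D
    by (rule minor_eq_0[OF that _ _ rc(3,4)]) (use rc strict_mono_on_imp_inj_on in auto)
  then have "{s. rank_le (\<lambda>i m. A i m + s * N i m) I J q} \<subseteq> {s. poly D s = 0}" by blast
  then show ?thesis by (rule finite_subset) (rule fin)
qed

definition block_rank :: "('i \<Rightarrow> 'j \<Rightarrow> 'f::field) \<Rightarrow> 'i set \<Rightarrow> 'j set \<Rightarrow> nat" where
  "block_rank A I J = (LEAST q. rank_le A I J q)"

lemma rank_le_card:
  assumes "finite I"
  shows "rank_le A I J (card I)"
  by (rule rank_le_index[of I _ _ _ _ "\<lambda>i e. unit_fun e i" A])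
    (use assms in \<open>auto simp: unit_fun_def if_distrib[of "\<lambda>x. x * _"] cong: if_cong\<close>)

lemma block_rank:
  assumes "finite I"
  shows "rank_le A I J (block_rank A I J)" "block_rank A I J \<le> card I"
    "q < block_rank A I J \<Longrightarrow> \<not> rank_le A I J q"
  unfolding block_rank_def
  using LeastI[of "rank_le A I J", OF rank_le_card[OF assms]]
    Least_le[of "rank_le A I J", OF rank_le_card[OF assms]] not_less_Least[of q "rank_le A I J"]
  by auto

lemma in_col_span_cong:
  assumes "\<And>i j. i \<in> I \<Longrightarrow> j \<in> J \<Longrightarrow> A i j = B i j" "\<And>i. i \<in> I \<Longrightarrow> x i = y i"
  shows "in_col_span A I J x \<longleftrightarrow> in_col_span B I J y"
  unfolding in_col_span_def
  by (intro ex_cong1 ball_cong refl arg_cong2[of _ _ _ _ "(=)"] sum.cong arg_cong2[of _ _ _ _ "(*)"] assms)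

section \<open>Rank conditions\<close>

text \<open>The two strict inequalities say that \<open>d j - r j\<close> and
  \<open>c j + r j\<close> increase strictly; the additive form avoids truncated
  subtraction.\<close>

locale rank_conditions =
  fixes k l v :: nat and d c r :: "nat \<Rightarrow> nat"
  assumes corner_mono: "i \<in> {1..v} \<Longrightarrow> j \<in> {1..v} \<Longrightarrow> i < j \<Longrightarrow>
      d i \<le> d j \<and> c i \<le> c j \<and> d i + r j < d j + r i \<and> c i + r i < c j + r j"
    and corner_bounds: "j \<in> {1..v} \<Longrightarrow> r j < d j \<and> d j \<le> k \<and> 1 \<le> c j \<and> c j + r j \<le> l"
begin

text \<open>A block is indexed by its upper right cell. For a staircase \<open>S\<close> the block
  of a cell in \<open>S\<close> lies inside \<open>S\<close>, so entries outside \<open>S\<close>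
  are irrelevant.\<close>

definition rank_cond :: "(nat \<times> nat) set \<Rightarrow> (nat \<Rightarrow> nat \<Rightarrow> 'f::field) \<Rightarrow> bool" where
  "rank_cond S A \<longleftrightarrow>
     (\<forall>j\<in>{1..v}. \<forall>(i, m)\<in>S. i \<le> d j \<longrightarrow> c j \<le> m \<longrightarrow> rank_le A {i..d j} {c j..m} (r j))"

definition staircase :: "(nat \<times> nat) set \<Rightarrow> bool" where
  "staircase S \<longleftrightarrow> S \<subseteq> {1..k} \<times> {1..l} \<and>
     (\<forall>i m i' m'. (i, m) \<in> S \<longrightarrow> i \<le> i' \<longrightarrow> i' \<le> k \<longrightarrow> 1 \<le> m' \<longrightarrow> m' \<le> m \<longrightarrow> (i', m') \<in> S)"

lemma rank_condD:
  "rank_cond S A \<Longrightarrow> j \<in> {1..v} \<Longrightarrow> (i, m) \<in> S \<Longrightarrow> i \<le> d j \<Longrightarrow> c j \<le> m \<Longrightarrow>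
    rank_le A {i..d j} {c j..m} (r j)"
  unfolding rank_cond_def by fastforce

lemma rank_condI:
  "(\<And>j i m. j \<in> {1..v} \<Longrightarrow> (i, m) \<in> S \<Longrightarrow> i \<le> d j \<Longrightarrow> c j \<le> m \<Longrightarrow>
    rank_le A {i..d j} {c j..m} (r j)) \<Longrightarrow> rank_cond S A"
  unfolding rank_cond_def by fastforce

lemma staircaseD:
  "staircase S \<Longrightarrow> (i, m) \<in> S \<Longrightarrow> i \<le> i' \<Longrightarrow> i' \<le> k \<Longrightarrow> 1 \<le> m' \<Longrightarrow> m' \<le> m \<Longrightarrow> (i', m') \<in> S"
  unfolding staircase_def by blast

lemma staircase_bounds: "staircase S \<Longrightarrow> (i, m) \<in> S \<Longrightarrow> 1 \<le> i \<and> i \<le> k \<and> 1 \<le> m \<and> m \<le> l"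
  unfolding staircase_def by auto

text \<open>In coordinates where the missing entry at \<open>(i0, m0)\<close> is \<open>- 1 / s\<close>, this replaces the
  entries below and to the left of it by the Schur complement.\<close>

definition schur_move :: "nat \<Rightarrow> nat \<Rightarrow> (nat \<Rightarrow> nat \<Rightarrow> 'f::field) \<Rightarrow> nat \<Rightarrow> nat \<Rightarrow> 'f" where
  "schur_move i0 m0 A i m = (if i0 < i \<and> m < m0 then A i m0 * A i0 m else 0)"

text \<open>On a block left of \<open>m0\<close> that starts at or above row \<open>i0\<close>, the
  change is a multiple of row \<open>i0\<close>; on a block that contains column \<open>m0\<close>,
  it is a multiple of that column. The blocks strictly to the lower left of the cell are parts of
  blocks of the first kind.\<close>

lemma rank_cond_schur_move:
  fixes A :: "nat \<Rightarrow> nat \<Rightarrow> 'f::field"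
  assumes S: "staircase S" and notin: "(i0, m0) \<notin> S" and bounds: "1 \<le> i0" "i0 \<le> k" "1 \<le> m0" "m0 \<le> l"
    and left: "1 < m0 \<Longrightarrow> (i0, m0 - 1) \<in> S" and A: "rank_cond S A"
  shows "rank_cond S (\<lambda>i m. A i m + s * schur_move i0 m0 A i m)" (is "rank_cond S ?A")
proof (rule rank_condI)
  fix j i m assume j: "j \<in> {1..v}" and im: "(i, m) \<in> S" "i \<le> d j" "c j \<le> m"
  have upper: "rank_le ?A {i..d j} {c j..m} (r j)"
    if im: "(i, m) \<in> S" "i \<le> d j" "c j \<le> m" and m: "m < m0" and i: "i \<le> i0" for i m
  proof -
    have R: "rank_le A {i..d j} {c j..m} (r j)" by (rule rank_condD[OF A j im])
    show ?thesis
    proof (cases "i0 \<le> d j")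
      case True
      have "in_row_span A {i..d j} {c j..m} (A i0)"
        by (rule in_col_span_column[of _ i0 _ _ _ 1]) (use True i in auto)
      from rank_le_add_in_row_span[OF R _ this, of "\<lambda>i. if i0 < i then s * A i m0 else 0"]
      have "rank_le (\<lambda>i m. A i m + (if i0 < i then s * A i m0 else 0) * A i0 m) {i..d j} {c j..m} (r j)"
        by simp
      then show ?thesis
        by (rule rank_le_mono) (use m in \<open>auto simp: schur_move_def\<close>)
    next
      case False
      show ?thesis
        by (rule rank_le_mono[OF R]) (use False in \<open>auto simp: schur_move_def\<close>)
    qed
  qed
  show "rank_le ?A {i..d j} {c j..m} (r j)"
  proof (cases "m < m0")
    case False
    then have i: "i0 < i"
      using staircaseD[OF S im(1), of i0 m0] notin bounds by force
    have R: "rank_le A {i..d j} {c j..m} (r j)" by (rule rank_condD[OF A j im])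
    show ?thesis
    proof (cases "c j \<le> m0")
      case True
      have "in_col_span A {i..d j} {c j..m} (\<lambda>i. A i m0)"
        by (rule in_col_span_column[of _ m0 _ _ _ 1]) (use True False in auto)
      from rank_le_add_in_col_span[OF R _ this, of "\<lambda>m. if m < m0 then s * A i0 m else 0"]
      have "rank_le (\<lambda>i m. A i m + A i m0 * (if m < m0 then s * A i0 m else 0)) {i..d j} {c j..m} (r j)"
        by simp
      then show ?thesis
        by (rule rank_le_mono) (use i in \<open>auto simp: schur_move_def\<close>)
    next
      case False
      show ?thesis
        by (rule rank_le_mono[OF R]) (use False in \<open>auto simp: schur_move_def\<close>)
    qed
  next
    case m: True
    show ?thesis
    proof (cases "i \<le> i0")
      case True
      then show ?thesis using upper im m by blast
    next
      case False
      have "(i0, m0 - 1) \<in> S" using left m staircase_bounds[OF S im(1)] by linarith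
      then have "(i0, m) \<in> S"
        by (rule staircaseD[OF S]) (use bounds m staircase_bounds[OF S im(1)] in auto)
      from upper[OF this _ im(3) m] show ?thesis
        by (rule rank_le_mono) (use False im in auto)
    qed
  qed
qed

text \<open>After a generic Schur move, each rank condition through the new cell \<open>(i0, m0)\<close> either holds for
  all values of the new entry or forces that value, and the forced values agree.\<close>

lemma rank_cond_fill_cell:
  fixes A :: "nat \<Rightarrow> nat \<Rightarrow> 'f::field"
  assumes inf: "infinite (UNIV :: 'f set)" and S: "staircase S" and notin: "(i0, m0) \<notin> S"
    and bounds: "1 \<le> i0" "i0 \<le> k" "1 \<le> m0" "m0 \<le> l"
    and left: "1 < m0 \<Longrightarrow> (i0, m0 - 1) \<in> S" and below: "i0 < k \<Longrightarrow> (i0 + 1, m0) \<in> S"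
    and A: "rank_cond S A" and G: "polyfun T G" "T \<subseteq> S" "G A \<noteq> 0"
  shows "\<exists>A'. rank_cond (insert (i0, m0) S) A' \<and> G A' \<noteq> 0"
proof -
  let ?A = "\<lambda>s i m. A i m + s * schur_move i0 m0 A i m"
  let ?I = "\<lambda>j. {i0<..d j}" and ?J = "\<lambda>j. {c j..<m0}"
  let ?q = "\<lambda>j. block_rank A (?I j) (?J j)"
  \<comment> \<open>Excluded are the trivial move, a zero of \<open>G\<close>, and any drop in the
    rank of a block strictly to the lower left of the cell.\<close>
  define bad where "bad = {0} \<union> {s. G (?A s) = 0} \<union>
    (\<Union>j\<in>{j\<in>{1..v}. 0 < ?q j}. {s. rank_le (?A s) (?I j) (?J j) (?q j - 1)})"
  have "finite bad"
    unfolding bad_def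
  proof (intro finite_UnI finite_UN_I)
    show "finite {s. G (?A s) = 0}" by (rule finite_line_zeros[where N = "schur_move i0 m0 A"]) (use G in auto)
    fix j assume "j \<in> {j \<in> {1..v}. 0 < ?q j}"
    then have "\<not> rank_le A (?I j) (?J j) (?q j - 1)" by (intro block_rank(3)) auto
    then show "finite {s. rank_le (?A s) (?I j) (?J j) (?q j - 1)}"
      by (rule finite_line_rank_drop)
  qed auto
  then obtain s where s: "s \<notin> bad" using inf ex_new_if_finite by blast
  define B where "B = ?A s"
  have GB: "G B \<noteq> 0" and s0: "s \<noteq> 0" using s by (auto simp: bad_def B_def)
  have B: "rank_cond S B"
    unfolding B_def by (rule rank_cond_schur_move[OF S notin bounds left A])
  have Bcol: "B i m0 = A i m0" and Brow: "B i0 m = A i0 m" for i m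
    by (auto simp: B_def schur_move_def)
  define row where "row j \<longleftrightarrow> in_row_span B (?I j) (?J j) (B i0)" for j
  define col where "col j \<longleftrightarrow> in_col_span B (?I j) (?J j) (\<lambda>i. B i m0)" for j
  \<comment> \<open>Undoing the move subtracts \<open>s\<close> times column \<open>m0\<close> times
    row \<open>i0\<close>. If both were independent of the block, rank reduction would make the rank
    of \<open>B\<close> smaller than that of \<open>A\<close>, which the choice of \<open>s\<close>
    excludes.\<close>
  have either: "row j \<or> col j" if j: "j \<in> {1..v}" for j
  proof (rule ccontr)
    assume "\<not> ?thesis"
    then have "\<not> in_col_span B (?I j) (?J j) (\<lambda>i. B i m0)" "\<not> in_row_span B (?I j) (?J j) (B i0)"
      by (auto simp: row_def col_def)
    note red = rank_le_reduce_span[OF _ _ this, of "- s" "?q j"]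
    have rk: "rank_le (\<lambda>i m. B i m + - s * B i m0 * B i0 m) (?I j) (?J j) (?q j)"
      by (rule rank_le_mono[OF block_rank(1)[of "?I j" A "?J j"]])
        (auto simp: Bcol Brow, auto simp: B_def schur_move_def)
    have "0 < ?q j" "rank_le B (?I j) (?J j) (?q j - 1)" using red rk s0 by auto
    then show False using s j by (auto simp: bad_def B_def)
  qed
  \<comment> \<open>The entry at the cell that a row relation forces once it is extended to column
    \<open>m0\<close>; \<open>colval\<close> is the same for a column relation extended to row
    \<open>i0\<close>.\<close>
  define rowval where "rowval j z \<longleftrightarrow> (\<exists>w. (\<forall>m\<in>?J j. B i0 m = (\<Sum>i\<in>?I j. B i m * w i)) \<and>
    z = (\<Sum>i\<in>?I j. B i m0 * w i))" for j z
  define colval where "colval j z \<longleftrightarrow> (\<exists>w. (\<forall>i\<in>?I j. B i m0 = (\<Sum>m\<in>?J j. B i m * w m)) \<and>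
    z = (\<Sum>m\<in>?J j. B i0 m * w m))" for j z
  have ex_row: "\<exists>z. rowval j z" if row: "row j" for j
  proof -
    obtain w where "\<forall>m\<in>?J j. B i0 m = (\<Sum>i\<in>?I j. B i m * w i)"
      by (rule in_col_spanE[OF row[unfolded row_def]])
    then show ?thesis unfolding rowval_def by (intro exI conjI) (assumption, rule refl)
  qed
  have ex_col: "\<exists>z. colval j z" if col: "col j" for j
  proof -
    obtain w where "\<forall>i\<in>?I j. B i m0 = (\<Sum>m\<in>?J j. B i m * w m)"
      by (rule in_col_spanE[OF col[unfolded col_def]])
    then show ?thesis unfolding colval_def by (intro exI conjI) (assumption, rule refl)
  qed
  \<comment> \<open>The rows for \<open>j\<close> are among those for \<open>j'\<close>, and the
    columns for \<open>j'\<close> are among those for \<open>j\<close>. Hence both relations apply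
    to the same double sum, which evaluates to either forced entry.\<close>
  have agree: "z = z'" if j: "j \<in> {1..v}" "j' \<in> {1..v}" "j \<le> j'" and z: "rowval j z" "colval j' z'" for j j' z z'
  proof -
    have le: "d j \<le> d j'" "c j \<le> c j'"
      using corner_mono[OF j(1,2)] j(3) by (cases "j = j'"; force)+
    obtain w where w: "\<forall>m\<in>?J j. B i0 m = (\<Sum>i\<in>?I j. B i m * w i)" "z = (\<Sum>i\<in>?I j. B i m0 * w i)"
      using z(1) unfolding rowval_def by (elim exE conjE)
    obtain u where u: "\<forall>i\<in>?I j'. B i m0 = (\<Sum>m\<in>?J j'. B i m * u m)" "z' = (\<Sum>m\<in>?J j'. B i0 m * u m)"
      using z(2) unfolding colval_def by (elim exE conjE)
    have "z = (\<Sum>i\<in>?I j. (\<Sum>m\<in>?J j'. B i m * u m) * w i)"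
      unfolding w(2) by (intro sum.cong refl arg_cong2[of _ _ _ _ "(*)"] bspec[OF u(1)]) (use le in auto)
    also have "\<dots> = (\<Sum>i\<in>?I j. \<Sum>m\<in>?J j'. B i m * w i * u m)"
      by (intro sum.cong refl) (simp add: sum_distrib_left mult_ac)
    also have "\<dots> = (\<Sum>m\<in>?J j'. \<Sum>i\<in>?I j. B i m * w i * u m)"
      by (rule sum.swap)
    also have "\<dots> = (\<Sum>m\<in>?J j'. (\<Sum>i\<in>?I j. B i m * w i) * u m)"
      by (simp only: sum_distrib_right)
    also have "\<dots> = z'"
      unfolding u(2) by (intro sum.cong refl arg_cong2[of _ _ _ _ "(*)"] bspec[OF w(1), symmetric]) (use le in auto)
    finally show ?thesis .
  qed
  \<comment> \<open>An entry is forced only for \<open>j\<close> with both relations, and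
    \<open>agree\<close> makes all these entries equal. If there is no such \<open>j\<close>, any
    entry will do, and \<open>0\<close> is taken.\<close>
  obtain z where z: "\<And>j z'. j \<in> {1..v} \<Longrightarrow> row j \<Longrightarrow> col j \<Longrightarrow> rowval j z' \<or> colval j z' \<Longrightarrow> z' = z"
  proof (cases "\<exists>j\<in>{1..v}. row j \<and> col j")
    case False
    then show ?thesis by (intro that[of 0]) blast
  next
    case True
    then obtain j where j: "j \<in> {1..v}" "row j" "col j" by blast
    obtain z zc where z: "rowval j z" and zc: "colval j zc" using ex_row ex_col j by blast
    have "zc = z" using agree[OF j(1) j(1) le_refl z zc] by simp
    with zc have zc: "colval j z" by simp
    show ?thesis
    proof (rule that[of z])
      fix j' z' assume j': "j' \<in> {1..v}" "row j'" "col j'" and z': "rowval j' z' \<or> colval j' z'"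
      obtain y yc where y: "rowval j' y" and yc: "colval j' yc" using ex_row ex_col j' by blast
      have uniq_row: "y' = yc" if "rowval j' y'" for y' by (rule agree[OF j'(1) j'(1) le_refl that yc])
      have uniq_col: "y = y'" if "colval j' y'" for y' by (rule agree[OF j'(1) j'(1) le_refl y that])
      have "z' = y" using z' uniq_row uniq_col y yc by metis
      moreover have "y = z"
      proof (cases "j \<le> j'")
        case True
        have "z = yc" by (rule agree[OF j(1) j'(1) True z yc])
        then show ?thesis using uniq_col[OF yc] by simp
      next
        case False
        then have "j' \<le> j" by simp
        from agree[OF j'(1) j(1) this y zc] show ?thesis .
      qed
      ultimately show "z' = z" by simp
    qed
  qed
  define C where "C i m = (if i = i0 \<and> m = m0 then z else B i m)" for i m
  have CB: "C i m = B i m" if "(i, m) \<noteq> (i0, m0)" for i m using that by (auto simp: C_def)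
  have "rank_cond (insert (i0, m0) S) C"
  proof (rule rank_condI)
    fix j i m assume j: "j \<in> {1..v}" and im: "(i, m) \<in> insert (i0, m0) S" "i \<le> d j" "c j \<le> m"
    show "rank_le C {i..d j} {c j..m} (r j)"
    proof (cases "(i, m) = (i0, m0)")
      case False
      with im have S': "(i, m) \<in> S" by blast
      have eq: "C a b = B a b" if "a \<in> {i..d j}" "b \<in> {c j..m}" for a b
        using that staircaseD[OF S S', of i0 m0] notin bounds by (intro CB) auto
      show ?thesis by (rule rank_le_mono[OF rank_condD[OF B j S' im(2,3)]]) (use eq in auto)
    next
      case True
      then have ij: "i0 \<le> d j" "c j \<le> m0" and i: "i = i0" and m: "m = m0" using im by auto
      have dk: "d j \<le> k" and c1: "1 \<le> c j" using corner_bounds[OF j] by auto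
      have rows: "{i0..d j} = insert i0 (?I j)" and cols: "{c j..m0} = insert m0 (?J j)" using ij by auto
      have R1: "rank_le C (?I j) (insert m0 (?J j)) (r j)"
      proof (cases "i0 < d j")
        case True
        have "rank_le B {i0 + 1..d j} {c j..m0} (r j)"
          by (rule rank_condD[OF B j below]) (use True dk ij in auto)
        then show ?thesis unfolding cols[symmetric] by (rule rank_le_mono) (auto simp: CB)
      next
        case False
        then show ?thesis by (simp add: rank_le_def)
      qed
      have R2: "rank_le C (insert i0 (?I j)) (?J j) (r j)"
      proof (cases "c j < m0")
        case True
        have "rank_le B {i0..d j} {c j..m0 - 1} (r j)"
          by (rule rank_condD[OF B j left]) (use True c1 ij in auto)
        then show ?thesis unfolding rows[symmetric] by (rule rank_le_mono) (use True in \<open>auto simp: CB\<close>)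
      next
        case False
        then show ?thesis by (simp add: rank_le_def)
      qed
      have spanC: "in_col_span C (?I j) (?J j) x = in_col_span B (?I j) (?J j) x"
        "in_row_span C (?I j) (?J j) y = in_row_span B (?I j) (?J j) y" for x y
        by (rule in_col_span_cong; simp add: CB)+
      \<comment> \<open>With a row relation the block is completed by that row, otherwise by the
        column relation after transposition. The new entry matters only if both relations
        exist.\<close>
      have "rank_le C (insert i0 (?I j)) (insert m0 (?J j)) (r j)"
      proof (cases "row j")
        case True
        then obtain w where w: "\<forall>m\<in>?J j. B i0 m = (\<Sum>i\<in>?I j. B i m * w i)"
          using in_col_spanE[OF True[unfolded row_def]] by blast
        show ?thesis
        proof (rule rank_le_corner_row[OF _ _ R1])
          fix m assume m: "m \<in> ?J j"
          then show "C i0 m = (\<Sum>i\<in>?I j. C i m * w i)" using bspec[OF w m] by (simp add: CB)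
        next
          show "C i0 m0 = (\<Sum>i\<in>?I j. C i m0 * w i) \<or> \<not> in_col_span C (?I j) (?J j) (\<lambda>i. C i m0)"
          proof (cases "col j")
            case c: True
            have "rowval j (\<Sum>i\<in>?I j. B i m0 * w i)" unfolding rowval_def
              by (intro exI conjI) (rule w, rule refl)
            then have "(\<Sum>i\<in>?I j. B i m0 * w i) = z" using z[OF j True c] by blast
            then show ?thesis by (simp add: CB) (simp add: C_def)
          next
            case False
            moreover have "in_col_span B (?I j) (?J j) (\<lambda>i. C i m0) = col j"
              unfolding col_def by (rule in_col_span_cong) (simp_all add: CB)
            ultimately show ?thesis unfolding spanC by simp
          qed
        qed auto
      next
        case False
        then have "col j" using either[OF j] by blast
        then obtain w where w: "\<forall>i\<in>?I j. B i m0 = (\<Sum>m\<in>?J j. B i m * w m)"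
          using in_col_spanE[unfolded col_def] unfolding col_def by blast
        have "rank_le (\<lambda>m i. C i m) (insert m0 (?J j)) (insert i0 (?I j)) (r j)"
        proof (rule rank_le_corner_row[OF _ _ rank_le_transpose[OF R2]])
          fix i assume i: "i \<in> ?I j"
          then show "C i m0 = (\<Sum>m\<in>?J j. C i m * w m)" using bspec[OF w i] by (simp add: CB)
        next
          show "C i0 m0 = (\<Sum>m\<in>?J j. C i0 m * w m) \<or> \<not> in_row_span C (?I j) (?J j) (\<lambda>m. C i0 m)"
          proof -
            have "in_row_span B (?I j) (?J j) (\<lambda>m. C i0 m) = row j"
              unfolding row_def by (rule in_col_span_cong) (simp_all add: CB)
            with False show ?thesis unfolding spanC by simp
          qed
        qed auto
        then show ?thesis by (rule rank_le_transpose)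
      qed
      then show ?thesis unfolding i m rows cols .
    qed
  qed
  moreover have "G C = G B" by (rule polyfun_agree[OF G(1)]) (use G(2) notin in \<open>auto simp: C_def\<close>)
  ultimately show ?thesis using GB by auto
qed

text \<open>The next cell is the leftmost missing one in the lowest incomplete row. This keeps
  \<open>S\<close> a staircase and puts the left and lower neighbours of the cell into it.\<close>

lemma rank_cond_fill:
  fixes A :: "nat \<Rightarrow> nat \<Rightarrow> 'f::field"
  assumes inf: "infinite (UNIV :: 'f set)" and S: "staircase S" 
    and A: "rank_cond S A" and G: "polyfun T G" "T \<subseteq> S" "G A \<noteq> 0"
  shows "\<exists>A'. rank_cond ({1..k} \<times> {1..l}) A' \<and> G A' \<noteq> 0"
  using S A G(2,3)
proof (induction "card ({1..k} \<times> {1..l} - S)" arbitrary: S A rule: less_induct)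
  case less
  show ?case
  proof (cases "{1..k} \<times> {1..l} - S = {}")
    case True
    then have "S = {1..k} \<times> {1..l}" using less.prems(1) unfolding staircase_def by blast
    then show ?thesis using less.prems by auto
  next
    case False
    define M where "M = {1..k} \<times> {1..l} - S"
    have fin: "finite (fst ` M)" "fst ` M \<noteq> {}" using False by (auto simp: M_def)
    define i0 where "i0 = Max (fst ` M)"
    have "i0 \<in> fst ` M" unfolding i0_def by (rule Max_in[OF fin])
    then have ex: "\<exists>m. (i0, m) \<in> M" by force
    define m0 where "m0 = (LEAST m. (i0, m) \<in> M)"
    have m0: "(i0, m0) \<in> M" unfolding m0_def by (rule LeastI_ex[OF ex])
    have max: "(i, m) \<in> M \<Longrightarrow> i \<le> i0" for i m unfolding i0_def using Max_ge[OF fin(1)] by force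
    have min: "(i0, m) \<in> M \<Longrightarrow> m0 \<le> m" for m unfolding m0_def by (rule Least_le)
    have bounds: "(i0, m0) \<notin> S" "1 \<le> i0" "i0 \<le> k" "1 \<le> m0" "m0 \<le> l" using m0 by (auto simp: M_def)
    have left: "(i0, m) \<in> S" if "1 \<le> m" "m < m0" for m
      using min[of m] that bounds by (force simp: M_def)
    have below: "(i, m) \<in> S" if "i0 < i" "i \<le> k" "1 \<le> m" "m \<le> l" for i m
      using max[of i m] that bounds by (force simp: M_def)
    have S': "staircase (insert (i0, m0) S)"
      unfolding staircase_def
    proof (intro conjI allI impI)
      show "insert (i0, m0) S \<subseteq> {1..k} \<times> {1..l}" using less.prems(1) bounds unfolding staircase_def by auto
      fix i m i' m' assume h: "(i, m) \<in> insert (i0, m0) S" "i \<le> i'" "i' \<le> k" "1 \<le> m'" "m' \<le> m"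
      show "(i', m') \<in> insert (i0, m0) S"
      proof (cases "(i, m) = (i0, m0)")
        case True
        then have "i = i0" "m = m0" by auto
        with h bounds left[of m'] below[of i' m'] show ?thesis
          by (cases "i' = i0"; cases "m' = m0") auto
      next
        case False
        with h staircaseD[OF less.prems(1), of i m i' m'] show ?thesis by auto
      qed
    qed
    have "\<exists>A'. rank_cond (insert (i0, m0) S) A' \<and> G A' \<noteq> 0"
      by (rule rank_cond_fill_cell[OF inf less.prems(1) bounds _ _ less.prems(2) G(1) less.prems(3,4)])
        (use left below bounds in auto)
    then obtain A' where A': "rank_cond (insert (i0, m0) S) A'" "G A' \<noteq> 0" by blast
    have "{1..k} \<times> {1..l} - insert (i0, m0) S \<subset> {1..k} \<times> {1..l} - S" using m0 by (auto simp: M_def)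
    then have lt: "card ({1..k} \<times> {1..l} - insert (i0, m0) S) < card ({1..k} \<times> {1..l} - S)"
      by (intro psubset_card_mono) auto
    show ?thesis by (rule less.hyps[OF lt S' A'(1) _ A'(2)]) (use less.prems(3) in auto)
  qed
qed

end

text \<open>A vector killed by all rows whose coordinate at \<open>j\<close> is \<open>1\<close> is
  a relation among the columns that can be solved for column \<open>j\<close>.\<close>

lemma in_col_span_unit:
  fixes A :: "'i \<Rightarrow> 'j \<Rightarrow> 'f::field"
  assumes fin: "finite I" "finite J" and j: "j \<in> J"
    and no: "\<not> in_row_span A I J (unit_fun j)"
  shows "in_col_span A I (J - {j}) (\<lambda>i. A i j)"
proof -
  obtain y where y: "\<forall>i\<in>I. (\<Sum>j'\<in>J. y j' * A i j') = 0" "(\<Sum>j'\<in>J. y j' * unit_fun j j') = (1 :: 'f)"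
    by (rule in_col_span_alternative[OF fin(2,1) no])
  have yj: "y j = 1" using y(2) unfolding sum_unit_fun_right[OF fin(2) j] .
  show ?thesis
  proof (rule in_col_spanI[where w = "\<lambda>j'. - y j'"])
    fix i assume "i \<in> I"
    have "(\<Sum>j'\<in>J. y j' * A i j') = y j * A i j + (\<Sum>j'\<in>J - {j}. y j' * A i j')"
      by (rule sum.remove[OF fin(2) j])
    then have "0 = A i j + (\<Sum>j'\<in>J - {j}. y j' * A i j')"
      using bspec[OF y(1) \<open>i \<in> I\<close>] yj by simp
    then have "A i j = - (\<Sum>j'\<in>J - {j}. y j' * A i j')"
      by (simp add: eq_neg_iff_add_eq_0)
    then show "A i j = (\<Sum>j'\<in>J - {j}. A i j' * - y j')"
      by (simp add: sum_negf mult.commute)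
  qed
qed

text \<open>Column \<open>m\<close> then depends on the rest of \<open>C\<close>, so one column
  fewer still spans everything.\<close>

lemma rank_le_if_no_unit:
  fixes A :: "'i \<Rightarrow> 'j \<Rightarrow> 'f::field"
  assumes fin: "finite I" "finite J" and m: "m \<in> C" "C \<subseteq> J" 
    and span: "\<And>j. j \<in> J \<Longrightarrow> in_col_span A I C (\<lambda>i. A i j)"
    and no: "\<not> in_row_span A I C (unit_fun m)"
  shows "rank_le A I J (card C - 1)"
proof -
  have finC: "finite C" using fin m finite_subset by blast
  have "rank_le A I (C - {m}) (card C - 1)"
  proof -
    have "rank_le (\<lambda>j i. A i j) (C - {m}) I (card (C - {m}))"
      by (rule rank_le_card) (use finC in auto)
    then show ?thesis using m finC by (auto dest: rank_le_transpose)
  qed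
  then have "rank_le A I C (card C - 1)"
  proof (rule rank_le_cols_span)
    fix j assume "j \<in> C"
    show "in_col_span A I (C - {m}) (\<lambda>i. A i j)"
    proof (cases "j = m")
      case True
      then show ?thesis using in_col_span_unit[OF fin(1) finC m(1) no] by simp
    next
      case False
      then show ?thesis
        by (intro in_col_span_column[of _ j _ _ _ 1]) (use \<open>j \<in> C\<close> finC in auto)
    qed
  qed (use finC in auto)
  then show ?thesis by (rule rank_le_cols_span) (use finC span in auto)
qed

section \<open>Points of the rank locus with maximal block ranks\<close>

context rank_conditions
begin

definition top_rows :: "nat \<Rightarrow> nat set" where "top_rows j = {1..d j}"
definition right_cols :: "nat \<Rightarrow> nat set" where "right_cols j = {c j..l}"
definition corner_rows :: "nat \<Rightarrow> nat set" where "corner_rows j = {d j - r j<..d j}"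
definition corner_cols :: "nat \<Rightarrow> nat set" where "corner_cols j = {c j..<c j + r j}"

lemmas block_defs = top_rows_def right_cols_def corner_rows_def corner_cols_def

lemma finite_blocks [simp, intro]:
  "finite (top_rows j)" "finite (right_cols j)" "finite (corner_rows j)" "finite (corner_cols j)"
  by (auto simp: block_defs)

lemma card_corner: "j \<in> {1..v} \<Longrightarrow> card (corner_rows j) = r j" "card (corner_cols j) = r j"
  using corner_bounds[of j] by (auto simp: block_defs)

lemma corner_subset:
  "corner_rows j \<subseteq> top_rows j" "j \<in> {1..v} \<Longrightarrow> corner_cols j \<subseteq> right_cols j"
  using corner_bounds[of j] by (auto simp: block_defs)

lemma rank_cond_full_iff:
  "rank_cond ({1..k} \<times> {1..l}) A \<longleftrightarrow> (\<forall>j\<in>{1..v}. rank_le A (top_rows j) (right_cols j) (r j))"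
proof
  assume h: "rank_cond ({1..k} \<times> {1..l}) A"
  show "\<forall>j\<in>{1..v}. rank_le A (top_rows j) (right_cols j) (r j)"
  proof
    fix j assume j: "j \<in> {1..v}"
    show "rank_le A (top_rows j) (right_cols j) (r j)"
      unfolding block_defs by (rule rank_condD[OF h j]) (use corner_bounds[OF j] in auto)
  qed
next
  assume h: "\<forall>j\<in>{1..v}. rank_le A (top_rows j) (right_cols j) (r j)"
  show "rank_cond ({1..k} \<times> {1..l}) A"
    by (rule rank_condI, rule rank_le_mono[OF bspec[OF h]]) (auto simp: block_defs)
qed

text \<open>Maximality of these three ranks yields, in this order, that the corner rows span the top
  rows, that the corner columns span the right columns, and that the corner block is
  nonsingular.\<close>

definition blocks :: "nat \<Rightarrow> (nat set \<times> nat set) set" where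
  "blocks j = {(corner_rows j, right_cols j), (top_rows j, corner_cols j), (corner_rows j, corner_cols j)}"

text \<open>A point of the locus \<open>G \<noteq> 0\<close> at which the ranks of the blocks cannot be raised any further.\<close>

definition extremal :: "((nat \<Rightarrow> nat \<Rightarrow> 'f::field) \<Rightarrow> 'f) \<Rightarrow> (nat \<Rightarrow> nat \<Rightarrow> 'f) \<Rightarrow> bool" where
  "extremal G A \<longleftrightarrow> rank_cond ({1..k} \<times> {1..l}) A \<and> G A \<noteq> 0 \<and>
     (\<forall>N. (\<forall>s. rank_cond ({1..k} \<times> {1..l}) (\<lambda>i m. A i m + s * N i m)) \<longrightarrow>
       (\<exists>s. s \<noteq> 0 \<and> (\<forall>j\<in>{1..v}. \<forall>(I, J)\<in>blocks j.
          rank_le (\<lambda>i m. A i m + s * N i m) I J (block_rank A I J))))"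

text \<open>The sum of the block ranks is bounded, so it has a maximum. On a line inside the locus
  almost every \<open>s\<close> keeps \<open>G\<close> nonzero and lowers no block rank; maximality
  of the sum then fixes each rank.\<close>

lemma extremal_exists:
  fixes A :: "nat \<Rightarrow> nat \<Rightarrow> 'f::field"
  assumes inf: "infinite (UNIV :: 'f set)" and A: "rank_cond ({1..k} \<times> {1..l}) A"
    and G: "polyfun T G" "G A \<noteq> 0"
  shows "\<exists>A'. extremal G A'"
proof -
  define bl where "bl = (\<Union>j\<in>{1..v}. blocks j)"
  have finbl: "finite bl" by (auto simp: bl_def blocks_def)
  have finI: "finite (fst b)" if "b \<in> bl" for b using that by (auto simp: bl_def blocks_def)
  define mu where "mu A = (\<Sum>b\<in>bl. block_rank A (fst b) (snd b))" for A :: "nat \<Rightarrow> nat \<Rightarrow> 'f"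
  have bound: "mu A \<le> (\<Sum>b\<in>bl. card (fst b))" for A
    unfolding mu_def by (intro sum_mono block_rank(2) finI)
  define P where "P A \<longleftrightarrow> rank_cond ({1..k} \<times> {1..l}) A \<and> G A \<noteq> 0" for A
  have "\<exists>A'. P A' \<and> (\<forall>A''. P A'' \<longrightarrow> mu A'' \<le> mu A')"
    by (rule ex_has_greatest_nat[of P A mu "Suc (\<Sum>b\<in>bl. card (fst b))"])
      (use A G bound in \<open>auto simp: P_def less_Suc_eq_le\<close>)
  then obtain A' where A': "P A'" and max: "\<And>A''. P A'' \<Longrightarrow> mu A'' \<le> mu A'" by blast
  have "extremal G A'"
    unfolding extremal_def
  proof (intro conjI allI impI)
    show "rank_cond ({1..k} \<times> {1..l}) A'" "G A' \<noteq> 0" using A' by (auto simp: P_def)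
    fix N :: "nat \<Rightarrow> nat \<Rightarrow> 'f"
    assume N: "\<forall>s. rank_cond ({1..k} \<times> {1..l}) (\<lambda>i m. A' i m + s * N i m)"
    let ?A = "\<lambda>s i m. A' i m + s * N i m"
    let ?q = "\<lambda>b. block_rank A' (fst b) (snd b)"
    define bad where "bad = {0} \<union> {s. G (?A s) = 0} \<union>
      (\<Union>b\<in>{b\<in>bl. 0 < ?q b}. {s. rank_le (?A s) (fst b) (snd b) (?q b - 1)})"
    have "finite bad"
      unfolding bad_def
    proof (intro finite_UnI finite_UN_I)
      show "finite {s. G (?A s) = 0}" by (rule finite_line_zeros[OF G(1)]) (use A' in \<open>auto simp: P_def\<close>)
      fix b assume "b \<in> {b \<in> bl. 0 < ?q b}"
      then have "\<not> rank_le A' (fst b) (snd b) (?q b - 1)" by (intro block_rank(3)) (auto intro: finI)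
      then show "finite {s. rank_le (?A s) (fst b) (snd b) (?q b - 1)}"
        by (rule finite_line_rank_drop)
    qed (use finbl in auto)
    then obtain s where s: "s \<notin> bad" using inf ex_new_if_finite by blast
    have ge: "?q b \<le> block_rank (?A s) (fst b) (snd b)" if b: "b \<in> bl" for b
    proof (rule ccontr)
      assume lt: "\<not> ?thesis"
      have rk: "rank_le (?A s) (fst b) (snd b) (?q b - 1)"
        by (rule rank_le_mono[OF block_rank(1)[OF finI[OF b]]]) (use lt in auto)
      have "b \<in> {b\<in>bl. 0 < ?q b}" using b lt by simp
      then have "s \<in> bad" unfolding bad_def by (intro UnI2 UN_I) (assumption, simp only: mem_Collect_eq rk)
      then show False using s by simp
    qed
    have "P (?A s)" using N s by (auto simp: P_def bad_def)
    then have le: "mu (?A s) \<le> mu A'" by (rule max)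
    have eq: "block_rank (?A s) (fst b) (snd b) = ?q b" if b: "b \<in> bl" for b
    proof (rule ccontr)
      assume "\<not> ?thesis"
      then have "?q b < block_rank (?A s) (fst b) (snd b)" using ge[OF b] by simp
      then have "mu A' < mu (?A s)"
        unfolding mu_def by (intro sum_strict_mono_ex1[OF finbl]) (use ge b in auto)
      then show False using le by simp
    qed
    show "\<exists>s. s \<noteq> 0 \<and> (\<forall>j\<in>{1..v}. \<forall>(I, J)\<in>blocks j. rank_le (?A s) I J (block_rank A' I J))"
    proof (intro exI[of _ s] conjI ballI)
      show "s \<noteq> 0" using s by (auto simp: bad_def)
      fix j b assume "j \<in> {1..v}" "b \<in> blocks j"
      then have b: "b \<in> bl" by (auto simp: bl_def)
      have "rank_le (?A s) (fst b) (snd b) (?q b)" using block_rank(1)[OF finI[OF b]] eq[OF b] by metis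
      then show "case b of (I, J) \<Rightarrow> rank_le (?A s) I J (block_rank A' I J)" by (simp add: case_prod_beta)
    qed
  qed
  then show ?thesis by blast
qed

text \<open>Adding \<open>x\<close> times \<open>y\<close> would raise the rank of the block if
  neither vector lay in its span. The direction \<open>N\<close> has to be of rank one only on this
  block.\<close>

lemma extremal_span:
  fixes A :: "nat \<Rightarrow> nat \<Rightarrow> 'f::field"
  assumes ext: "extremal G A" and j: "j \<in> {1..v}" and b: "(I, J) \<in> blocks j"
    and N: "\<And>i m. i \<in> I \<Longrightarrow> m \<in> J \<Longrightarrow> N i m = x i * y m"
    and cond: "\<And>s j. j \<in> {1..v} \<Longrightarrow> rank_le (\<lambda>i m. A i m + s * N i m) (top_rows j) (right_cols j) (r j)"
  shows "in_col_span A I J x \<or> in_row_span A I J y"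
proof (rule ccontr)
  assume no: "\<not> ?thesis"
  have fin: "finite I" "finite J" using b by (auto simp: blocks_def)
  have "\<forall>s. rank_cond ({1..k} \<times> {1..l}) (\<lambda>i m. A i m + s * N i m)"
    using cond unfolding rank_cond_full_iff by blast
  then obtain s where s: "s \<noteq> 0" "rank_le (\<lambda>i m. A i m + s * N i m) I J (block_rank A I J)"
    using ext j b unfolding extremal_def by blast
  have rk: "rank_le (\<lambda>i m. A i m + s * x i * y m) I J (block_rank A I J)"
    by (rule rank_le_mono[OF s(2)]) (auto simp: N)
  have "0 < block_rank A I J" "rank_le A I J (block_rank A I J - 1)"
    using rank_le_reduce_span[OF fin _ _ s(1) rk] no by auto
  then show False using block_rank(3)[OF fin(1), of "block_rank A I J - 1" A J] by simp
qed

text \<open>The perturbation adds a multiple of row \<open>i\<close> to a corner row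
  \<open>i'\<close> below it. A condition that sees row \<open>i'\<close> also sees row
  \<open>i\<close>, because its block starts in row \<open>1\<close>, so every condition is
  preserved.\<close>

lemma extremal_corner_rows_span:
  fixes A :: "nat \<Rightarrow> nat \<Rightarrow> 'f::field"
  assumes ext: "extremal G A" and j: "j \<in> {1..v}" and i: "i \<in> top_rows j"
  shows "in_row_span A (corner_rows j) (right_cols j) (A i)"
proof (cases "i \<in> corner_rows j")
  case True
  then show ?thesis by (intro in_col_span_column[of _ i _ _ _ 1]) auto
next
  case False
  have A: "rank_le A (top_rows j) (right_cols j) (r j)" if "j \<in> {1..v}" for j
    using ext that unfolding extremal_def rank_cond_full_iff by blast
  show ?thesis
  proof (rule in_row_span_if_units[OF _ _ False])
    show "rank_le A (insert i (corner_rows j)) (right_cols j) (card (corner_rows j))"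
      unfolding card_corner(1)[OF j]
      by (rule rank_le_mono[OF A[OF j]]) (use i corner_subset in auto)
    fix i' assume i': "i' \<in> corner_rows j"
    have lt: "i < i'" using False i i' by (auto simp: block_defs)
    define N where "N a m = unit_fun i' a * A i m" for a m
    show "in_col_span A (corner_rows j) (right_cols j) (unit_fun i') \<or>
      in_row_span A (corner_rows j) (right_cols j) (A i)"
    proof (rule extremal_span[OF ext j])
      show "(corner_rows j, right_cols j) \<in> blocks j" by (simp add: blocks_def)
      show "N a m = unit_fun i' a * A i m" for a m by (simp add: N_def)
      fix s j' assume j': "j' \<in> {1..v}"
      show "rank_le (\<lambda>a m. A a m + s * N a m) (top_rows j') (right_cols j') (r j')"
      proof (cases "i' \<in> top_rows j'")
        case True
        have "in_row_span A (top_rows j') (right_cols j') (A i)"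
          by (rule in_col_span_column[of _ i _ _ _ 1]) (use True lt i in \<open>auto simp: block_defs\<close>)
        from rank_le_add_in_row_span[OF A[OF j'] _ this, of "\<lambda>a. s * unit_fun i' a"]
        show ?thesis by (simp add: N_def mult.assoc)
      next
        case False
        show ?thesis by (rule rank_le_mono[OF A[OF j']]) (use False in \<open>auto simp: N_def unit_fun_def\<close>)
      qed
    qed
  qed auto
qed

text \<open>The mirror image: a column is added to a corner column to its left, and every condition
  that sees the latter extends to column \<open>l\<close>.\<close>

lemma extremal_corner_cols_span:
  fixes A :: "nat \<Rightarrow> nat \<Rightarrow> 'f::field"
  assumes ext: "extremal G A" and j: "j \<in> {1..v}" and m: "m \<in> right_cols j"
  shows "in_col_span A (top_rows j) (corner_cols j) (\<lambda>i. A i m)"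
proof (cases "m \<in> corner_cols j")
  case True
  then show ?thesis by (intro in_col_span_column[of _ m _ _ _ 1]) auto
next
  case False
  have A: "rank_le A (top_rows j) (right_cols j) (r j)" if "j \<in> {1..v}" for j
    using ext that unfolding extremal_def rank_cond_full_iff by blast
  have "in_row_span (\<lambda>m i. A i m) (corner_cols j) (top_rows j) (\<lambda>i. A i m)"
  proof (rule in_row_span_if_units[OF _ _ False])
    have "rank_le A (top_rows j) (insert m (corner_cols j)) (card (corner_cols j))"
      unfolding card_corner(2)
      by (rule rank_le_mono[OF A[OF j]]) (use m corner_subset[of j] j in auto)
    then show "rank_le (\<lambda>m i. A i m) (insert m (corner_cols j)) (top_rows j) (card (corner_cols j))"
      by (rule rank_le_transpose)
    fix m' assume m': "m' \<in> corner_cols j"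
    have lt: "m' < m" using False m m' by (auto simp: block_defs)
    define N where "N i b = A i m * unit_fun m' b" for i b
    have "in_col_span A (top_rows j) (corner_cols j) (\<lambda>i. A i m) \<or>
      in_row_span A (top_rows j) (corner_cols j) (unit_fun m')"
    proof (rule extremal_span[OF ext j])
      show "(top_rows j, corner_cols j) \<in> blocks j" by (simp add: blocks_def)
      show "N i b = A i m * unit_fun m' b" for i b by (simp add: N_def)
      fix s j' assume j': "j' \<in> {1..v}"
      show "rank_le (\<lambda>i b. A i b + s * N i b) (top_rows j') (right_cols j') (r j')"
      proof (cases "m' \<in> right_cols j'")
        case True
        have "in_col_span A (top_rows j') (right_cols j') (\<lambda>i. A i m)"
          by (rule in_col_span_column[of _ m _ _ _ 1]) (use True lt m in \<open>auto simp: block_defs\<close>)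
        from rank_le_add_in_col_span[OF A[OF j'] _ this, of "\<lambda>b. s * unit_fun m' b"]
        show ?thesis by (simp add: N_def mult_ac)
      next
        case False
        show ?thesis by (rule rank_le_mono[OF A[OF j']]) (use False in \<open>auto simp: N_def unit_fun_def\<close>)
      qed
    qed
    then show "in_col_span (\<lambda>m i. A i m) (corner_cols j) (top_rows j) (unit_fun m') \<or>
        in_row_span (\<lambda>m i. A i m) (corner_cols j) (top_rows j) (\<lambda>i. A i m)"
      by (simp only: disj_commute)
  qed auto
  then show ?thesis by simp
qed

text \<open>A condition that is not tight leaves room for an arbitrary rank one term.\<close>

definition tight :: "(nat \<Rightarrow> nat \<Rightarrow> 'f::field) \<Rightarrow> nat \<Rightarrow> bool" where
  "tight A j \<longleftrightarrow> (\<forall>q<r j. \<not> rank_le A (top_rows j) (right_cols j) q)"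

text \<open>The first later tight condition \<open>j1\<close> that sees column \<open>m\<close>
  supplies the row. Its corner columns are independent and contain the corner columns of
  \<open>j\<close> from \<open>c j1\<close> on, so its rows generate the unit vector there. Later
  conditions have more rows and fewer columns and inherit this.\<close>

lemma tight_row_vector:
  fixes A :: "nat \<Rightarrow> nat \<Rightarrow> 'f::field"
  assumes ext: "extremal G A" and j: "j \<in> {1..v}" and m: "m \<in> corner_cols j"
  shows "\<exists>y. (\<forall>m'\<in>corner_cols j. y m' = unit_fun m m') \<and>
    (\<forall>j'\<in>{1..v}. j < j' \<and> tight A j' \<longrightarrow> in_row_span A (top_rows j') (right_cols j') y)"
proof -
  define Jt where "Jt = {j'. j < j' \<and> j' \<le> v \<and> c j' \<le> m \<and> tight A j'}"
  show ?thesis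
  proof (cases "Jt = {}")
    case True
    show ?thesis
    proof (intro exI[of _ "unit_fun m"] conjI ballI impI)
      fix j' assume "j' \<in> {1..v}" "j < j' \<and> tight A j'"
      then have "\<not> c j' \<le> m" using True unfolding Jt_def by (simp only: atLeastAtMost_iff) blast
      then have "m < c j'" by simp
      then show "in_row_span A (top_rows j') (right_cols j') (unit_fun m)"
        by (intro in_col_spanI[where w = "\<lambda>_. 0"]) (auto simp: block_defs unit_fun_def)
    qed (rule refl)
  next
    case False
    define j1 where "j1 = (LEAST j'. j' \<in> Jt)"
    have "\<exists>j'. j' \<in> Jt" using False by blast
    then have j1: "j1 \<in> Jt" unfolding j1_def by (rule LeastI_ex)
    have least: "j' \<in> Jt \<Longrightarrow> j1 \<le> j'" for j' unfolding j1_def by (rule Least_le)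
    have j1v: "j1 \<in> {1..v}" "j < j1" "c j1 \<le> m" "tight A j1" using j1 by (auto simp: Jt_def)
    have mono1: "c j \<le> c j1" "c j + r j < c j1 + r j1" using corner_mono[OF j j1v(1,2)] by auto
    have m1: "m \<in> corner_cols j1" using m mono1 j1v by (auto simp: block_defs)
    have "in_row_span A (top_rows j1) (corner_cols j1) (unit_fun m)"
    proof (rule ccontr)
      assume no: "\<not> ?thesis"
      have "rank_le A (top_rows j1) (right_cols j1) (card (corner_cols j1) - 1)"
        by (rule rank_le_if_no_unit[OF _ _ m1 _ _ no])
          (use corner_subset j1v extremal_corner_cols_span[OF ext j1v(1)] in auto)
      moreover have "0 < r j1" using m1 by (auto simp: block_defs)
      ultimately show False using j1v(4) unfolding tight_def card_corner(2) by auto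
    qed
    then obtain w where w: "\<forall>m'\<in>corner_cols j1. unit_fun m m' = (\<Sum>i\<in>top_rows j1. A i m' * w i)"
      by (rule in_col_spanE)
    define y where "y m' = (if c j1 \<le> m' then \<Sum>i\<in>top_rows j1. A i m' * w i else 0)" for m'
    show ?thesis
    proof (intro exI[of _ y] conjI ballI impI)
      fix m' assume m': "m' \<in> corner_cols j"
      show "y m' = unit_fun m m'"
      proof (cases "c j1 \<le> m'")
        case True
        then have "m' \<in> corner_cols j1" using m' mono1 by (auto simp: block_defs)
        then show ?thesis using bspec[OF w] True by (simp add: y_def)
      next
        case False
        then show ?thesis using j1v by (auto simp: y_def unit_fun_def)
      qed
    next
      fix j' assume j': "j' \<in> {1..v}" "j < j' \<and> tight A j'"
      have le: "j1 \<le> j'"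
      proof (rule ccontr)
        assume n: "\<not> ?thesis"
        with n have "c j' \<le> c j1" using corner_mono[OF j'(1) j1v(1)] by auto
        then have "j' \<in> Jt" using j' j1v by (auto simp: Jt_def)
        then show False using least n by blast
      qed
      then have dc: "d j1 \<le> d j'" "c j1 \<le> c j'"
        using corner_mono[OF j1v(1) j'(1)] by (cases "j1 = j'"; auto)+
      have "in_row_span A (top_rows j1) (right_cols j1) y"
        by (rule in_col_spanI[where w = w]) (auto simp: y_def right_cols_def)
      then show "in_row_span A (top_rows j') (right_cols j') y"
        by (rule in_col_span_mono) (use dc in \<open>auto simp: block_defs\<close>)
    qed
  qed
qed

text \<open>The mirror image, with the last earlier tight condition \<open>j1\<close> that sees row
  \<open>i\<close>.\<close>

lemma tight_col_vector:
  fixes A :: "nat \<Rightarrow> nat \<Rightarrow> 'f::field"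
  assumes ext: "extremal G A" and j: "j \<in> {1..v}" and i: "i \<in> corner_rows j"
  shows "\<exists>x. (\<forall>i'\<in>corner_rows j. x i' = unit_fun i i') \<and>
    (\<forall>j'\<in>{1..v}. j' < j \<and> tight A j' \<longrightarrow> in_col_span A (top_rows j') (right_cols j') x)"
proof -
  define Jt where "Jt = {j'. j' < j \<and> 1 \<le> j' \<and> i \<le> d j' \<and> tight A j'}"
  show ?thesis
  proof (cases "Jt = {}")
    case True
    show ?thesis
    proof (intro exI[of _ "unit_fun i"] conjI ballI impI)
      fix j' assume "j' \<in> {1..v}" "j' < j \<and> tight A j'"
      then have "\<not> i \<le> d j'" using True unfolding Jt_def by (simp only: atLeastAtMost_iff) blast
      then have "d j' < i" by simp
      then show "in_col_span A (top_rows j') (right_cols j') (unit_fun i)"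
        by (intro in_col_spanI[where w = "\<lambda>_. 0"]) (auto simp: block_defs unit_fun_def)
    qed (rule refl)
  next
    case False
    have finJt: "finite Jt" by (rule finite_subset[of _ "{..j}"]) (auto simp: Jt_def)
    define j1 where "j1 = Max Jt"
    have j1: "j1 \<in> Jt" unfolding j1_def by (rule Max_in[OF finJt False])
    have greatest: "j' \<in> Jt \<Longrightarrow> j' \<le> j1" for j' unfolding j1_def by (rule Max_ge[OF finJt])
    have j1v: "j1 \<in> {1..v}" "j1 < j" "i \<le> d j1" "tight A j1" using j1 j by (auto simp: Jt_def)
    have mono1: "d j1 \<le> d j" "d j1 + r j < d j + r j1" using corner_mono[OF j1v(1) j j1v(2)] by auto
    have i1: "i \<in> corner_rows j1" using i mono1 j1v corner_bounds[OF j] by (auto simp: block_defs)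
    have "in_col_span A (corner_rows j1) (right_cols j1) (unit_fun i)"
    proof (rule ccontr)
      assume no: "\<not> ?thesis"
      have "rank_le (\<lambda>m i. A i m) (right_cols j1) (top_rows j1) (card (corner_rows j1) - 1)"
        by (rule rank_le_if_no_unit[OF _ _ i1 _ _ no])
          (use corner_subset j1v extremal_corner_rows_span[OF ext j1v(1)] in auto)
      from rank_le_transpose[OF this]
      have "rank_le A (top_rows j1) (right_cols j1) (r j1 - 1)" unfolding card_corner(1)[OF j1v(1)] .
      moreover have "0 < r j1" using i1 by (auto simp: block_defs)
      ultimately show False using j1v(4) unfolding tight_def by auto
    qed
    then obtain w where w: "\<forall>i'\<in>corner_rows j1. unit_fun i i' = (\<Sum>m\<in>right_cols j1. A i' m * w m)"
      by (rule in_col_spanE)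
    define x where "x i' = (if i' \<le> d j1 then \<Sum>m\<in>right_cols j1. A i' m * w m else 0)" for i'
    show ?thesis
    proof (intro exI[of _ x] conjI ballI impI)
      fix i' assume i': "i' \<in> corner_rows j"
      show "x i' = unit_fun i i'"
      proof (cases "i' \<le> d j1")
        case True
        then have "i' \<in> corner_rows j1" using i' mono1 corner_bounds[OF j] by (auto simp: block_defs)
        then show ?thesis using bspec[OF w] True by (simp add: x_def)
      next
        case False
        then show ?thesis using j1v by (auto simp: x_def unit_fun_def)
      qed
    next
      fix j' assume j': "j' \<in> {1..v}" "j' < j \<and> tight A j'"
      have le: "j' \<le> j1"
      proof (rule ccontr)
        assume n: "\<not> ?thesis"
        with n have "d j1 \<le> d j'" using corner_mono[OF j1v(1) j'(1)] by auto
        then have "j' \<in> Jt" using j' j1v by (auto simp: Jt_def)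
        then show False using greatest n by blast
      qed
      then have dc: "d j' \<le> d j1" "c j' \<le> c j1"
        using corner_mono[OF j'(1) j1v(1)] by (cases "j1 = j'"; auto)+
      have "in_col_span A (top_rows j1) (right_cols j1) x"
        by (rule in_col_spanI[where w = w]) (auto simp: x_def top_rows_def)
      then show "in_col_span A (top_rows j') (right_cols j') x"
        by (rule in_col_span_mono) (use dc in \<open>auto simp: block_defs\<close>)
    qed
  qed
qed

text \<open>If the corner block were singular, one could add a multiple of a rank one matrix, built from a
  row and a column that the rank conditions tolerate, and thereby raise its rank.\<close>

lemma extremal_corner_nonsing:
  fixes A :: "nat \<Rightarrow> nat \<Rightarrow> 'f::field"
  assumes ext: "extremal G A" and j: "j \<in> {1..v}"
  shows "nonsing A (corner_rows j) (corner_cols j)"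
proof (cases "r j = 0")
  case True
  then show ?thesis by (simp add: nonsing_def corner_cols_def)
next
  case False
  have A: "rank_le A (top_rows j) (right_cols j) (r j)" if "j \<in> {1..v}" for j
    using ext that unfolding extremal_def rank_cond_full_iff by blast
  have "\<not> rank_le A (corner_rows j) (corner_cols j) (r j - 1)"
  proof
    assume small: "rank_le A (corner_rows j) (corner_cols j) (r j - 1)"
    have "\<exists>i\<in>corner_rows j. \<not> in_col_span A (corner_rows j) (corner_cols j) (unit_fun i)"
    proof (rule ccontr)
      assume "\<not> ?thesis"
      then have "nonsing (\<lambda>m i. A i m) (corner_cols j) (corner_rows j)"
        by (intro nonsing_rows_if_units) auto
      moreover have "\<not> nonsing (\<lambda>m i. A i m) (corner_cols j) (corner_rows j)"
        by (rule rank_le_not_nonsing[OF rank_le_transpose[OF small]]) (use False card_corner(1)[OF j] card_corner(2)[of j] in auto)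
      ultimately show False by blast
    qed
    then obtain i where i: "i \<in> corner_rows j" "\<not> in_col_span A (corner_rows j) (corner_cols j) (unit_fun i)"
      by blast
    have "\<exists>m\<in>corner_cols j. \<not> in_row_span A (corner_rows j) (corner_cols j) (unit_fun m)"
    proof (rule ccontr)
      assume "\<not> ?thesis"
      then have "nonsing A (corner_rows j) (corner_cols j)"
        by (intro nonsing_rows_if_units[where A = "\<lambda>m i. A i m"]) auto
      moreover have "\<not> nonsing A (corner_rows j) (corner_cols j)"
        by (rule rank_le_not_nonsing[OF small]) (use False card_corner(1)[OF j] card_corner(2)[of j] in auto)
      ultimately show False by blast
    qed
    then obtain m where m: "m \<in> corner_cols j" "\<not> in_row_span A (corner_rows j) (corner_cols j) (unit_fun m)"
      by blast
    \<comment> \<open>As the corner rows and columns span the block, a rank defect of the corner is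
      one of the whole condition, so condition \<open>j\<close> is not tight.\<close>
    have "rank_le A (corner_rows j) (right_cols j) (r j - 1)"
      by (rule rank_le_cols_span[OF small])
        (use extremal_corner_cols_span[OF ext j] corner_subset[of j] in \<open>auto intro: in_col_span_mono\<close>)
    then have loose: "rank_le A (top_rows j) (right_cols j) (r j - 1)"
      by (rule rank_le_rows_span) (use extremal_corner_rows_span[OF ext j] in auto)
    obtain y where y: "\<forall>m'\<in>corner_cols j. y m' = unit_fun m m'"
      "\<forall>j'\<in>{1..v}. j < j' \<and> tight A j' \<longrightarrow> in_row_span A (top_rows j') (right_cols j') y"
      using tight_row_vector[OF ext j m(1)] by blast
    obtain x where x: "\<forall>i'\<in>corner_rows j. x i' = unit_fun i i'"
      "\<forall>j'\<in>{1..v}. j' < j \<and> tight A j' \<longrightarrow> in_col_span A (top_rows j') (right_cols j') x"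
      using tight_col_vector[OF ext j i(1)] by blast
    have "in_col_span A (corner_rows j) (corner_cols j) x \<or> in_row_span A (corner_rows j) (corner_cols j) y"
    proof (rule extremal_span[OF ext j, where N = "\<lambda>i m. x i * y m"])
      show "(corner_rows j, corner_cols j) \<in> blocks j" by (simp add: blocks_def)
      fix s j' assume j': "j' \<in> {1..v}"
      show "rank_le (\<lambda>i m. A i m + s * (x i * y m)) (top_rows j') (right_cols j') (r j')"
      \<comment> \<open>Conditions with room absorb any rank one term; tight later conditions
        tolerate the row \<open>y\<close>, tight earlier ones the column \<open>x\<close>.\<close>
      proof (cases "j' = j \<or> \<not> tight A j'")
        case True
        have "r j - 1 < r j" using False by simp
        with True loose have "\<exists>q<r j'. rank_le A (top_rows j') (right_cols j') q"
          unfolding tight_def by blast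
        then obtain q where q: "q < r j'" "rank_le A (top_rows j') (right_cols j') q" by blast
        from rank_le_add_rank_one[OF q(2), of "\<lambda>i. s * x i" y]
        show ?thesis by (rule rank_le_mono) (use q(1) in \<open>auto simp: mult.assoc\<close>)
      next
        case t: False
        show ?thesis
        proof (cases "j < j'")
          case True
          then have "in_row_span A (top_rows j') (right_cols j') y" using y(2) j' t by blast
          from rank_le_add_in_row_span[OF A[OF j'] _ this, of "\<lambda>i. s * x i"]
          show ?thesis by (simp add: mult.assoc)
        next
          case False
          then have "in_col_span A (top_rows j') (right_cols j') x" using x(2) j' t by auto
          from rank_le_add_in_col_span[OF A[OF j'] _ this, of "\<lambda>m. s * y m"]
          show ?thesis by (simp add: mult.left_commute)
        qed
      qed
    qed auto
    moreover have "in_col_span A (corner_rows j) (corner_cols j) x =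
        in_col_span A (corner_rows j) (corner_cols j) (unit_fun i)"
      by (rule in_col_span_cong) (use x(1) in auto)
    moreover have "in_row_span A (corner_rows j) (corner_cols j) y =
        in_row_span A (corner_rows j) (corner_cols j) (unit_fun m)"
      by (rule in_col_span_cong) (use y(1) in auto)
    ultimately show False using i m by blast
  qed
  then obtain I0 J0 where IJ: "I0 \<subseteq> corner_rows j" "J0 \<subseteq> corner_cols j" "card I0 = r j" "card J0 = r j"
      "nonsing A I0 J0"
    using nonsing_exists[of A "corner_rows j" "corner_cols j" "r j - 1"] False by auto
  have "I0 = corner_rows j" by (rule card_subset_eq[OF _ IJ(1)]) (use card_corner(1)[OF j] IJ in auto)
  moreover have "J0 = corner_cols j" by (rule card_subset_eq[OF _ IJ(2)]) (use card_corner(2)[of j] IJ in auto)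
  ultimately show ?thesis using IJ(5) by simp
qed

text \<open>Filling the matrix reduces the claim to full rectangles, where extremal points exist;
  the outcome is then restricted to \<open>S\<close> again.\<close>

theorem rank_cond_dense:
  fixes A :: "nat \<Rightarrow> nat \<Rightarrow> 'f::field"
  assumes "infinite (UNIV :: 'f set)" "staircase S" "rank_cond S A" "polyfun S G" "G A \<noteq> 0"
  shows "\<exists>A'. rank_cond S A' \<and> G A' \<noteq> 0 \<and> (\<forall>j\<in>{1..v}. nonsing A' (corner_rows j) (corner_cols j))"
proof -
  obtain B where "rank_cond ({1..k} \<times> {1..l}) B" "G B \<noteq> 0"
    using rank_cond_fill[OF assms(1-4) subset_refl assms(5)] by blast
  then obtain A' where A': "extremal G A'" using extremal_exists[OF assms(1) _ assms(4)] by blast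
  then have full: "rank_cond ({1..k} \<times> {1..l}) A'" and G: "G A' \<noteq> 0" by (auto simp: extremal_def)
  have "rank_cond S A'"
    by (rule rank_condI, rule rank_condD[OF full]) (use assms(2) in \<open>auto simp: staircase_def\<close>)
  then show ?thesis using G extremal_corner_nonsing[OF A'] by blast
qed

end

section \<open>Splittings and purity\<close>

text \<open>The left inverse is carried out on representatives: \<open>?B\<close> maps relations to
  relations and undoes \<open>?F\<close>, so two cosets with the same image differ by an element of
  \<open>?K\<close>.\<close>

lemma pure_map_if_split:
  fixes S :: "'s ring" and N :: "('s, 'n) module" and N' :: "('s, 'n') module"
  assumes phi: "\<And>y. y \<in> carrier N \<Longrightarrow> \<phi> y \<in> carrier N'"
    and closed: "\<And>y y'. y \<in> carrier N' \<Longrightarrow> y' \<in> carrier N' \<Longrightarrow> y \<oplus>\<^bsub>N'\<^esub> y' \<in> carrier N'"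
      "\<And>s y. s \<in> carrier S \<Longrightarrow> y \<in> carrier N' \<Longrightarrow> s \<odot>\<^bsub>N'\<^esub> y \<in> carrier N'"
    and closedN: "\<And>y y'. y \<in> carrier N \<Longrightarrow> y' \<in> carrier N \<Longrightarrow> y \<oplus>\<^bsub>N\<^esub> y' \<in> carrier N"
      "\<And>s y. s \<in> carrier S \<Longrightarrow> y \<in> carrier N \<Longrightarrow> s \<odot>\<^bsub>N\<^esub> y \<in> carrier N"
    and psi: "\<And>y. y \<in> carrier N' \<Longrightarrow> \<psi> y \<in> carrier N"
      "\<And>y y'. y \<in> carrier N' \<Longrightarrow> y' \<in> carrier N' \<Longrightarrow> \<psi> (y \<oplus>\<^bsub>N'\<^esub> y') = \<psi> y \<oplus>\<^bsub>N\<^esub> \<psi> y'"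
      "\<And>s y. s \<in> carrier S \<Longrightarrow> y \<in> carrier N' \<Longrightarrow> \<psi> (s \<odot>\<^bsub>N'\<^esub> y) = s \<odot>\<^bsub>N\<^esub> \<psi> y"
    and left_inverse: "\<And>y. y \<in> carrier N \<Longrightarrow> \<psi> (\<phi> y) = y"
  shows "pure_map TYPE('m) S N N' \<phi>"
  unfolding pure_map_def
proof (intro allI impI inj_onI)
  fix M :: "('s, 'm) module" and C1 C2
  assume M: "module S M" and C: "C1 \<in> carrier (tensor_product S M N)" "C2 \<in> carrier (tensor_product S M N)"
    and eq: "tensor_map S M N' \<phi> C1 = tensor_map S M N' \<phi> C2"
  interpret module S M by (rule M)
  let ?G = "free_Abelian_group (carrier M \<times> carrier N)"
  let ?G' = "free_Abelian_group (carrier M \<times> carrier N')"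
  let ?K = "tensor_kernel S M N" and ?K' = "tensor_kernel S M N'"
  let ?F = "frag_extend (\<lambda>(x, y). frag_of (x, \<phi> y))"
  let ?B = "frag_extend (\<lambda>(x, y). frag_of (x, \<psi> y))"
  interpret G: comm_group ?G by (rule abelian_free_Abelian_group)
  interpret G': comm_group ?G' by (rule abelian_free_Abelian_group)
  have rel: "tensor_relators S M N \<subseteq> carrier ?G" "tensor_relators S M N' \<subseteq> carrier ?G'"
    unfolding tensor_relators_def
    by (auto simp: keys_frag_of closed closedN dest!: subsetD[OF keys_diff])
  have sub: "subgroup ?K ?G" unfolding tensor_kernel_def by (rule G.generate_is_subgroup[OF rel(1)])
  have K0: "0 \<in> ?K" using subgroup.one_closed[OF sub] by simp
  have Kadd: "x + y \<in> ?K" if "x \<in> ?K" "y \<in> ?K" for x y using subgroup.m_closed[OF sub that] by simp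
  have Kminus: "- x \<in> ?K" if "x \<in> ?K" for x
    using subgroup.m_inv_closed[OF sub that] subgroup.mem_carrier[OF sub that] by simp
  have B_rel: "?B h \<in> tensor_relators S M N" if "h \<in> tensor_relators S M N'" for h
    using that unfolding tensor_relators_def
    by (auto simp: frag_extend_diff psi) (blast intro: psi(1))+
  have B: "?B z \<in> ?K" if "z \<in> ?K'" for z
    using that unfolding tensor_kernel_def
  proof (induction rule: generate.induct)
    case one
    then show ?case using generate.one[of ?G] by simp
  next
    case (incl h)
    then show ?case by (intro generate.incl B_rel)
  next
    case (inv h)
    have "?B h \<in> carrier ?G" using rel(1) B_rel[OF inv] by blast
    moreover have "h \<in> carrier ?G'" using rel(2) inv by blast
    ultimately show ?case using generate.inv[OF B_rel[OF inv], of ?G] by (simp add: frag_extend_minus)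
  next
    case (eng h1 h2)
    then show ?case using generate.eng[of _ ?G] by (fastforce simp: frag_extend_add)
  qed
  have BF: "?B (?F z) = z" if "z \<in> carrier ?G" for z
  proof -
    have "?F z = frag_extend (frag_of \<circ> (\<lambda>(x, y). (x, \<phi> y))) z"
      by (rule frag_extend_eq) auto
    then have "?B (?F z) = frag_extend ((\<lambda>(x, y). frag_of (x, \<psi> y)) \<circ> (\<lambda>(x, y). (x, \<phi> y))) z"
      by (simp add: frag_extend_compose)
    also have "\<dots> = frag_extend frag_of z"
      by (rule frag_extend_eq) (use that left_inverse in auto)
    finally show ?thesis by (simp add: frag_expansion[symmetric])
  qed
  have coset: "K #>\<^bsub>free_Abelian_group V\<^esub> z = {h + z | h. h \<in> K}" for K V and z :: "'q \<Rightarrow>\<^sub>0 int"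
    by (auto simp: r_coset_def)
  obtain z1 where z1: "z1 \<in> carrier ?G" "C1 = ?K #>\<^bsub>?G\<^esub> z1"
    using C(1) by (auto simp: tensor_product_def FactGroup_def RCOSETS_def)
  obtain z2 where z2: "z2 \<in> carrier ?G" "C2 = ?K #>\<^bsub>?G\<^esub> z2"
    using C(2) by (auto simp: tensor_product_def FactGroup_def RCOSETS_def)
  have "0 \<in> ?K'" unfolding tensor_kernel_def using generate.one[of ?G'] by simp
  then have "?F z1 \<in> ?K' #>\<^bsub>?G'\<^esub> ?F z1" unfolding coset by force
  moreover have "z1 \<in> C1" unfolding z1 coset using K0 by force
  ultimately have "?F z1 \<in> tensor_map S M N' \<phi> C1" unfolding tensor_map_def by blast
  then obtain z h where z: "z \<in> C2" "h \<in> ?K'" "?F z1 = h + ?F z"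
    unfolding eq unfolding tensor_map_def coset by blast
  obtain h2 where h2: "h2 \<in> ?K" "z = h2 + z2" using z(1) unfolding z2 coset by blast
  have zG: "z \<in> carrier ?G"
    using h2 z2(1) subgroup.mem_carrier[OF sub h2(1)] keys_add[of h2 z2] by auto
  define w where "w = ?B h + h2"
  have w: "w \<in> ?K" unfolding w_def by (intro Kadd B z h2)
  have "?B (?F z1) = ?B h + ?B (?F z)" unfolding z(3) by (rule frag_extend_add)
  then have "z1 = ?B h + z" unfolding BF[OF z1(1)] BF[OF zG] .
  then have z1w: "z1 = w + z2" by (simp add: h2(2) w_def add.assoc)
  show "C1 = C2"
    unfolding z1 z2 coset
  proof (intro equalityI subsetI)
    fix y assume "y \<in> {h + z1 | h. h \<in> ?K}"
    then obtain h where "h \<in> ?K" "y = h + z1" by blast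
    then show "y \<in> {h + z2 | h. h \<in> ?K}"
      using Kadd[OF _ w] by (auto simp: z1w add.assoc[symmetric])
  next
    fix y assume "y \<in> {h + z2 | h. h \<in> ?K}"
    then obtain h where "h \<in> ?K" "y = h + z2" by blast
    moreover have "h + z2 = (h + - w) + z1" by (simp add: z1w)
    ultimately show "y \<in> {h + z1 | h. h \<in> ?K}" using Kadd Kminus[OF w] by blast
  qed
qed

text \<open>Linearity over \<open>p\<close>-th powers gives
  \<open>\<psi> (s ^ p) = s * \<psi> 1\<close>, so being \<open>1\<close> at \<open>1\<close>
  already makes \<open>\<psi>\<close> a left inverse.\<close>

lemma pure_frobenius_if_split:
  fixes S :: "'s ring"
  assumes "cring S"
    and psi: "\<And>y. y \<in> carrier S \<Longrightarrow> \<psi> y \<in> carrier S"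
      "\<And>y y'. y \<in> carrier S \<Longrightarrow> y' \<in> carrier S \<Longrightarrow> \<psi> (y \<oplus>\<^bsub>S\<^esub> y') = \<psi> y \<oplus>\<^bsub>S\<^esub> \<psi> y'"
      "\<And>s y. s \<in> carrier S \<Longrightarrow> y \<in> carrier S \<Longrightarrow> \<psi> ((s [^]\<^bsub>S\<^esub> p) \<otimes>\<^bsub>S\<^esub> y) = s \<otimes>\<^bsub>S\<^esub> \<psi> y"
      "\<psi> \<one>\<^bsub>S\<^esub> = \<one>\<^bsub>S\<^esub>"
  shows "pure_map TYPE('m) S (regular_module S) (frobenius_module p S) (\<lambda>x. x [^]\<^bsub>S\<^esub> (p::nat))"
proof -
  interpret cring S by fact
  have "\<psi> (s [^]\<^bsub>S\<^esub> p) = s" if "s \<in> carrier S" for s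
    using psi(3)[OF that one_closed] psi(4) that by simp
  then show ?thesis
    by (intro pure_map_if_split[where \<psi> = \<psi>])
      (auto simp: regular_module_def frobenius_module_def psi)
qed

section \<open>Rings given by a subring of a commutative ring type\<close>

text \<open>The operations are those of the type, so arithmetic, sums and determinants of the type
  class can be used, with closure of the carrier as the only extra obligation.\<close>

locale typed_cring =
  fixes R :: "'r::comm_ring_1 ring"
  assumes ops [simp]: "monoid.mult R = (*)" "one R = 1" "ring.zero R = 0" "add R = (+)"
    and one_carrier: "1 \<in> carrier R"
    and add_carrier: "x \<in> carrier R \<Longrightarrow> y \<in> carrier R \<Longrightarrow> x + y \<in> carrier R"
    and minus_carrier: "x \<in> carrier R \<Longrightarrow> - x \<in> carrier R"
    and mult_carrier: "x \<in> carrier R \<Longrightarrow> y \<in> carrier R \<Longrightarrow> x * y \<in> carrier R"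
begin

lemma zero_carrier: "0 \<in> carrier R"
  using add_carrier[OF one_carrier minus_carrier[OF one_carrier]] by simp

lemma diff_carrier: "x \<in> carrier R \<Longrightarrow> y \<in> carrier R \<Longrightarrow> x - y \<in> carrier R"
  using add_carrier minus_carrier by fastforce

lemma power_carrier: "x \<in> carrier R \<Longrightarrow> x ^ n \<in> carrier R"
  by (induction n) (auto intro: one_carrier mult_carrier)

lemma sum_carrier: "(\<And>i. i \<in> E \<Longrightarrow> f i \<in> carrier R) \<Longrightarrow> sum f E \<in> carrier R"
  by (induction E rule: infinite_finite_induct) (auto intro: zero_carrier add_carrier)

lemma prod_carrier: "(\<And>i. i \<in> E \<Longrightarrow> f i \<in> carrier R) \<Longrightarrow> prod f E \<in> carrier R"
  by (induction E rule: infinite_finite_induct) (auto intro: one_carrier mult_carrier)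

lemmas carrier_intros = zero_carrier one_carrier add_carrier minus_carrier mult_carrier
  diff_carrier power_carrier sum_carrier prod_carrier

lemma det_carrier:
  assumes "A \<in> carrier_mat n n" "\<And>i j. i < n \<Longrightarrow> j < n \<Longrightarrow> A $$ (i, j) \<in> carrier R"
  shows "det A \<in> carrier R"
  unfolding det_def'[OF assms(1)]
proof (rule sum_carrier)
  fix q assume "q \<in> {q. q permutes {0..<n}}"
  then have q: "q i < n" if "i < n" for i using permutes_in_image[of q "{0..<n}" i] that by simp
  have "(\<Prod>i = 0..<n. A $$ (i, q i)) \<in> carrier R"
    by (intro prod_carrier assms(2)) (use q in auto)
  then show "signof q * (\<Prod>i = 0..<n. A $$ (i, q i)) \<in> carrier R"
    by (cases "evenperm q") (auto simp: sign_def intro: minus_carrier)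
qed

lemma is_cring: "cring R"
proof (rule cringI)
  show "abelian_group R"
  proof (rule abelian_groupI)
    show "\<exists>y\<in>carrier R. y \<oplus>\<^bsub>R\<^esub> x = \<zero>\<^bsub>R\<^esub>" if "x \<in> carrier R" for x
      using that by (intro bexI[of _ "- x"]) (auto intro: carrier_intros)
  qed (auto intro: carrier_intros simp: algebra_simps)
  show "comm_monoid R"
    by (rule comm_monoidI) (auto intro: carrier_intros simp: algebra_simps)
qed (auto simp: algebra_simps)

sublocale cring R by (rule is_cring)

lemma a_inv_eq: "x \<in> carrier R \<Longrightarrow> \<ominus>\<^bsub>R\<^esub> x = - x"
  by (rule sum_zero_eq_neg[symmetric]) (auto intro: carrier_intros)

lemma finsum_eq: "(\<And>i. i \<in> E \<Longrightarrow> f i \<in> carrier R) \<Longrightarrow> finite E \<Longrightarrow> finsum R f E = sum f E"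
  by (induction E rule: infinite_finite_induct) (auto simp: Pi_def)

lemma ideal_iff:
  "ideal I R \<longleftrightarrow> I \<subseteq> carrier R \<and> 0 \<in> I \<and> (\<forall>x\<in>I. \<forall>y\<in>I. x + y \<in> I) \<and> (\<forall>a\<in>carrier R. \<forall>x\<in>I. a * x \<in> I)"
  (is "_ \<longleftrightarrow> ?rhs")
proof
  assume "ideal I R"
  then interpret ideal I R .
  show ?rhs
    using a_subset I_l_closed additive_subgroup.zero_closed[OF additive_subgroup_axioms]
      additive_subgroup.a_closed[OF additive_subgroup_axioms] by auto
next
  assume r: ?rhs
  show "ideal I R"
  proof (rule idealI)
    show "subgroup I (add_monoid R)"
    proof (rule add.subgroupI)
      fix a assume "a \<in> I"
      then have "- 1 * a \<in> I" using r minus_carrier[OF one_carrier] by blast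
      then show "\<ominus>\<^bsub>R\<^esub> a \<in> I" using a_inv_eq[of a] \<open>a \<in> I\<close> r by auto
    qed (use r in auto)
  next
    fix a x assume "a \<in> I" "x \<in> carrier R"
    then have "x * a \<in> I" using r by blast
    then show "x \<otimes>\<^bsub>R\<^esub> a \<in> I" "a \<otimes>\<^bsub>R\<^esub> x \<in> I" by (simp_all add: mult.commute)
  qed (rule ring_axioms)
qed

lemma idealI':
  assumes "I \<subseteq> carrier R" "0 \<in> I" "\<And>x y. x \<in> I \<Longrightarrow> y \<in> I \<Longrightarrow> x + y \<in> I"
    "\<And>a x. a \<in> carrier R \<Longrightarrow> x \<in> I \<Longrightarrow> a * x \<in> I"
  shows "ideal I R"
  using assms by (auto simp: ideal_iff)

lemma idealD:
  assumes "ideal I R"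
  shows "x \<in> I \<Longrightarrow> x \<in> carrier R" "0 \<in> I" "x \<in> I \<Longrightarrow> y \<in> I \<Longrightarrow> x + y \<in> I"
    "a \<in> carrier R \<Longrightarrow> x \<in> I \<Longrightarrow> a * x \<in> I" "a \<in> carrier R \<Longrightarrow> x \<in> I \<Longrightarrow> x * a \<in> I"
    "x \<in> I \<Longrightarrow> - x \<in> I" "x \<in> I \<Longrightarrow> y \<in> I \<Longrightarrow> x - y \<in> I"
proof -
  have I: "I \<subseteq> carrier R" "0 \<in> I" "\<And>x y. x \<in> I \<Longrightarrow> y \<in> I \<Longrightarrow> x + y \<in> I"
    "\<And>a x. a \<in> carrier R \<Longrightarrow> x \<in> I \<Longrightarrow> a * x \<in> I" using assms by (auto simp: ideal_iff)
  have neg: "- x \<in> I" if "x \<in> I" for x using I(4)[OF minus_carrier[OF one_carrier] that] by simp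
  show "x \<in> I \<Longrightarrow> x \<in> carrier R" "0 \<in> I" "x \<in> I \<Longrightarrow> y \<in> I \<Longrightarrow> x + y \<in> I"
    "a \<in> carrier R \<Longrightarrow> x \<in> I \<Longrightarrow> a * x \<in> I" "a \<in> carrier R \<Longrightarrow> x \<in> I \<Longrightarrow> x * a \<in> I" "x \<in> I \<Longrightarrow> - x \<in> I"
    using I neg by (auto simp: mult.commute)
  show "x - y \<in> I" if "x \<in> I" "y \<in> I" using I(3)[OF that(1) neg[OF that(2)]] by simp
qed

lemma ideal_sum: "ideal I R \<Longrightarrow> (\<And>i. i \<in> E \<Longrightarrow> f i \<in> I) \<Longrightarrow> sum f E \<in> I"
  by (induction E rule: infinite_finite_induct) (auto intro: idealD)

section \<open>Powers of ideals\<close>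

abbreviation ideal_power :: "'r set \<Rightarrow> nat \<Rightarrow> 'r set" where
  "ideal_power I n \<equiv> I [^]\<^bsub>ideals_set R\<^esub> n"

lemma ideals_set_simps [simp]:
  "\<one>\<^bsub>ideals_set R\<^esub> = carrier R" "A \<otimes>\<^bsub>ideals_set R\<^esub> B = ideal_prod R A B"
  by (simp_all add: ideals_set_def)

lemma ideal_power_0: "ideal_power I 0 = carrier R"
  by (simp add: nat_pow_def ideals_set_def)

lemma ideal_power_Suc: "ideal_power I (Suc n) = ideal_prod R (ideal_power I n) I"
  by (simp add: nat_pow_def ideals_set_def)

lemma ideal_power_ideal: "ideal I R \<Longrightarrow> ideal (ideal_power I n) R"
  by (induction n) (auto intro: oneideal ideal_prod_is_ideal)

lemma ideal_power_Suc_mult: "x \<in> ideal_power I n \<Longrightarrow> y \<in> I \<Longrightarrow> x * y \<in> ideal_power I (Suc n)"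
  unfolding ideal_power_Suc using ideal_prod.prod[of x "ideal_power I n" y I R] by simp

text \<open>The induction principle for powers: it suffices to treat a product with one more element
  of \<open>I\<close>, since sums are absorbed by the ideals \<open>K n\<close>.\<close>

lemma ideal_power_least:
  assumes I: "ideal I R" and K: "\<And>n. ideal (K n) R" "K 0 = carrier R"
    and step: "\<And>n x y. x \<in> K n \<Longrightarrow> y \<in> I \<Longrightarrow> x * y \<in> K (Suc n)"
  shows "ideal_power I n \<subseteq> K n"
proof (induction n)
  case 0
  then show ?case by (simp add: ideal_power_0 K)
next
  case (Suc n)
  show ?case
  proof
    fix x assume "x \<in> ideal_power I (Suc n)"
    then show "x \<in> K (Suc n)"
      unfolding ideal_power_Suc
    proof (induction rule: ideal_prod.induct)
      case (prod i j)
      then show ?case using step[of i n j] Suc.IH by auto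
    next
      case (sum s1 s2)
      then show ?case using idealD(3)[OF K(1)] by simp
    qed
  qed
qed

text \<open>The colon ideals \<open>K n\<close> of \<open>ideal_power I (m + n)\<close> by
  \<open>x\<close> satisfy the hypotheses of \<open>ideal_power_least\<close>.\<close>

lemma ideal_power_mult:
  assumes I: "ideal I R" and x: "x \<in> ideal_power I m" and y: "y \<in> ideal_power I n"
  shows "x * y \<in> ideal_power I (m + n)"
proof -
  define K where "K n = {y \<in> carrier R. x * y \<in> ideal_power I (m + n)}" for n
  note id = idealD[OF ideal_power_ideal[OF I]]
  have xR: "x \<in> carrier R" by (rule id(1)[OF x])
  have "ideal_power I n \<subseteq> K n"
  proof (rule ideal_power_least[OF I])
    show "ideal (K n) R" for n
      by (rule idealI') (auto simp: K_def distrib_left mult.left_commute intro: carrier_intros id)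
    show "K 0 = carrier R" using id(5)[OF _ x] by (auto simp: K_def)
    show "z * w \<in> K (Suc n)" if "z \<in> K n" "w \<in> I" for n z w
      using that ideal_power_Suc_mult[of "x * z" I "m + n" w] idealD(1)[OF I]
      by (auto simp: K_def mult.assoc intro: carrier_intros)
  qed
  then show ?thesis using y by (auto simp: K_def)
qed

lemma ideal_power_antimono:
  assumes I: "ideal I R" and "m \<le> n"
  shows "ideal_power I n \<subseteq> ideal_power I m"
  using assms(2)
proof (induction n rule: dec_induct)
  case (step n)
  have "ideal_power I (Suc n) \<subseteq> ideal_power I n"
    unfolding ideal_power_Suc
    using ideal_prod_inter[OF ideal_power_ideal[OF I, of n] I] by blast
  then show ?case using step.IH by blast
qed simp

lemma ideal_power_mem:
  assumes I: "ideal I R" and "x \<in> I"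
  shows "x ^ n \<in> ideal_power I n"
proof (induction n)
  case 0
  then show ?case by (simp add: ideal_power_0 one_carrier)
next
  case (Suc n)
  then show ?case using ideal_power_Suc_mult[OF Suc assms(2)] by (simp add: mult.commute)
qed

lemma ideal_power_1: "ideal I R \<Longrightarrow> x \<in> I \<Longrightarrow> x \<in> ideal_power I 1"
  using ideal_power_mem[of I x 1] by simp

lemma ideal_power_prod:
  assumes I: "ideal I R" and "finite E" "\<And>e. e \<in> E \<Longrightarrow> f e \<in> ideal_power I (n e)"
  shows "prod f E \<in> ideal_power I (sum n E)"
  using assms(2,3)
  by (induction E rule: finite_induct)
    (auto simp: ideal_power_0 one_carrier intro!: ideal_power_mult[OF I])

section \<open>Primes and symbolic powers\<close>

lemma primeidealD:
  assumes "primeideal P R"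
  shows "ideal P R" "1 \<notin> P"
    "x \<in> carrier R \<Longrightarrow> y \<in> carrier R \<Longrightarrow> x * y \<in> P \<Longrightarrow> x \<in> P \<or> y \<in> P"
proof -
  interpret primeideal P R by fact
  show I: "ideal P R" by (rule ideal_axioms)
  show "1 \<notin> P" using one_imp_carrier I_notcarr by auto
  show "x \<in> carrier R \<Longrightarrow> y \<in> carrier R \<Longrightarrow> x * y \<in> P \<Longrightarrow> x \<in> P \<or> y \<in> P"
    using I_prime[of x y] by simp
qed

lemma prime_power_notin:
  assumes "primeideal P R" "x \<in> carrier R" "x \<notin> P"
  shows "x ^ n \<notin> P"
  by (induction n) (use assms primeidealD[OF assms(1)] power_carrier in auto)

lemma prime_prod_notin:
  assumes "primeideal P R" "finite E" "\<And>e. e \<in> E \<Longrightarrow> f e \<in> carrier R - P"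
  shows "prod f E \<notin> P"
  using assms(2,3)
proof (induction E rule: finite_induct)
  case (insert e E)
  then show ?case using primeidealD(3)[OF assms(1), of "f e" "prod f E"] by (auto intro: prod_carrier)
qed (use primeidealD[OF assms(1)] in auto)

definition mult_closed :: "'r set \<Rightarrow> bool" where
  "mult_closed M \<longleftrightarrow> M \<subseteq> carrier R \<and> 1 \<in> M \<and> (\<forall>x\<in>M. \<forall>y\<in>M. x * y \<in> M)"

text \<open>By Zorn there is an ideal maximal among those containing \<open>I\<close> and disjoint
  from \<open>M\<close>, and such an ideal is prime.\<close>

lemma prime_avoiding_exists:
  assumes I: "ideal I R" and M: "mult_closed M" "I \<inter> M = {}"
  shows "\<exists>P. primeideal P R \<and> I \<subseteq> P \<and> P \<inter> M = {}"
proof -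
  define A where "A = {K. ideal K R \<and> I \<subseteq> K \<and> K \<inter> M = {}}"
  have "\<exists>P\<in>A. \<forall>K\<in>A. P \<subseteq> K \<longrightarrow> K = P"
  proof (rule subset_Zorn_nonempty)
    show "A \<noteq> {}" using assms by (auto simp: A_def)
    fix C assume C: "C \<noteq> {}" "subset.chain A C"
    have CA: "K \<in> A" if "K \<in> C" for K using C(2) that by (auto simp: subset.chain_def)
    have chain: "K \<subseteq> K' \<or> K' \<subseteq> K" if "K \<in> C" "K' \<in> C" for K K'
      using C(2) that by (auto simp: subset.chain_def)
    have id: "ideal K R" if "K \<in> C" for K using CA[OF that] by (auto simp: A_def)
    have "ideal (\<Union>C) R"
    proof (rule idealI')
      show "\<Union>C \<subseteq> carrier R" using idealD(1)[OF id] by blast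
      show "0 \<in> \<Union>C" using C(1) idealD(2)[OF id] by blast
      fix x y assume "x \<in> \<Union>C" "y \<in> \<Union>C"
      then obtain K K' where K: "K \<in> C" "K' \<in> C" "x \<in> K" "y \<in> K'" by blast
      then show "x + y \<in> \<Union>C"
        using chain[OF K(1,2)] idealD(3)[OF id[OF K(1)]] idealD(3)[OF id[OF K(2)]] by blast
    next
      fix a x assume "a \<in> carrier R" "x \<in> \<Union>C"
      then show "a * x \<in> \<Union>C" using idealD(4)[OF id] by blast
    qed
    then show "\<Union>C \<in> A" using C(1) CA by (fastforce simp: A_def)
  qed
  then obtain P where P: "ideal P R" "I \<subseteq> P" "P \<inter> M = {}"
    and max: "\<And>K. ideal K R \<Longrightarrow> P \<subseteq> K \<Longrightarrow> K \<inter> M = {} \<Longrightarrow> K = P" by (auto simp: A_def)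
  have ext: "\<exists>q\<in>P. \<exists>r\<in>carrier R. q + r * x \<in> M" if x: "x \<in> carrier R" "x \<notin> P" for x
  proof (rule ccontr)
    assume no: "\<not> ?thesis"
    define K where "K = {q + r * x | q r. q \<in> P \<and> r \<in> carrier R}"
    have "ideal K R"
    proof (rule idealI')
      show "K \<subseteq> carrier R" using idealD(1)[OF P(1)] x by (auto simp: K_def intro!: carrier_intros)
      have "0 = 0 + 0 * x" by simp
      then show "0 \<in> K" unfolding K_def using idealD(2)[OF P(1)] zero_carrier by blast
      fix y z assume "y \<in> K" "z \<in> K"
      then obtain q r q' r' where h: "y = q + r * x" "z = q' + r' * x" "q \<in> P" "q' \<in> P" "r \<in> carrier R" "r' \<in> carrier R"
        by (auto simp: K_def)
      then have "y + z = (q + q') + (r + r') * x" by (simp add: algebra_simps)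
      then show "y + z \<in> K" unfolding K_def using h idealD(3)[OF P(1)] add_carrier by blast
    next
      fix a y assume a: "a \<in> carrier R" "y \<in> K"
      then obtain q r where h: "y = q + r * x" "q \<in> P" "r \<in> carrier R" by (auto simp: K_def)
      then have "a * y = a * q + (a * r) * x" by (simp add: algebra_simps)
      then show "a * y \<in> K" unfolding K_def using h a idealD(4)[OF P(1)] mult_carrier by blast
    qed
    moreover have "P \<subseteq> K"
    proof
      fix q assume "q \<in> P"
      moreover have "q = q + 0 * x" by simp
      ultimately show "q \<in> K" unfolding K_def using zero_carrier by blast
    qed
    moreover have "K \<inter> M = {}" using no by (auto simp: K_def)
    ultimately have "K = P" by (rule max)
    moreover have "x \<in> K"
    proof -
      have "x = 0 + 1 * x" by simp
      then show ?thesis unfolding K_def using idealD(2)[OF P(1)] one_carrier by blast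
    qed
    ultimately show False using x by blast
  qed
  have "primeideal P R"
  proof (rule primeidealI[OF P(1) is_cring])
    have "1 \<in> M" using M(1) by (simp add: mult_closed_def)
    then show "carrier R \<noteq> P" using P(3) one_carrier by blast
    fix x y assume xy: "x \<in> carrier R" "y \<in> carrier R" "x \<otimes>\<^bsub>R\<^esub> y \<in> P"
    show "x \<in> P \<or> y \<in> P"
    proof (rule ccontr)
      assume no: "\<not> ?thesis"
      obtain q r q' r' where h: "q \<in> P" "r \<in> carrier R" "q + r * x \<in> M" "q' \<in> P" "r' \<in> carrier R" "q' + r' * y \<in> M"
        using ext[of x] ext[of y] xy no by blast
      have "(q + r * x) * (q' + r' * y) = q * (q' + r' * y) + (r * x) * q' + (r * r') * (x * y)"
        by (simp add: algebra_simps)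
      also have "\<dots> \<in> P"
      proof (intro idealD(3)[OF P(1)])
        show "q * (q' + r' * y) \<in> P"
          by (rule idealD(5)[OF P(1)]) (use h xy idealD(1)[OF P(1)] in \<open>auto intro!: carrier_intros\<close>)
        show "r * x * q' \<in> P" by (rule idealD(4)[OF P(1)]) (use h xy in \<open>auto intro!: carrier_intros\<close>)
        show "r * r' * (x * y) \<in> P" by (rule idealD(4)[OF P(1)]) (use h xy in \<open>auto intro!: carrier_intros\<close>)
      qed
      finally show False using h(3,6) M(1) P(3) by (auto simp: mult_closed_def)
    qed
  qed
  then show ?thesis using P by blast
qed

text \<open>Zorn is applied to the multiplicative sets disjoint from \<open>I\<close>. A maximal one
  equals the complement of any prime above \<open>I\<close> that avoids it, which leaves no room for
  a smaller prime.\<close>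

lemma minimal_prime_exists:
  assumes I: "ideal I R" and M: "1 \<notin> I"
  shows "minimal_primes R I \<noteq> {}"
proof -
  define A where "A = {M. mult_closed M \<and> I \<inter> M = {}}"
  have "\<exists>M\<in>A. \<forall>N\<in>A. M \<subseteq> N \<longrightarrow> N = M"
  proof (rule subset_Zorn_nonempty)
    have "mult_closed {1}" by (simp add: mult_closed_def one_carrier)
    then show "A \<noteq> {}" using M by (auto simp: A_def)
    fix C assume C: "C \<noteq> {}" "subset.chain A C"
    have CA: "K \<in> A" if "K \<in> C" for K using C(2) that by (auto simp: subset.chain_def)
    have chain: "K \<subseteq> K' \<or> K' \<subseteq> K" if "K \<in> C" "K' \<in> C" for K K'
      using C(2) that by (auto simp: subset.chain_def)
    have mc: "mult_closed K" if "K \<in> C" for K using CA[OF that] by (auto simp: A_def)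
    have "mult_closed (\<Union>C)"
      unfolding mult_closed_def
    proof (intro conjI ballI)
      show "\<Union>C \<subseteq> carrier R" using mc by (auto simp: mult_closed_def)
      show "1 \<in> \<Union>C" using mc C(1) by (auto simp: mult_closed_def)
      fix x y assume "x \<in> \<Union>C" "y \<in> \<Union>C"
      then obtain K K' where K: "K \<in> C" "K' \<in> C" "x \<in> K" "y \<in> K'" by blast
      have closed: "x * y \<in> N" if "N \<in> C" "x \<in> N" "y \<in> N" for N
        using mc[OF that(1)] that unfolding mult_closed_def by simp
      from chain[OF K(1,2)] show "x * y \<in> \<Union>C"
      proof
        assume "K \<subseteq> K'"
        then show ?thesis using closed[of K'] K by (intro UnionI[of K']) auto
      next
        assume "K' \<subseteq> K"
        then show ?thesis using closed[of K] K by (intro UnionI[of K]) auto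
      qed
    qed
    then show "\<Union>C \<in> A" using CA by (auto simp: A_def)
  qed
  then obtain M where M: "mult_closed M" "I \<inter> M = {}"
    and max: "\<And>N. mult_closed N \<Longrightarrow> I \<inter> N = {} \<Longrightarrow> M \<subseteq> N \<Longrightarrow> N = M" by (auto simp: A_def)
  obtain P where P: "primeideal P R" "I \<subseteq> P" "P \<inter> M = {}"
    using prime_avoiding_exists[OF I M] by blast
  have comp: "mult_closed (carrier R - Q)" if "primeideal Q R" for Q
    using primeidealD[OF that] by (auto simp: mult_closed_def intro: carrier_intros)
  have "P \<in> minimal_primes R I"
    unfolding minimal_primes_def
  proof (intro CollectI conjI allI impI)
    fix Q assume Q: "primeideal Q R \<and> I \<subseteq> Q \<and> Q \<subseteq> P"
    have "carrier R - P = M"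
      by (rule max[OF comp[OF P(1)]]) (use P M(1) in \<open>auto simp: mult_closed_def\<close>)
    moreover have "carrier R - Q = M"
      by (rule max[OF comp]) (use Q P M(1) in \<open>auto simp: mult_closed_def\<close>)
    ultimately show "Q = P"
      using idealD(1)[OF primeidealD(1)[OF P(1)]] idealD(1)[OF primeidealD(1), of Q] Q by blast
  qed (use P in auto)
  then show ?thesis by blast
qed

text \<open>In the localization of \<open>R / I\<close> at a minimal prime every element of that
  prime is nilpotent. Otherwise the products \<open>g * x ^ n\<close> would avoid \<open>I\<close>,
  and some prime inside \<open>P\<close> would miss \<open>x\<close>.\<close>

lemma minimal_prime_nilpotent:
  assumes I: "ideal I R" and P: "P \<in> minimal_primes R I" and x: "x \<in> P"
  shows "\<exists>g n. g \<in> carrier R - P \<and> g * x ^ n \<in> I"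
proof (rule ccontr)
  assume no: "\<not> ?thesis"
  have Pp: "primeideal P R" "I \<subseteq> P" using P by (auto simp: minimal_primes_def)
  note pd = primeidealD[OF Pp(1)]
  have xR: "x \<in> carrier R" using idealD(1)[OF pd(1)] x by blast
  define M where "M = {g * x ^ n | g n. g \<in> carrier R - P}"
  have M: "g * x ^ n \<in> M" if "g \<in> carrier R - P" for g n using that by (auto simp: M_def)
  have "mult_closed M"
    unfolding mult_closed_def
  proof (intro conjI ballI)
    show "M \<subseteq> carrier R" using xR by (auto simp: M_def intro!: carrier_intros)
    show "1 \<in> M" using M[of 1 0] one_carrier pd by simp
    fix y z assume "y \<in> M" "z \<in> M"
    then obtain g n g' n' where h: "y = g * x ^ n" "z = g' * x ^ n'" "g \<in> carrier R - P" "g' \<in> carrier R - P"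
      by (auto simp: M_def)
    have "g * g' \<in> carrier R - P" using h pd(3)[of g g'] by (auto intro: carrier_intros)
    from M[OF this, of "n + n'"] show "y * z \<in> M" by (simp add: h power_add algebra_simps)
  qed
  moreover have "I \<inter> M = {}" using no by (auto simp: M_def)
  ultimately obtain Q where Q: "primeideal Q R" "I \<subseteq> Q" "Q \<inter> M = {}"
    using prime_avoiding_exists[OF I] by blast
  have "Q \<subseteq> P"
  proof
    fix y assume y: "y \<in> Q"
    then have "y \<in> carrier R" using idealD(1)[OF primeidealD(1)[OF Q(1)]] by blast
    then show "y \<in> P" using M[of y 0] Q(3) y by auto
  qed
  then have "Q = P" using P Q by (auto simp: minimal_primes_def)
  moreover have "x \<in> M" using M[of 1 1] one_carrier pd by simp
  ultimately show False using x Q(3) by blast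
qed

lemma symbolic_powerD:
  assumes "f \<in> symbolic_power R I n"
  shows "f \<in> carrier R"
    "P \<in> minimal_primes R I \<Longrightarrow> \<exists>s. s \<in> carrier R \<and> s \<notin> P \<and> s * f \<in> ideal_power I n"
  using assms unfolding symbolic_power_def by auto

lemma symbolic_powerI:
  assumes "f \<in> carrier R"
    "\<And>P. P \<in> minimal_primes R I \<Longrightarrow> \<exists>s. s \<in> carrier R \<and> s \<notin> P \<and> s * f \<in> ideal_power I n"
  shows "f \<in> symbolic_power R I n"
  using assms unfolding symbolic_power_def by auto

lemma symbolic_power_mult:
  assumes I: "ideal I R" and f: "f \<in> symbolic_power R I m" and g: "g \<in> symbolic_power R I n"
  shows "f * g \<in> symbolic_power R I (m + n)"
proof (rule symbolic_powerI)
  show "f * g \<in> carrier R" using f g symbolic_powerD(1) mult_carrier by blast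
  fix P assume P: "P \<in> minimal_primes R I"
  then have Pp: "primeideal P R" by (auto simp: minimal_primes_def)
  obtain s where s: "s \<in> carrier R" "s \<notin> P" "s * f \<in> ideal_power I m" using symbolic_powerD(2)[OF f P] by blast
  obtain s' where s': "s' \<in> carrier R" "s' \<notin> P" "s' * g \<in> ideal_power I n" using symbolic_powerD(2)[OF g P] by blast
  have "(s * f) * (s' * g) \<in> ideal_power I (m + n)" by (rule ideal_power_mult[OF I s(3) s'(3)])
  moreover have "(s * f) * (s' * g) = s * s' * (f * g)" by (simp add: algebra_simps)
  ultimately show "\<exists>s. s \<in> carrier R \<and> s \<notin> P \<and> s * (f * g) \<in> ideal_power I (m + n)"
    using s s' primeidealD(3)[OF Pp s(1) s'(1)] by (intro exI[of _ "s * s'"]) (auto intro: carrier_intros)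
qed

lemma symbolic_power_ideal:
  assumes I: "ideal I R"
  shows "ideal (symbolic_power R I n) R"
proof (rule idealI')
  note id = idealD[OF ideal_power_ideal[OF I, of n]]
  show "symbolic_power R I n \<subseteq> carrier R" using symbolic_powerD(1) by blast
  show "0 \<in> symbolic_power R I n"
  proof (rule symbolic_powerI[OF zero_carrier])
    fix P assume "P \<in> minimal_primes R I"
    then have "1 \<notin> P" using primeidealD(2) by (auto simp: minimal_primes_def)
    then show "\<exists>s. s \<in> carrier R \<and> s \<notin> P \<and> s * 0 \<in> ideal_power I n"
      using id(2) one_carrier by (intro exI[of _ 1]) auto
  qed
  fix f g assume f: "f \<in> symbolic_power R I n" and g: "g \<in> symbolic_power R I n"
  show "f + g \<in> symbolic_power R I n"
  proof (rule symbolic_powerI)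
    show "f + g \<in> carrier R" using f g symbolic_powerD(1) add_carrier by blast
    fix P assume P: "P \<in> minimal_primes R I"
    then have Pp: "primeideal P R" by (auto simp: minimal_primes_def)
    obtain s where s: "s \<in> carrier R" "s \<notin> P" "s * f \<in> ideal_power I n" using symbolic_powerD(2)[OF f P] by blast
    obtain s' where s': "s' \<in> carrier R" "s' \<notin> P" "s' * g \<in> ideal_power I n" using symbolic_powerD(2)[OF g P] by blast
    have "s' * (s * f) + s * (s' * g) \<in> ideal_power I n"
      by (rule id(3)[OF id(4)[OF s'(1) s(3)] id(4)[OF s(1) s'(3)]])
    moreover have "s' * (s * f) + s * (s' * g) = s * s' * (f + g)" by (simp add: algebra_simps)
    ultimately show "\<exists>s. s \<in> carrier R \<and> s \<notin> P \<and> s * (f + g) \<in> ideal_power I n"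
      using s s' primeidealD(3)[OF Pp s(1) s'(1)] by (intro exI[of _ "s * s'"]) (auto intro: carrier_intros)
  qed
next
  note id = idealD[OF ideal_power_ideal[OF I, of n]]
  fix a f assume a: "a \<in> carrier R" and f: "f \<in> symbolic_power R I n"
  show "a * f \<in> symbolic_power R I n"
  proof (rule symbolic_powerI)
    show "a * f \<in> carrier R" using a f symbolic_powerD(1) mult_carrier by blast
    fix P assume P: "P \<in> minimal_primes R I"
    obtain s where s: "s \<in> carrier R" "s \<notin> P" "s * f \<in> ideal_power I n" using symbolic_powerD(2)[OF f P] by blast
    have "a * (s * f) \<in> ideal_power I n" by (rule id(4)[OF a s(3)])
    then show "\<exists>s. s \<in> carrier R \<and> s \<notin> P \<and> s * (a * f) \<in> ideal_power I n"
      using s by (intro exI[of _ s]) (simp add: mult.left_commute)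
  qed
qed

lemma symbolic_power_0: "symbolic_power R I 0 = carrier R"
proof
  show "carrier R \<subseteq> symbolic_power R I 0"
  proof
    fix f assume f: "f \<in> carrier R"
    show "f \<in> symbolic_power R I 0"
    proof (rule symbolic_powerI[OF f])
      fix P assume "P \<in> minimal_primes R I"
      then have "1 \<notin> P" using primeidealD(2) by (auto simp: minimal_primes_def)
      then show "\<exists>s. s \<in> carrier R \<and> s \<notin> P \<and> s * f \<in> ideal_power I 0"
        using f one_carrier by (intro exI[of _ 1]) (auto simp: ideal_power_0)
    qed
  qed
qed (use symbolic_powerD in blast)

lemma symbolic_power_antimono:
  assumes I: "ideal I R" and "m \<le> n"
  shows "symbolic_power R I n \<subseteq> symbolic_power R I m"
proof
  fix f assume f: "f \<in> symbolic_power R I n"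
  show "f \<in> symbolic_power R I m"
    by (rule symbolic_powerI) (use symbolic_powerD[OF f] ideal_power_antimono[OF assms] in blast)+
qed

lemma one_notin_symbolic_power:
  assumes I: "ideal I R" and "1 \<notin> I"
  shows "1 \<notin> symbolic_power R I (Suc 0)"
proof
  assume h: "1 \<in> symbolic_power R I (Suc 0)"
  obtain P where P: "P \<in> minimal_primes R I" using minimal_prime_exists[OF assms] by blast
  then obtain s where s: "s \<in> carrier R" "s \<notin> P" "s * 1 \<in> ideal_power I (Suc 0)"
    using symbolic_powerD(2)[OF h] by blast
  have "ideal_power I (Suc 0) \<subseteq> I"
    unfolding ideal_power_Suc using ideal_prod_inter[OF ideal_power_ideal[OF I, of 0] I] by blast
  then show False using s P by (auto simp: minimal_primes_def)
qed

end

section \<open>The ladder ring\<close>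

lemma keys_indet: "Poly_Mapping.keys (indet x :: 'a::comm_ring_1 matpoly) = {Poly_Mapping.single x 1}"
  by (simp add: indet_def)

lemma ladder_ring_carrier:
  "f \<in> carrier (ladder_ring L) \<longleftrightarrow> (\<forall>m\<in>Poly_Mapping.keys f. Poly_Mapping.keys m \<subseteq> L)"
  by (simp add: ladder_ring_def)

lemma typed_cring_ladder_ring: "typed_cring (ladder_ring L :: 'k::field matpoly ring)"
proof
  fix f g :: "'k matpoly"
  assume f: "f \<in> carrier (ladder_ring L)" and g: "g \<in> carrier (ladder_ring L)"
  show "f + g \<in> carrier (ladder_ring L)"
    using f g keys_add[of f g] unfolding ladder_ring_carrier by blast
  show "f * g \<in> carrier (ladder_ring L)"
    unfolding ladder_ring_carrier
  proof
    fix m assume "m \<in> Poly_Mapping.keys (f * g)"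
    then obtain a b where ab: "m = a + b" "a \<in> Poly_Mapping.keys f" "b \<in> Poly_Mapping.keys g"
      using keys_mult[of f g] by blast
    then show "Poly_Mapping.keys m \<subseteq> L"
      using f g keys_add[of a b] unfolding ladder_ring_carrier by blast
  qed
next
  fix f :: "'k matpoly"
  assume "f \<in> carrier (ladder_ring L)"
  then show "- f \<in> carrier (ladder_ring L)"
    unfolding ladder_ring_carrier by (simp add: in_keys_iff)
qed (auto simp: ladder_ring_def)

lemma indet_carrier: "x \<in> L \<Longrightarrow> indet x \<in> carrier (ladder_ring L :: 'k::field matpoly ring)"
  by (simp add: ladder_ring_carrier keys_indet)

section \<open>Monomials\<close>

lemma poly_mapping_sum_monomials:
  "f = (\<Sum>m\<in>Poly_Mapping.keys f. Poly_Mapping.single m (Poly_Mapping.lookup f m))"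
proof (rule poly_mapping_eqI)
  fix k
  have "Poly_Mapping.lookup (\<Sum>m\<in>Poly_Mapping.keys f. Poly_Mapping.single m (Poly_Mapping.lookup f m)) k =
      (\<Sum>m\<in>Poly_Mapping.keys f. if m = k then Poly_Mapping.lookup f m else 0)"
    by (simp add: lookup_sum lookup_single when_def)
  then show "Poly_Mapping.lookup f k =
      Poly_Mapping.lookup (\<Sum>m\<in>Poly_Mapping.keys f. Poly_Mapping.single m (Poly_Mapping.lookup f m)) k"
    by (simp add: in_keys_iff)
qed

lemma lookup_single_mult:
  fixes b :: "('x \<Rightarrow>\<^sub>0 nat) \<Rightarrow>\<^sub>0 'k::comm_ring_1"
  shows "Poly_Mapping.lookup (Poly_Mapping.single m c * b) (m + k) = c * Poly_Mapping.lookup b k"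
proof -
  have "Poly_Mapping.single m c * b =
      (\<Sum>e\<in>Poly_Mapping.keys b. Poly_Mapping.single (m + e) (c * Poly_Mapping.lookup b e))"
    by (subst poly_mapping_sum_monomials[of b]) (simp add: sum_distrib_left mult_single)
  then have "Poly_Mapping.lookup (Poly_Mapping.single m c * b) (m + k) =
      (\<Sum>e\<in>Poly_Mapping.keys b. if e = k then c * Poly_Mapping.lookup b e else 0)"
    by (simp add: lookup_sum lookup_single when_def)
  then show ?thesis by (simp add: in_keys_iff)
qed

lemma lookup_single_mult_0:
  fixes b :: "('x \<Rightarrow>\<^sub>0 nat) \<Rightarrow>\<^sub>0 'k::comm_ring_1"
  assumes "\<And>k. e \<noteq> m + k"
  shows "Poly_Mapping.lookup (Poly_Mapping.single m c * b) e = 0"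
proof -
  have "e \<notin> Poly_Mapping.keys (Poly_Mapping.single m c * b)"
    using keys_mult[of "Poly_Mapping.single m c" b] assms by (auto split: if_splits)
  then show ?thesis by (simp add: in_keys_iff)
qed

lemma single_power:
  "Poly_Mapping.single m (c :: 'k::comm_ring_1) ^ n = Poly_Mapping.single (\<Sum>i<n. m) (c ^ n)"
  for m :: "'x \<Rightarrow>\<^sub>0 nat"
  by (induction n) (auto simp: mult_single add.commute)

lemma lookup_sum_const: "Poly_Mapping.lookup (\<Sum>i<n. m) x = n * Poly_Mapping.lookup m x"
  for m :: "'x \<Rightarrow>\<^sub>0 nat"
  by (simp add: lookup_sum)

lemma keys_add_nat:
  "Poly_Mapping.keys (a + b) = Poly_Mapping.keys a \<union> Poly_Mapping.keys b" for a b :: "'x \<Rightarrow>\<^sub>0 nat"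
  by (auto simp: in_keys_iff lookup_add)

lemma CHAR_matpoly: "CHAR('x::comm_monoid_add \<Rightarrow>\<^sub>0 'k::comm_ring_1) = CHAR('k)"
proof (rule CHAR_eqI)
  have "of_nat n = (0 :: 'x \<Rightarrow>\<^sub>0 'k) \<longleftrightarrow> of_nat n = (0 :: 'k)" for n
  proof -
    have eq: "of_nat n = (Poly_Mapping.single 0 (of_nat n) :: 'x \<Rightarrow>\<^sub>0 'k)" by simp
    show ?thesis
    proof
      assume "of_nat n = (0 :: 'x \<Rightarrow>\<^sub>0 'k)"
      then have "Poly_Mapping.lookup (Poly_Mapping.single 0 (of_nat n) :: 'x \<Rightarrow>\<^sub>0 'k) 0 = 0" unfolding eq[symmetric] by simp
      then show "of_nat n = (0 :: 'k)" by (simp only: lookup_single_eq)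
    next
      assume "of_nat n = (0 :: 'k)"
      then show "of_nat n = (0 :: 'x \<Rightarrow>\<^sub>0 'k)" unfolding eq by simp
    qed
  qed
  then show "of_nat CHAR('k) = (0 :: 'x \<Rightarrow>\<^sub>0 'k)" "\<And>n. of_nat n = (0 :: 'x \<Rightarrow>\<^sub>0 'k) \<Longrightarrow> CHAR('k) dvd n"
    by (auto simp: of_nat_eq_0_iff_char_dvd)
qed

section \<open>The trace\<close>

definition pth_root :: "nat \<Rightarrow> 'k::field \<Rightarrow> 'k" where
  "pth_root p y = (THE x. x ^ p = y)"

text \<open>The trace picks out the coefficient of the monomial all of whose exponents are \<open>p - 1\<close>, in the
  basis of the polynomial ring over its \<open>p\<close>-th powers given by the monomials with exponents below \<open>p\<close>.\<close>

definition trace_exponent :: "nat \<Rightarrow> 'x set \<Rightarrow> ('x \<Rightarrow>\<^sub>0 nat) \<Rightarrow> 'x \<Rightarrow>\<^sub>0 nat" where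
  "trace_exponent p L n = (\<Sum>x\<in>L. Poly_Mapping.single x (p * Poly_Mapping.lookup n x + (p - 1)))"

definition frob_trace :: "nat \<Rightarrow> 'x set \<Rightarrow> (('x \<Rightarrow>\<^sub>0 nat) \<Rightarrow>\<^sub>0 'k::field) \<Rightarrow> ('x \<Rightarrow>\<^sub>0 nat) \<Rightarrow>\<^sub>0 'k" where
  "frob_trace p L f = Abs_poly_mapping (\<lambda>n. if Poly_Mapping.keys n \<subseteq> L
     then pth_root p (Poly_Mapping.lookup f (trace_exponent p L n)) else 0)"

locale perfect_char =
  fixes p :: nat and L :: "'x set"
  assumes p: "Factorial_Ring.prime p" "CHAR('k::field) = p" and perfect: "\<And>x::'k. \<exists>y. y ^ p = x"
    and finite_L: "finite L"
begin

lemma p_pos: "0 < p"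
  using p(1) by (simp add: prime_gt_0_nat)

lemma pth_power_inj: "x ^ p = y ^ p \<Longrightarrow> x = y" for x y :: 'k
proof -
  assume h: "x ^ p = y ^ p"
  have "((x - y) + y) ^ p = (x - y) ^ p + y ^ p"
    by (rule freshmans_dream) (use p in auto)
  then have "(x - y) ^ p = 0" using h by simp
  then show "x = y" using p_pos by simp
qed

lemma pth_root_eqI: "x ^ p = y \<Longrightarrow> pth_root p y = x" for x y :: 'k
  unfolding pth_root_def by (rule the_equality) (auto dest: pth_power_inj)

lemma pth_root_power: "pth_root p y ^ p = y" for y :: 'k
  using perfect[of y] pth_root_eqI by metis

lemma pth_root_0: "pth_root p (0 :: 'k) = 0"
  by (rule pth_root_eqI) (simp add: p_pos)

lemma pth_root_1: "pth_root p (1 :: 'k) = 1"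
  by (rule pth_root_eqI) simp

lemma pth_root_add: "pth_root p (x + y) = pth_root p x + pth_root p (y :: 'k)"
proof (rule pth_root_eqI)
  have "(pth_root p x + pth_root p y) ^ p = pth_root p x ^ p + pth_root p y ^ p"
    by (rule freshmans_dream) (use p in auto)
  then show "(pth_root p x + pth_root p y) ^ p = x + y" by (simp add: pth_root_power)
qed

lemma pth_root_mult: "pth_root p (c ^ p * y) = c * pth_root p (y :: 'k)"
  by (rule pth_root_eqI) (simp add: power_mult_distrib pth_root_power)

lemma lookup_trace_exponent:
  "Poly_Mapping.lookup (trace_exponent p L n) x = (if x \<in> L then p * Poly_Mapping.lookup n x + (p - 1) else 0)"
proof -
  have "Poly_Mapping.lookup (trace_exponent p L n) x =
      (\<Sum>y\<in>L. if y = x then p * Poly_Mapping.lookup n y + (p - 1) else 0)"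
    unfolding trace_exponent_def lookup_sum lookup_single when_def by (rule refl)
  then show ?thesis using finite_L by simp
qed

lemma inj_trace_exponent: "inj_on (trace_exponent p L) {n. Poly_Mapping.keys n \<subseteq> L}"
proof (rule inj_onI, rule poly_mapping_eqI)
  fix n n' :: "'x \<Rightarrow>\<^sub>0 nat" and x
  assume h: "n \<in> {n. Poly_Mapping.keys n \<subseteq> L}" "n' \<in> {n. Poly_Mapping.keys n \<subseteq> L}"
    "trace_exponent p L n = trace_exponent p L n'"
  show "Poly_Mapping.lookup n x = Poly_Mapping.lookup n' x"
  proof (cases "x \<in> L")
    case True
    then have "p * Poly_Mapping.lookup n x + (p - 1) = p * Poly_Mapping.lookup n' x + (p - 1)"
      using arg_cong[OF h(3), of "\<lambda>e. Poly_Mapping.lookup e x"] by (simp only: lookup_trace_exponent if_True)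
    then show ?thesis using p_pos by (simp only: add_right_cancel mult_cancel1) simp
  next
    case False
    then have "x \<notin> Poly_Mapping.keys n" "x \<notin> Poly_Mapping.keys n'" using h by blast+
    then show ?thesis by (simp add: in_keys_iff)
  qed
qed

text \<open>Injectivity of \<open>trace_exponent\<close> bounds the support by that of
  \<open>f\<close>; this finiteness is what \<open>Abs_poly_mapping\<close> requires.\<close>

lemma lookup_frob_trace:
  fixes f :: "('x \<Rightarrow>\<^sub>0 nat) \<Rightarrow>\<^sub>0 'k"
  shows "Poly_Mapping.lookup (frob_trace p L f) n = (if Poly_Mapping.keys n \<subseteq> L
     then pth_root p (Poly_Mapping.lookup f (trace_exponent p L n)) else 0)"
proof -
  let ?t = "\<lambda>n. if Poly_Mapping.keys n \<subseteq> L
     then pth_root p (Poly_Mapping.lookup f (trace_exponent p L n)) else 0"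
  have "{n. ?t n \<noteq> 0} \<subseteq> {n. Poly_Mapping.keys n \<subseteq> L} \<inter> trace_exponent p L -` Poly_Mapping.keys f"
    by (auto simp: in_keys_iff pth_root_0 split: if_splits)
  moreover have "finite \<dots>"
    by (subst Int_commute) (rule finite_vimage_IntI[OF finite_keys inj_trace_exponent])
  ultimately have "finite {n. ?t n \<noteq> 0}" by (rule finite_subset)
  then show ?thesis unfolding frob_trace_def by (simp add: lookup_Abs_poly_mapping)
qed

lemma frob_trace_keys: "m \<in> Poly_Mapping.keys (frob_trace p L f) \<Longrightarrow> Poly_Mapping.keys m \<subseteq> L"
  for f :: "('x \<Rightarrow>\<^sub>0 nat) \<Rightarrow>\<^sub>0 'k"
  by (auto simp: in_keys_iff lookup_frob_trace split: if_splits)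

lemma frob_trace_0: "frob_trace p L (0 :: ('x \<Rightarrow>\<^sub>0 nat) \<Rightarrow>\<^sub>0 'k) = 0"
  by (rule poly_mapping_eqI) (simp add: lookup_frob_trace pth_root_0)

lemma frob_trace_add: "frob_trace p L (f + g) = frob_trace p L f + frob_trace p L g"
  for f g :: "('x \<Rightarrow>\<^sub>0 nat) \<Rightarrow>\<^sub>0 'k"
  by (rule poly_mapping_eqI) (simp add: lookup_frob_trace lookup_add pth_root_add)

lemma frob_trace_sum: "frob_trace p L (sum f E) = (\<Sum>e\<in>E. frob_trace p L (f e))"
  for f :: "'e \<Rightarrow> ('x \<Rightarrow>\<^sub>0 nat) \<Rightarrow>\<^sub>0 'k"
  by (induction E rule: infinite_finite_induct) (auto simp: frob_trace_0 frob_trace_add)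

text \<open>Multiplication by the \<open>p\<close>-th power shifts trace exponents by
  \<open>p * m\<close>. No exponent that fails to be a multiple of \<open>m\<close> slips in,
  because \<open>p * a \<le> p * b + (p - 1)\<close> implies \<open>a \<le> b\<close>.\<close>

lemma frob_trace_monomial_mult:
  fixes b :: "('x \<Rightarrow>\<^sub>0 nat) \<Rightarrow>\<^sub>0 'k"
  assumes m: "Poly_Mapping.keys m \<subseteq> L"
  shows "frob_trace p L (Poly_Mapping.single m c ^ p * b) = Poly_Mapping.single m c * frob_trace p L b"
proof (rule poly_mapping_eqI)
  fix n
  let ?m = "\<Sum>i<p. m"
  have lm: "Poly_Mapping.lookup m x = 0" if "x \<notin> L" for x
    using m that by (auto simp: in_keys_iff)
  have shift: "trace_exponent p L (m + n') = ?m + trace_exponent p L n'" for n'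
    by (rule poly_mapping_eqI)
      (simp add: lookup_trace_exponent lookup_add lookup_sum_const lm algebra_simps)
  show "Poly_Mapping.lookup (frob_trace p L (Poly_Mapping.single m c ^ p * b)) n =
      Poly_Mapping.lookup (Poly_Mapping.single m c * frob_trace p L b) n"
  proof (cases "\<exists>n'. n = m + n'")
    case True
    then obtain n' where n': "n = m + n'" by blast
    have keys: "Poly_Mapping.keys n \<subseteq> L \<longleftrightarrow> Poly_Mapping.keys n' \<subseteq> L"
      unfolding n' keys_add_nat using m by blast
    show ?thesis
      unfolding lookup_frob_trace keys unfolding n' lookup_single_mult lookup_frob_trace
      by (simp add: single_power shift lookup_single_mult pth_root_mult)
  next
    case False
    have "Poly_Mapping.lookup (Poly_Mapping.single m c ^ p * b) (trace_exponent p L n) = 0" if n: "Poly_Mapping.keys n \<subseteq> L"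
      unfolding single_power
    proof (rule lookup_single_mult_0)
      fix k
      show "trace_exponent p L n \<noteq> ?m + k"
      proof
        assume eq: "trace_exponent p L n = ?m + k"
        have le: "Poly_Mapping.lookup m x \<le> Poly_Mapping.lookup n x" for x
        proof (cases "x \<in> L")
          case True
          then have "p * Poly_Mapping.lookup n x + (p - 1) \<ge> p * Poly_Mapping.lookup m x"
            using arg_cong[OF eq, of "\<lambda>e. Poly_Mapping.lookup e x"]
            by (simp add: lookup_trace_exponent lookup_add lookup_sum_const)
          then have "p * Poly_Mapping.lookup m x < p * Suc (Poly_Mapping.lookup n x)" using p_pos by simp
          then show ?thesis by (simp only: mult_less_cancel1 less_Suc_eq_le)
        qed (simp add: lm)
        have "n = m + (n - m)"
          by (rule poly_mapping_eqI) (use le in \<open>simp add: lookup_add lookup_minus\<close>)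
        then show False using False by blast
      qed
    qed
    moreover have "Poly_Mapping.lookup (Poly_Mapping.single m c * frob_trace p L b) n = 0"
      by (rule lookup_single_mult_0) (use False in blast)
    ultimately show ?thesis by (simp add: lookup_frob_trace pth_root_0)
  qed
qed

text \<open>In characteristic \<open>p\<close> the \<open>p\<close>-th power of a sum of monomials
  is the sum of their \<open>p\<close>-th powers, which reduces the claim to monomials.\<close>

lemma frob_trace_mult:
  fixes a b :: "('x \<Rightarrow>\<^sub>0 nat) \<Rightarrow>\<^sub>0 'k"
  assumes a: "\<And>m. m \<in> Poly_Mapping.keys a \<Longrightarrow> Poly_Mapping.keys m \<subseteq> L"
  shows "frob_trace p L (a ^ p * b) = a * frob_trace p L b"
proof -
  let ?s = "\<lambda>m. Poly_Mapping.single m (Poly_Mapping.lookup a m)"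
  have "a ^ p = (\<Sum>m\<in>Poly_Mapping.keys a. ?s m) ^ p"
    using poly_mapping_sum_monomials[of a] by simp
  also have "\<dots> = (\<Sum>m\<in>Poly_Mapping.keys a. ?s m ^ p)"
    by (rule freshmans_dream_sum) (use p in \<open>auto simp: CHAR_matpoly\<close>)
  finally have "frob_trace p L (a ^ p * b) = (\<Sum>m\<in>Poly_Mapping.keys a. frob_trace p L (?s m ^ p * b))"
    by (simp add: sum_distrib_right frob_trace_sum)
  also have "\<dots> = (\<Sum>m\<in>Poly_Mapping.keys a. ?s m * frob_trace p L b)"
    by (intro sum.cong refl frob_trace_monomial_mult a)
  also have "\<dots> = a * frob_trace p L b"
    using poly_mapping_sum_monomials[of a] by (simp add: sum_distrib_right[symmetric])
  finally show ?thesis .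
qed

end

section \<open>Extremal monomials\<close>

definition mdeg :: "('x \<Rightarrow>\<^sub>0 nat) \<Rightarrow> nat" where
  "mdeg m = (\<Sum>x\<in>Poly_Mapping.keys m. Poly_Mapping.lookup m x)"

text \<open>A stand-in for a monomial order: it is additive on products, and the strict convexity of
  the square singles out the antidiagonal term of a minor.\<close>

definition weight :: "(nat \<times> nat \<Rightarrow>\<^sub>0 nat) \<Rightarrow> nat" where
  "weight m = (\<Sum>x\<in>Poly_Mapping.keys m. Poly_Mapping.lookup m x * (fst x + snd x)\<^sup>2)"

lemma mdeg_add: "mdeg (a + b) = mdeg a + mdeg b"
  unfolding mdeg_def by (rule setsum_keys_plus_distrib) auto

lemma weight_add: "weight (a + b) = weight a + weight b"
  unfolding weight_def by (rule setsum_keys_plus_distrib) (auto simp: algebra_simps)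

lemma mdeg_0: "mdeg 0 = 0" and weight_0: "weight 0 = 0"
  by (auto simp: mdeg_def weight_def)

lemma mdeg_sum: "mdeg (sum f E) = (\<Sum>e\<in>E. mdeg (f e))"
  by (induction E rule: infinite_finite_induct) (auto simp: mdeg_0 mdeg_add)

lemma weight_sum: "weight (sum f E) = (\<Sum>e\<in>E. weight (f e))"
  by (induction E rule: infinite_finite_induct) (auto simp: weight_0 weight_add)

lemma mdeg_single: "mdeg (Poly_Mapping.single x n) = n"
  by (auto simp: mdeg_def)

lemma weight_single: "weight (Poly_Mapping.single x n) = n * (fst x + snd x)\<^sup>2"
  by (auto simp: weight_def)

text \<open>Homogeneity is included because degrees alone later decide which trace exponents can
  occur in a power of \<open>f\<close>.\<close>

definition extremal_monomial :: "'k::comm_ring_1 matpoly \<Rightarrow> (nat \<times> nat \<Rightarrow>\<^sub>0 nat) \<Rightarrow> 'k \<Rightarrow> bool" where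
  "extremal_monomial f M c \<longleftrightarrow> Poly_Mapping.lookup f M = c \<and>
     (\<forall>m\<in>Poly_Mapping.keys f. mdeg m = mdeg M \<and> (m = M \<or> weight M < weight m))"

text \<open>The minimal weight of the product is reached only by the product of the two minima, so
  nothing can cancel it.\<close>

lemma extremal_monomial_mult:
  assumes f: "extremal_monomial f M c" and g: "extremal_monomial g N d"
  shows "extremal_monomial (f * g) (M + N) (c * d)"
  unfolding extremal_monomial_def
proof
  define f' where "f' = f - Poly_Mapping.single M c"
  define g' where "g' = g - Poly_Mapping.single N d"
  have f': "weight M < weight m" if "m \<in> Poly_Mapping.keys f'" for m
    using that f unfolding extremal_monomial_def f'_def
    by (auto simp: in_keys_iff lookup_minus lookup_single when_def split: if_splits)
  have g': "weight N < weight m" if "m \<in> Poly_Mapping.keys g'" for m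
    using that g unfolding extremal_monomial_def g'_def
    by (auto simp: in_keys_iff lookup_minus lookup_single when_def split: if_splits)
  have g_le: "weight N \<le> weight m" if "m \<in> Poly_Mapping.keys g" for m
    using that g unfolding extremal_monomial_def by (auto intro: less_imp_le)
  have "M + N \<notin> Poly_Mapping.keys (f' * g)"
  proof
    assume "M + N \<in> Poly_Mapping.keys (f' * g)"
    then obtain a b where ab: "M + N = a + b" "a \<in> Poly_Mapping.keys f'" "b \<in> Poly_Mapping.keys g"
      using keys_mult[of f' g] by blast
    then have "weight M + weight N < weight a + weight b" using f' g_le by (meson add_less_le_mono)
    then show False using arg_cong[OF ab(1), of weight] by (simp add: weight_add)
  qed
  then have "Poly_Mapping.lookup (f' * g) (M + N) = 0" by (simp add: in_keys_iff)
  moreover have "f * g = Poly_Mapping.single M c * g + f' * g" by (simp add: f'_def algebra_simps)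
  ultimately show "Poly_Mapping.lookup (f * g) (M + N) = c * d"
    using g by (simp add: lookup_add lookup_single_mult extremal_monomial_def)
  show "\<forall>m\<in>Poly_Mapping.keys (f * g). mdeg m = mdeg (M + N) \<and> (m = M + N \<or> weight (M + N) < weight m)"
  proof
    fix m assume "m \<in> Poly_Mapping.keys (f * g)"
    then obtain a b where ab: "m = a + b" "a \<in> Poly_Mapping.keys f" "b \<in> Poly_Mapping.keys g"
      using keys_mult[of f g] by blast
    then have "mdeg a = mdeg M" "a = M \<or> weight M < weight a" "mdeg b = mdeg N" "b = N \<or> weight N < weight b"
      using f g unfolding extremal_monomial_def by blast+
    then show "mdeg m = mdeg (M + N) \<and> (m = M + N \<or> weight (M + N) < weight m)"
      unfolding ab(1) mdeg_add weight_add by auto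
  qed
qed

lemma extremal_monomial_1: "extremal_monomial 1 0 1"
  by (auto simp: extremal_monomial_def)

lemma extremal_monomial_prod:
  "(\<And>e. e \<in> E \<Longrightarrow> extremal_monomial (f e) (M e) (c e)) \<Longrightarrow>
    extremal_monomial (prod f E) (sum M E) (prod c E)"
  by (induction E rule: infinite_finite_induct)
    (auto simp: extremal_monomial_1 intro!: extremal_monomial_mult)

lemma extremal_monomial_power:
  "extremal_monomial f M c \<Longrightarrow> extremal_monomial (f ^ n) (\<Sum>i<n. M) (c ^ n)"
  by (induction n) (auto simp: extremal_monomial_1 add.commute intro!: extremal_monomial_mult)

lemma extremal_monomial_indet: "extremal_monomial (indet x) (Poly_Mapping.single x 1) 1"
  by (simp add: extremal_monomial_def keys_indet) (simp add: indet_def)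

lemma prod_indet: "finite E \<Longrightarrow> (\<Prod>e\<in>E. indet (g e)) = Poly_Mapping.single (\<Sum>e\<in>E. Poly_Mapping.single (g e) 1) 1"
  by (induction E rule: finite_induct) (auto simp: indet_def mult_single)

definition square_minor :: "nat \<Rightarrow> nat \<Rightarrow> nat \<Rightarrow> 'k::field matpoly" where
  "square_minor i m n = minor n (\<lambda>a. i + a) (\<lambda>b. m + b)"

text \<open>A permutation \<open>q\<close> contributes the weight \<open>\<Sum>a<n. (i + m + a + q a)\<^sup>2\<close>; as the sum of the
  bases does not depend on \<open>q\<close>, this is minimal exactly when all bases are equal.\<close>

lemma extremal_monomial_square_minor:
  "\<exists>c. extremal_monomial (square_minor i m n :: 'k::field matpoly)
     (\<Sum>a<n. Poly_Mapping.single (i + a, m + (n - 1 - a)) 1) c \<and> c ^ 2 = 1"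
proof -
  define mon :: "(nat \<Rightarrow> nat) \<Rightarrow> (nat \<times> nat) \<Rightarrow>\<^sub>0 nat"
    where "mon q = (\<Sum>a<n. Poly_Mapping.single (i + a, m + q a) 1)" for q
  define rv where "rv a = (if a < n then n - 1 - a else a)" for a
  have rv: "rv permutes {0..<n}"
    by (rule bij_imp_permutes) (auto simp: rv_def intro!: bij_betwI[where g = rv])
  have mon_rv: "mon rv = (\<Sum>a<n. Poly_Mapping.single (i + a, m + (n - 1 - a)) 1)"
    by (simp add: mon_def rv_def)
  have deg: "mdeg (mon q) = n" for q by (simp add: mon_def mdeg_sum mdeg_single)
  have wt: "weight (mon q) = (\<Sum>a<n. (i + a + (m + q a))\<^sup>2)" for q
    by (simp add: mon_def weight_sum weight_single)
  have wt_less: "weight (mon rv) < weight (mon q)" if q: "q permutes {0..<n}" "q \<noteq> rv" for q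
  proof -
    define y where "y a = int (i + a + (m + q a))" for a
    \<comment> \<open>The base of every square on the antidiagonal, and the mean of the bases for
      every permutation. The sum of squares exceeds \<open>n * s^2\<close> by the sum of the squared
      deviations from \<open>s\<close>.\<close>
    define s where "s = int (i + m + n) - 1"
    have sumq: "(\<Sum>a<n. int (q a)) = (\<Sum>a<n. int a)"
      using sum.permute[OF q(1), of int] by (simp add: lessThan_atLeast0 comp_def)
    have sumrv: "(\<Sum>a<n. int (rv a)) = (\<Sum>a<n. int a)"
      using sum.permute[OF rv, of int] by (simp add: lessThan_atLeast0 comp_def)
    have "(\<Sum>a<n. y a) = (\<Sum>a<n. int (i + m + a) + int (q a))"
      by (rule sum.cong) (auto simp: y_def)
    also have "\<dots> = (\<Sum>a<n. int (i + m + a)) + (\<Sum>a<n. int (q a))"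
      by (rule sum.distrib)
    also have "\<dots> = (\<Sum>a<n. int (i + m + a) + int (rv a))" by (simp add: sumq sumrv sum.distrib)
    also have "\<dots> = (\<Sum>a<n. s)" by (rule sum.cong) (auto simp: rv_def s_def)
    finally have sumy: "(\<Sum>a<n. y a) = int n * s" by simp
    obtain a where a: "a < n" "q a \<noteq> rv a"
    proof (rule ccontr)
      assume "\<not> thesis"
      then have "q a = rv a" if "a < n" for a using that \<open>\<And>a. \<lbrakk>a < n; q a \<noteq> rv a\<rbrakk> \<Longrightarrow> thesis\<close> by blast
      moreover have "q a = rv a" if "\<not> a < n" for a
        using permutes_not_in[OF q(1)] that by (simp add: rv_def)
      ultimately show False using q(2) by blast
    qed
    have "y a \<noteq> s" using a by (auto simp: y_def s_def rv_def)
    then have "0 < (y a - s)\<^sup>2" by simp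
    then have pos: "0 < (\<Sum>a<n. (y a - s)\<^sup>2)"
      using a(1) by (intro sum_pos2[of _ a]) auto
    have "(\<Sum>a<n. (y a)\<^sup>2) = (\<Sum>a<n. (y a - s)\<^sup>2 + 2 * s * y a - s\<^sup>2)"
      by (rule sum.cong) (auto simp: power2_eq_square algebra_simps)
    also have "\<dots> = (\<Sum>a<n. (y a - s)\<^sup>2) + 2 * s * (\<Sum>a<n. y a) - int n * s\<^sup>2"
      by (simp add: sum.distrib sum_subtractf sum_distrib_left)
    also have "\<dots> = (\<Sum>a<n. (y a - s)\<^sup>2) + int n * s\<^sup>2"
      by (simp add: sumy power2_eq_square algebra_simps)
    finally have "int n * s\<^sup>2 < (\<Sum>a<n. (y a)\<^sup>2)" using pos by simp
    also have "\<dots> = int (weight (mon q))" by (simp add: wt y_def)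
    also have "int n * s\<^sup>2 = (\<Sum>a<n. (int (i + a + (m + rv a)))\<^sup>2)"
    proof -
      have "(int (i + a + (m + rv a)))\<^sup>2 = s\<^sup>2" if "a < n" for a
        using that by (intro arg_cong[of _ _ "\<lambda>x. x\<^sup>2"]) (auto simp: rv_def s_def)
      then show ?thesis by simp
    qed
    also have "\<dots> = int (weight (mon rv))" by (simp add: wt)
    finally show ?thesis by simp
  qed
  have eq: "(square_minor i m n :: 'k matpoly) =
      (\<Sum>q | q permutes {0..<n}. Poly_Mapping.single (mon q) (signof q))"
  proof -
    have "(square_minor i m n :: 'k matpoly) = (\<Sum>q | q permutes {0..<n}. signof q *
        (\<Prod>a = 0..<n. mat n n (\<lambda>(a, b). indet (i + a, m + b)) $$ (a, q a)))"
      unfolding square_minor_def minor_def by (rule det_def') simp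
    also have "\<dots> = (\<Sum>q | q permutes {0..<n}. Poly_Mapping.single (mon q) (signof q))"
    proof (rule sum.cong)
      fix q assume "q \<in> {q. q permutes {0..<n}}"
      then have q: "q permutes {0..<n}" by simp
      have "(\<Prod>a = 0..<n. mat n n (\<lambda>(a, b). indet (i + a, m + b)) $$ (a, q a)) =
          (\<Prod>a<n. indet (i + a, m + q a) :: 'k matpoly)"
        unfolding lessThan_atLeast0
        by (rule prod.cong) (use permutes_in_image[OF q] in auto)
      also have "\<dots> = Poly_Mapping.single (mon q) 1" by (simp add: prod_indet mon_def)
      finally show "signof q * (\<Prod>a = 0..<n. mat n n (\<lambda>(a, b). indet (i + a, m + b)) $$ (a, q a)) =
          Poly_Mapping.single (mon q) (signof q :: 'k)"
        by (cases "evenperm q") (simp_all add: sign_def single_uminus)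
    qed simp
    finally show ?thesis .
  qed
  let ?P = "{q. q permutes {0..<n}}"
  have fin: "finite ?P" by (simp add: finite_permutations)
  have keys: "\<exists>q. q permutes {0..<n} \<and> e = mon q" if "e \<in> Poly_Mapping.keys (square_minor i m n :: 'k matpoly)" for e
    using that keys_sum[of "\<lambda>q. Poly_Mapping.single (mon q) (signof q :: 'k)" ?P] unfolding eq
    by (auto split: if_splits)
  have "Poly_Mapping.lookup (square_minor i m n :: 'k matpoly) (mon rv) =
      (\<Sum>q\<in>?P. if q = rv then signof q else 0)"
    unfolding eq lookup_sum lookup_single when_def
    by (rule sum.cong) (use wt_less in force)+
  also have "\<dots> = signof rv" using fin rv by simp
  finally have "Poly_Mapping.lookup (square_minor i m n :: 'k matpoly) (mon rv) = signof rv" .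
  moreover have "mdeg e = mdeg (mon rv) \<and> (e = mon rv \<or> weight (mon rv) < weight e)"
    if "e \<in> Poly_Mapping.keys (square_minor i m n :: 'k matpoly)" for e
    using keys[OF that] wt_less by (auto simp: deg)
  ultimately have "extremal_monomial (square_minor i m n :: 'k matpoly) (mon rv) (signof rv)"
    by (simp add: extremal_monomial_def)
  moreover have "(signof rv :: 'k)\<^sup>2 = 1" by (cases "evenperm rv") (simp_all add: sign_def)
  ultimately show ?thesis unfolding mon_rv by blast
qed

text \<open>The extremal monomial of \<open>f ^ (p - 1)\<close> is the trace exponent of
  \<open>0\<close>. The trace exponent of any other \<open>n\<close> has degree larger by
  \<open>p * mdeg n\<close>, so it does not occur in the homogeneous polynomial
  \<open>f ^ (p - 1)\<close>.\<close>

lemma frob_trace_extremal: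
  fixes f :: "'k::field matpoly"
  assumes pc: "perfect_char TYPE('k) p L"
    and f: "extremal_monomial f (\<Sum>x\<in>L. Poly_Mapping.single x 1) c" and c: "c\<^sup>2 = 1"
  shows "frob_trace p L (f ^ (p - 1)) = 1"
proof -
  interpret perfect_char p L by (rule pc)
  let ?M = "\<Sum>x\<in>L. Poly_Mapping.single x (1::nat)"
  let ?q = "p - 1"
  have e0: "trace_exponent p L 0 = (\<Sum>i<?q. ?M)"
    by (rule poly_mapping_eqI)
      (use finite_L in \<open>simp add: lookup_trace_exponent lookup_sum_const lookup_sum lookup_single when_def\<close>)
  have ex: "extremal_monomial (f ^ ?q) (trace_exponent p L 0) (c ^ ?q)"
    unfolding e0 by (rule extremal_monomial_power[OF f])
  \<comment> \<open>For odd \<open>p\<close> the exponent is even; for \<open>p = 2\<close> the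
    equation \<open>c^2 = 1\<close> reads \<open>(c - 1)^2 = 0\<close>.\<close>
  have cq: "c ^ ?q = 1"
  proof (cases "p = 2")
    case True
    then have two: "(2 :: 'k) = 0" using p(2) of_nat_CHAR[where ?'a = 'k] by simp
    have "(c - 1) ^ 2 = c\<^sup>2 + 1 - 2 * c" by (simp add: power2_eq_square algebra_simps)
    also have "\<dots> = 2 * (1 - c)" by (simp add: c algebra_simps)
    also have "\<dots> = 0" by (simp only: two mult_zero_left)
    finally show ?thesis using True by simp
  next
    case False
    then have "odd p" using p(1) primes_dvd_imp_eq two_is_prime_nat by blast
    then have "even ?q" by simp
    then obtain e where "?q = 2 * e" by (rule evenE)
    then show ?thesis by (simp add: power_mult c)
  qed
  have mdeg_trace: "mdeg (trace_exponent p L n) = p * mdeg n + card L * (p - 1)" if "Poly_Mapping.keys n \<subseteq> L" for n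
  proof -
    have "mdeg n = (\<Sum>x\<in>L. Poly_Mapping.lookup n x)"
      unfolding mdeg_def by (rule sum.mono_neutral_left) (use finite_L that in \<open>auto simp: in_keys_iff\<close>)
    then show ?thesis
      by (simp add: trace_exponent_def mdeg_sum mdeg_single sum.distrib sum_distrib_left)
  qed
  show ?thesis
  proof (rule poly_mapping_eqI)
    fix n
    show "Poly_Mapping.lookup (frob_trace p L (f ^ ?q)) n = Poly_Mapping.lookup (1 :: 'k matpoly) n"
    proof (cases "n = 0")
      case True
      then show ?thesis using ex cq
        by (simp add: lookup_frob_trace extremal_monomial_def pth_root_1)
    next
      case n0: False
      have "Poly_Mapping.lookup (f ^ ?q) (trace_exponent p L n) = 0" if n: "Poly_Mapping.keys n \<subseteq> L"
      proof (rule ccontr)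
        assume "\<not> ?thesis"
        then have "mdeg (trace_exponent p L n) = mdeg (trace_exponent p L 0)"
          using ex unfolding extremal_monomial_def by (simp add: in_keys_iff)
        then have "mdeg n = 0" using p_pos by (simp add: mdeg_trace n mdeg_0)
        then have "Poly_Mapping.lookup n x = 0" for x by (cases x) (auto simp: mdeg_def in_keys_iff)
        then have "n = 0" by (intro poly_mapping_eqI) simp
        then show False using n0 by simp
      qed
      then show ?thesis using n0 by (simp add: lookup_frob_trace pth_root_0 lookup_one when_def)
    qed
  qed
qed

section \<open>Graded rings of filtrations\<close>

locale filtration = typed_cring R for R :: "'r::comm_ring_1 ring" +
  fixes J :: "nat \<Rightarrow> 'r set"
  assumes J_ideal: "ideal (J n) R" and J_0: "J 0 = carrier R" and J_Suc: "J (Suc n) \<subseteq> J n"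
    and J_mult: "x \<in> J m \<Longrightarrow> y \<in> J n \<Longrightarrow> x * y \<in> J (m + n)"
begin

lemmas J_intros = idealD(2-7)[OF J_ideal]

lemma J_carrier: "x \<in> J n \<Longrightarrow> x \<in> carrier R" by (rule idealD(1)[OF J_ideal])

lemma J_antimono: "m \<le> n \<Longrightarrow> J n \<subseteq> J m"
  by (induction n rule: dec_induct) (use J_Suc in blast)+

lemma coset: "J n +>\<^bsub>R\<^esub> x = {h + x | h. h \<in> J n}"
  by (auto simp: a_r_coset_def r_coset_def)

lemma coset_self: "x \<in> J n +>\<^bsub>R\<^esub> x"
  unfolding coset using J_intros(1)[of n] by force

lemma coset_eq: "J n +>\<^bsub>R\<^esub> x = J n +>\<^bsub>R\<^esub> y \<longleftrightarrow> x - y \<in> J n"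
proof
  assume "J n +>\<^bsub>R\<^esub> x = J n +>\<^bsub>R\<^esub> y"
  then have "x \<in> {h + y | h. h \<in> J n}" using coset_self[of x n] unfolding coset by simp
  then show "x - y \<in> J n" by auto
next
  have sub: "{h + x | h. h \<in> J n} \<subseteq> {h + y | h. h \<in> J n}" if "x - y \<in> J n" for x y
  proof
    fix z assume "z \<in> {h + x | h. h \<in> J n}"
    then obtain h where h: "h \<in> J n" "z = (h + (x - y)) + y" by auto
    then show "z \<in> {h + y | h. h \<in> J n}" using J_intros(2)[OF h(1) that] by blast
  qed
  assume h: "x - y \<in> J n"
  moreover have "y - x \<in> J n" using J_intros(5)[OF h] by simp
  ultimately show "J n +>\<^bsub>R\<^esub> x = J n +>\<^bsub>R\<^esub> y" unfolding coset using sub by blast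
qed

text \<open>The Rees-type ring of polynomials whose \<open>n\<close>-th coefficient lies in \<open>J n\<close> maps onto the graded ring;
  computations in the graded ring are carried out with representatives there.\<close>

definition rees :: "'r poly set" where
  "rees = {q. \<forall>n. poly.coeff q n \<in> J n}"

definition proj :: "'r poly \<Rightarrow> nat \<Rightarrow> 'r set" where
  "proj q = (\<lambda>n. J (Suc n) +>\<^bsub>R\<^esub> poly.coeff q n)"

abbreviation gr :: "(nat \<Rightarrow> 'r set) ring" where "gr \<equiv> graded_ring R J"

lemma reesD: "q \<in> rees \<Longrightarrow> poly.coeff q n \<in> J n" by (simp add: rees_def)

lemma proj_eq: "proj q = proj q' \<longleftrightarrow> (\<forall>n. poly.coeff q n - poly.coeff q' n \<in> J (Suc n))"
  by (simp add: proj_def fun_eq_iff coset_eq)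

lemma gr_carrier: "carrier gr = proj ` rees"
proof
  show "proj ` rees \<subseteq> carrier gr"
  proof
    fix g assume "g \<in> proj ` rees"
    then obtain q where q: "q \<in> rees" "g = proj q" by blast
    have "{n. g n \<noteq> J (Suc n)} \<subseteq> {..degree q}"
    proof (intro subsetI)
      fix n assume n: "n \<in> {n. g n \<noteq> J (Suc n)}"
      show "n \<in> {..Polynomial.degree q}"
      proof (rule ccontr)
        assume "n \<notin> {..Polynomial.degree q}"
        then have "g n = J (Suc n) +>\<^bsub>R\<^esub> 0" by (simp add: q proj_def coeff_eq_0)
        then show False using n by (simp add: coset)
      qed
    qed
    then have "finite {n. g n \<noteq> J (Suc n)}" by (rule finite_subset) simp
    then show "g \<in> carrier gr"
      unfolding graded_ring_def using reesD[OF q(1)] by (auto simp: q proj_def)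
  qed
  show "carrier gr \<subseteq> proj ` rees"
  proof
    fix g assume "g \<in> carrier gr"
    then have "\<forall>n. \<exists>x. x \<in> J n \<and> g n = J (Suc n) +>\<^bsub>R\<^esub> x" and fin: "finite {n. g n \<noteq> J (Suc n)}"
      by (auto simp: graded_ring_def)
    then obtain x where x: "\<And>n. x n \<in> J n" "\<And>n. g n = J (Suc n) +>\<^bsub>R\<^esub> x n" by metis
    \<comment> \<open>A zero coset may have been given a nonzero representative; taking
      \<open>0\<close> there makes the support finite.\<close>
    define y where "y n = (if g n = J (Suc n) then 0 else x n)" for n
    have y: "y n \<in> J n" "g n = J (Suc n) +>\<^bsub>R\<^esub> y n" for n
    proof -
      show "y n \<in> J n" using x(1) J_intros(1) by (simp add: y_def)
      show "g n = J (Suc n) +>\<^bsub>R\<^esub> y n"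
      proof (cases "g n = J (Suc n)")
        case True
        then show ?thesis by (simp add: y_def coset)
      next
        case False
        then show ?thesis using x(2)[of n] by (simp add: y_def)
      qed
    qed
    have "finite {n. y n \<noteq> 0}" by (rule finite_subset[OF _ fin]) (auto simp: y_def)
    then have c: "poly.coeff (Abs_poly y) = y"
      by (intro Abs_poly_inverse) (simp add: eventually_cofinite)
    have "Abs_poly y \<in> rees" by (simp add: rees_def c y)
    moreover have "proj (Abs_poly y) = g" by (simp add: proj_def c fun_eq_iff y(2))
    ultimately show "g \<in> proj ` rees" by blast
  qed
qed

lemma gr_cases:
  assumes "g \<in> carrier gr"
  obtains q where "q \<in> rees" "g = proj q"
  using assms unfolding gr_carrier by blast

lemma proj_in_carrier: "q \<in> rees \<Longrightarrow> proj q \<in> carrier gr"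
  unfolding gr_carrier by blast

lemma gr_zero: "\<zero>\<^bsub>gr\<^esub> = proj 0"
  by (auto simp: graded_ring_def proj_def coset)

lemma gr_one: "\<one>\<^bsub>gr\<^esub> = proj 1"
  by (auto simp: graded_ring_def proj_def coset fun_eq_iff)

lemma gr_add:
  assumes "q \<in> rees" "q' \<in> rees"
  shows "proj q \<oplus>\<^bsub>gr\<^esub> proj q' = proj (q + q')"
proof -
  have "(J n +>\<^bsub>R\<^esub> x) <+>\<^bsub>R\<^esub> (J n +>\<^bsub>R\<^esub> y) = J n +>\<^bsub>R\<^esub> (x + y)" for n x y
  proof (intro equalityI subsetI)
    fix z assume "z \<in> (J n +>\<^bsub>R\<^esub> x) <+>\<^bsub>R\<^esub> (J n +>\<^bsub>R\<^esub> y)"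
    then obtain h h' where "h \<in> J n" "h' \<in> J n" "z = (h + x) + (h' + y)"
      by (auto simp: coset set_add_def set_mult_def)
    then show "z \<in> J n +>\<^bsub>R\<^esub> (x + y)"
      unfolding coset by (intro CollectI exI[of _ "h + h'"]) (auto intro: J_intros)
  next
    fix z assume "z \<in> J n +>\<^bsub>R\<^esub> (x + y)"
    then obtain h where h: "h \<in> J n" "z = (h + x) + (0 + y)" by (auto simp: coset algebra_simps)
    have "h + x \<in> J n +>\<^bsub>R\<^esub> x" "0 + y \<in> J n +>\<^bsub>R\<^esub> y"
      unfolding coset using h(1) J_intros(1)[of n] by blast+
    then show "z \<in> (J n +>\<^bsub>R\<^esub> x) <+>\<^bsub>R\<^esub> (J n +>\<^bsub>R\<^esub> y)"
      unfolding h(2) set_add_def set_mult_def by auto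
  qed
  then show ?thesis by (simp add: graded_ring_def proj_def)
qed

text \<open>Changing the representatives by \<open>h\<close> and \<open>h'\<close> changes the
  product by \<open>h * (h' + y) + x * h'\<close>, whose two terms both lie in
  \<open>J (Suc n)\<close>.\<close>

lemma rcoset_mult_eq:
  assumes "i \<le> n" "x \<in> J i" "y \<in> J (n - i)"
  shows "rcoset_mult R (J (Suc n)) (J (Suc i) +>\<^bsub>R\<^esub> x) (J (Suc (n - i)) +>\<^bsub>R\<^esub> y) = J (Suc n) +>\<^bsub>R\<^esub> (x * y)"
proof -
  have eq: "J (Suc n) +>\<^bsub>R\<^esub> (a * b) = J (Suc n) +>\<^bsub>R\<^esub> (x * y)"
    if ab: "a \<in> J (Suc i) +>\<^bsub>R\<^esub> x" "b \<in> J (Suc (n - i)) +>\<^bsub>R\<^esub> y" for a b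
  proof -
    obtain h h' where h: "h \<in> J (Suc i)" "h' \<in> J (Suc (n - i))" "a = h + x" "b = h' + y"
      using ab unfolding coset by blast
    have "h' + y \<in> J (n - i)" using J_intros(2)[of h' "n - i" y] h(2) J_Suc assms(3) by blast
    then have "h * (h' + y) \<in> J (Suc i + (n - i))" by (rule J_mult[OF h(1)])
    moreover have "x * h' \<in> J (i + Suc (n - i))" by (rule J_mult[OF assms(2) h(2)])
    ultimately have "h * (h' + y) + x * h' \<in> J (Suc n)" using assms(1) by (intro J_intros(2)) simp_all
    moreover have "a * b - x * y = h * (h' + y) + x * h'" by (simp add: h algebra_simps)
    ultimately show ?thesis unfolding coset_eq by simp
  qed
  have "rcoset_mult R (J (Suc n)) (J (Suc i) +>\<^bsub>R\<^esub> x) (J (Suc (n - i)) +>\<^bsub>R\<^esub> y) =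
      (\<Union>a\<in>J (Suc i) +>\<^bsub>R\<^esub> x. \<Union>b\<in>J (Suc (n - i)) +>\<^bsub>R\<^esub> y. J (Suc n) +>\<^bsub>R\<^esub> (x * y))"
    unfolding rcoset_mult_def ops by (intro SUP_cong refl eq)
  also have "\<dots> = J (Suc n) +>\<^bsub>R\<^esub> (x * y)"
    using coset_self[of x "Suc i"] coset_self[of y "Suc (n - i)"] by blast
  finally show ?thesis .
qed

lemma rees_mult: 
  assumes "q \<in> rees" "q' \<in> rees"
  shows "q * q' \<in> rees"
  unfolding rees_def
proof (intro CollectI allI)
  fix n
  have "poly.coeff q i * poly.coeff q' (n - i) \<in> J n" if "i \<in> {..n}" for i
    using J_mult[OF reesD[OF assms(1), of i] reesD[OF assms(2), of "n - i"]] that by simp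
  then show "poly.coeff (q * q') n \<in> J n" unfolding coeff_mult by (rule ideal_sum[OF J_ideal])
qed

lemma rees_add: "q \<in> rees \<Longrightarrow> q' \<in> rees \<Longrightarrow> q + q' \<in> rees"
  by (auto simp: rees_def intro: J_intros)

lemma rees_minus: "q \<in> rees \<Longrightarrow> - q \<in> rees"
  by (auto simp: rees_def intro: J_intros)

lemma rees_zero: "0 \<in> rees"
  by (auto simp: rees_def intro: J_intros)

lemma rees_one: "1 \<in> rees"
  unfolding rees_def by (auto simp: coeff_1 J_0 one_carrier intro: J_intros)

lemma rees_power: "q \<in> rees \<Longrightarrow> q ^ n \<in> rees"
  by (induction n) (auto intro: rees_one rees_mult)

lemma gr_mult:
  assumes q: "q \<in> rees" and q': "q' \<in> rees"
  shows "proj q \<otimes>\<^bsub>gr\<^esub> proj q' = proj (q * q')"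
proof
  fix n
  let ?I = "J (Suc n)"
  interpret I: ideal ?I R by (rule J_ideal)
  interpret h: ring_hom_cring R "R Quot ?I" "(+>\<^bsub>R\<^esub>) ?I" by (rule I.rcos_ring_hom_cring[OF is_cring])
  let ?f = "\<lambda>i. poly.coeff q i * poly.coeff q' (n - i)"
  have f: "?f i \<in> carrier R" for i
    by (intro mult_carrier J_carrier[OF reesD] q q')
  have eq: "rcoset_mult R ?I (proj q i) (proj q' (n - i)) = ?I +>\<^bsub>R\<^esub> ?f i" if "i \<le> n" for i
    unfolding proj_def by (rule rcoset_mult_eq[OF that reesD[OF q] reesD[OF q']])
  have "(proj q \<otimes>\<^bsub>gr\<^esub> proj q') n =
      (\<Oplus>\<^bsub>R Quot ?I\<^esub>i\<in>{..n}. rcoset_mult R ?I (proj q i) (proj q' (n - i)))"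
    by (simp add: graded_ring_def)
  also have "\<dots> = (\<Oplus>\<^bsub>R Quot ?I\<^esub>i\<in>{..n}. ?I +>\<^bsub>R\<^esub> ?f i)"
    by (rule h.S.finsum_cong') (use f h.hom_closed eq in auto)
  also have "\<dots> = ?I +>\<^bsub>R\<^esub> (\<Oplus>\<^bsub>R\<^esub>i\<in>{..n}. ?f i)"
    using f by (subst h.hom_finsum) (auto simp: comp_def)
  also have "\<dots> = ?I +>\<^bsub>R\<^esub> poly.coeff (q * q') n"
    using f by (subst finsum_eq) (auto simp: coeff_mult)
  finally show "(proj q \<otimes>\<^bsub>gr\<^esub> proj q') n = proj (q * q') n" by (simp add: proj_def)
qed

lemma gr_cring: "cring gr"
proof (rule cringI)
  show "abelian_group gr"
  proof (rule abelian_groupI)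
    fix x assume "x \<in> carrier gr"
    then obtain q where q: "q \<in> rees" "x = proj q" by (rule gr_cases)
    show "\<exists>y\<in>carrier gr. y \<oplus>\<^bsub>gr\<^esub> x = \<zero>\<^bsub>gr\<^esub>"
      by (rule bexI[of _ "proj (- q)"])
        (use q in \<open>simp_all add: gr_add gr_zero rees_minus proj_in_carrier\<close>)
  qed (auto elim!: gr_cases simp: proj_in_carrier gr_add gr_zero rees_add rees_zero add_ac)
  show "comm_monoid gr"
    by (rule comm_monoidI) (auto elim!: gr_cases
      simp: proj_in_carrier gr_mult gr_one rees_mult rees_one mult_ac)
qed (auto elim!: gr_cases simp: gr_mult gr_add rees_mult rees_add algebra_simps)

sublocale gr: cring gr by (rule gr_cring)

lemma gr_power: "q \<in> rees \<Longrightarrow> proj q [^]\<^bsub>gr\<^esub> (n::nat) = proj (q ^ n)"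
  by (induction n) (auto simp: gr_one gr_mult rees_power mult.commute)

text \<open>The multiples of one live in degree \<open>0\<close>. A number prime to \<open>p\<close>
  is a unit of \<open>R\<close>, so it lies outside the proper ideal
  \<open>J (Suc 0)\<close>.\<close>

lemma gr_char:
  assumes one: "1 \<notin> J (Suc 0)" and unit: "\<And>n::nat. \<not> p dvd n \<Longrightarrow> \<exists>y\<in>carrier R. y * of_nat n = 1"
    and char: "of_nat p = (0 :: 'r)"
  shows "has_characteristic gr p"
  unfolding has_characteristic_def
proof
  fix n :: nat
  have of_nat_rees: "of_nat n \<in> rees" for n
    by (induction n) (auto intro: rees_zero rees_one rees_add)
  have eq: "[n] \<cdot>\<^bsub>gr\<^esub> \<one>\<^bsub>gr\<^esub> = proj (of_nat n)" for n :: nat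
    by (induction n) (auto simp: gr_zero gr_one gr_add of_nat_rees rees_one add.commute)
  have coeff: "poly.coeff (of_nat n) i = (if i = 0 then of_nat n else 0 :: 'r)" for i
    by (simp add: of_nat_poly coeff_pCons split: nat.splits)
  have "[n] \<cdot>\<^bsub>gr\<^esub> \<one>\<^bsub>gr\<^esub> = \<zero>\<^bsub>gr\<^esub> \<longleftrightarrow> of_nat n \<in> J (Suc 0)"
    unfolding eq gr_zero proj_eq by (auto simp: coeff intro: J_intros)
  also have "\<dots> \<longleftrightarrow> p dvd n"
  proof
    assume h: "of_nat n \<in> J (Suc 0)"
    show "p dvd n"
    proof (rule ccontr)
      assume "\<not> p dvd n"
      then obtain y where "y \<in> carrier R" "y * of_nat n = 1" using unit by blast
      then have "1 \<in> J (Suc 0)" using J_intros(3)[OF _ h] by metis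
      then show False using one by blast
    qed
  next
    assume "p dvd n"
    then have "of_nat n = (0 :: 'r)" using char by (auto simp: dvd_def)
    then show "of_nat n \<in> J (Suc 0)" using J_intros(1) by simp
  qed
  finally show "[n] \<cdot>\<^bsub>gr\<^esub> \<one>\<^bsub>gr\<^esub> = \<zero>\<^bsub>gr\<^esub> \<longleftrightarrow> p dvd n" .
qed

text \<open>The Frobenius map multiplies degrees by \<open>p\<close>, so its splitting reads degree
  \<open>n\<close> off degree \<open>p * n\<close> and forgets the degrees not divisible by
  \<open>p\<close>. As \<open>n \<le> p * n\<close>, summing up to the degree of \<open>q\<close>
  loses nothing.\<close>

definition split_poly :: "('r \<Rightarrow> 'r) \<Rightarrow> nat \<Rightarrow> 'r poly \<Rightarrow> 'r poly" where
  "split_poly \<phi> p q = (\<Sum>n\<le>Polynomial.degree q. Polynomial.monom (\<phi> (poly.coeff q (p * n))) n)"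

lemma coeff_split_poly:
  assumes "\<phi> 0 = 0" "0 < p"
  shows "poly.coeff (split_poly \<phi> p q) n = \<phi> (poly.coeff q (p * n))"
proof (cases "n \<le> Polynomial.degree q")
  case True
  then show ?thesis by (simp add: split_poly_def coeff_sum)
next
  case False
  moreover have "n \<le> p * n" using assms(2) by simp
  ultimately have "Polynomial.degree q < p * n" by linarith
  then show ?thesis using False assms(1) by (simp add: split_poly_def coeff_sum coeff_eq_0)
qed

text \<open>In characteristic \<open>p\<close> the power \<open>q ^ p\<close> has coefficients only
  in degrees divisible by \<open>p\<close>, namely the \<open>p\<close>-th powers of those of
  \<open>q\<close>.\<close>

lemma coeff_power_char_mult:
  fixes q q' :: "'r poly"
  assumes "Factorial_Ring.prime p" "CHAR('r) = p"
  shows "poly.coeff (q ^ p * q') (p * n) = (\<Sum>i\<le>n. poly.coeff q i ^ p * poly.coeff q' (p * (n - i)))"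
proof -
  have p: "0 < p" using assms(1) by (simp add: prime_gt_0_nat)
  have "q ^ p = (\<Sum>i\<le>Polynomial.degree q. Polynomial.monom (poly.coeff q i) i) ^ p" by (simp add: poly_as_sum_of_monoms)
  also have "\<dots> = (\<Sum>i\<le>Polynomial.degree q. Polynomial.monom (poly.coeff q i) i ^ p)"
    by (rule freshmans_dream_sum) (use assms in auto)
  finally have qp: "q ^ p = (\<Sum>i\<le>Polynomial.degree q. Polynomial.monom (poly.coeff q i ^ p) (p * i))"
    by (simp add: monom_power mult.commute)
  have cqp: "poly.coeff (q ^ p) (p * i) = poly.coeff q i ^ p" for i
  proof -
    have "poly.coeff (q ^ p) (p * i) = (\<Sum>j\<le>Polynomial.degree q. if j = i then poly.coeff q j ^ p else 0)"
      unfolding qp coeff_sum using p by (intro sum.cong) auto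
    also have "\<dots> = (if i \<le> Polynomial.degree q then poly.coeff q i ^ p else 0)" by simp
    finally show ?thesis using p by (simp add: coeff_eq_0 zero_power)
  qed
  have cqp0: "poly.coeff (q ^ p) m = 0" if "\<not> p dvd m" for m
    unfolding qp coeff_sum using that by (intro sum.neutral) auto
  have "poly.coeff (q ^ p * q') (p * n) = (\<Sum>m\<le>p * n. poly.coeff (q ^ p) m * poly.coeff q' (p * n - m))"
    by (simp add: coeff_mult)
  also have "\<dots> = (\<Sum>m\<in>(*) p ` {..n}. poly.coeff (q ^ p) m * poly.coeff q' (p * n - m))"
  proof (rule sum.mono_neutral_right)
    show "\<forall>m\<in>{..p * n} - (*) p ` {..n}. poly.coeff (q ^ p) m * poly.coeff q' (p * n - m) = 0"
    proof
      fix m assume m: "m \<in> {..p * n} - (*) p ` {..n}"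
      have "\<not> p dvd m"
      proof
        assume "p dvd m"
        then obtain i where "m = p * i" by (rule dvdE)
        then show False using m p by auto
      qed
      then show "poly.coeff (q ^ p) m * poly.coeff q' (p * n - m) = 0" by (simp add: cqp0)
    qed
  qed (use p in auto)
  also have "\<dots> = (\<Sum>i\<le>n. poly.coeff (q ^ p) (p * i) * poly.coeff q' (p * n - p * i))"
    by (subst sum.reindex) (use p in \<open>auto simp: inj_on_def\<close>)
  finally show ?thesis by (simp add: cqp right_diff_distrib')
qed

text \<open>The last property of \<open>\<phi>\<close> is used twice. It makes the map on degree
  \<open>n * p\<close> independent of representatives modulo \<open>J (n * p + 1)\<close>, and it
  sends \<open>J (p * n)\<close> into \<open>J n\<close>.\<close>

theorem F_pure_graded_ring:
  assumes p: "Factorial_Ring.prime p" "CHAR('r) = p"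
    and one: "1 \<notin> J (Suc 0)" and unit: "\<And>n::nat. \<not> p dvd n \<Longrightarrow> \<exists>y\<in>carrier R. y * of_nat n = 1"
    and phi: "\<And>x. x \<in> carrier R \<Longrightarrow> \<phi> x \<in> carrier R" 
      "\<And>x y. x \<in> carrier R \<Longrightarrow> y \<in> carrier R \<Longrightarrow> \<phi> (x + y) = \<phi> x + \<phi> y"
      "\<And>x y. x \<in> carrier R \<Longrightarrow> y \<in> carrier R \<Longrightarrow> \<phi> (x ^ p * y) = x * \<phi> y" "\<phi> 1 = 1"
      "\<And>n x. x \<in> J (n * p + 1) \<Longrightarrow> \<phi> x \<in> J (Suc n)"
  shows "F_pure TYPE('m) p gr"
  unfolding F_pure_def
proof (intro conjI)
  have p0: "0 < p" using p(1) by (simp add: prime_gt_0_nat)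
  have phi0: "\<phi> 0 = 0" using phi(2)[OF zero_carrier zero_carrier] by simp
  have phi_minus: "\<phi> (x - y) = \<phi> x - \<phi> y" if "x \<in> carrier R" "y \<in> carrier R" for x y
  proof -
    have "\<phi> ((x - y) + y) = \<phi> (x - y) + \<phi> y" by (rule phi(2)) (use that in \<open>auto intro: diff_carrier\<close>)
    then show ?thesis by (simp add: algebra_simps)
  qed
  have phi_sum: "\<phi> (sum f E) = (\<Sum>e\<in>E. \<phi> (f e))" if "finite E" "\<And>e. e \<in> E \<Longrightarrow> f e \<in> carrier R" for f :: "nat \<Rightarrow> 'r" and E
    using that by (induction E rule: finite_induct) (auto simp: phi0 phi(2) sum_carrier)
  note cs = coeff_split_poly[of \<phi>, OF phi0 p0]
  let ?\<Psi> = "split_poly \<phi> p"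
  have rc: "poly.coeff q n \<in> carrier R" if "q \<in> rees" for q n using J_carrier[OF reesD[OF that]] .
  have split_rees: "?\<Psi> q \<in> rees" if q: "q \<in> rees" for q
    unfolding rees_def
  proof (intro CollectI allI)
    fix n
    show "poly.coeff (?\<Psi> q) n \<in> J n"
    proof (cases n)
      case 0
      then show ?thesis using rc[OF q] by (simp add: cs J_0 phi)
    next
      case (Suc m)
      have "poly.coeff q (p * n) \<in> J (p * n)" by (rule reesD[OF q])
      \<comment> \<open>For \<open>n = Suc m\<close> the exponent \<open>p * n\<close> exceeds
        \<open>m * p\<close> by \<open>p\<close>, which is at least \<open>1\<close>; so the
        property of \<open>\<phi>\<close> applies with \<open>m\<close>.\<close>
      moreover have "m * p + 1 \<le> p * n" using Suc p0 by (simp add: algebra_simps)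
      ultimately have "poly.coeff q (p * n) \<in> J (m * p + 1)" using J_antimono by blast
      then show ?thesis using phi(5) Suc by (simp add: cs)
    qed
  qed
  have split_cong: "proj (?\<Psi> q) = proj (?\<Psi> q')" if q: "q \<in> rees" "q' \<in> rees" "proj q = proj q'" for q q'
    unfolding proj_eq
  proof
    fix n
    have "poly.coeff q (p * n) - poly.coeff q' (p * n) \<in> J (n * p + 1)"
      using q(3) unfolding proj_eq by (metis Suc_eq_plus1 mult.commute)
    then show "poly.coeff (?\<Psi> q) n - poly.coeff (?\<Psi> q') n \<in> J (Suc n)"
      unfolding cs phi_minus[OF rc[OF q(1)] rc[OF q(2)], symmetric] by (rule phi(5))
  qed
  \<comment> \<open>An arbitrary representative in the Rees-type ring; by \<open>split_cong\<close>
    the choice does not affect the image.\<close>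
  define rep where "rep g = (SOME q. q \<in> rees \<and> proj q = g)" for g
  have rep: "rep (proj q) \<in> rees \<and> proj (rep (proj q)) = proj q" if "q \<in> rees" for q
    unfolding rep_def by (rule someI[of _ q]) (use that in simp)
  define \<psi> where "\<psi> g = proj (?\<Psi> (rep g))" for g
  have psi: "\<psi> (proj q) = proj (?\<Psi> q)" if "q \<in> rees" for q
    unfolding \<psi>_def by (rule split_cong) (use rep[OF that] that in auto)
  show "pure_map TYPE('m) gr (regular_module gr) (frobenius_module p gr) (\<lambda>x. x [^]\<^bsub>gr\<^esub> p)"
  proof (rule pure_frobenius_if_split[OF gr_cring, where \<psi> = \<psi>])
    fix y assume "y \<in> carrier gr"
    then obtain q where q: "q \<in> rees" "y = proj q" by (rule gr_cases)
    then show "\<psi> y \<in> carrier gr" by (auto simp: psi intro: proj_in_carrier split_rees)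
  next
    fix y y' assume "y \<in> carrier gr" "y' \<in> carrier gr"
    then obtain q q' where q: "q \<in> rees" "y = proj q" "q' \<in> rees" "y' = proj q'" by (meson gr_cases)
    have "?\<Psi> (q + q') = ?\<Psi> q + ?\<Psi> q'"
      by (rule poly_eqI) (simp add: cs phi(2) rc q)
    then show "\<psi> (y \<oplus>\<^bsub>gr\<^esub> y') = \<psi> y \<oplus>\<^bsub>gr\<^esub> \<psi> y'"
      by (simp add: q gr_add psi rees_add split_rees)
  next
    fix s y assume "s \<in> carrier gr" "y \<in> carrier gr"
    then obtain q q' where q: "q \<in> rees" "s = proj q" "q' \<in> rees" "y = proj q'" by (meson gr_cases)
    have "?\<Psi> (q ^ p * q') = q * ?\<Psi> q'"
    proof (rule poly_eqI)
      fix n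
      have "poly.coeff (?\<Psi> (q ^ p * q')) n = (\<Sum>i\<le>n. \<phi> (poly.coeff q i ^ p * poly.coeff q' (p * (n - i))))"
        unfolding cs coeff_power_char_mult[OF p]
        by (rule phi_sum) (auto intro: mult_carrier power_carrier rc q)
      also have "\<dots> = (\<Sum>i\<le>n. poly.coeff q i * \<phi> (poly.coeff q' (p * (n - i))))"
        by (intro sum.cong refl phi(3) rc q)
      finally show "poly.coeff (?\<Psi> (q ^ p * q')) n = poly.coeff (q * ?\<Psi> q') n"
        by (simp add: coeff_mult cs)
    qed
    then show "\<psi> (s [^]\<^bsub>gr\<^esub> p \<otimes>\<^bsub>gr\<^esub> y) = s \<otimes>\<^bsub>gr\<^esub> \<psi> y"
      by (simp add: q gr_power gr_mult psi rees_mult rees_power split_rees)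
  next
    have "?\<Psi> 1 = 1" by (rule poly_eqI) (use p0 in \<open>auto simp: cs coeff_1 phi phi0\<close>)
    then show "\<psi> \<one>\<^bsub>gr\<^esub> = \<one>\<^bsub>gr\<^esub>" by (simp add: gr_one psi rees_one)
  qed
  show "cring gr" by (rule gr_cring)
  show "Factorial_Ring.prime p" by (rule p)
  show "has_characteristic gr p"
    by (rule gr_char[OF one unit]) (use p(2) in auto)
qed

end

section \<open>Determinants\<close>

text \<open>The new row comes first and the new column last, so that bordering a lower left block by
  a cell to its upper right keeps the indices increasing.\<close>

definition border_row :: "nat \<Rightarrow> (nat \<Rightarrow> nat) \<Rightarrow> nat \<Rightarrow> nat" where
  "border_row i \<rho> a = (case a of 0 \<Rightarrow> i | Suc e \<Rightarrow> \<rho> e)"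

definition border_col :: "nat \<Rightarrow> nat \<Rightarrow> (nat \<Rightarrow> nat) \<Rightarrow> nat \<Rightarrow> nat" where
  "border_col n m \<kappa> b = (if b < n then \<kappa> b else m)"

definition sub_mat :: "nat \<Rightarrow> (nat \<Rightarrow> nat \<Rightarrow> 'r) \<Rightarrow> (nat \<Rightarrow> nat) \<Rightarrow> (nat \<Rightarrow> nat) \<Rightarrow> 'r mat" where
  "sub_mat n A \<rho> \<kappa> = mat n n (\<lambda>(a, b). A (\<rho> a) (\<kappa> b))"

lemma sub_mat_carrier [simp]: "sub_mat n A \<rho> \<kappa> \<in> carrier_mat n n"
  by (simp add: sub_mat_def)

lemma sub_mat_index [simp]: "a < n \<Longrightarrow> b < n \<Longrightarrow> sub_mat n A \<rho> \<kappa> $$ (a, b) = A (\<rho> a) (\<kappa> b)"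
  by (simp add: sub_mat_def)

lemma adj_sub_mat:
  fixes A :: "nat \<Rightarrow> nat \<Rightarrow> 'r::comm_ring_1"
  assumes "a < n" "b < n"
  shows "(\<Sum>q<n. A (\<rho> a) (\<kappa> q) * adj_mat (sub_mat n A \<rho> \<kappa>) $$ (q, b)) =
      (if a = b then det (sub_mat n A \<rho> \<kappa>) else 0)"
    and "(\<Sum>e<n. adj_mat (sub_mat n A \<rho> \<kappa>) $$ (a, e) * A (\<rho> e) (\<kappa> b)) =
      (if a = b then det (sub_mat n A \<rho> \<kappa>) else 0)"
proof -
  let ?M = "sub_mat n A \<rho> \<kappa>"
  have dims: "dim_row ?M = n" "dim_col ?M = n" "dim_row (adj_mat ?M) = n" "dim_col (adj_mat ?M) = n"
    by (simp_all add: sub_mat_def adj_mat_def)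
  have "(?M * adj_mat ?M) $$ (a, b) = (det ?M \<cdot>\<^sub>m 1\<^sub>m n) $$ (a, b)"
    by (simp only: adj_mat(2)[OF sub_mat_carrier])
  then show "(\<Sum>q<n. A (\<rho> a) (\<kappa> q) * adj_mat ?M $$ (q, b)) = (if a = b then det ?M else 0)"
    using assms by (simp add: dims scalar_prod_def lessThan_atLeast0)
  have "(adj_mat ?M * ?M) $$ (a, b) = (det ?M \<cdot>\<^sub>m 1\<^sub>m n) $$ (a, b)"
    by (simp only: adj_mat(3)[OF sub_mat_carrier])
  then show "(\<Sum>e<n. adj_mat ?M $$ (a, e) * A (\<rho> e) (\<kappa> b)) = (if a = b then det ?M else 0)"
    using assms by (simp add: dims scalar_prod_def lessThan_atLeast0)
qed

text \<open>The usual Schur complement multiplied by the determinant of the block; the adjugate in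
  place of the inverse makes sense over any commutative ring.\<close>

definition schur_complement :: "nat \<Rightarrow> (nat \<Rightarrow> nat \<Rightarrow> 'r::comm_ring_1) \<Rightarrow> (nat \<Rightarrow> nat) \<Rightarrow> (nat \<Rightarrow> nat) \<Rightarrow> nat \<Rightarrow> nat \<Rightarrow> 'r" where
  "schur_complement n A \<rho> \<kappa> i m = det (sub_mat n A \<rho> \<kappa>) * A i m -
     (\<Sum>e<n. \<Sum>q<n. A i (\<kappa> q) * adj_mat (sub_mat n A \<rho> \<kappa>) $$ (q, e) * A (\<rho> e) m)"

text \<open>Expansion along the last column and then along the first row of the remaining minors
  produces the entries of the adjugate; the sign comes from the position of the border.\<close>

lemma det_border:
  fixes A :: "nat \<Rightarrow> nat \<Rightarrow> 'r::comm_ring_1"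
  shows "det (sub_mat (Suc n) A (border_row i \<rho>) (border_col n m \<kappa>)) =
      (-1) ^ n * schur_complement n A \<rho> \<kappa> i m"
proof -
  let ?W = "sub_mat (Suc n) A (border_row i \<rho>) (border_col n m \<kappa>)" and ?M = "sub_mat n A \<rho> \<kappa>"
  have dimW: "dim_row ?W = Suc n" "dim_col ?W = Suc n" by (simp_all add: sub_mat_def)
  have W0: "mat_delete ?W 0 n = ?M"
    by (rule eq_matI) (auto simp: mat_delete_def sub_mat_def border_row_def border_col_def)
  have cof: "cofactor ?W (Suc e) n = - ((-1) ^ n) * (\<Sum>q<n. A i (\<kappa> q) * adj_mat ?M $$ (q, e))" if e: "e < n" for e
  proof -
    let ?D = "mat_delete ?W (Suc e) n"
    have n: "0 < n" using e by simp
    have D: "?D \<in> carrier_mat n n" using dimW by (auto simp: mat_delete_def)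
    have D0: "?D $$ (0, q) = A i (\<kappa> q)" if "q < n" for q
      using that n by (simp add: mat_delete_def dimW border_row_def border_col_def)
    have DD: "mat_delete ?D 0 q = mat_delete ?M e q" if q: "q < n" for q
      by (rule eq_matI) (use e q in \<open>auto simp: mat_delete_def dimW sub_mat_def border_row_def border_col_def split: nat.splits\<close>)
    have "det ?D = (\<Sum>q<n. ?D $$ (0, q) * cofactor ?D 0 q)" by (rule laplace_expansion_row[OF D n])
    also have "\<dots> = (\<Sum>q<n. (-1) ^ e * (A i (\<kappa> q) * adj_mat ?M $$ (q, e)))"
    proof (rule sum.cong)
      fix q assume "q \<in> {..<n}"
      then have q: "q < n" by simp
      have "adj_mat ?M $$ (q, e) = (-1) ^ (e + q) * det (mat_delete ?M e q)"
        using q e by (simp add: adj_mat_def cofactor_def sub_mat_def)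
      moreover have "cofactor ?D 0 q = (-1) ^ q * det (mat_delete ?M e q)"
        by (simp add: cofactor_def DD[OF q])
      moreover have "(-1 :: 'r) ^ q = (-1) ^ e * (-1) ^ (e + q)"
        by (simp add: power_add[symmetric])
          (metis even_add minus_one_power_iff)
      ultimately show "?D $$ (0, q) * cofactor ?D 0 q = (-1) ^ e * (A i (\<kappa> q) * adj_mat ?M $$ (q, e))"
        by (simp add: D0[OF q] mult_ac)
    qed simp
    finally have "det ?D = (-1) ^ e * (\<Sum>q<n. A i (\<kappa> q) * adj_mat ?M $$ (q, e))"
      by (simp add: sum_distrib_left)
    then have "cofactor ?W (Suc e) n = (-1) ^ (Suc e + n) * (-1) ^ e * (\<Sum>q<n. A i (\<kappa> q) * adj_mat ?M $$ (q, e))"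
      by (simp add: cofactor_def)
    also have "(-1 :: 'r) ^ (Suc e + n) * (-1) ^ e = - ((-1) ^ n)"
      by (cases "even e"; cases "even n") auto
    finally show ?thesis .
  qed
  have "det ?W = (\<Sum>a<Suc n. ?W $$ (a, n) * cofactor ?W a n)"
    by (rule laplace_expansion_column[OF sub_mat_carrier]) simp
  also have "\<dots> = ?W $$ (0, n) * cofactor ?W 0 n + (\<Sum>e<n. ?W $$ (Suc e, n) * cofactor ?W (Suc e) n)"
    by (rule sum.lessThan_Suc_shift)
  also have "?W $$ (0, n) * cofactor ?W 0 n = (-1) ^ n * (det ?M * A i m)"
    by (simp add: cofactor_def W0 border_row_def border_col_def)
  also have "(\<Sum>e<n. ?W $$ (Suc e, n) * cofactor ?W (Suc e) n) =
      (\<Sum>e<n. - ((-1) ^ n) * (\<Sum>q<n. A i (\<kappa> q) * adj_mat ?M $$ (q, e) * A (\<rho> e) m))"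
    by (rule sum.cong) (auto simp: cof border_row_def border_col_def sum_distrib_left sum_distrib_right mult_ac)
  also have "\<dots> = - ((-1) ^ n) * (\<Sum>e<n. \<Sum>q<n. A i (\<kappa> q) * adj_mat ?M $$ (q, e) * A (\<rho> e) m)"
    by (simp add: sum_distrib_left)
  finally show ?thesis by (simp add: schur_complement_def algebra_simps)
qed

text \<open>Block elimination: the matrix is the product of the two triangular block matrices
  \<open>?W1\<close> and \<open>?W2\<close>, one of determinant \<open>1\<close>.\<close>

lemma det_block_schur:
  fixes B C E :: "'r::idom mat"
  assumes B: "B \<in> carrier_mat n r" and C: "C \<in> carrier_mat r n" and E: "E \<in> carrier_mat n n"
  shows "det (four_block_mat (1\<^sub>m r) (- C) B E) = det (B * C + E)"
proof -
  let ?W1 = "four_block_mat (1\<^sub>m r) (0\<^sub>m r n) B (1\<^sub>m n)" and ?W2 = "four_block_mat (1\<^sub>m r) (- C) (0\<^sub>m n r) (B * C + E)"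
  have "B * - C + (B * C + E) = - (B * C) + (B * C + E)"
    using B C by (simp add: mult_minus_distrib_mat[of B n r C n])
  also have "\<dots> = E" by (rule eq_matI) (use B C E in auto)
  finally have "?W1 * ?W2 = four_block_mat (1\<^sub>m r) (- C) B E"
    using B C E by (subst mult_four_block_mat[of _ r r _ n _ n _ _ r _ n]) auto
  then have "det (four_block_mat (1\<^sub>m r) (- C) B E) = det ?W1 * det ?W2"
    using det_mult[of ?W1 "r + n" ?W2] B C E by auto
  also have "det ?W1 = 1"
    using B by (subst det_four_block_mat_upper_right_zero[of _ r _ n]) auto
  also have "det ?W2 = det (B * C + E)"
    using B C E by (subst det_four_block_mat_lower_left_zero[of _ r _ n]) auto
  finally show ?thesis by simp
qed

lemma (in typed_cring) power_neg_one_mult: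
  assumes "ideal I R" "x \<in> I"
  shows "(-1) ^ n * x \<in> I"
  by (rule idealD(4)[OF assms(1) power_carrier[OF minus_carrier[OF one_carrier]] assms(2)])

locale typed_idom = typed_cring R for R :: "'r::idom ring"
begin

text \<open>In the Leibniz expansion of the block determinant of \<^const>\<open>four_block_mat\<close> shape, every
  term contains at least \<open>n - r\<close> entries of \<open>E\<close>.\<close>

lemma det_factor_plus_in_ideal_power:
  assumes I: "ideal I R"
    and B: "\<And>a q. a < n \<Longrightarrow> q < r \<Longrightarrow> B a q \<in> carrier R"
    and C: "\<And>q b. q < r \<Longrightarrow> b < n \<Longrightarrow> C q b \<in> carrier R"
    and E: "\<And>a b. a < n \<Longrightarrow> b < n \<Longrightarrow> E a b \<in> I"
  shows "det (mat n n (\<lambda>(a, b). (\<Sum>q<r. B a q * C q b) + E a b)) \<in> ideal_power I (n - r)"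
proof -
  let ?B = "mat n r (\<lambda>(a, q). B a q)" and ?C = "mat r n (\<lambda>(q, b). C q b)" and ?E = "mat n n (\<lambda>(a, b). E a b)"
  let ?W = "four_block_mat (1\<^sub>m r) (- ?C) ?B ?E"
  have "mat n n (\<lambda>(a, b). (\<Sum>q<r. B a q * C q b) + E a b) = ?B * ?C + ?E"
    by (rule eq_matI) (auto simp: scalar_prod_def lessThan_atLeast0)
  then have "det (mat n n (\<lambda>(a, b). (\<Sum>q<r. B a q * C q b) + E a b)) = det ?W"
    using det_block_schur[of ?B n r ?C ?E] by simp
  also have "\<dots> = (\<Sum>q | q permutes {0..<r + n}. signof q * (\<Prod>a = 0..<r + n. ?W $$ (a, q a)))"
    by (rule det_def') auto
  also have "\<dots> \<in> ideal_power I (n - r)"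
  proof (rule ideal_sum[OF ideal_power_ideal[OF I]])
    fix s assume "s \<in> {q. q permutes {0..<r + n}}"
    then have s: "s permutes {0..<r + n}" by simp
    have s_lt: "s a < r + n" if "a < r + n" for a using permutes_in_image[OF s, of a] that by simp
    \<comment> \<open>The lower rows that the permutation sends to the right columns, where the
      entries come from \<open>E\<close>. At most \<open>r\<close> lower rows can go to the left
      columns, so at least \<open>n - r\<close> remain.\<close>
    define K where "K = {a\<in>{r..<r + n}. r \<le> s a}"
    have WR: "?W $$ (a, b) \<in> carrier R" if "a < r + n" "b < r + n" for a b
      using that idealD(1)[OF I E] by (auto simp: B C intro!: carrier_intros)
    have WI: "?W $$ (a, s a) \<in> ideal_power I 1" if "a \<in> K" for a
    proof -
      have "r \<le> a" "a < r + n" "r \<le> s a" "s a < r + n" using that s_lt by (auto simp: K_def)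
      then have "?W $$ (a, s a) = E (a - r) (s a - r)" by simp
      moreover have "E (a - r) (s a - r) \<in> I" using \<open>r \<le> a\<close> \<open>a < r + n\<close> \<open>r \<le> s a\<close> \<open>s a < r + n\<close> by (intro E) auto
      ultimately show ?thesis using ideal_power_1[OF I] by simp
    qed
    have "card ({r..<r + n} - K) \<le> card {..<r}"
      by (rule card_inj_on_le[of s]) (auto simp: K_def intro: inj_on_subset[OF permutes_inj[OF s]])
    moreover have "card ({r..<r + n} - K) = n - card K"
      by (subst card_Diff_subset) (auto simp: K_def)
    ultimately have cardK: "n - r \<le> card K" by simp
    have "(\<Prod>a\<in>K. ?W $$ (a, s a)) \<in> ideal_power I (\<Sum>a\<in>K. 1)"
      by (rule ideal_power_prod[OF I _ WI]) (auto simp: K_def)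
    then have PK: "(\<Prod>a\<in>K. ?W $$ (a, s a)) \<in> ideal_power I (n - r)"
      using ideal_power_antimono[OF I cardK] by auto
    have PC: "(\<Prod>a\<in>{0..<r + n} - K. ?W $$ (a, s a)) \<in> carrier R"
      by (intro prod_carrier WR s_lt) auto
    have "(\<Prod>a = 0..<r + n. ?W $$ (a, s a)) =
        (\<Prod>a\<in>{0..<r + n} - K. ?W $$ (a, s a)) * (\<Prod>a\<in>K. ?W $$ (a, s a))"
      by (rule prod.subset_diff) (auto simp: K_def)
    then have "(\<Prod>a = 0..<r + n. ?W $$ (a, s a)) \<in> ideal_power I (n - r)"
      using idealD(4)[OF ideal_power_ideal[OF I] PC PK] by simp
    then show "signof s * (\<Prod>a = 0..<r + n. ?W $$ (a, s a)) \<in> ideal_power I (n - r)"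
      using idealD(6)[OF ideal_power_ideal[OF I]] by (cases "evenperm s") (auto simp: sign_def)
  qed
  finally show ?thesis .
qed

section \<open>Contractions of localizations\<close>

definition contraction :: "'r set \<Rightarrow> 'r set \<Rightarrow> 'r set" where
  "contraction P K = {x \<in> carrier R. \<exists>s\<in>carrier R - P. s * x \<in> K}"

lemma contraction_ideal:
  assumes P: "primeideal P R" and K: "ideal K R"
  shows "ideal (contraction P K) R"
proof (rule idealI')
  show "contraction P K \<subseteq> carrier R" by (auto simp: contraction_def)
  show "0 \<in> contraction P K"
    unfolding contraction_def using idealD(2)[OF K] primeidealD(2)[OF P]
    by (auto intro!: carrier_intros bexI[of _ 1])
  fix x y assume "x \<in> contraction P K" "y \<in> contraction P K"
  then obtain s s' where s: "x \<in> carrier R" "y \<in> carrier R" "s \<in> carrier R - P" "s * x \<in> K" "s' \<in> carrier R - P" "s' * y \<in> K"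
    by (auto simp: contraction_def)
  have "s' * (s * x) + s * (s' * y) \<in> K"
    by (rule idealD(3)[OF K idealD(4)[OF K] idealD(4)[OF K]]) (use s in auto)
  then have "s * s' * (x + y) \<in> K" by (simp add: algebra_simps)
  moreover have "s * s' \<in> carrier R - P"
    using s primeidealD(3)[OF P, of s s'] by (auto intro: mult_carrier)
  ultimately show "x + y \<in> contraction P K" using s by (auto simp: contraction_def intro: add_carrier)
next
  fix a x assume "a \<in> carrier R" "x \<in> contraction P K"
  then obtain s where s: "a \<in> carrier R" "x \<in> carrier R" "s \<in> carrier R - P" "s * x \<in> K"
    by (auto simp: contraction_def)
  have "a * (s * x) \<in> K" by (rule idealD(4)[OF K]) (use s in auto)
  then have "s * (a * x) \<in> K" by (simp add: mult.left_commute)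
  then show "a * x \<in> contraction P K" using s by (auto simp: contraction_def intro: mult_carrier)
qed

lemma subset_contraction:
  assumes P: "primeideal P R" and K: "ideal K R"
  shows "K \<subseteq> contraction P K"
proof
  fix x assume "x \<in> K"
  then show "x \<in> contraction P K"
    unfolding contraction_def using idealD(1)[OF K] primeidealD(2)[OF P] one_carrier
    by (auto intro!: bexI[of _ 1])
qed

lemma contraction_cancel:
  assumes P: "primeideal P R" and "x \<in> carrier R" "s \<in> carrier R" "s \<notin> P" "s * x \<in> contraction P K"
  shows "x \<in> contraction P K"
proof -
  obtain s' where s': "s' \<in> carrier R - P" "s' * (s * x) \<in> K" using assms(5) by (auto simp: contraction_def)
  have "s' * s \<in> carrier R - P"
    using s' assms primeidealD(3)[OF P, of s' s] by (auto intro: mult_carrier)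
  moreover have "s' * s * x \<in> K" using s'(2) by (simp add: mult.assoc)
  ultimately show ?thesis using assms(2) unfolding contraction_def by blast
qed

lemma ideal_power_contraction:
  assumes P: "primeideal P R" and K: "ideal K R" and I: "ideal I R" "I \<subseteq> contraction P K"
  shows "ideal_power I n \<subseteq> contraction P (ideal_power K n)"
proof (rule ideal_power_least[OF I(1)])
  show "ideal (contraction P (ideal_power K n)) R" for n
    by (rule contraction_ideal[OF P ideal_power_ideal[OF K]])
  show "contraction P (ideal_power K 0) = carrier R"
    unfolding ideal_power_0 contraction_def using primeidealD(2)[OF P]
    by (auto intro!: bexI[of _ 1] one_carrier)
  fix n x y assume x: "x \<in> contraction P (ideal_power K n)" and "y \<in> I"
  then have "y \<in> contraction P K" using I(2) by blast
  then obtain s s' where s: "x \<in> carrier R" "y \<in> carrier R" "s \<in> carrier R - P" "s * x \<in> ideal_power K n"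
      "s' \<in> carrier R - P" "s' * y \<in> K"
    using x by (auto simp: contraction_def)
  have "(s * x) * (s' * y) \<in> ideal_power K (Suc n)" by (rule ideal_power_Suc_mult) (use s in auto)
  then have "s * s' * (x * y) \<in> ideal_power K (Suc n)" by (simp add: mult_ac)
  moreover have "s * s' \<in> carrier R - P"
    using s primeidealD(3)[OF P, of s s'] by (auto intro: mult_carrier)
  ultimately show "x * y \<in> contraction P (ideal_power K (Suc n))"
    unfolding contraction_def using s by (blast intro: mult_carrier)
qed

text \<open>Membership is tested on monomials only: passing to the colon ideal by one generator
  \<open>g e\<close> lowers the degree by one.\<close>

lemma ideal_power_generators:
  assumes fin: "finite E" and g: "\<And>e. e \<in> E \<Longrightarrow> g e \<in> carrier R" and K: "ideal K R"
    and gen: "\<And>a. (\<Sum>e\<in>E. a e) = n \<Longrightarrow> (\<Prod>e\<in>E. g e ^ a e) \<in> K"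
  shows "ideal_power (Idl\<^bsub>R\<^esub> (g ` E)) n \<subseteq> K"
  using K gen
proof (induction n arbitrary: K)
  case 0
  have "1 \<in> K" using 0(2)[of "\<lambda>_. 0"] by simp
  then show ?case unfolding ideal_power_0 using idealD(5)[OF 0(1), of _ 1] by auto
next
  case (Suc n)
  define K' where "K' e = {x \<in> carrier R. x * g e \<in> K}" for e
  have K'id: "ideal (K' e) R" if "e \<in> E" for e
    by (rule idealI')
      (auto simp: K'_def distrib_right mult.assoc intro: carrier_intros idealD[OF Suc.prems(1)])
  have sub: "ideal_power (Idl\<^bsub>R\<^esub> (g ` E)) n \<subseteq> K' e" if e: "e \<in> E" for e
  proof (rule Suc.IH[OF K'id[OF e]])
    fix a :: "'a \<Rightarrow> nat" assume a: "(\<Sum>e\<in>E. a e) = n"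
    have ne: "(\<Prod>e'\<in>E - {e}. g e' ^ (a(e := Suc (a e))) e') = (\<Prod>e'\<in>E - {e}. g e' ^ a e')"
      by (rule prod.cong) auto
    have "(\<Sum>e'\<in>E. (a(e := Suc (a e))) e') = Suc n"
    proof -
      have "(\<Sum>e'\<in>E - {e}. (a(e := Suc (a e))) e') = (\<Sum>e'\<in>E - {e}. a e')"
        by (rule sum.cong) auto
      then show ?thesis
        using a unfolding sum.remove[OF fin e, of a] sum.remove[OF fin e, of "a(e := Suc (a e))"] by simp
    qed
    then have "(\<Prod>e'\<in>E. g e' ^ (a(e := Suc (a e))) e') \<in> K" by (rule Suc.prems(2))
    also have "(\<Prod>e'\<in>E. g e' ^ (a(e := Suc (a e))) e') = g e ^ Suc (a e) * (\<Prod>e'\<in>E - {e}. g e' ^ a e')"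
      unfolding prod.remove[OF fin e] ne by simp
    also have "\<dots> = (\<Prod>e\<in>E. g e ^ a e) * g e"
      unfolding prod.remove[OF fin e, of "\<lambda>e. g e ^ a e"] by (simp add: mult_ac)
    finally show "(\<Prod>e\<in>E. g e ^ a e) \<in> K' e"
      unfolding K'_def using g by (auto intro!: prod_carrier power_carrier)
  qed
  have gE: "g ` E \<subseteq> carrier R" using g by blast
  define J where "J = {y \<in> carrier R. \<forall>x\<in>ideal_power (Idl\<^bsub>R\<^esub> (g ` E)) n. x * y \<in> K}"
  have "ideal J R"
    by (rule idealI')
      (auto simp: J_def distrib_left mult.left_commute intro: carrier_intros idealD[OF Suc.prems(1)])
  moreover have "g ` E \<subseteq> J" using sub g by (auto simp: J_def K'_def)
  ultimately have J: "Idl\<^bsub>R\<^esub> (g ` E) \<subseteq> J" by (rule genideal_minimal)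
  show ?case
  proof
    fix z assume "z \<in> ideal_power (Idl\<^bsub>R\<^esub> (g ` E)) (Suc n)"
    then show "z \<in> K"
      unfolding ideal_power_Suc
      by (induction rule: ideal_prod.induct) (use J idealD(3)[OF Suc.prems(1)] in \<open>auto simp: J_def\<close>)
  qed
qed

end

text \<open>Cramer coefficients: up to Schur complements, the determinant times column
  \<open>m\<close> is the combination of the block columns with these coefficients.
  \<open>schur_nu\<close> does the same for rows.\<close>

definition schur_mu :: "nat \<Rightarrow> (nat \<Rightarrow> nat \<Rightarrow> 'r::comm_ring_1) \<Rightarrow> (nat \<Rightarrow> nat) \<Rightarrow> (nat \<Rightarrow> nat) \<Rightarrow> nat \<Rightarrow> nat \<Rightarrow> 'r" where
  "schur_mu n A \<rho> \<kappa> m q = (\<Sum>e<n. adj_mat (sub_mat n A \<rho> \<kappa>) $$ (q, e) * A (\<rho> e) m)"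

definition schur_nu :: "nat \<Rightarrow> (nat \<Rightarrow> nat \<Rightarrow> 'r::comm_ring_1) \<Rightarrow> (nat \<Rightarrow> nat) \<Rightarrow> (nat \<Rightarrow> nat) \<Rightarrow> nat \<Rightarrow> nat \<Rightarrow> 'r" where
  "schur_nu n A \<rho> \<kappa> i e = (\<Sum>q<n. A i (\<kappa> q) * adj_mat (sub_mat n A \<rho> \<kappa>) $$ (q, e))"

lemma schur_complement_nu:
  "schur_complement n A \<rho> \<kappa> i m =
     det (sub_mat n A \<rho> \<kappa>) * A i m - (\<Sum>e<n. schur_nu n A \<rho> \<kappa> i e * A (\<rho> e) m)"
  by (simp add: schur_complement_def schur_nu_def sum_distrib_right)

lemma schur_complement_mu:
  "schur_complement n A \<rho> \<kappa> i m =
     det (sub_mat n A \<rho> \<kappa>) * A i m - (\<Sum>q<n. A i (\<kappa> q) * schur_mu n A \<rho> \<kappa> m q)"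
proof -
  have "(\<Sum>e<n. \<Sum>q<n. A i (\<kappa> q) * adj_mat (sub_mat n A \<rho> \<kappa>) $$ (q, e) * A (\<rho> e) m) =
      (\<Sum>q<n. \<Sum>e<n. A i (\<kappa> q) * adj_mat (sub_mat n A \<rho> \<kappa>) $$ (q, e) * A (\<rho> e) m)"
    by (rule sum.swap)
  then show ?thesis by (simp add: schur_complement_def schur_mu_def sum_distrib_left mult.assoc)
qed

lemma schur_complement_row:
  assumes "e0 < n"
  shows "schur_complement n A \<rho> \<kappa> (\<rho> e0) m = 0"
proof -
  have "schur_nu n A \<rho> \<kappa> (\<rho> e0) e = (if e0 = e then det (sub_mat n A \<rho> \<kappa>) else 0)" if "e < n" for e
    unfolding schur_nu_def by (rule adj_sub_mat(1)[OF assms that])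
  then have "(\<Sum>e<n. schur_nu n A \<rho> \<kappa> (\<rho> e0) e * A (\<rho> e) m) =
      (\<Sum>e<n. if e0 = e then det (sub_mat n A \<rho> \<kappa>) * A (\<rho> e) m else 0)"
    by (intro sum.cong) auto
  then show ?thesis using assms by (simp add: schur_complement_nu)
qed

lemma schur_complement_col:
  assumes "q0 < n"
  shows "schur_complement n A \<rho> \<kappa> i (\<kappa> q0) = 0"
proof -
  have "schur_mu n A \<rho> \<kappa> (\<kappa> q0) q = (if q = q0 then det (sub_mat n A \<rho> \<kappa>) else 0)" if "q < n" for q
    unfolding schur_mu_def by (rule adj_sub_mat(2)[OF that assms])
  then have "(\<Sum>q<n. A i (\<kappa> q) * schur_mu n A \<rho> \<kappa> (\<kappa> q0) q) =
      (\<Sum>q<n. if q = q0 then det (sub_mat n A \<rho> \<kappa>) * A i (\<kappa> q) else 0)"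
    by (intro sum.cong) auto
  then show ?thesis using assms by (simp add: schur_complement_mu)
qed

text \<open>One entry is expanded by rows of the first block and by columns of the second. The
  double sum over entries in rows of the first and columns of the second block occurs on both sides
  and cancels.\<close>

lemma schur_complement_exchange:
  fixes A :: "nat \<Rightarrow> nat \<Rightarrow> 'r::comm_ring_1"
  shows "det (sub_mat n' A \<rho>' \<kappa>') * schur_complement n A \<rho> \<kappa> i m -
      det (sub_mat n A \<rho> \<kappa>) * schur_complement n' A \<rho>' \<kappa>' i m =
      (\<Sum>q<n'. schur_mu n' A \<rho>' \<kappa>' m q * schur_complement n A \<rho> \<kappa> i (\<kappa>' q)) -
      (\<Sum>e<n. schur_nu n A \<rho> \<kappa> i e * schur_complement n' A \<rho>' \<kappa>' (\<rho> e) m)"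
proof -
  let ?D = "det (sub_mat n A \<rho> \<kappa>)" and ?D' = "det (sub_mat n' A \<rho>' \<kappa>')"
  let ?nu = "schur_nu n A \<rho> \<kappa> i" and ?mu = "schur_mu n' A \<rho>' \<kappa>' m"
  let ?S = "\<Sum>q<n'. \<Sum>e<n. ?mu q * (?nu e * A (\<rho> e) (\<kappa>' q))"
  have "(\<Sum>q<n'. ?mu q * schur_complement n A \<rho> \<kappa> i (\<kappa>' q)) =
      (\<Sum>q<n'. ?D * (A i (\<kappa>' q) * ?mu q) - (\<Sum>e<n. ?mu q * (?nu e * A (\<rho> e) (\<kappa>' q))))"
    by (intro sum.cong refl) (simp add: schur_complement_nu right_diff_distrib sum_distrib_left mult_ac)
  then have 1: "(\<Sum>q<n'. ?mu q * schur_complement n A \<rho> \<kappa> i (\<kappa>' q)) =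
      ?D * (\<Sum>q<n'. A i (\<kappa>' q) * ?mu q) - ?S"
    by (simp add: sum_subtractf sum_distrib_left)
  have "(\<Sum>e<n. ?nu e * schur_complement n' A \<rho>' \<kappa>' (\<rho> e) m) =
      (\<Sum>e<n. ?D' * (?nu e * A (\<rho> e) m) - (\<Sum>q<n'. ?mu q * (?nu e * A (\<rho> e) (\<kappa>' q))))"
    by (intro sum.cong refl) (simp add: schur_complement_mu right_diff_distrib sum_distrib_left mult_ac)
  then have 2: "(\<Sum>e<n. ?nu e * schur_complement n' A \<rho>' \<kappa>' (\<rho> e) m) =
      ?D' * (\<Sum>e<n. ?nu e * A (\<rho> e) m) - (\<Sum>e<n. \<Sum>q<n'. ?mu q * (?nu e * A (\<rho> e) (\<kappa>' q)))"
    by (simp add: sum_subtractf sum_distrib_left)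
  have 3: "(\<Sum>e<n. \<Sum>q<n'. ?mu q * (?nu e * A (\<rho> e) (\<kappa>' q))) = ?S" by (rule sum.swap)
  have 4: "?D' * schur_complement n A \<rho> \<kappa> i m = ?D' * (?D * A i m) - ?D' * (\<Sum>e<n. ?nu e * A (\<rho> e) m)"
    by (simp add: schur_complement_nu right_diff_distrib)
  have 5: "?D * schur_complement n' A \<rho>' \<kappa>' i m = ?D * (?D' * A i m) - ?D * (\<Sum>q<n'. A i (\<kappa>' q) * ?mu q)"
    by (simp add: schur_complement_mu right_diff_distrib)
  show ?thesis unfolding 1 2 3 4 5 by (simp add: mult.left_commute)
qed

lemma (in typed_cring) adj_carrier:
  assumes "\<And>a b. a < n \<Longrightarrow> b < n \<Longrightarrow> A (\<rho> a) (\<kappa> b) \<in> carrier R" "q < n" "e < n"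
  shows "adj_mat (sub_mat n A \<rho> \<kappa>) $$ (q, e) \<in> carrier R"
proof -
  have "det (mat_delete (sub_mat n A \<rho> \<kappa>) e q) \<in> carrier R"
    by (rule det_carrier[OF mat_delete_carrier[OF sub_mat_carrier]])
      (use assms in \<open>auto simp: mat_delete_def sub_mat_def\<close>)
  then show ?thesis
    using assms(2,3) by (auto simp: adj_mat_def cofactor_def sub_mat_def
      intro!: mult_carrier power_carrier minus_carrier one_carrier)
qed

lemma (in typed_cring) ideal_power_1_subset: "ideal I R \<Longrightarrow> ideal_power I (Suc 0) \<subseteq> I"
  unfolding ideal_power_Suc using ideal_prod_inter[OF ideal_power_ideal[of I 0], of I] by blast

text \<open>Together with the ladder property, \<open>gap_in\<close> places the whole corner block
  of each condition inside \<open>L\<close>, so that \<open>delta j\<close> is a polynomial in the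
  entries of \<open>L\<close>.\<close>

locale ladder_data = rank_conditions k l v d c r for k l v d c r +
  fixes L :: "(nat \<times> nat) set" and type :: "'k::field itself"
  assumes ladder: "is_ladder k l L"
    and corner_in: "j \<in> {1..v} \<Longrightarrow> (d j, c j) \<in> L"
    and gap_in: "j \<in> {1..v} \<Longrightarrow> (d j - r j, c j + r j) \<in> L"
begin

abbreviation R :: "'k matpoly ring" where "R \<equiv> ladder_ring L"

sublocale typed_idom R
  by (rule typed_idom.intro) (rule typed_cring_ladder_ring)

definition entry :: "nat \<Rightarrow> nat \<Rightarrow> 'k matpoly" where "entry i m = indet (i, m)"
definition rho :: "nat \<Rightarrow> nat \<Rightarrow> nat" where "rho j e = d j - r j + 1 + e"
definition kap :: "nat \<Rightarrow> nat \<Rightarrow> nat" where "kap j q = c j + q"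
definition delta :: "nat \<Rightarrow> 'k matpoly" where "delta j = det (sub_mat (r j) entry (rho j) (kap j))"
definition bord :: "nat \<Rightarrow> nat \<Rightarrow> nat \<Rightarrow> 'k matpoly" where
  "bord j i m = schur_complement (r j) entry (rho j) (kap j) i m"
definition I :: "'k matpoly set" where "I = mixed_ladder_ideal l L v d c (\<lambda>j. Suc (r j))"
text \<open>The cells that can border the corner block of \<open>j\<close> from above and from the
  right inside the ladder.\<close>

definition reach :: "nat \<Rightarrow> (nat \<times> nat) set" where
  "reach j = {(i, m). (i, m) \<in> L \<and> i \<le> d j - r j \<and> c j + r j \<le> m}"

lemma L_bounds: "(i, m) \<in> L \<Longrightarrow> 1 \<le> i \<and> i \<le> k \<and> 1 \<le> m \<and> m \<le> l"
  using ladder by (auto simp: is_ladder_def)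

lemma finite_L: "finite L"
proof (rule finite_subset)
  show "L \<subseteq> {1..k} \<times> {1..l}" using ladder by (simp add: is_ladder_def)
qed simp

lemma in_rect:
  assumes "j \<in> {1..v}" "(i, m) \<in> L" "i \<le> i'" "i' \<le> d j" "c j \<le> m'" "m' \<le> m"
  shows "(i', m') \<in> L"
proof -
  have "{i..d j} \<times> {c j..m} \<subseteq> L"
    using ladder assms corner_in[OF assms(1)] unfolding is_ladder_def
    by (meson order_trans)
  then show ?thesis using assms by auto
qed

lemma entry_carrier: "(i, m) \<in> L \<Longrightarrow> entry i m \<in> carrier R"
  unfolding entry_def by (rule indet_carrier)

lemma reachD:
  "(i, m) \<in> reach j \<Longrightarrow> (i, m) \<in> L \<and> i \<le> d j - r j \<and> c j + r j \<le> m"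
  by (simp add: reach_def)

lemma corner_in_L:
  assumes "j \<in> {1..v}" "e < r j" "q < r j"
  shows "(rho j e, kap j q) \<in> L"
  by (rule in_rect[OF assms(1) gap_in[OF assms(1)]])
    (use assms corner_bounds[OF assms(1)] in \<open>auto simp: rho_def kap_def\<close>)

lemma delta_carrier: "j \<in> {1..v} \<Longrightarrow> delta j \<in> carrier R"
  unfolding delta_def
  by (rule det_carrier[OF sub_mat_carrier]) (auto intro!: entry_carrier corner_in_L)

lemma adj_in_carrier:
  "j \<in> {1..v} \<Longrightarrow> q < r j \<Longrightarrow> e < r j \<Longrightarrow> adj_mat (sub_mat (r j) entry (rho j) (kap j)) $$ (q, e) \<in> carrier R"
  by (rule adj_carrier) (auto intro!: entry_carrier corner_in_L)

lemma nu_carrier: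
  assumes j: "j \<in> {1..v}" and im: "(i, m) \<in> L" "i \<le> d j" "c j + r j \<le> m" and e: "e < r j"
  shows "schur_nu (r j) entry (rho j) (kap j) i e \<in> carrier R"
  unfolding schur_nu_def
proof (rule sum_carrier)
  fix q assume "q \<in> {..<r j}"
  then have q: "q < r j" by simp
  have "(i, kap j q) \<in> L" by (rule in_rect[OF j im(1)]) (use im q in \<open>auto simp: kap_def\<close>)
  then show "entry i (kap j q) * adj_mat (sub_mat (r j) entry (rho j) (kap j)) $$ (q, e) \<in> carrier R"
    by (intro mult_carrier entry_carrier adj_in_carrier j q e)
qed

lemma mu_carrier:
  assumes j: "j \<in> {1..v}" and im: "(i, m) \<in> L" "i \<le> d j - r j" "c j \<le> m" and q: "q < r j"
  shows "schur_mu (r j) entry (rho j) (kap j) m q \<in> carrier R"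
  unfolding schur_mu_def
proof (rule sum_carrier)
  fix e assume "e \<in> {..<r j}"
  then have e: "e < r j" by simp
  have "(rho j e, m) \<in> L"
    by (rule in_rect[OF j im(1)]) (use im e corner_bounds[OF j] in \<open>auto simp: rho_def\<close>)
  then show "adj_mat (sub_mat (r j) entry (rho j) (kap j)) $$ (q, e) * entry (rho j e) m \<in> carrier R"
    by (intro mult_carrier entry_carrier adj_in_carrier j q e)
qed

lemma bord_corner_row:
  assumes "j \<in> {1..v}" "d j - r j < i" "i \<le> d j"
  shows "bord j i m = 0"
proof -
  have "i = rho j (i - (d j - r j + 1))" "i - (d j - r j + 1) < r j"
    using assms corner_bounds[OF assms(1)] by (auto simp: rho_def)
  then show ?thesis unfolding bord_def using schur_complement_row by metis
qed

lemma bord_corner_col: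
  assumes "c j \<le> m" "m < c j + r j"
  shows "bord j i m = 0"
proof -
  have "m = kap j (m - c j)" "m - c j < r j" using assms by (auto simp: kap_def)
  then show ?thesis unfolding bord_def using schur_complement_col by metis
qed

lemma minor_eq_det: "minor n f g = det (sub_mat n entry f g)"
  by (simp add: minor_def sub_mat_def entry_def)

lemma subladder_iff: "(i, m) \<in> subladder l L d c j \<longleftrightarrow> (i, m) \<in> L \<and> i \<le> d j \<and> c j \<le> m"
  using L_bounds by (auto simp: subladder_def)

lemma submatrix_entry:
  "submatrix_in n L' f g \<Longrightarrow> a < n \<Longrightarrow> b < n \<Longrightarrow> (f a, g b) \<in> L'"
  by (auto simp: submatrix_in_def)

lemma minor_carrier:
  assumes "submatrix_in n L' f g" "L' \<subseteq> L"
  shows "minor n f g \<in> carrier R"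
  unfolding minor_eq_det
  by (rule det_carrier[OF sub_mat_carrier]) (use submatrix_entry[OF assms(1)] assms(2) in \<open>auto intro!: entry_carrier\<close>)

lemma subladder_subset: "subladder l L d c j \<subseteq> L"
  by (auto simp: subladder_def)

lemma minors_ideal_ideal: "ideal (minors_ideal L n (subladder l L d c j)) R"
  unfolding minors_ideal_def by (rule genideal_ideal) (use minor_carrier subladder_subset in blast)

lemma I_ideal: "ideal I R"
  unfolding I_def mixed_ladder_ideal_def
  by (rule genideal_ideal) (use idealD(1)[OF minors_ideal_ideal] in blast)

lemma minor_in_I:
  assumes "j \<in> {1..v}" "submatrix_in (Suc (r j)) (subladder l L d c j) f g"
  shows "minor (Suc (r j)) f g \<in> I"
proof -
  have "(minor (Suc (r j)) f g :: 'k matpoly) \<in> minors_ideal L (Suc (r j)) (subladder l L d c j)"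
    unfolding minors_ideal_def
    by (rule subsetD[OF genideal_self]) (use assms minor_carrier subladder_subset in blast)+
  moreover have "(\<Union>j\<in>{1..v}. minors_ideal L (Suc (r j)) (subladder l L d c j)) \<subseteq> I"
    unfolding I_def mixed_ladder_ideal_def
    by (rule genideal_self) (use idealD(1)[OF minors_ideal_ideal] in blast)
  ultimately show ?thesis using assms(1) by blast
qed

lemma I_least:
  assumes K: "ideal K R"
    and minors: "\<And>j f g. j \<in> {1..v} \<Longrightarrow> submatrix_in (Suc (r j)) (subladder l L d c j) f g \<Longrightarrow> minor (Suc (r j)) f g \<in> K"
  shows "I \<subseteq> K"
  unfolding I_def mixed_ladder_ideal_def minors_ideal_def
  by (intro genideal_minimal K UN_least) (use minors in blast)

lemma bord_in_I:
  assumes j: "j \<in> {1..v}" and im: "(i, m) \<in> reach j"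
  shows "bord j i m \<in> I"
proof -
  let ?f = "border_row i (rho j)" and ?g = "border_col (r j) m (kap j)"
  have im': "(i, m) \<in> L" "i \<le> d j - r j" "c j + r j \<le> m" using reachD[OF im] by auto
  have f: "strict_mono_on {..<Suc (r j)} ?f"
    by (rule strict_mono_onI) (use im' in \<open>auto simp: border_row_def rho_def split: nat.splits\<close>)
  have g: "strict_mono_on {..<Suc (r j)} ?g"
    by (rule strict_mono_onI) (use im' in \<open>auto simp: border_col_def kap_def\<close>)
  have fb: "i \<le> ?f a \<and> ?f a \<le> d j" if "a < Suc (r j)" for a
    using that im' corner_bounds[OF j] by (auto simp: border_row_def rho_def split: nat.splits)
  have gb: "c j \<le> ?g b \<and> ?g b \<le> m" if "b < Suc (r j)" for b
    using that im' by (auto simp: border_col_def kap_def)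
  have "(?f a, ?g b) \<in> subladder l L d c j" if "a < Suc (r j)" "b < Suc (r j)" for a b
    unfolding subladder_iff using fb[OF that(1)] gb[OF that(2)] in_rect[OF j im'(1)] by blast
  then have "submatrix_in (Suc (r j)) (subladder l L d c j) ?f ?g"
    using f g unfolding submatrix_in_def by blast
  then have "minor (Suc (r j)) ?f ?g \<in> I" by (rule minor_in_I[OF j])
  then have "(-1) ^ r j * bord j i m \<in> I" unfolding minor_eq_det det_border bord_def .
  then have "(-1) ^ r j * ((-1) ^ r j * bord j i m) \<in> I" by (rule power_neg_one_mult[OF I_ideal])
  then show ?thesis by (simp add: mult.assoc[symmetric] power_add[symmetric])
qed

text \<open>Scaled by \<open>delta j\<close>, each entry is a sum over the \<open>r j\<close> corner
  rows plus an error \<open>bord\<close> in \<open>K\<close>. A matrix of rank at most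
  \<open>r j\<close> modulo \<open>K\<close> has its determinant in the power \<open>n - r j\<close>
  of \<open>K\<close>.\<close>

lemma delta_power_minor:
  assumes j: "j \<in> {1..v}" and im: "(i, m) \<in> reach j"
    and f: "\<And>a. a < n \<Longrightarrow> i \<le> f a \<and> f a \<le> d j" and g: "\<And>b. b < n \<Longrightarrow> c j \<le> g b \<and> g b \<le> m"
    and K: "ideal K R" "\<And>i m. (i, m) \<in> reach j \<Longrightarrow> bord j i m \<in> K"
  shows "delta j ^ n * minor n f g \<in> ideal_power K (n - r j)"
proof -
  have im': "(i, m) \<in> L" "i \<le> d j - r j" "c j + r j \<le> m" using reachD[OF im] by auto
  have inL: "(i', m') \<in> L" if "i \<le> i'" "i' \<le> d j" "c j \<le> m'" "m' \<le> m" for i' m'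
    using in_rect[OF j im'(1)] that by blast
  have bord: "bord j i' m' \<in> K" if "i \<le> i'" "i' \<le> d j" "c j \<le> m'" "m' \<le> m" for i' m'
  proof (cases "i' \<le> d j - r j \<and> c j + r j \<le> m'")
    case True
    then show ?thesis using inL[OF that] by (intro K(2)) (auto simp: reach_def)
  next
    case False
    then have "bord j i' m' = 0"
      using bord_corner_row[OF j, of i' m'] bord_corner_col[of j m' i'] that by auto
    then show ?thesis using idealD(2)[OF K(1)] by simp
  qed
  let ?nu = "\<lambda>a e. schur_nu (r j) entry (rho j) (kap j) (f a) e"
  have "delta j ^ n * minor n f g = det (delta j \<cdot>\<^sub>m sub_mat n entry f g)"
    by (simp add: minor_eq_det det_smult) (simp add: sub_mat_def)
  also have "delta j \<cdot>\<^sub>m sub_mat n entry f g =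
      mat n n (\<lambda>(a, b). (\<Sum>e<r j. ?nu a e * entry (rho j e) (g b)) + bord j (f a) (g b))"
    by (rule eq_matI) (auto simp: sub_mat_def bord_def schur_complement_nu delta_def)
  also have "det \<dots> \<in> ideal_power K (n - r j)"
  proof (rule det_factor_plus_in_ideal_power[OF K(1)])
    fix a e assume "a < n" "e < r j"
    moreover have "(f a, m) \<in> L" using f[OF \<open>a < n\<close>] im' by (intro inL) auto
    ultimately show "?nu a e \<in> carrier R" using f[of a] im' by (intro nu_carrier[OF j, of _ m]) auto
  next
    fix e b assume eb: "e < r j" "b < n"
    show "entry (rho j e) (g b) \<in> carrier R"
      by (intro entry_carrier inL) (use eb g[OF eb(2)] im' corner_bounds[OF j] in \<open>auto simp: rho_def\<close>)
  next
    fix a b assume "a < n" "b < n"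
    then show "bord j (f a) (g b) \<in> K" using f g by (intro bord) auto
  qed
  finally show ?thesis .
qed

section \<open>Local generators\<close>

definition H :: "(nat \<times> nat) set" where "H = (\<Union>j\<in>{1..v}. reach j)"

text \<open>Several \<open>j\<close> may reach the same cell; one is selected so that the number of
  local generators is at most \<open>card H\<close>, one for each cell.\<close>

definition chosen :: "nat \<times> nat \<Rightarrow> nat" where
  "chosen x = (SOME j. j \<in> {1..v} \<and> x \<in> reach j)"

lemma chosen: "x \<in> H \<Longrightarrow> chosen x \<in> {1..v} \<and> x \<in> reach (chosen x)"
  unfolding chosen_def by (rule someI_ex) (auto simp: H_def)

definition local_gen :: "nat \<times> nat \<Rightarrow> 'k matpoly" where
  "local_gen x = bord (chosen x) (fst x) (snd x)"

definition J :: "'k matpoly set" where "J = Idl\<^bsub>R\<^esub> (local_gen ` H)"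

lemma finite_H: "finite H"
  by (rule finite_subset[OF _ finite_L]) (auto simp: H_def reach_def)

lemma local_gen_in_I: "x \<in> H \<Longrightarrow> local_gen x \<in> I"
  unfolding local_gen_def using chosen[of x] by (intro bord_in_I) auto

lemma local_gen_carrier: "x \<in> H \<Longrightarrow> local_gen x \<in> carrier R"
  using idealD(1)[OF I_ideal local_gen_in_I] .

lemma J_ideal: "ideal J R"
  unfolding J_def by (rule genideal_ideal) (use local_gen_carrier in blast)

lemma local_gen_in_J: "x \<in> H \<Longrightarrow> local_gen x \<in> J"
  unfolding J_def by (rule subsetD[OF genideal_self]) (use local_gen_carrier in auto)

text \<open>By the exchange identity the difference involves only bordered minors of cells further
  left in row \<open>i\<close> or further down in column \<open>m\<close>. Those in a corner row or
  column are zero; the others are covered by \<open>IH\<close>.\<close>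

lemma bord_exchange:
  assumes j: "j \<in> {1..v}" "j' \<in> {1..v}" "j < j'" and im: "(i, m) \<in> reach j" "(i, m) \<in> reach j'"
    and K: "ideal K R"
    and IH: "\<And>i' m' j. j \<in> {1..v} \<Longrightarrow> (i', m') \<in> reach j \<Longrightarrow> i \<le> i' \<Longrightarrow> m' \<le> m \<Longrightarrow> (i', m') \<noteq> (i, m) \<Longrightarrow> bord j i' m' \<in> K"
  shows "delta j' * bord j i m - delta j * bord j' i m \<in> K"
  unfolding delta_def bord_def schur_complement_exchange unfolding bord_def[symmetric]
proof (intro idealD(7)[OF K] ideal_sum[OF K] idealD(4)[OF K])
  have im': "(i, m) \<in> L" "i \<le> d j - r j" "c j + r j \<le> m" "i \<le> d j' - r j'" "c j' + r j' \<le> m"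
    using reachD[OF im(1)] reachD[OF im(2)] by auto
  have mono: "d j \<le> d j'" "c j \<le> c j'" using corner_mono[OF j] by auto
  fix q assume "q \<in> {..<r j'}"
  then have q: "q < r j'" by simp
  show "schur_mu (r j') entry (rho j') (kap j') m q \<in> carrier R"
    by (rule mu_carrier[OF j(2) im'(1)]) (use im' q in auto)
  show "bord j i (kap j' q) \<in> K"
  proof (cases "kap j' q < c j + r j")
    case True
    then have "bord j i (kap j' q) = 0" using mono by (intro bord_corner_col) (auto simp: kap_def)
    then show ?thesis using idealD(2)[OF K] by simp
  next
    case False
    have "(i, kap j' q) \<in> L"
      by (rule in_rect[OF j(2) im'(1)]) (use im' q in \<open>auto simp: kap_def\<close>)
    then have "(i, kap j' q) \<in> reach j" using False im' by (auto simp: reach_def)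
    then show ?thesis by (rule IH[OF j(1)]) (use im' q in \<open>auto simp: kap_def\<close>)
  qed
next
  have im': "(i, m) \<in> L" "i \<le> d j - r j" "c j + r j \<le> m" "i \<le> d j' - r j'" "c j' + r j' \<le> m"
    using reachD[OF im(1)] reachD[OF im(2)] by auto
  have mono: "d j \<le> d j'" "c j \<le> c j'" using corner_mono[OF j] by auto
  fix e assume "e \<in> {..<r j}"
  then have e: "e < r j" by simp
  show "schur_nu (r j) entry (rho j) (kap j) i e \<in> carrier R"
    by (rule nu_carrier[OF j(1) im'(1)]) (use im' e in auto)
  show "bord j' (rho j e) m \<in> K"
  proof (cases "d j' - r j' < rho j e")
    case True
    then have "bord j' (rho j e) m = 0"
      using mono e corner_bounds[OF j(1)] by (intro bord_corner_row[OF j(2)]) (auto simp: rho_def)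
    then show ?thesis using idealD(2)[OF K] by simp
  next
    case False
    have "(rho j e, m) \<in> L"
      by (rule in_rect[OF j(1) im'(1)]) (use im' e corner_bounds[OF j(1)] in \<open>auto simp: rho_def\<close>)
    then have "(rho j e, m) \<in> reach j'" using False im' by (auto simp: reach_def)
    then show ?thesis by (rule IH[OF j(2)]) (use im' e in \<open>auto simp: rho_def\<close>)
  qed
qed

text \<open>Induction from the lower left: up to the units \<open>delta j0\<close> and
  \<open>delta j\<close>, the bordered minor agrees with the selected generator of the cell modulo
  earlier cells.\<close>

lemma bord_in_contraction:
  assumes P: "primeideal P R" "\<And>j. j \<in> {1..v} \<Longrightarrow> delta j \<notin> P"
    and j: "j \<in> {1..v}" and im: "(i, m) \<in> reach j"
  shows "bord j i m \<in> contraction P J"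
  using j im
proof (induction "k - i + m" arbitrary: i m j rule: less_induct)
  case less
  let ?K = "contraction P J"
  note K = contraction_ideal[OF P(1) J_ideal]
  have imH: "(i, m) \<in> H" using less.prems by (auto simp: H_def)
  define j0 where "j0 = chosen (i, m)"
  have j0: "j0 \<in> {1..v}" "(i, m) \<in> reach j0" using chosen[OF imH] by (auto simp: j0_def)
  have b0: "bord j0 i m \<in> ?K"
    using local_gen_in_J[OF imH] subset_contraction[OF P(1) J_ideal] by (auto simp: local_gen_def j0_def)
  have IH: "bord j i' m' \<in> ?K"
    if "j \<in> {1..v}" "(i', m') \<in> reach j" "i \<le> i'" "m' \<le> m" "(i', m') \<noteq> (i, m)" for i' m' j
  proof (rule less.hyps[OF _ that(1,2)])
    have "i' \<le> k" using L_bounds reachD[OF that(2)] by blast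
    then show "k - i' + m' < k - i + m" using that(3-5) by (cases "i = i'") auto
  qed
  have bR: "bord j i m \<in> carrier R" by (rule idealD(1)[OF I_ideal bord_in_I[OF less.prems]])
  have "delta j0 * bord j i m \<in> ?K"
  proof -
    consider "j = j0" | "j < j0" | "j0 < j" by linarith
    then show ?thesis
    proof cases
      case 1
      then show ?thesis using b0 idealD(4)[OF K delta_carrier[OF j0(1)]] by simp
    next
      case 2
      have "delta j0 * bord j i m - delta j * bord j0 i m \<in> ?K"
        by (rule bord_exchange[OF less.prems(1) j0(1) 2 less.prems(2) j0(2) K IH])
      from idealD(3)[OF K this idealD(4)[OF K delta_carrier[OF less.prems(1)] b0]] show ?thesis by simp
    next
      case 3
      have "delta j * bord j0 i m - delta j0 * bord j i m \<in> ?K"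
        by (rule bord_exchange[OF j0(1) less.prems(1) 3 j0(2) less.prems(2) K IH])
      from idealD(7)[OF K idealD(4)[OF K delta_carrier[OF less.prems(1)] b0] this] show ?thesis by simp
    qed
  qed
  then show ?case by (rule contraction_cancel[OF P(1) bR delta_carrier[OF j0(1)] P(2)[OF j0(1)]])
qed

lemma I_subset_contraction:
  assumes P: "primeideal P R" "\<And>j. j \<in> {1..v} \<Longrightarrow> delta j \<notin> P"
  shows "I \<subseteq> contraction P J"
proof (rule I_least)
  let ?K = "contraction P J"
  note K = contraction_ideal[OF P(1) J_ideal]
  show "ideal ?K R" by (rule K)
  fix j f g assume j: "j \<in> {1..v}" and fg: "submatrix_in (Suc (r j)) (subladder l L d c j) f g"
  have sm: "strict_mono_on {..<Suc (r j)} f" "strict_mono_on {..<Suc (r j)} g"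
    using fg by (auto simp: submatrix_in_def)
  have sub: "(f a, g b) \<in> L \<and> f a \<le> d j \<and> c j \<le> g b" if "a < Suc (r j)" "b < Suc (r j)" for a b
    using submatrix_entry[OF fg that] unfolding subladder_iff .
  have f_ge: "f 0 + a \<le> f a" if "a < Suc (r j)" for a
    using that
  proof (induction a)
    case (Suc a)
    then have "f a < f (Suc a)" using strict_mono_onD[OF sm(1), of a "Suc a"] by auto
    then show ?case using Suc by simp
  qed simp
  have g_ge: "g b + (r j - b) \<le> g (r j)" if "b \<le> r j" for b
    using that
  proof (induction b rule: inc_induct)
    case (step b)
    then have "g b < g (Suc b)" using strict_mono_onD[OF sm(2), of b "Suc b"] by auto
    then show ?case using step by simp
  qed simp
  have f0: "f 0 \<le> f a" if "a < Suc (r j)" for a using f_ge[OF that] by simp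
  have gr: "g b \<le> g (r j)" if "b < Suc (r j)" for b using g_ge[of b] that by simp
  have reach: "(f 0, g (r j)) \<in> reach j"
    unfolding reach_def using sub[of 0 "r j"] sub[of "r j" 0] f_ge[of "r j"] g_ge[of 0] by auto
  \<comment> \<open>A minor of size \<open>Suc (r j)\<close> is one larger than the rank, so the
    exponent \<open>Suc (r j) - r j\<close> is \<open>1\<close>.\<close>
  have "delta j ^ Suc (r j) * minor (Suc (r j)) f g \<in> ideal_power ?K (Suc (r j) - r j)"
  proof (rule delta_power_minor[OF j reach _ _ K])
    show "f 0 \<le> f a \<and> f a \<le> d j" if "a < Suc (r j)" for a using f0[OF that] sub[OF that, of 0] by simp
    show "c j \<le> g b \<and> g b \<le> g (r j)" if "b < Suc (r j)" for b using gr[OF that] sub[OF _ that, of 0] by simp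
    show "bord j i m \<in> ?K" if "(i, m) \<in> reach j" for i m by (rule bord_in_contraction[OF P j that])
  qed
  then have "delta j ^ Suc (r j) * minor (Suc (r j)) f g \<in> ?K"
    using ideal_power_1_subset[OF K] by auto
  then show "minor (Suc (r j)) f g \<in> ?K"
    by (rule contraction_cancel[OF P(1) minor_carrier[OF fg subladder_subset]
        power_carrier[OF delta_carrier[OF j]]
        prime_power_notin[OF P(1) delta_carrier[OF j] P(2)[OF j]]])
qed

section \<open>The splitting polynomial\<close>

text \<open>The local units that occur are the products of the minors \<open>delta j\<close>.\<close>

definition local_unit :: "'k matpoly \<Rightarrow> bool" where
  "local_unit w \<longleftrightarrow> w \<in> carrier R \<and>
     (\<forall>P. primeideal P R \<longrightarrow> (\<forall>j\<in>{1..v}. delta j \<notin> P) \<longrightarrow> w \<notin> P)"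

text \<open>The antidiagonal of the square minor runs from the topmost cell of \<open>L\<close> down
  to the lowest cell of \<open>H\<close> and then \<open>r j\<close> steps through the corner rows
  of a \<open>j\<close> that reaches this cell. The surplus \<open>n - r j\<close> counts the rows
  that can contain cells of \<open>H\<close>; the other cells of the antidiagonal contribute single
  variables.\<close>

lemma antidiagonal_factor:
  "\<exists>F c w. F \<in> carrier R \<and> extremal_monomial F (\<Sum>x\<in>{x\<in>L. fst x + snd x = s}. Poly_Mapping.single x 1) c \<and>
     c\<^sup>2 = 1 \<and> local_unit w \<and> w * F \<in> ideal_power I (card {x\<in>H. fst x + snd x = s})"
proof -
  let ?Ls = "{x\<in>L. fst x + snd x = s}" and ?Hs = "{x\<in>H. fst x + snd x = s}"
  have HL: "H \<subseteq> L" by (auto simp: H_def reach_def)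
  have fin: "finite ?Ls" "finite ?Hs" using finite_L finite_H by auto
  have indets: "extremal_monomial (\<Prod>x\<in>E. indet x) (\<Sum>x\<in>E. Poly_Mapping.single x 1) (\<Prod>x\<in>E. 1 :: 'k)"
    for E :: "(nat \<times> nat) set" by (rule extremal_monomial_prod) (rule extremal_monomial_indet)
  have prod_in: "(\<Prod>x\<in>E. indet x) \<in> carrier R" if "E \<subseteq> L" for E
    by (rule prod_carrier) (use that in \<open>auto intro!: indet_carrier\<close>)
  show ?thesis
  proof (cases "?Hs = {}")
    case True
    have "local_unit 1" unfolding local_unit_def using primeidealD(2) one_carrier by blast
    then show ?thesis
      using indets[of ?Ls] prod_in[of ?Ls] unfolding True
      by (intro exI[of _ "\<Prod>x\<in>?Ls. indet x"] exI[of _ 1]) (auto simp: ideal_power_0)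
  next
    case False
    have finf: "finite (fst ` ?Ls)" "fst ` ?Ls \<noteq> {}" "finite (fst ` ?Hs)" "fst ` ?Hs \<noteq> {}"
      using fin False HL by auto
    define lo where "lo = Min (fst ` ?Ls)"
    define e where "e = Max (fst ` ?Hs)"
    have lo_in: "lo \<in> fst ` ?Ls" unfolding lo_def by (rule Min_in[OF finf(1,2)])
    have e_in: "e \<in> fst ` ?Hs" unfolding e_def by (rule Max_in[OF finf(3,4)])
    have lo_le: "lo \<le> fst x" if "x \<in> ?Ls" for x unfolding lo_def using that finf(1) by (intro Min_le) auto
    have e_ge: "fst x \<le> e" if "x \<in> ?Hs" for x unfolding e_def using that finf(3) by (intro Max_ge) auto
    obtain m0 where m0: "(lo, m0) \<in> L" "lo + m0 = s" using lo_in by auto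
    obtain me where me: "(e, me) \<in> H" "e + me = s" using e_in by auto
    obtain j where j: "j \<in> {1..v}" "(e, me) \<in> reach j" using me(1) by (auto simp: H_def)
    have ej: "e \<le> d j - r j" "c j + r j \<le> me" "(e, me) \<in> L" using reachD[OF j(2)] by auto
    have rd: "r j < d j" using corner_bounds[OF j(1)] by auto
    have lo_e: "lo \<le> e" using lo_le[of "(e, me)"] ej me by simp
    \<comment> \<open>The rows run from \<open>lo\<close> to \<open>e + r j\<close>, which is at
      most \<open>d j\<close>; correspondingly the first column \<open>cm = me - r j\<close> is at
      least \<open>c j\<close>.\<close>
    define n where "n = e - lo + 1 + r j"
    define cm where "cm = me - r j"
    have n_pos: "0 < n" and cmn: "cm + n - 1 = m0" using m0 me ej lo_e by (auto simp: n_def cm_def)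
    have reach: "(lo, m0) \<in> reach j" unfolding reach_def using m0 me ej lo_e by auto
    define Sq where "Sq = (\<lambda>a. (lo + a, cm + (n - 1 - a))) ` {..<n}"
    have cell: "(lo + a, cm + (n - 1 - a)) \<in> ?Ls" if "a < n" for a
    proof -
      have "(lo + a, cm + (n - 1 - a)) \<in> L"
        by (rule in_rect[OF j(1) m0(1)]) (use that ej rd me m0 lo_e in \<open>auto simp: n_def cm_def\<close>)
      then show ?thesis using that cmn m0 by auto
    qed
    have inj: "inj_on (\<lambda>a. (lo + a, cm + (n - 1 - a))) {..<n}" by (auto simp: inj_on_def)
    have SqL: "Sq \<subseteq> ?Ls" using cell by (auto simp: Sq_def)
    obtain c' where c': "extremal_monomial (square_minor lo cm n :: 'k matpoly)
        (\<Sum>a<n. Poly_Mapping.single (lo + a, cm + (n - 1 - a)) 1) c'" "c'\<^sup>2 = 1"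
      using extremal_monomial_square_minor by blast
    have "(\<Sum>a<n. Poly_Mapping.single (lo + a, cm + (n - 1 - a)) 1) = (\<Sum>x\<in>Sq. Poly_Mapping.single x (1::nat))"
      unfolding Sq_def by (subst sum.reindex[OF inj]) simp
    then have ex: "extremal_monomial (square_minor lo cm n :: 'k matpoly) (\<Sum>x\<in>Sq. Poly_Mapping.single x 1) c'"
      using c'(1) by simp
    define F where "F = square_minor lo cm n * (\<Prod>x\<in>?Ls - Sq. indet x :: 'k matpoly)"
    have "extremal_monomial F ((\<Sum>x\<in>Sq. Poly_Mapping.single x 1) + (\<Sum>x\<in>?Ls - Sq. Poly_Mapping.single x 1)) (c' * (\<Prod>x\<in>?Ls - Sq. 1))"
      unfolding F_def by (rule extremal_monomial_mult[OF ex indets])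
    moreover have "(\<Sum>x\<in>Sq. Poly_Mapping.single x 1) + (\<Sum>x\<in>?Ls - Sq. Poly_Mapping.single x 1) =
        (\<Sum>x\<in>?Ls. Poly_Mapping.single x (1::nat))"
      using sum.subset_diff[OF SqL fin(1), of "\<lambda>x. Poly_Mapping.single x (1::nat)"] by (simp add: add.commute)
    ultimately have exF: "extremal_monomial F (\<Sum>x\<in>?Ls. Poly_Mapping.single x 1) c'" by simp
    have rest: "(\<Prod>x\<in>?Ls - Sq. indet x) \<in> carrier R" by (rule prod_in) auto
    have fb: "lo \<le> lo + a \<and> lo + a \<le> d j" if "a < n" for a
      using that ej rd lo_e by (auto simp: n_def)
    have gb: "c j \<le> cm + b \<and> cm + b \<le> m0" if "b < n" for b
      using that ej cmn by (auto simp: cm_def)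
    have sqR: "square_minor lo cm n \<in> carrier R"
      unfolding square_minor_def minor_eq_det
      by (rule det_carrier[OF sub_mat_carrier])
        (use in_rect[OF j(1) m0(1)] fb gb in \<open>auto intro!: entry_carrier\<close>)
    have "delta j ^ n * square_minor lo cm n \<in> ideal_power I (n - r j)"
      unfolding square_minor_def
      by (rule delta_power_minor[OF j(1) reach fb gb I_ideal bord_in_I[OF j(1)]]) auto
    then have "delta j ^ n * square_minor lo cm n * (\<Prod>x\<in>?Ls - Sq. indet x) \<in> ideal_power I (n - r j)"
      by (rule idealD(5)[OF ideal_power_ideal[OF I_ideal] rest])
    then have "delta j ^ n * F \<in> ideal_power I (n - r j)" by (simp add: F_def mult.assoc)
    moreover have "card ?Hs \<le> n - r j"
    proof -
      have "card ?Hs = card (fst ` ?Hs)"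
        by (rule card_image[symmetric]) (auto simp: inj_on_def)
      also have "\<dots> \<le> card {lo..e}"
        by (rule card_mono) (use lo_le e_ge HL in force)+
      finally show ?thesis using lo_e by (simp add: n_def)
    qed
    ultimately have "delta j ^ n * F \<in> ideal_power I (card ?Hs)"
      using ideal_power_antimono[OF I_ideal] by blast
    moreover have "local_unit (delta j ^ n)"
      unfolding local_unit_def using prime_power_notin delta_carrier[OF j(1)] power_carrier j(1) by blast
    moreover have "F \<in> carrier R" unfolding F_def by (rule mult_carrier[OF sqR rest])
    ultimately show ?thesis using exF c'(2) by blast
  qed
qed

text \<open>The antidiagonals partition both \<open>L\<close> and \<open>H\<close>, so the monomials
  multiply to the product of all entries and the exponents add up to \<open>card H\<close>.\<close>

lemma splitting_polynomial:
  "\<exists>F c w. F \<in> carrier R \<and> extremal_monomial F (\<Sum>x\<in>L. Poly_Mapping.single x 1) c \<and>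
     c\<^sup>2 = 1 \<and> local_unit w \<and> w * F \<in> ideal_power I (card H)"
proof -
  let ?a = "\<lambda>x :: nat \<times> nat. fst x + snd x"
  let ?T = "?a ` L"
  have HL: "H \<subseteq> L" by (auto simp: H_def reach_def)
  define Q where "Q s F c w \<longleftrightarrow> F \<in> carrier R \<and>
     extremal_monomial F (\<Sum>x\<in>{x\<in>L. ?a x = s}. Poly_Mapping.single x 1) c \<and>
     c\<^sup>2 = 1 \<and> local_unit w \<and> w * F \<in> ideal_power I (card {x\<in>H. ?a x = s})" for s F c w
  have "\<exists>F c w. Q s F c w" for s unfolding Q_def by (rule antidiagonal_factor)
  then obtain F c w where "\<And>s. Q s (F s) (c s) (w s)" by metis
  then have F: "\<And>s. F s \<in> carrier R"
      "\<And>s. extremal_monomial (F s) (\<Sum>x\<in>{x\<in>L. ?a x = s}. Poly_Mapping.single x 1) (c s)"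
      "\<And>s. (c s)\<^sup>2 = 1" "\<And>s. local_unit (w s)" "\<And>s. w s * F s \<in> ideal_power I (card {x\<in>H. ?a x = s})"
    unfolding Q_def by blast+
  have finT: "finite ?T" using finite_L by simp
  have sumL: "(\<Sum>s\<in>?T. \<Sum>x\<in>{x\<in>L. ?a x = s}. Poly_Mapping.single x 1) = (\<Sum>x\<in>L. Poly_Mapping.single x (1::nat))"
    by (rule sum.group[OF finite_L finT]) simp
  have cardH: "(\<Sum>s\<in>?T. card {x\<in>H. ?a x = s}) = card H"
    using sum.group[OF finite_H finT, of ?a "\<lambda>_. 1::nat"] HL by auto
  have "prod F ?T \<in> carrier R" by (rule prod_carrier) (rule F(1))
  moreover have "extremal_monomial (prod F ?T) (\<Sum>x\<in>L. Poly_Mapping.single x 1) (prod c ?T)"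
    unfolding sumL[symmetric] by (rule extremal_monomial_prod) (rule F(2))
  moreover have "(prod c ?T)\<^sup>2 = 1" by (simp add: prod_power_distrib F(3))
  moreover have "local_unit (prod w ?T)"
    unfolding local_unit_def
  proof (intro conjI allI impI)
    show "prod w ?T \<in> carrier R" by (rule prod_carrier) (use F(4) in \<open>auto simp: local_unit_def\<close>)
    fix P assume "primeideal P R" "\<forall>j\<in>{1..v}. delta j \<notin> P"
    then show "prod w ?T \<notin> P"
      by (intro prime_prod_notin[OF _ finT]) (use F(4) in \<open>auto simp: local_unit_def\<close>)
  qed
  moreover have "prod w ?T * prod F ?T \<in> ideal_power I (card H)"
    unfolding cardH[symmetric] prod.distrib[symmetric]
    by (rule ideal_power_prod[OF I_ideal finT]) (rule F(5))
  ultimately show ?thesis by blast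
qed

end

context ladder_data
begin

lemma frob_trace_carrier:
  assumes "perfect_char TYPE('k) p L"
  shows "frob_trace p L (f :: 'k matpoly) \<in> carrier R"
  unfolding ladder_ring_carrier using perfect_char.frob_trace_keys[OF assms] by blast

lemma frob_trace_pth_power_mult:
  assumes "perfect_char TYPE('k) p L" "a \<in> carrier R"
  shows "frob_trace p L (a ^ p * b) = a * frob_trace p L b"
  by (rule perfect_char.frob_trace_mult[OF assms(1)]) (use assms(2) in \<open>auto simp: ladder_ring_carrier\<close>)

text \<open>A monomial of degree greater than \<open>card H * (p - 1) + n * p\<close> in \<open>card H\<close> generators is
  divisible by the \<open>p\<close>-th power of one of degree greater than \<open>n\<close>.\<close>

lemma frob_trace_ideal_power:
  assumes pc: "perfect_char TYPE('k) p L"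
    and y: "y \<in> ideal_power J (card H * (p - 1) + n * p + 1)" and b: "b \<in> carrier R"
  shows "frob_trace p L (y * b) \<in> ideal_power I (Suc n)"
proof -
  interpret perfect_char p L by (rule pc)
  note IS = idealD[OF ideal_power_ideal[OF I_ideal, of "Suc n"]]
  \<comment> \<open>The condition for all multipliers \<open>b\<close> makes \<open>K\<close> an
    ideal, so that it can be tested on monomials in the local generators.\<close>
  define K where "K = {y \<in> carrier R. \<forall>b\<in>carrier R. frob_trace p L (y * b) \<in> ideal_power I (Suc n)}"
  have K: "ideal K R"
  proof (rule idealI')
    show "K \<subseteq> carrier R" by (auto simp: K_def)
    show "0 \<in> K" using zero_carrier IS(2) by (simp add: K_def frob_trace_0)
    show "x + z \<in> K" if "x \<in> K" "z \<in> K" for x z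
      using that IS(3) by (auto simp: K_def distrib_right frob_trace_add intro: add_carrier)
    fix a x assume a: "a \<in> carrier R" "x \<in> K"
    have "frob_trace p L (a * x * b) \<in> ideal_power I (Suc n)" if "b \<in> carrier R" for b
    proof -
      have "a * b \<in> carrier R" by (rule mult_carrier[OF a(1) that])
      then have "frob_trace p L (x * (a * b)) \<in> ideal_power I (Suc n)" using a(2) by (simp add: K_def)
      then show ?thesis by (simp add: mult_ac)
    qed
    then show "a * x \<in> K" using a by (auto simp: K_def intro: mult_carrier)
  qed
  have "ideal_power J (card H * (p - 1) + n * p + 1) \<subseteq> K"
    unfolding J_def
  proof (rule ideal_power_generators[OF finite_H local_gen_carrier K])
    fix a assume a: "(\<Sum>e\<in>H. a e) = card H * (p - 1) + n * p + 1"
    let ?A = "\<Prod>e\<in>H. local_gen e ^ (a e div p)" and ?B = "\<Prod>e\<in>H. local_gen e ^ (a e mod p)"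
    have "(\<Sum>e\<in>H. a e) = p * (\<Sum>e\<in>H. a e div p) + (\<Sum>e\<in>H. a e mod p)"
      by (simp add: sum_distrib_left sum.distrib[symmetric])
    moreover have "(\<Sum>e\<in>H. a e mod p) \<le> card H * (p - 1)"
    proof -
      have "a e mod p \<le> p - 1" for e using mod_less_divisor[OF p_pos, of "a e"] by linarith
      then show ?thesis using sum_bounded_above[of H "\<lambda>e. a e mod p" "p - 1"] by simp
    qed
    ultimately have "n * p < p * (\<Sum>e\<in>H. a e div p)" using a by linarith
    then have "n < (\<Sum>e\<in>H. a e div p)" by (simp add: mult.commute[of n])
    then have le: "Suc n \<le> (\<Sum>e\<in>H. a e div p)" by simp
    have "?A \<in> ideal_power I (\<Sum>e\<in>H. a e div p)"
      by (rule ideal_power_prod[OF I_ideal finite_H]) (rule ideal_power_mem[OF I_ideal local_gen_in_I])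
    then have A: "?A \<in> ideal_power I (Suc n)" using ideal_power_antimono[OF I_ideal le] by blast
    have AR: "?A \<in> carrier R" and BR: "?B \<in> carrier R"
      by (auto intro!: prod_carrier power_carrier local_gen_carrier)
    have eq: "(\<Prod>e\<in>H. local_gen e ^ a e) = ?A ^ p * ?B"
      by (simp add: prod_power_distrib prod.distrib[symmetric] power_mult[symmetric] power_add[symmetric])
    have "frob_trace p L (?A ^ p * ?B * b) \<in> ideal_power I (Suc n)" if "b \<in> carrier R" for b
      unfolding mult.assoc frob_trace_pth_power_mult[OF pc AR]
      by (rule IS(5)[OF frob_trace_carrier[OF pc] A])
    then show "(\<Prod>e\<in>H. local_gen e ^ a e) \<in> K"
      unfolding eq K_def by (auto intro!: mult_carrier power_carrier AR BR)
  qed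
  then show ?thesis using y b by (auto simp: K_def)
qed

text \<open>All generating minors have positive size and therefore no constant term.\<close>

lemma one_notin_I: "1 \<notin> I"
proof -
  define K where "K = {f \<in> carrier R. Poly_Mapping.lookup f 0 = 0}"
  have K: "ideal K R"
  proof (rule idealI')
    fix a x assume a: "a \<in> carrier R" "x \<in> K"
    have "0 \<notin> Poly_Mapping.keys (a * x)"
    proof
      assume "0 \<in> Poly_Mapping.keys (a * x)"
      then obtain m n where mn: "0 = m + n" "n \<in> Poly_Mapping.keys x" using keys_mult[of a x] by blast
      have "n = 0"
      proof (rule poly_mapping_eqI)
        fix i show "Poly_Mapping.lookup n i = Poly_Mapping.lookup 0 i"
          using arg_cong[OF mn(1), of "\<lambda>e. Poly_Mapping.lookup e i"] by (simp add: lookup_add)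
      qed
      then show False using mn(2) a(2) by (simp add: K_def in_keys_iff)
    qed
    then show "a * x \<in> K" using a by (auto simp: K_def in_keys_iff intro: mult_carrier)
  qed (auto simp: K_def lookup_add intro: carrier_intros)
  have "I \<subseteq> K"
  proof (rule I_least[OF K])
    fix j f g assume fg: "submatrix_in (Suc (r j)) (subladder l L d c j) f g"
    let ?M = "sub_mat (Suc (r j)) entry f g"
    have inL: "(f a, g b) \<in> L" if "a < Suc (r j)" "b < Suc (r j)" for a b
      using submatrix_entry[OF fg that] subladder_subset by blast
    have "det ?M = (\<Sum>b<Suc (r j). ?M $$ (0, b) * cofactor ?M 0 b)"
      by (rule laplace_expansion_row[OF sub_mat_carrier]) simp
    also have "\<dots> \<in> K"
    proof (rule ideal_sum[OF K], rule idealD(5)[OF K])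
      fix b assume "b \<in> {..<Suc (r j)}"
      then have b: "b < Suc (r j)" by simp
      have "det (mat_delete ?M 0 b) \<in> carrier R"
        by (rule det_carrier[OF mat_delete_carrier[OF sub_mat_carrier]])
          (use inL in \<open>auto simp: mat_delete_def sub_mat_def intro!: entry_carrier\<close>)
      then show "cofactor ?M 0 b \<in> carrier R"
        unfolding cofactor_def by (intro mult_carrier power_carrier minus_carrier one_carrier)
      have "Poly_Mapping.lookup (entry (f 0) (g b)) 0 = 0"
      proof -
        have "Poly_Mapping.lookup (Poly_Mapping.single (f 0, g b) (1::nat)) (f 0, g b) \<noteq>
            Poly_Mapping.lookup 0 (f 0, g b)" by simp
        then have "Poly_Mapping.single (f 0, g b) (1::nat) \<noteq> 0" by metis
        then show ?thesis unfolding entry_def indet_def lookup_single when_def by simp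
      qed
      then show "?M $$ (0, b) \<in> K" using inL[of 0 b] b by (simp add: K_def entry_carrier)
    qed
    finally show "minor (Suc (r j)) f g \<in> K" by (simp add: minor_eq_det)
  qed
  moreover have "1 \<notin> K" by (simp add: K_def)
  ultimately show ?thesis by blast
qed

theorem F_pure_symbolic_gr:
  assumes pc: "perfect_char TYPE('k) p L"
    and avoid: "\<And>P j. P \<in> minimal_primes R I \<Longrightarrow> j \<in> {1..v} \<Longrightarrow> delta j \<notin> P"
  shows "F_pure TYPE('m) p (symbolic_gr R I)"
proof -
  interpret perfect_char p L by (rule pc)
  interpret F: filtration R "symbolic_power R I"
  proof (rule filtration.intro[OF typed_cring_axioms], rule filtration_axioms.intro)
    show "ideal (symbolic_power R I n) R" for n by (rule symbolic_power_ideal[OF I_ideal])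
    show "symbolic_power R I 0 = carrier R" by (rule symbolic_power_0)
    show "symbolic_power R I (Suc n) \<subseteq> symbolic_power R I n" for n
      by (rule symbolic_power_antimono[OF I_ideal]) simp
    show "x \<in> symbolic_power R I m \<Longrightarrow> y \<in> symbolic_power R I n \<Longrightarrow> x * y \<in> symbolic_power R I (m + n)" for x y m n
      by (rule symbolic_power_mult[OF I_ideal])
  qed
  obtain f e w where f: "f \<in> carrier R" "extremal_monomial f (\<Sum>x\<in>L. Poly_Mapping.single x 1) e"
      "e\<^sup>2 = 1" "local_unit w" "w * f \<in> ideal_power I (card H)"
    using splitting_polynomial by blast
  define \<phi> where "\<phi> x = frob_trace p L (f ^ (p - 1) * x)" for x
  have wR: "w \<in> carrier R" using f(4) by (simp add: local_unit_def)
  show ?thesis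
    unfolding symbolic_gr_def
  proof (rule F.F_pure_graded_ring[where \<phi> = \<phi>])
    show "Factorial_Ring.prime p" by (rule p(1))
    show "CHAR('k matpoly) = p" by (simp add: CHAR_matpoly p(2))
    show "1 \<notin> symbolic_power R I (Suc 0)" by (rule one_notin_symbolic_power[OF I_ideal one_notin_I])
    fix n :: nat assume "\<not> p dvd n"
    then have n0: "of_nat n \<noteq> (0 :: 'k)" using p(2) of_nat_eq_0_iff_char_dvd[where ?'a = 'k] by auto
    show "\<exists>y\<in>carrier R. y * of_nat n = 1"
    proof (rule bexI[of _ "Poly_Mapping.single 0 (inverse (of_nat n))"])
      have "(of_nat n :: 'k matpoly) = Poly_Mapping.single 0 (of_nat n)" by simp
      then show "Poly_Mapping.single 0 (inverse (of_nat n)) * of_nat n = (1 :: 'k matpoly)"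
        using n0 by (simp only: mult_single) simp
    qed (simp add: ladder_ring_carrier)
  next
    show "\<phi> x \<in> carrier R" for x unfolding \<phi>_def by (rule frob_trace_carrier[OF pc])
    show "\<phi> (x + y) = \<phi> x + \<phi> y" for x y by (simp add: \<phi>_def distrib_left frob_trace_add)
    show "\<phi> (x ^ p * y) = x * \<phi> y" if "x \<in> carrier R" for x y
    proof -
      have "\<phi> (x ^ p * y) = frob_trace p L (x ^ p * (f ^ (p - 1) * y))" by (simp add: \<phi>_def mult.left_commute)
      then show ?thesis unfolding \<phi>_def frob_trace_pth_power_mult[OF pc that] .
    qed
    show "\<phi> 1 = 1" unfolding \<phi>_def using frob_trace_extremal[OF pc f(2,3)] by simp
  next
    fix n g assume g: "g \<in> symbolic_power R I (n * p + 1)"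
    show "\<phi> g \<in> symbolic_power R I (Suc n)"
    proof (rule symbolic_powerI)
      show "\<phi> g \<in> carrier R" unfolding \<phi>_def by (rule frob_trace_carrier[OF pc])
      fix P assume P: "P \<in> minimal_primes R I"
      then have Pp: "primeideal P R" by (simp add: minimal_primes_def)
      have wP: "w \<notin> P" using f(4) Pp avoid[OF P] by (simp add: local_unit_def)
      obtain s where s: "s \<in> carrier R" "s \<notin> P" "s * g \<in> ideal_power I (n * p + 1)"
        using symbolic_powerD(2)[OF g P] by blast
      have "(w * f) ^ (p - 1) \<in> ideal_power I (card H * (p - 1))"
      proof -
        have "(\<Prod>i<p - 1. w * f) \<in> ideal_power I (\<Sum>i<p - 1. card H)"
          by (rule ideal_power_prod[OF I_ideal]) (use f(5) in auto)
        then show ?thesis by (simp add: mult.commute)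
      qed
      \<comment> \<open>The factor from \<open>f\<close> contributes \<open>card H * (p - 1)\<close>
        and \<open>g\<close> contributes \<open>n * p + 1\<close>; the total is the exponent at
        which the pigeonhole argument starts.\<close>
      from ideal_power_mult[OF I_ideal this s(3)]
      have "(w * f) ^ (p - 1) * (s * g) \<in> ideal_power I (card H * (p - 1) + n * p + 1)"
        by (simp only: add.assoc)
      then have "(w * f) ^ (p - 1) * (s * g) \<in> contraction P (ideal_power J (card H * (p - 1) + n * p + 1))"
        using ideal_power_contraction[OF Pp J_ideal I_ideal I_subset_contraction[OF Pp avoid[OF P]]] by blast
      then obtain s' where s': "s' \<in> carrier R" "s' \<notin> P"
          "s' * ((w * f) ^ (p - 1) * (s * g)) \<in> ideal_power J (card H * (p - 1) + n * p + 1)"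
        unfolding contraction_def by blast
      define u where "u = s' * (w ^ (p - 1) * s)"
      have wpR: "w ^ (p - 1) \<in> carrier R" by (rule power_carrier[OF wR])
      have uR: "u \<in> carrier R" unfolding u_def by (intro mult_carrier s s' wpR)
      have uP: "u \<notin> P"
        using primeidealD(3)[OF Pp s'(1) mult_carrier[OF wpR s(1)]] primeidealD(3)[OF Pp wpR s(1)]
          prime_power_notin[OF Pp wR wP, of "p - 1"] s(2) s'(2) by (auto simp: u_def)
      have uJ: "u * (f ^ (p - 1) * g) \<in> ideal_power J (card H * (p - 1) + n * p + 1)"
        using s'(3) by (simp add: u_def power_mult_distrib mult_ac)
      \<comment> \<open>A factor can leave the trace only as a \<open>p\<close>-th power: one copy
        of \<open>u\<close> brings \<open>f ^ (p - 1) * g\<close> into the power of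
        \<open>J\<close>, and the other \<open>p - 1\<close> copies serve as the multiplier
        \<open>b\<close>.\<close>
      have up: "u ^ p = u * u ^ (p - 1)" using p_pos by (cases p) auto
      have "u * \<phi> g = frob_trace p L (u ^ p * (f ^ (p - 1) * g))"
        unfolding \<phi>_def frob_trace_pth_power_mult[OF pc uR] ..
      also have "u ^ p * (f ^ (p - 1) * g) = u * (f ^ (p - 1) * g) * u ^ (p - 1)" unfolding up by (simp add: mult_ac)
      also have "frob_trace p L \<dots> \<in> ideal_power I (Suc n)"
        by (rule frob_trace_ideal_power[OF pc uJ power_carrier[OF uR]])
      finally show "\<exists>s. s \<in> carrier R \<and> s \<notin> P \<and> s * \<phi> g \<in> ideal_power I (Suc n)" using uR uP by blast
    qed
  qed
qed

end

section \<open>Evaluation of polynomials\<close>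

definition monom_eval :: "('x \<Rightarrow> 'b::comm_ring_1) \<Rightarrow> ('x \<Rightarrow>\<^sub>0 nat) \<Rightarrow> 'b" where
  "monom_eval A m = (\<Prod>x\<in>Poly_Mapping.keys m. A x ^ Poly_Mapping.lookup m x)"

definition poly_eval :: "('a::comm_ring_1 \<Rightarrow> 'b::comm_ring_1) \<Rightarrow> ('x \<Rightarrow> 'b) \<Rightarrow> (('x \<Rightarrow>\<^sub>0 nat) \<Rightarrow>\<^sub>0 'a) \<Rightarrow> 'b" where
  "poly_eval \<iota> A f = (\<Sum>m\<in>Poly_Mapping.keys f. \<iota> (Poly_Mapping.lookup f m) * monom_eval A m)"

lemma monom_eval_superset:
  assumes "finite E" "Poly_Mapping.keys m \<subseteq> E"
  shows "monom_eval A m = (\<Prod>x\<in>E. A x ^ Poly_Mapping.lookup m x)"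
  unfolding monom_eval_def by (rule prod.mono_neutral_left) (use assms in \<open>auto simp: in_keys_iff\<close>)

lemma monom_eval_0 [simp]: "monom_eval A 0 = 1"
  by (simp add: monom_eval_def)

lemma monom_eval_add: "monom_eval A (m + n) = monom_eval A m * monom_eval A n"
proof -
  let ?E = "Poly_Mapping.keys m \<union> Poly_Mapping.keys n"
  have "Poly_Mapping.keys (m + n) \<subseteq> ?E" by (rule keys_add)
  then show ?thesis
    by (simp add: monom_eval_superset[of ?E] lookup_add power_add prod.distrib)
qed

locale coefficient_hom = comm_ring_hom \<iota> for \<iota> :: "'a::comm_ring_1 \<Rightarrow> 'b::comm_ring_1"
begin

lemma poly_eval_superset:
  assumes "finite E" "Poly_Mapping.keys f \<subseteq> E"
  shows "poly_eval \<iota> A f = (\<Sum>m\<in>E. \<iota> (Poly_Mapping.lookup f m) * monom_eval A m)"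
  unfolding poly_eval_def by (rule sum.mono_neutral_left) (use assms in \<open>auto simp: in_keys_iff\<close>)

lemma poly_eval_single: "poly_eval \<iota> A (Poly_Mapping.single m c) = \<iota> c * monom_eval A m"
  by (simp add: poly_eval_def)

lemma poly_eval_add: "poly_eval \<iota> A (f + g) = poly_eval \<iota> A f + poly_eval \<iota> A g"
proof -
  let ?E = "Poly_Mapping.keys f \<union> Poly_Mapping.keys g"
  have "Poly_Mapping.keys (f + g) \<subseteq> ?E" by (rule keys_add)
  then show ?thesis
    by (simp add: poly_eval_superset[of ?E] lookup_add hom_add distrib_right sum.distrib)
qed

lemma poly_eval_0: "poly_eval \<iota> A 0 = 0"
  by (simp add: poly_eval_def)

lemma poly_eval_sum: "poly_eval \<iota> A (sum f E) = (\<Sum>e\<in>E. poly_eval \<iota> A (f e))"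
  by (induction E rule: infinite_finite_induct) (auto simp: poly_eval_0 poly_eval_add)

lemma poly_eval_mult: "poly_eval \<iota> A (f * g) = poly_eval \<iota> A f * poly_eval \<iota> A g"
proof -
  let ?f = "\<lambda>m. Poly_Mapping.single m (Poly_Mapping.lookup f m)"
  let ?g = "\<lambda>m. Poly_Mapping.single m (Poly_Mapping.lookup g m)"
  have fg: "f * g = (\<Sum>m\<in>Poly_Mapping.keys f. \<Sum>n\<in>Poly_Mapping.keys g. ?f m * ?g n)"
    using poly_mapping_sum_monomials[of f] poly_mapping_sum_monomials[of g]
    by (simp add: sum_product[symmetric])
  have "poly_eval \<iota> A (?f m * ?g n) = poly_eval \<iota> A (?f m) * poly_eval \<iota> A (?g n)" for m n
    by (simp add: mult_single poly_eval_single monom_eval_add hom_mult mult_ac)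
  then have "poly_eval \<iota> A (f * g) =
      (\<Sum>m\<in>Poly_Mapping.keys f. poly_eval \<iota> A (?f m)) * (\<Sum>n\<in>Poly_Mapping.keys g. poly_eval \<iota> A (?g n))"
    unfolding fg by (simp add: poly_eval_sum sum_product)
  then show ?thesis
    unfolding poly_eval_sum[symmetric] using poly_mapping_sum_monomials[of f] poly_mapping_sum_monomials[of g] by simp
qed

lemma poly_eval_hom: "comm_ring_hom (poly_eval \<iota> A)"
proof
  show "poly_eval \<iota> A 1 = 1"
    using poly_eval_single[of A 0 1] by simp
qed (simp_all add: poly_eval_0 poly_eval_add poly_eval_mult)

lemma poly_eval_indet: "poly_eval \<iota> A (indet x) = A x"
  by (simp add: indet_def poly_eval_single monom_eval_def)

end

text \<open>A homomorphism on polynomials is evaluation at the images of the indeterminates. This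
  turns \<open>h g\<close> into the value of a polynomial function at a matrix, which can then be
  deformed.\<close>

lemma poly_eval_generic:
  fixes h :: "'a::comm_ring_1 matpoly \<Rightarrow> 'b::comm_ring_1"
  assumes "comm_ring_hom h"
  shows "poly_eval (\<lambda>c. h (Poly_Mapping.single 0 c)) (\<lambda>x. h (indet x)) f = h f"
proof -
  interpret h: comm_ring_hom h by fact
  have pow: "indet x ^ n = (Poly_Mapping.single (Poly_Mapping.single x n) 1 :: 'a matpoly)" for x n
    by (induction n) (auto simp: indet_def mult_single single_add[symmetric])
  have mon: "(\<Prod>x\<in>E. indet x ^ Poly_Mapping.lookup m x) =
      (Poly_Mapping.single (\<Sum>x\<in>E. Poly_Mapping.single x (Poly_Mapping.lookup m x)) 1 :: 'a matpoly)"
    if "finite E" for E m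
    using that by (induction E rule: finite_induct) (auto simp: pow mult_single)
  have h_single: "h (Poly_Mapping.single m c) = h (Poly_Mapping.single 0 c) * monom_eval (\<lambda>x. h (indet x)) m" for m c
  proof -
    have "(\<Sum>x\<in>Poly_Mapping.keys m. Poly_Mapping.single x (Poly_Mapping.lookup m x)) = m"
      by (rule poly_mapping_sum_monomials[symmetric])
    then have "(Poly_Mapping.single m c :: 'a matpoly) =
        Poly_Mapping.single 0 c * (\<Prod>x\<in>Poly_Mapping.keys m. indet x ^ Poly_Mapping.lookup m x)"
      by (simp add: mon[OF finite_keys] mult_single)
    then show ?thesis by (simp add: monom_eval_def h.hom_mult h.hom_prod h.hom_power)
  qed
  have "poly_eval (\<lambda>c. h (Poly_Mapping.single 0 c)) (\<lambda>x. h (indet x)) f =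
      (\<Sum>m\<in>Poly_Mapping.keys f. h (Poly_Mapping.single m (Poly_Mapping.lookup f m)))"
    unfolding poly_eval_def by (rule sum.cong[OF refl]) (rule h_single[symmetric])
  also have "\<dots> = h (\<Sum>m\<in>Poly_Mapping.keys f. Poly_Mapping.single m (Poly_Mapping.lookup f m))"
    by (simp add: h.hom_sum)
  finally show ?thesis using poly_mapping_sum_monomials[of f] by simp
qed

section \<open>Density of the locus where the corner minors do not vanish\<close>

context ladder_data
begin

lemma corner_images:
  assumes "j \<in> {1..v}"
  shows "rho j ` {..<r j} = corner_rows j" "kap j ` {..<r j} = corner_cols j"
    "inj_on (rho j) {..<r j}" "inj_on (kap j) {..<r j}"
proof -
  show "kap j ` {..<r j} = corner_cols j"
    unfolding kap_def corner_cols_def by (simp add: lessThan_atLeast0 add.commute)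
  show "rho j ` {..<r j} = corner_rows j"
  proof (intro equalityI subsetI)
    fix i assume "i \<in> corner_rows j"
    then have "i = rho j (i - (d j - r j + 1))" "i - (d j - r j + 1) < r j"
      using corner_bounds[OF assms] by (auto simp: corner_rows_def rho_def)
    then show "i \<in> rho j ` {..<r j}" by blast
  qed (use corner_bounds[OF assms] in \<open>auto simp: corner_rows_def rho_def\<close>)
qed (auto simp: rho_def kap_def inj_on_def)

text \<open>The least staircase containing \<open>L\<close>. By \<open>sw_hull_rect\<close> the
  blocks it adds to the conditions still lie in the subladders, so no rank condition beyond those
  from the minors arises.\<close>

definition sw_hull :: "(nat \<times> nat) set" where
  "sw_hull = {(i, m). i \<in> {1..k} \<and> m \<in> {1..l} \<and> (\<exists>i' m'. (i', m') \<in> L \<and> i' \<le> i \<and> m \<le> m')}"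

lemma L_subset_sw_hull: "L \<subseteq> sw_hull"
  using L_bounds by (auto simp: sw_hull_def)

lemma staircase_sw_hull: "staircase sw_hull"
  unfolding staircase_def sw_hull_def by fastforce

lemma sw_hull_rect:
  assumes "j \<in> {1..v}" "(i, m) \<in> sw_hull" "i \<le> d j" "c j \<le> m" "i' \<in> {i..d j}" "m' \<in> {c j..m}"
  shows "(i', m') \<in> subladder l L d c j"
proof -
  obtain i0 m0 where "(i0, m0) \<in> L" "i0 \<le> i" "m \<le> m0" using assms(2) by (auto simp: sw_hull_def)
  then have "(i', m') \<in> L" using in_rect[OF assms(1), of i0 m0 i' m'] assms by auto
  then show ?thesis using assms(5,6) by (simp add: subladder_iff)
qed

text \<open>The matrix of images under \<open>h\<close> satisfies the rank conditions and
  \<open>g\<close> is nonzero there. A nearby choice makes all corner minors nonzero as well, and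
  evaluation at that point kills \<open>I\<close> but not \<open>g * delta j ^ n\<close>.\<close>

lemma generic_point_contradiction:
  fixes h :: "'k matpoly \<Rightarrow> 'f::field"
  assumes inf: "infinite (UNIV :: 'f set)" and h: "comm_ring_hom h"
    and minors: "\<And>j f g. j \<in> {1..v} \<Longrightarrow> submatrix_in (Suc (r j)) (subladder l L d c j) f g \<Longrightarrow> h (minor (Suc (r j)) f g) = 0"
    and g: "g \<in> carrier R" "h g \<noteq> 0" and j: "j \<in> {1..v}"
  shows "g * delta j ^ n \<notin> I"
proof
  assume gI: "g * delta j ^ n \<in> I"
  interpret h: comm_ring_hom h by (rule h)
  define A where "A i m = h (indet (i, m))" for i m
  define \<iota> where "\<iota> c = h (Poly_Mapping.single 0 c)" for c
  interpret \<iota>: coefficient_hom \<iota>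
  proof
    show "\<iota> (x + y) = \<iota> x + \<iota> y" for x y by (simp add: \<iota>_def single_add h.hom_add)
    show "\<iota> (x * y) = \<iota> x * \<iota> y" for x y
      unfolding \<iota>_def h.hom_mult[symmetric] mult_single by simp
  qed (simp_all add: \<iota>_def)
  define G where "G B = poly_eval \<iota> (\<lambda>x. B (fst x) (snd x)) g" for B
  have det_hom: "h' (minor s f f') = det (mat s s (\<lambda>(a, b). h' (indet (f a, f' b))))"
    if "comm_ring_hom h'" for s f f' and h' :: "'k matpoly \<Rightarrow> 'f"
  proof -
    interpret h': comm_ring_hom h' by (rule that)
    show ?thesis unfolding minor_def h'.hom_det[symmetric]
      by (rule arg_cong[of _ _ det]) (rule eq_matI, auto)
  qed
  have cond: "rank_cond sw_hull A"
  proof (rule rank_condI, rule ccontr)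
    fix j i m assume jim: "j \<in> {1..v}" "(i, m) \<in> sw_hull" "i \<le> d j" "c j \<le> m"
      and no: "\<not> rank_le A {i..d j} {c j..m} (r j)"
    obtain f f' where f: "strict_mono_on {..<Suc (r j)} f" "strict_mono_on {..<Suc (r j)} f'"
      "f ` {..<Suc (r j)} \<subseteq> {i..d j}" "f' ` {..<Suc (r j)} \<subseteq> {c j..m}"
      "det (mat (Suc (r j)) (Suc (r j)) (\<lambda>(a, b). A (f a) (f' b))) \<noteq> 0"
      by (rule minor_neq_0_exists[OF no])
    have "f ` {..<Suc (r j)} \<times> f' ` {..<Suc (r j)} \<subseteq> subladder l L d c j"
      using f(3,4) sw_hull_rect[OF jim] by blast
    then have "submatrix_in (Suc (r j)) (subladder l L d c j) f f'"
      using f(1,2) by (simp add: submatrix_in_def)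
    from minors[OF jim(1) this] show False using f(5) unfolding det_hom[OF h] A_def by simp
  qed
  have pG: "polyfun sw_hull G"
    unfolding G_def poly_eval_def monom_eval_def
  proof (intro polyfun_sum polyfun_mult polyfun_const polyfun_prod polyfun_power finite_keys)
    fix m x assume "m \<in> Poly_Mapping.keys g" "x \<in> Poly_Mapping.keys m"
    then have "(fst x, snd x) \<in> sw_hull" using g(1) L_subset_sw_hull unfolding ladder_ring_carrier by force
    then show "polyfun sw_hull (\<lambda>B. B (fst x) (snd x))" by (rule polyfun_coord)
  qed
  have "G A = h g" using poly_eval_generic[OF h, of g] by (simp add: G_def A_def \<iota>_def[abs_def])
  then have "G A \<noteq> 0" using g(2) by simp
  then obtain B where B: "rank_cond sw_hull B" "G B \<noteq> 0"
    "\<And>j. j \<in> {1..v} \<Longrightarrow> nonsing B (corner_rows j) (corner_cols j)"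
    using rank_cond_dense[OF inf staircase_sw_hull cond pG] by blast
  define ev where "ev = poly_eval \<iota> (\<lambda>x. B (fst x) (snd x))"
  have ev: "comm_ring_hom ev" unfolding ev_def by (rule \<iota>.poly_eval_hom)
  interpret ev: comm_ring_hom ev by (rule ev)
  have ev_minor: "ev (minor s f f') = det (mat s s (\<lambda>(a, b). B (f a) (f' b)))" for s f f'
    unfolding det_hom[OF ev] by (simp add: ev_def \<iota>.poly_eval_indet)
  have "I \<subseteq> {f \<in> carrier R. ev f = 0}"
  proof (rule I_least)
    show "ideal {f \<in> carrier R. ev f = 0} R"
      by (rule idealI') (auto simp: ev.hom_add ev.hom_mult intro: carrier_intros)
    fix j f f' assume j: "j \<in> {1..v}" and s: "submatrix_in (Suc (r j)) (subladder l L d c j) f f'"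
    have sm: "strict_mono_on {..<Suc (r j)} f" "strict_mono_on {..<Suc (r j)} f'"
      using s by (auto simp: submatrix_in_def)
    have sub: "(f a, f' b) \<in> L \<and> f a \<le> d j \<and> c j \<le> f' b" if "a < Suc (r j)" "b < Suc (r j)" for a b
      using submatrix_entry[OF s that] unfolding subladder_iff .
    have f0: "f 0 \<le> f a" if "a < Suc (r j)" for a
      using strict_mono_onD[OF sm(1), of 0 a] that by (cases a) auto
    have fr: "f' b \<le> f' (r j)" if "b < Suc (r j)" for b
      using strict_mono_onD[OF sm(2), of b "r j"] that by (cases "b = r j") auto
    have "rank_le B {f 0..d j} {c j..f' (r j)} (r j)"
      by (rule rank_condD[OF B(1) j]) (use sub[of 0 "r j"] L_subset_sw_hull in auto)
    then have "det (mat (Suc (r j)) (Suc (r j)) (\<lambda>(a, b). B (f a) (f' b))) = 0"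
    proof (rule minor_eq_0)
      show "f ` {..<Suc (r j)} \<subseteq> {f 0..d j}" using f0 sub[of _ 0] by auto
      show "f' ` {..<Suc (r j)} \<subseteq> {c j..f' (r j)}" using fr sub[of 0] by auto
    qed (use sm strict_mono_on_imp_inj_on in auto)
    then show "minor (Suc (r j)) f f' \<in> {f \<in> carrier R. ev f = 0}"
      using minor_carrier[OF s subladder_subset] by (simp add: ev_minor)
  qed
  then have "ev (g * delta j ^ n) = 0" using gI by blast
  then have "ev g * ev (delta j) ^ n = 0" by (simp add: ev.hom_mult ev.hom_power)
  moreover have "ev g \<noteq> 0" using B(2) by (simp add: ev_def G_def)
  moreover have "ev (delta j) \<noteq> 0"
  proof -
    have "delta j = minor (r j) (rho j) (kap j)" by (simp add: delta_def minor_eq_det)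
    then have "ev (delta j) = det (mat (r j) (r j) (\<lambda>(a, b). B (rho j a) (kap j b)))"
      using ev_minor by simp
    then show ?thesis
      using det_eq_0_iff_not_nonsing[OF corner_images(3,4)[OF j], of B] B(3)[OF j] corner_images(1,2)[OF j] by simp
  qed
  ultimately show False by simp
qed

end

section \<open>Residue fields\<close>

definition prime_set :: "'r::comm_ring_1 set \<Rightarrow> bool" where
  "prime_set Q \<longleftrightarrow> 0 \<in> Q \<and> 1 \<notin> Q \<and> (\<forall>x\<in>Q. \<forall>y\<in>Q. x + y \<in> Q) \<and> (\<forall>a. \<forall>x\<in>Q. a * x \<in> Q) \<and>
     (\<forall>x y. x * y \<in> Q \<longrightarrow> x \<in> Q \<or> y \<in> Q)"

text \<open>All ladder data are quantified inside, so that the property concerns \<open>Q\<close>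
  alone; a counterexample can then be selected without parameters, as the definition of a type
  requires.\<close>

definition avoids_corner_minors :: "'k::field matpoly set \<Rightarrow> bool" where
  "avoids_corner_minors Q \<longleftrightarrow> (\<forall>k l v d c r L j g n. ladder_data k l v d c r L \<longrightarrow>
     ladder_data.I l v d c r L \<subseteq> Q \<longrightarrow> j \<in> {1..v} \<longrightarrow> g \<in> carrier (ladder_ring L) - Q \<longrightarrow>
     g * ladder_data.delta d c r j ^ n \<notin> ladder_data.I l v d c r L)"

text \<open>The density theorem is about a type of class \<open>field\<close>, whereas the residue field of a prime
  is a set depending on that prime. So the quotient is formed as a type for one particular prime, a
  counterexample to the claim if there is one; once the claim is proved for that prime, it holds
  for all of them.\<close>

definition test_prime :: "'k::field matpoly set" where
  "test_prime = (if \<exists>Q :: 'k matpoly set. prime_set Q \<and> \<not> avoids_corner_minors Q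
     then SOME Q. prime_set Q \<and> \<not> avoids_corner_minors Q else {f. Poly_Mapping.lookup f 0 = 0})"

text \<open>Provides the default of \<open>test_prime\<close>, so that the quotient is a domain in
  every case. Taking constant terms is evaluation at the origin, hence multiplicative.\<close>

lemma prime_set_no_constant_term: "prime_set {f :: 'k::field matpoly. Poly_Mapping.lookup f 0 = 0}"
proof -
  have "Poly_Mapping.lookup (f * g) 0 = Poly_Mapping.lookup f 0 * Poly_Mapping.lookup g 0" for f g :: "'k matpoly"
  proof -
    have "coefficient_hom (\<lambda>x :: 'k. x)" by unfold_locales auto
    then interpret e: comm_ring_hom "poly_eval (\<lambda>x :: 'k. x) (\<lambda>_ :: nat \<times> nat. 0)"
      by (rule coefficient_hom.poly_eval_hom)
    have "poly_eval (\<lambda>x :: 'k. x) (\<lambda>_ :: nat \<times> nat. 0) f = Poly_Mapping.lookup f 0" for f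
    proof -
      have "monom_eval (\<lambda>_ :: nat \<times> nat. 0 :: 'k) m = (if m = 0 then 1 else 0)" for m
      proof (cases "m = 0")
        case False
        then have "Poly_Mapping.keys m \<noteq> {}" by simp
        then obtain x where x: "x \<in> Poly_Mapping.keys m"
          unfolding ex_in_conv[symmetric] by (rule exE)
        then have "(0 :: 'k) ^ Poly_Mapping.lookup m x = 0" unfolding in_keys_iff by simp
        then have "(\<Prod>x\<in>Poly_Mapping.keys m. (0 :: 'k) ^ Poly_Mapping.lookup m x) = 0"
          using x by (intro prod_zero[OF finite_keys] bexI)
        then show ?thesis using False by (simp add: monom_eval_def)
      qed simp
      then have "poly_eval (\<lambda>x :: 'k. x) (\<lambda>_ :: nat \<times> nat. 0) f =
          (\<Sum>m\<in>Poly_Mapping.keys f. if m = 0 then Poly_Mapping.lookup f m else 0)"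
        unfolding poly_eval_def by (intro sum.cong) auto
      then show ?thesis by (simp add: in_keys_iff)
    qed
    then show ?thesis using e.hom_mult[of f g] by simp
  qed
  then show ?thesis by (auto simp: prime_set_def lookup_add)
qed

lemma prime_set_test_prime: "prime_set (test_prime :: 'k::field matpoly set)"
proof (cases "\<exists>Q :: 'k matpoly set. prime_set Q \<and> \<not> avoids_corner_minors Q")
  case True
  then show ?thesis unfolding test_prime_def if_P[OF True] using someI_ex[OF True] by blast
next
  case False
  show ?thesis unfolding test_prime_def if_not_P[OF False] by (rule prime_set_no_constant_term[where 'k = 'k])
qed

lemma test_prime:
  shows "0 \<in> (test_prime :: 'k::field matpoly set)" "1 \<notin> (test_prime :: 'k matpoly set)"
    "x \<in> test_prime \<Longrightarrow> y \<in> test_prime \<Longrightarrow> x + y \<in> (test_prime :: 'k matpoly set)"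
    "x \<in> test_prime \<Longrightarrow> a * x \<in> (test_prime :: 'k matpoly set)"
    "x * y \<in> test_prime \<Longrightarrow> x \<in> test_prime \<or> y \<in> (test_prime :: 'k matpoly set)"
    "x \<in> test_prime \<Longrightarrow> - x \<in> (test_prime :: 'k matpoly set)"
proof -
  note t = prime_set_test_prime[where 'k = 'k, unfolded prime_set_def]
  show "0 \<in> (test_prime :: 'k::field matpoly set)" "1 \<notin> (test_prime :: 'k matpoly set)"
    "x \<in> test_prime \<Longrightarrow> y \<in> test_prime \<Longrightarrow> x + y \<in> (test_prime :: 'k matpoly set)"
    "x * y \<in> test_prime \<Longrightarrow> x \<in> test_prime \<or> y \<in> (test_prime :: 'k matpoly set)"
    using t by blast+
  show abs: "x \<in> test_prime \<Longrightarrow> a * x \<in> (test_prime :: 'k matpoly set)" for a x using t by blast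
  show "x \<in> test_prime \<Longrightarrow> - x \<in> (test_prime :: 'k matpoly set)" using abs[of x "- 1"] by simp
qed

definition same_residue :: "'k::field matpoly \<Rightarrow> 'k matpoly \<Rightarrow> bool" where
  "same_residue f g \<longleftrightarrow> f - g \<in> test_prime"

lemma same_residue_equivp: "equivp (same_residue :: 'k::field matpoly \<Rightarrow> _)"
proof (rule equivpI)
  show "reflp (same_residue :: 'k matpoly \<Rightarrow> _)" by (rule reflpI) (simp add: same_residue_def test_prime)
  show "symp (same_residue :: 'k matpoly \<Rightarrow> _)"
  proof (rule sympI)
    fix a b :: "'k matpoly"
    assume "same_residue a b"
    then have "- (a - b) \<in> test_prime" unfolding same_residue_def by (rule test_prime(6))
    then show "same_residue b a" by (simp add: same_residue_def)
  qed
  show "transp (same_residue :: 'k matpoly \<Rightarrow> _)"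
  proof (rule transpI)
    fix a b c :: "'k matpoly"
    assume "same_residue a b" "same_residue b c"
    then have "(a - b) + (b - c) \<in> test_prime" unfolding same_residue_def by (rule test_prime(3))
    then show "same_residue a c" by (simp add: same_residue_def)
  qed
qed

quotient_type (overloaded) 'k residue = "'k::field matpoly" / same_residue
  by (rule same_residue_equivp)

instantiation residue :: (field) idom
begin

lift_definition zero_residue :: "'a residue" is 0 .
lift_definition one_residue :: "'a residue" is 1 .

lift_definition plus_residue :: "'a residue \<Rightarrow> 'a residue \<Rightarrow> 'a residue" is "(+)"
proof -
  fix a b a' b' :: "'a matpoly"
  assume "same_residue a b" "same_residue a' b'"
  then have "(a - b) + (a' - b') \<in> test_prime" unfolding same_residue_def by (rule test_prime(3))
  then show "same_residue (a + a') (b + b')" by (simp add: same_residue_def algebra_simps)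
qed

lift_definition uminus_residue :: "'a residue \<Rightarrow> 'a residue" is uminus
proof -
  fix a b :: "'a matpoly"
  assume "same_residue a b"
  then have "- (a - b) \<in> test_prime" unfolding same_residue_def by (rule test_prime(6))
  then show "same_residue (- a) (- b)" by (simp add: same_residue_def)
qed

lift_definition minus_residue :: "'a residue \<Rightarrow> 'a residue \<Rightarrow> 'a residue" is "(-)"
proof -
  fix a b a' b' :: "'a matpoly"
  assume "same_residue a b" "same_residue a' b'"
  then have "(a - b) + - (a' - b') \<in> test_prime"
    unfolding same_residue_def by (intro test_prime(3,6))
  then show "same_residue (a - a') (b - b')" by (simp add: same_residue_def algebra_simps)
qed

lift_definition times_residue :: "'a residue \<Rightarrow> 'a residue \<Rightarrow> 'a residue" is "(*)"
proof -
  fix a b a' b' :: "'a matpoly"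
  assume "same_residue a b" "same_residue a' b'"
  then have "a' * (a - b) + b * (a' - b') \<in> test_prime"
    unfolding same_residue_def by (intro test_prime(3,4))
  then show "same_residue (a * a') (b * b')" by (simp add: same_residue_def algebra_simps)
qed

instance
proof
  fix x y z :: "'a residue"
  show "x + y + z = x + (y + z)" by transfer (simp add: same_residue_def test_prime algebra_simps)
  show "x + y = y + x" by transfer (simp add: same_residue_def test_prime algebra_simps)
  show "0 + x = x" by transfer (simp add: same_residue_def test_prime)
  show "- x + x = 0" by transfer (simp add: same_residue_def test_prime)
  show "x - y = x + - y" by transfer (simp add: same_residue_def test_prime)
  show "x * y * z = x * (y * z)" by transfer (simp add: same_residue_def test_prime algebra_simps)
  show "x * y = y * x" by transfer (simp add: same_residue_def test_prime algebra_simps)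
  show "1 * x = x" by transfer (simp add: same_residue_def test_prime)
  show "(x + y) * z = x * z + y * z" by transfer (simp add: same_residue_def test_prime algebra_simps)
  show "0 * x = 0" "x * 0 = 0" by (transfer, simp add: same_residue_def test_prime)+
  show "x * (y + z) = x * y + x * z" by transfer (simp add: same_residue_def test_prime algebra_simps)
  show "(0 :: 'a residue) \<noteq> 1" by transfer (use test_prime(2,6) in \<open>fastforce simp: same_residue_def\<close>)
  show "x \<noteq> 0 \<Longrightarrow> y \<noteq> 0 \<Longrightarrow> x * y \<noteq> 0"
    by transfer (use test_prime(5) in \<open>auto simp: same_residue_def\<close>)
qed

end

text \<open>The residue domain may be finite, so a variable is adjoined before passing to fractions;
  this makes the field infinite.\<close>

definition residue_point :: "'k::field matpoly \<Rightarrow> 'k residue poly fract" where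
  "residue_point f = Fract [:abs_residue f:] 1"

lemma residue_point_hom: "comm_ring_hom (residue_point :: 'k::field matpoly \<Rightarrow> _)"
proof -
  have "abs_residue (f + g) = abs_residue f + abs_residue g"
    "abs_residue (f * g) = abs_residue f * abs_residue g"
    "abs_residue (1 :: 'k matpoly) = 1" "abs_residue (0 :: 'k matpoly) = 0" for f g :: "'k matpoly"
    by (simp_all add: plus_residue.abs_eq times_residue.abs_eq one_residue_def zero_residue_def)
  then show ?thesis
    by unfold_locales (simp_all add: residue_point_def One_fract_def Zero_fract_def one_pCons mult.commute)
qed

lemma residue_point_eq_0: "residue_point f = 0 \<longleftrightarrow> f \<in> test_prime"
proof -
  have "residue_point f = 0 \<longleftrightarrow> abs_residue f = 0"
    by (simp add: residue_point_def Zero_fract_def eq_fract)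
  also have "\<dots> \<longleftrightarrow> f \<in> test_prime" by (simp add: zero_residue_def residue.abs_eq_iff same_residue_def)
  finally show ?thesis .
qed

lemma infinite_residue_field: "infinite (UNIV :: 'k::field residue poly fract set)"
proof -
  have "inj (\<lambda>n. Fract (Polynomial.monom 1 n) 1 :: 'k residue poly fract)"
    by (rule injI) (simp add: eq_fract monom_eq_iff')
  then show ?thesis by (rule range_inj_infinite[THEN infinite_super[OF subset_UNIV]])
qed

lemma avoids_corner_minors_test_prime: "avoids_corner_minors (test_prime :: 'k::field matpoly set)"
  unfolding avoids_corner_minors_def
proof (intro allI impI)
  fix k l v d c r L j n and g :: "'k matpoly"
  assume ld: "ladder_data k l v d c r L" and I: "ladder_data.I l v d c r L \<subseteq> (test_prime :: 'k matpoly set)"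
    and j: "j \<in> {1..v}" and g: "g \<in> carrier (ladder_ring L) - test_prime"
  interpret ladder_data k l v d c r L "TYPE('k)" by (rule ld)
  show "g * delta j ^ n \<notin> I"
  proof (rule generic_point_contradiction[OF infinite_residue_field residue_point_hom])
    show "residue_point (minor (Suc (r j)) f f' :: 'k matpoly) = 0"
      if "j \<in> {1..v}" "submatrix_in (Suc (r j)) (subladder l L d c j) f f'" for j f f'
      unfolding residue_point_eq_0 by (rule subsetD[OF I minor_in_I[OF that]])
    show "g \<in> carrier (ladder_ring L)" "residue_point g \<noteq> 0" "j \<in> {1..v}"
      unfolding residue_point_eq_0 using g j by simp_all
  qed
qed

text \<open>If some prime failed, \<open>test_prime\<close> would be a failing one by its
  definition.\<close>

lemma prime_set_avoids_corner_minors: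
  fixes Q :: "'k::field matpoly set"
  assumes "prime_set Q"
  shows "avoids_corner_minors Q"
proof (rule ccontr)
  assume "\<not> avoids_corner_minors Q"
  with assms have ex: "\<exists>Q :: 'k matpoly set. prime_set Q \<and> \<not> avoids_corner_minors Q" by blast
  then have "\<not> avoids_corner_minors (test_prime :: 'k matpoly set)"
    unfolding test_prime_def if_P[OF ex] using someI_ex[OF ex] by blast
  then show False using avoids_corner_minors_test_prime by blast
qed

section \<open>Minimal primes\<close>

text \<open>The variables outside \<open>L\<close> are set to \<open>0\<close>. This retraction
  pulls primes of the ladder ring back to primes of the whole polynomial type.\<close>

definition restrict_vars :: "'x set \<Rightarrow> (('x \<Rightarrow>\<^sub>0 nat) \<Rightarrow>\<^sub>0 'a::comm_ring_1) \<Rightarrow> ('x \<Rightarrow>\<^sub>0 nat) \<Rightarrow>\<^sub>0 'a" where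
  "restrict_vars L f = (\<Sum>m\<in>{m\<in>Poly_Mapping.keys f. Poly_Mapping.keys m \<subseteq> L}. Poly_Mapping.single m (Poly_Mapping.lookup f m))"

lemma lookup_restrict_vars:
  "Poly_Mapping.lookup (restrict_vars L f) m = (if Poly_Mapping.keys m \<subseteq> L then Poly_Mapping.lookup f m else 0)"
proof -
  have "Poly_Mapping.lookup (restrict_vars L f) m =
      (\<Sum>e\<in>{m\<in>Poly_Mapping.keys f. Poly_Mapping.keys m \<subseteq> L}. if e = m then Poly_Mapping.lookup f e else 0)"
    unfolding restrict_vars_def lookup_sum lookup_single when_def by (rule refl)
  then show ?thesis by (simp add: in_keys_iff)
qed

lemma keys_restrict_vars: "m \<in> Poly_Mapping.keys (restrict_vars L f) \<Longrightarrow> Poly_Mapping.keys m \<subseteq> L"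
  unfolding in_keys_iff[of m] lookup_restrict_vars by (simp split: if_splits)

lemma restrict_vars_id: "(\<And>m. m \<in> Poly_Mapping.keys f \<Longrightarrow> Poly_Mapping.keys m \<subseteq> L) \<Longrightarrow> restrict_vars L f = f"
  by (rule poly_mapping_eqI) (auto simp: lookup_restrict_vars in_keys_iff)

lemma restrict_vars_add: "restrict_vars L (f + g) = restrict_vars L f + restrict_vars L g"
  by (rule poly_mapping_eqI) (simp add: lookup_restrict_vars lookup_add)

lemma restrict_vars_mult:
  fixes f g :: "('x \<Rightarrow>\<^sub>0 nat) \<Rightarrow>\<^sub>0 'a::comm_ring_1"
  shows "restrict_vars L (f * g) = restrict_vars L f * restrict_vars L g"
proof -
  have zero: "restrict_vars L (a * b) = 0" if a: "\<And>m. m \<in> Poly_Mapping.keys a \<Longrightarrow> \<not> Poly_Mapping.keys m \<subseteq> L"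
    for a b :: "('x \<Rightarrow>\<^sub>0 nat) \<Rightarrow>\<^sub>0 'a"
  proof (rule poly_mapping_eqI)
    fix m
    have "m \<notin> Poly_Mapping.keys (a * b)" if m: "Poly_Mapping.keys m \<subseteq> L"
    proof
      assume "m \<in> Poly_Mapping.keys (a * b)"
      then obtain x y where "m = x + y" "x \<in> Poly_Mapping.keys a" using keys_mult[of a b] by blast
      then show False using m a[of x]
        by (auto simp: keys_add_nat)
    qed
    then show "Poly_Mapping.lookup (restrict_vars L (a * b)) m = Poly_Mapping.lookup 0 m"
      by (auto simp: lookup_restrict_vars in_keys_iff)
  qed
  have keys: "\<not> Poly_Mapping.keys m \<subseteq> L" if "m \<in> Poly_Mapping.keys (h - restrict_vars L h)"
    for m and h :: "('x \<Rightarrow>\<^sub>0 nat) \<Rightarrow>\<^sub>0 'a"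
    using that by (auto simp: in_keys_iff lookup_minus lookup_restrict_vars)
  let ?f = "restrict_vars L f" and ?g = "restrict_vars L g"
  have "f * g = ?f * ?g + ((f - ?f) * g + (g - ?g) * ?f)" by (simp add: algebra_simps)
  then have "restrict_vars L (f * g) = restrict_vars L (?f * ?g) +
      (restrict_vars L ((f - ?f) * g) + restrict_vars L ((g - ?g) * ?f))"
    by (metis restrict_vars_add)
  also have "\<dots> = restrict_vars L (?f * ?g)" by (simp add: zero keys)
  also have "\<dots> = ?f * ?g"
  proof (rule restrict_vars_id)
    fix m assume "m \<in> Poly_Mapping.keys (?f * ?g)"
    then obtain x y where "m = x + y" "x \<in> Poly_Mapping.keys ?f" "y \<in> Poly_Mapping.keys ?g"
      using keys_mult[of ?f ?g] by blast
    then show "Poly_Mapping.keys m \<subseteq> L" using keys_restrict_vars by (auto simp: keys_add_nat)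
  qed
  finally show ?thesis .
qed

text \<open>Minimality of \<open>P\<close> would give some \<open>g\<close> outside \<open>P\<close>
  with \<open>g * delta j ^ n\<close> in \<open>I\<close>. The preimage \<open>Q\<close> of
  \<open>P\<close> under \<open>restrict_vars\<close> then contradicts
  \<open>avoids_corner_minors\<close>.\<close>

lemma (in ladder_data) delta_notin_minimal_prime:
  assumes P: "P \<in> minimal_primes R I" and j: "j \<in> {1..v}"
  shows "delta j \<notin> P"
proof
  assume dP: "delta j \<in> P"
  have Pp: "primeideal P R" "I \<subseteq> P" using P by (auto simp: minimal_primes_def)
  note Pd = primeidealD[OF Pp(1)]
  note Pi = idealD[OF Pd(1)]
  obtain g n where g: "g \<in> carrier R - P" "g * delta j ^ n \<in> I"
    using minimal_prime_nilpotent[OF I_ideal P dP] by blast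
  define Q where "Q = {f :: 'k matpoly. restrict_vars L f \<in> P}"
  have rR: "restrict_vars L f \<in> carrier R" for f :: "'k matpoly"
    unfolding ladder_ring_carrier using keys_restrict_vars by blast
  have id: "restrict_vars L f = f" if "f \<in> carrier R" for f
    using that unfolding ladder_ring_carrier by (intro restrict_vars_id) blast
  have QP: "f \<in> Q \<longleftrightarrow> f \<in> P" if "f \<in> carrier R" for f using id[OF that] by (simp add: Q_def)
  have "prime_set Q"
    unfolding prime_set_def
  proof (intro conjI ballI allI impI)
    show "0 \<in> Q" using QP[OF zero_carrier] Pi(2) by simp
    show "1 \<notin> Q" using QP[OF one_carrier] Pd(2) by simp
    show "x + y \<in> Q" if "x \<in> Q" "y \<in> Q" for x y
      using that Pi(3) by (simp add: Q_def restrict_vars_add)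
    show "a * x \<in> Q" if "x \<in> Q" for a x
      using that Pi(4)[OF rR] by (simp add: Q_def restrict_vars_mult)
    show "x \<in> Q \<or> y \<in> Q" if "x * y \<in> Q" for x y
      using that Pd(3)[OF rR rR] by (simp add: Q_def restrict_vars_mult)
  qed
  then have "avoids_corner_minors Q" by (rule prime_set_avoids_corner_minors)
  moreover have "I \<subseteq> Q" using Pp(2) Pi(1) QP by blast
  moreover have "g \<in> carrier R - Q" using g(1) QP by blast
  ultimately show False
    using g(2) j ladder_data_axioms unfolding avoids_corner_minors_def by blast
qed

section \<open>Laplace expansion\<close>

definition skip :: "nat \<Rightarrow> nat \<Rightarrow> nat" where
  "skip q b = (if b < q then b else Suc b)"

lemma skip_less: "b < n \<Longrightarrow> skip q b < Suc n"
  by (simp add: skip_def)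

lemma strict_mono_on_skip:
  assumes "strict_mono_on {..<Suc n} f"
  shows "strict_mono_on {..<n} (\<lambda>b. f (skip q b))"
  by (rule strict_mono_onI) (rule strict_mono_onD[OF assms], auto simp: skip_def)

lemma submatrix_in_iff:
  "submatrix_in n L' f g \<longleftrightarrow>
     strict_mono_on {..<n} f \<and> strict_mono_on {..<n} g \<and> (\<forall>a<n. \<forall>b<n. (f a, g b) \<in> L')"
  by (auto simp: submatrix_in_def)

lemma strict_mono_on_gap:
  fixes f :: "nat \<Rightarrow> nat"
  assumes "strict_mono_on {..<n} f"
  shows "a + m < n \<Longrightarrow> f a + m \<le> f (a + m)"
proof (induction m)
  case (Suc m)
  then show ?case using strict_mono_onD[OF assms, of "a + m" "a + Suc m"] by simp
qed simp

lemma minor_expand_last_row: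
  "(minor (Suc n) f g :: 'k::field matpoly) = (\<Sum>q<Suc n. indet (f n, g q) * ((-1) ^ (n + q) * minor n f (\<lambda>b. g (skip q b))))"
proof -
  let ?W = "mat (Suc n) (Suc n) (\<lambda>(a, b). indet (f a, g b)) :: 'k matpoly mat"
  have "mat_delete ?W n q = mat n n (\<lambda>(a, b). indet (f a, g (skip q b)))" for q
    by (rule eq_matI) (auto simp: mat_delete_def skip_def)
  then have cof: "cofactor ?W n q = (-1) ^ (n + q) * minor n f (\<lambda>b. g (skip q b))" for q
    by (simp add: cofactor_def minor_def)
  have "det ?W = (\<Sum>q<Suc n. ?W $$ (n, q) * cofactor ?W n q)"
    by (rule laplace_expansion_row) auto
  also have "\<dots> = (\<Sum>q<Suc n. indet (f n, g q) * ((-1) ^ (n + q) * minor n f (\<lambda>b. g (skip q b))))"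
    by (rule sum.cong[OF refl]) (simp add: cof)
  finally show ?thesis by (simp only: minor_def)
qed

lemma minor_expand_first_column:
  "(minor (Suc n) f g :: 'k::field matpoly) = (\<Sum>q<Suc n. indet (f q, g 0) * ((-1) ^ q * minor n (\<lambda>a. f (skip q a)) (\<lambda>b. g (Suc b))))"
proof -
  let ?W = "mat (Suc n) (Suc n) (\<lambda>(a, b). indet (f a, g b)) :: 'k matpoly mat"
  have "mat_delete ?W q 0 = mat n n (\<lambda>(a, b). indet (f (skip q a), g (Suc b)))" for q
    by (rule eq_matI) (auto simp: mat_delete_def skip_def)
  then have cof: "cofactor ?W q 0 = (-1) ^ q * minor n (\<lambda>a. f (skip q a)) (\<lambda>b. g (Suc b))" for q
    by (simp add: cofactor_def minor_def)
  have "det ?W = (\<Sum>q<Suc n. ?W $$ (q, 0) * cofactor ?W q 0)"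
    by (rule laplace_expansion_column) auto
  also have "\<dots> = (\<Sum>q<Suc n. indet (f q, g 0) * ((-1) ^ q * minor n (\<lambda>a. f (skip q a)) (\<lambda>b. g (Suc b))))"
    by (rule sum.cong[OF refl]) (simp add: cof)
  finally show ?thesis by (simp only: minor_def)
qed

lemma (in typed_cring) sum_in_ideal:
  assumes "ideal K R" "\<And>x. x \<in> A \<Longrightarrow> f x \<in> K"
  shows "sum f A \<in> K"
  using assms(2) by (induction A rule: infinite_finite_induct) (auto simp: idealD[OF assms(1)])

text \<open>Repeated expansion along the last row leaves minors of the first \<open>s\<close> rows,
  in varying columns.\<close>

lemma minor_in_ideal_of_top_rows:
  fixes K :: "'k::field matpoly set"
  assumes K: "ideal K (ladder_ring L)"
  shows "submatrix_in (s + n) L f g \<Longrightarrow>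
    (\<And>g'. submatrix_in s L f g' \<Longrightarrow> g' ` {..<s} \<subseteq> g ` {..<s + n} \<Longrightarrow> minor s f g' \<in> K) \<Longrightarrow>
    minor (s + n) f g \<in> K"
proof (induction n arbitrary: g)
  case 0
  then show ?case by simp
next
  case (Suc n)
  interpret typed_cring "ladder_ring L :: 'k matpoly ring" by (rule typed_cring_ladder_ring)
  have fg: "strict_mono_on {..<Suc (s + n)} f" "strict_mono_on {..<Suc (s + n)} g"
    "\<And>a b. a < Suc (s + n) \<Longrightarrow> b < Suc (s + n) \<Longrightarrow> (f a, g b) \<in> L"
    using Suc.prems(1) by (auto simp: submatrix_in_iff)
  have *: "minor (s + n) f (\<lambda>b. g (skip q b)) \<in> K" for q
  proof (rule Suc.IH)
    show "submatrix_in (s + n) L f (\<lambda>b. g (skip q b))"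
      unfolding submatrix_in_iff
    proof (intro conjI allI impI)
      show "strict_mono_on {..<s + n} f"
        using fg(1) by (auto simp: strict_mono_on_def)
      show "strict_mono_on {..<s + n} (\<lambda>b. g (skip q b))"
        using fg(2) by (rule strict_mono_on_skip)
    qed (use fg(3) skip_less in auto)
    fix g' assume g': "submatrix_in s L f g'" "g' ` {..<s} \<subseteq> (\<lambda>b. g (skip q b)) ` {..<s + n}"
    have "(\<lambda>b. g (skip q b)) ` {..<s + n} \<subseteq> g ` {..<s + Suc n}"
      using skip_less[of _ "s + n" q] by auto
    with g' show "minor s f g' \<in> K" by (intro Suc.prems(2)) auto
  qed
  have "indet (f (s + n), g q) * ((-1) ^ (s + n + q) * minor (s + n) f (\<lambda>b. g (skip q b))) \<in> K"
    if "q < Suc (s + n)" for q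
    by (rule idealD(4)[OF K indet_carrier power_neg_one_mult[OF K *]]) (use fg(3) that in auto)
  then show ?case
    unfolding add_Suc_right minor_expand_last_row by (intro sum_in_ideal[OF K]) simp
qed

text \<open>Repeated expansion along the first column leaves minors of the last \<open>s\<close>
  columns, in varying rows.\<close>

lemma minor_in_ideal_of_right_columns:
  fixes K :: "'k::field matpoly set"
  assumes K: "ideal K (ladder_ring L)"
  shows "submatrix_in (s + n) L f g \<Longrightarrow>
    (\<And>f'. submatrix_in s L f' (\<lambda>b. g (b + n)) \<Longrightarrow> f' ` {..<s} \<subseteq> f ` {..<s + n} \<Longrightarrow> minor s f' (\<lambda>b. g (b + n)) \<in> K) \<Longrightarrow>
    minor (s + n) f g \<in> K"
proof (induction n arbitrary: f g)
  case 0
  then show ?case by simp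
next
  case (Suc n)
  interpret typed_cring "ladder_ring L :: 'k matpoly ring" by (rule typed_cring_ladder_ring)
  have fg: "strict_mono_on {..<Suc (s + n)} f" "strict_mono_on {..<Suc (s + n)} g"
    "\<And>a b. a < Suc (s + n) \<Longrightarrow> b < Suc (s + n) \<Longrightarrow> (f a, g b) \<in> L"
    using Suc.prems(1) by (auto simp: submatrix_in_iff)
  have *: "minor (s + n) (\<lambda>a. f (skip q a)) (\<lambda>b. g (Suc b)) \<in> K" for q
  proof (rule Suc.IH)
    show "submatrix_in (s + n) L (\<lambda>a. f (skip q a)) (\<lambda>b. g (Suc b))"
      unfolding submatrix_in_iff
    proof (intro conjI allI impI)
      show "strict_mono_on {..<s + n} (\<lambda>b. f (skip q b))"
        using fg(1) by (rule strict_mono_on_skip)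
      show "strict_mono_on {..<s + n} (\<lambda>b. g (Suc b))"
        using strict_mono_on_skip[OF fg(2), where q = 0] by (simp add: skip_def)
    qed (use fg(3) skip_less in auto)
    fix f' assume f': "submatrix_in s L f' (\<lambda>b. g (Suc (b + n)))" "f' ` {..<s} \<subseteq> (\<lambda>b. f (skip q b)) ` {..<s + n}"
    have "(\<lambda>b. f (skip q b)) ` {..<s + n} \<subseteq> f ` {..<s + Suc n}"
      using skip_less[of _ "s + n" q] by auto
    with f' show "minor s f' (\<lambda>b. g (Suc (b + n))) \<in> K" using Suc.prems(2)[of f'] by auto
  qed
  have "indet (f q, g 0) * ((-1) ^ q * minor (s + n) (\<lambda>a. f (skip q a)) (\<lambda>b. g (Suc b))) \<in> K"
    if "q < Suc (s + n)" for q
    by (rule idealD(4)[OF K indet_carrier power_neg_one_mult[OF K *]]) (use fg(3) that in auto)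
  then show ?case
    unfolding add_Suc_right minor_expand_first_column by (intro sum_in_ideal[OF K]) simp
qed

section \<open>Consequences of irredundancy\<close>

lemma minors_in_carrier:
  assumes "L' \<subseteq> L"
  shows "{minor n f g | f g. submatrix_in n L' f g} \<subseteq> carrier (ladder_ring L :: 'k::field matpoly ring)"
proof
  interpret typed_cring "ladder_ring L :: 'k matpoly ring" by (rule typed_cring_ladder_ring)
  fix x :: "'k matpoly" assume "x \<in> {minor n f g | f g. submatrix_in n L' f g}"
  then obtain f g where x: "x = minor n f g" and s: "submatrix_in n L' f g" by blast
  show "x \<in> carrier (ladder_ring L)"
    unfolding x minor_def
    by (rule det_carrier[of _ n]) (use s assms in \<open>auto simp: submatrix_in_iff intro!: indet_carrier\<close>)
qed

lemma minors_ideal_subsetI: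
  assumes "L1 \<subseteq> L" "L2 \<subseteq> L"
    and "\<And>f g K. ideal K (ladder_ring L) \<Longrightarrow>
      (\<And>f g. submatrix_in n2 L2 f g \<Longrightarrow> (minor n2 f g :: 'k matpoly) \<in> K) \<Longrightarrow>
      submatrix_in n1 L1 f g \<Longrightarrow> (minor n1 f g :: 'k::field matpoly) \<in> K"
  shows "(minors_ideal L n1 L1 :: 'k matpoly set) \<subseteq> minors_ideal L n2 L2"
proof -
  interpret typed_cring "ladder_ring L :: 'k matpoly ring" by (rule typed_cring_ladder_ring)
  have id: "ideal (minors_ideal L n2 L2 :: 'k matpoly set) (ladder_ring L)"
    unfolding minors_ideal_def by (rule genideal_ideal[OF minors_in_carrier[OF assms(2)]])
  have gen: "(minor n2 f g :: 'k matpoly) \<in> minors_ideal L n2 L2" if "submatrix_in n2 L2 f g" for f g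
    unfolding minors_ideal_def
    by (rule subsetD[OF genideal_self[OF minors_in_carrier[OF assms(2)]]]) (use that in blast)
  show ?thesis
    unfolding minors_ideal_def[of L n1 L1]
    by (rule genideal_minimal[OF id]) (use assms(3)[OF id gen] in blast)
qed

lemma subladder_iff':
  assumes "is_ladder k l L"
  shows "(i, m) \<in> subladder l L d c j \<longleftrightarrow> (i, m) \<in> L \<and> i \<le> d j \<and> c j \<le> m"
  using assms by (auto simp: subladder_def is_ladder_def)

text \<open>The first \<open>t i\<close> rows of a minor of size \<open>t j\<close> end at least
  \<open>t j - t i\<close> above row \<open>d j\<close>, hence at or above row \<open>d i\<close>.
  Every minor of size \<open>t i\<close> in these rows thus belongs to the subladder of
  \<open>i\<close>.\<close>

lemma minors_ideal_subset_rows: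
  assumes lad: "is_ladder k l L" and c: "c i \<le> c j" and td: "t i \<le> t j" "d j + t i \<le> d i + t j" and t: "0 < t i"
  shows "(minors_ideal L (t j) (subladder l L d c j) :: 'k::field matpoly set)
    \<subseteq> minors_ideal L (t i) (subladder l L d c i)"
proof (rule minors_ideal_subsetI)
  fix f g and K :: "'k matpoly set"
  assume K: "ideal K (ladder_ring L)"
    and min: "\<And>f g. submatrix_in (t i) (subladder l L d c i) f g \<Longrightarrow> minor (t i) f g \<in> K"
    and s: "submatrix_in (t j) (subladder l L d c j) f g"
  define n where "n = t j - t i"
  have n: "t j = t i + n" using td(1) by (simp add: n_def)
  note s' = s[unfolded submatrix_in_iff n subladder_iff'[OF lad]]
  have f: "f a \<le> d i" if "a < t i" for a
  proof -
    have "a + (t i - 1 - a + n) < t i + n" using that by linarith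
    from strict_mono_on_gap[OF conjunct1[OF s'] this]
    have "f a + (t i - 1 - a + n) \<le> f (t i + n - 1)" using that by simp
    also have "\<dots> \<le> d j" using conjunct2[OF conjunct2[OF s'], rule_format, of "t i + n - 1" 0] t by simp
    finally show ?thesis using td(2) n by linarith
  qed
  show "minor (t j) f g \<in> K"
    unfolding n
  proof (rule minor_in_ideal_of_top_rows[OF K])
    show "submatrix_in (t i + n) L f g" using s' by (auto simp: submatrix_in_iff)
    fix g' assume g': "submatrix_in (t i) L f g'" "g' ` {..<t i} \<subseteq> g ` {..<t i + n}"
    have "c i \<le> g' b" if "b < t i" for b
    proof -
      have "g' b \<in> g ` {..<t i + n}" using g'(2) that by blast
      then obtain b' where "g' b = g b'" "b' < t i + n" by auto
      then show ?thesis using s' c by (metis le_trans)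
    qed
    then show "minor (t i) f g' \<in> K"
      using g'(1) f by (intro min) (auto simp: submatrix_in_iff subladder_iff'[OF lad])
  qed
qed (auto simp: subladder_def)

text \<open>The last \<open>t j\<close> columns of a minor of size \<open>t i\<close> start at least
  \<open>t i - t j\<close> to the right of column \<open>c i\<close>, hence at or beyond column
  \<open>c j\<close>.\<close>

lemma minors_ideal_subset_columns:
  assumes lad: "is_ladder k l L" and d: "d i \<le> d j" and tc: "t j \<le> t i" "c j + t j \<le> c i + t i"
  shows "(minors_ideal L (t i) (subladder l L d c i) :: 'k::field matpoly set)
    \<subseteq> minors_ideal L (t j) (subladder l L d c j)"
proof (rule minors_ideal_subsetI)
  fix f g and K :: "'k matpoly set"
  assume K: "ideal K (ladder_ring L)"
    and min: "\<And>f g. submatrix_in (t j) (subladder l L d c j) f g \<Longrightarrow> minor (t j) f g \<in> K"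
    and s: "submatrix_in (t i) (subladder l L d c i) f g"
  define n where "n = t i - t j"
  have n: "t i = t j + n" using tc(1) by (simp add: n_def)
  note s' = s[unfolded submatrix_in_iff n subladder_iff'[OF lad]]
  have g: "c j \<le> g (b + n)" if "b < t j" for b
  proof -
    have "b + n < t j + n" using that by linarith
    from strict_mono_on_gap[OF conjunct1[OF conjunct2[OF s']] this]
    have "g b + n \<le> g (b + n)" .
    moreover have "c i \<le> g b" using conjunct2[OF conjunct2[OF s'], rule_format, of 0 b] that by simp
    ultimately show ?thesis using tc(2) n by linarith
  qed
  show "minor (t i) f g \<in> K"
    unfolding n
  proof (rule minor_in_ideal_of_right_columns[OF K])
    show "submatrix_in (t j + n) L f g" using s' by (auto simp: submatrix_in_iff)
    fix f' assume f': "submatrix_in (t j) L f' (\<lambda>b. g (b + n))" "f' ` {..<t j} \<subseteq> f ` {..<t j + n}"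
    have "f' a \<le> d j" if "a < t j" for a
    proof -
      have "f' a \<in> f ` {..<t j + n}" using f'(2) that by blast
      then obtain a' where "f' a = f a'" "a' < t j + n" by auto
      then show ?thesis using s' d by (metis le_trans)
    qed
    then show "minor (t j) f' (\<lambda>b. g (b + n)) \<in> K"
      using f'(1) g by (intro min) (auto simp: submatrix_in_iff subladder_iff'[OF lad])
  qed
qed (auto simp: subladder_def)

text \<open>The upper right entry of the submatrix and the corner span a rectangle inside
  \<open>L\<close> with at least \<open>Suc n\<close> rows and columns, and the point
  \<open>n\<close> steps up and right from the corner lies in it.\<close>

lemma corner_gap:
  assumes lad: "is_ladder k l L" and corner: "(d j, c j) \<in> L"
    and s: "submatrix_in (Suc n) (subladder l L d c j) f g"
  shows "(d j - n, c j + n) \<in> L \<and> n < d j \<and> d j \<le> k \<and> 1 \<le> c j \<and> c j + n \<le> l"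
proof -
  note s' = s[unfolded submatrix_in_iff subladder_iff'[OF lad]]
  have fg: "(f 0, g n) \<in> L" "f n \<le> d j" "c j \<le> g 0" using s' by auto
  have "f 0 + n \<le> f n" "g 0 + n \<le> g n"
    using strict_mono_on_gap[of "Suc n" f 0 n] strict_mono_on_gap[of "Suc n" g 0 n] s' by auto
  then have b: "f 0 + n \<le> d j" "c j + n \<le> g n" using fg by auto
  have L: "L \<subseteq> {1..k} \<times> {1..l}" using lad by (simp add: is_ladder_def)
  have "{f 0..d j} \<times> {c j..g n} \<subseteq> L"
    using lad fg(1) corner b unfolding is_ladder_def by (meson add_leD1)
  then have "(d j - n, c j + n) \<in> L" using b by auto
  then show ?thesis using subsetD[OF L fg(1)] subsetD[OF L corner] b by auto
qed

theorem theoremB: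
  fixes p k l u v :: nat
    and L :: "(nat \<times> nat) set"
    and b a d c t :: "nat \<Rightarrow> nat"
  assumes char_pos: "CHAR('k::field) = p" "p > 0"
    and perfect: "\<forall>x::'k. \<exists>y. y ^ p = x"
    and ladder: "is_ladder k l L"
    and upper: "upper_outside_corners l L u b a"
    and lower: "lower_outside_corners k L v d c"
    and t_pos: "\<forall>j\<in>{1..v}. t j > 0"
    and entries_involved:
      "\<forall>x\<in>L. \<exists>j\<in>{1..v}. \<exists>r s. submatrix_in (t j) (subladder l L d c j) r s \<and>
         x \<in> r ` {..<t j} \<times> s ` {..<t j}"
    and distinct: "corners_distinct u b a v d c"
    and irredundant:
      "\<forall>i\<in>{1..v}. \<forall>j\<in>{1..v}. i \<noteq> j \<longrightarrow>
         \<not> (minors_ideal L (t i) (subladder l L d c i) :: 'k matpoly set)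
             \<subseteq> minors_ideal L (t j) (subladder l L d c j)"
    and no_proper_submatrix:
      "\<forall>A B. A \<subseteq> {1..k} \<and> B \<subseteq> {1..l} \<and> L \<subseteq> A \<times> B \<longrightarrow> A = {1..k} \<and> B = {1..l}"
  shows "F_pure TYPE('m) p
           (symbolic_gr (ladder_ring L) (mixed_ladder_ideal l L v d c t :: 'k matpoly set))"
proof -
  define r where "r j = t j - 1" for j
  have t: "t j = Suc (r j)" if "j \<in> {1..v}" for j using t_pos that by (auto simp: r_def)
  have corner: "(d j, c j) \<in> L" if "j \<in> {1..v}" for j
    using lower that by (simp add: lower_outside_corners_def)
  have v: "1 \<le> v" using lower by (simp add: lower_outside_corners_def)
  have mono: "d i \<le> d j" "c i \<le> c j" if "i \<in> {1..v}" "j \<in> {1..v}" "i < j" for i j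
    using lower that by (auto simp: lower_outside_corners_def intro: mono_onD)
  have irr: "\<not> (minors_ideal L (t i) (subladder l L d c i) :: 'k matpoly set)
      \<subseteq> minors_ideal L (t j) (subladder l L d c j)" if "i \<in> {1..v}" "j \<in> {1..v}" "i \<noteq> j" for i j
    using irredundant that by blast
  \<comment> \<open>If there is another corner, a subladder without minors of its size would
    generate the zero ideal, which every other ideal contains. If there is only one, the minor
    through the corner entry serves.\<close>
  have ex: "\<exists>f g. submatrix_in (t j) (subladder l L d c j) f g" if j: "j \<in> {1..v}" for j
  proof (cases "\<exists>i\<in>{1..v}. i \<noteq> j")
    case True
    then obtain i where i: "i \<in> {1..v}" "j \<noteq> i" by blast
    show ?thesis
    proof (rule ccontr)
      assume no: "\<nexists>f g. submatrix_in (t j) (subladder l L d c j) f g"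
      have "(minors_ideal L (t j) (subladder l L d c j) :: 'k matpoly set)
          \<subseteq> minors_ideal L (t i) (subladder l L d c i)"
        by (rule minors_ideal_subsetI) (use no in \<open>auto simp: subladder_def\<close>)
      with irr[OF j i] show False by contradiction
    qed
  next
    case False
    obtain i f g where i: "i \<in> {1..v}" and s: "submatrix_in (t i) (subladder l L d c i) f g"
      using bspec[OF entries_involved corner[OF j]] by blast
    have "i = j" using False i by blast
    with s show ?thesis by blast
  qed
  have gap: "(d j - r j, c j + r j) \<in> L \<and> r j < d j \<and> d j \<le> k \<and> 1 \<le> c j \<and> c j + r j \<le> l" if j: "j \<in> {1..v}" for j
  proof -
    obtain f g where "submatrix_in (Suc (r j)) (subladder l L d c j) f g" using ex[OF j] t[OF j] by auto
    then show ?thesis using corner_gap[of k l L d j c "r j"] ladder corner[OF j] by blast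
  qed
  have "ladder_data k l v d c r L"
  proof
    fix i j assume i: "i \<in> {1..v}" and j: "j \<in> {1..v}" and ij: "i < j"
    have ne: "i \<noteq> j" "j \<noteq> i" using ij by auto
    \<comment> \<open>Each inequality of the staircase excludes one inclusion: if this one failed,
      the ideal of \<open>j\<close> would lie in that of \<open>i\<close>; if the next one failed,
      the ideal of \<open>i\<close> would lie in that of \<open>j\<close>.\<close>
    have "d i + t j < d j + t i"
    proof (rule ccontr)
      assume *: "\<not> d i + t j < d j + t i"
      have "(minors_ideal L (t j) (subladder l L d c j) :: 'k matpoly set)
          \<subseteq> minors_ideal L (t i) (subladder l L d c i)"
        by (rule minors_ideal_subset_rows[where c = c and d = d and t = t, OF ladder mono(2)[OF i j ij]])
          (use * mono(1)[OF i j ij] t[OF i] in auto)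
      with irr[OF j i ne(2)] show False by contradiction
    qed
    moreover have "c i + t i < c j + t j"
    proof (rule ccontr)
      assume *: "\<not> c i + t i < c j + t j"
      have "(minors_ideal L (t i) (subladder l L d c i) :: 'k matpoly set)
          \<subseteq> minors_ideal L (t j) (subladder l L d c j)"
        by (rule minors_ideal_subset_columns[where c = c and d = d and t = t, OF ladder mono(1)[OF i j ij]])
          (use * mono(2)[OF i j ij] in auto)
      with irr[OF i j ne(1)] show False by contradiction
    qed
    ultimately show "d i \<le> d j \<and> c i \<le> c j \<and> d i + r j < d j + r i \<and> c i + r i < c j + r j"
      using mono[OF i j ij] t[OF i] t[OF j] by auto
  qed (use gap corner ladder in blast)+
  then interpret ladder_data k l v d c r L "TYPE('k)" .
  have pc: "perfect_char TYPE('k) p L"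
  proof
    show "Factorial_Ring.prime p" using prime_CHAR_semidom[where 'a = 'k] char_pos by simp
  qed (use char_pos(1) perfect finite_L in blast)+
  \<comment> \<open>The sizes \<open>t j\<close> and \<open>Suc (r j)\<close> are known to agree for
    \<open>j\<close> in \<open>{1..v}\<close>, which is the range of the union; hence a congruence
    over that range.\<close>
  have "mixed_ladder_ideal l L v d c t = I"
    unfolding I_def mixed_ladder_ideal_def
    by (rule arg_cong[of _ _ "genideal R"]) (rule SUP_cong[OF refl], simp only: t)
  then show ?thesis
    using F_pure_symbolic_gr[OF pc delta_notin_minimal_prime] by simp
qed

end
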